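(* Let $\sigma>0$. Assume that, for each $k\in\{1,3,\ldots,n-2\}$, the permittivities satisfy $$\frac{\varepsilon_{k+1}^2+(\sigma/\omega)^2}{\varepsilon_k|\varepsilon_{k+1}|}>(C_1^{(k)}C^{(k)})^2,\qquad \frac{\varepsilon_{k+1}^2+(\sigma/\omega)^2}{\varepsilon_{k+2}|\varepsilon_{k+1}|}>(C_1^{(k)}C^{(k+2)})^2, \qquad(\ast)$$ where $C_1^{(k)}=\|\mathcal{R}_k\|$ and $C^{(k)},C^{(k+2)}$ are the trace constants, depending only on $d$ and the geometries of $D_k$ and $D_{k+2}$ respectively. Then there exists a discrete set $I\subset(0,\infty)$ such that for every $\omega\in(0,\infty)\setminus I$ (for which $(\ast)$ holds) and every $f\in L^2(\mathbb{R}^d)$ with $\operatorname{supp}f\Subset B_{R_0}$, the problem $$\nabla\cdot(\varepsilon_\sigma^{-1}\nabla u_\sigma)+\omega^2\mu u_\sigma+\mathrm{i}\sigma u_\sigma=f\ \text{ in }\mathbb{R}^d,\qquad u_\sigma\ \text{satisfies the outgoing condition as }|x|\to\infty,$$ admits a unique solution $u_\sigma\in H^1(\mathbb{R}^d)$.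
   Context: Setting. Let $d\ge2$, let $n\ge3$ be odd, and let $0<R_1<\dots<R_{n-1}<\infty$. Put $D_1=\{x\in\mathbb{R}^d:|x|<R_1\}$, $D_i=\{R_{i-1}<|x|<R_i\}$ for $2\le i\le n-1$, $D_n=\{|x|>R_{n-1}\}$, and $\Gamma_i=\{|x|=R_i\}$ for $1\le i\le n-1$. $B_R$ is the open ball of radius $R$ centred at $0$. $R_0>0$ is a fixed radius. Coefficients. $\varepsilon,\mu$ are piecewise constant: $\varepsilon=\varepsilon_i$, $\mu=\mu_i$ in $D_i$, with real constants $\varepsilon_i,\mu_i>0$ for $i$ odd and $\varepsilon_i,\mu_i<0$ for $i$ even; it is assumed throughout that $\varepsilon_i/\varepsilon_{i+1}\ne-1$ for all $1\le i\le n-1$. For frequency $\omega>0$ and $\sigma>0$, $\varepsilon_\sigma=\varepsilon_i$ in $D_i$ for $i$ odd and $\varepsilon_\sigma=\varepsilon_i+\mathrm{i}\sigma/\omega$ in $D_i$ for $i$ even. The equation is understood in the weak (distributional) sense on $\mathbb{R}^d$, which encodes continuity of the trace of $u_\sigma$ and of the conormal derivative $\varepsilon_\sigma^{-1}\nabla u_\sigma\cdot\vec n$ across each $\Gamma_i$. Outgoing condition. With $\kappa_\sigma=(\omega^2\varepsilon_n\mu_n+\mathrm{i}\varepsilon_n\sigma)^{1/2}$ (root with $\operatorname{Im}\kappa_\sigma>0$), the outgoing condition on $u_\sigma$ means that outside a large ball $u_\sigma$ is the exponentially decaying solution of $\Delta u_\sigma+\kappa_\sigma^2u_\sigma=0$,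 i.e. its spherical-harmonic modes of degree $m$ have radial profile proportional to $r^{-(d-2)/2}H^{(1)}_{m+(d-2)/2}(\kappa_\sigma r)$. Constants. For $k\in\{1,3,\ldots,n-2\}$, $\mathcal{R}_k:H^{1/2}(\partial D_{k+1})\to H^1(D_{k+1})$ is the harmonic lifting: $\mathcal{R}_k\psi=w$ is the unique solution of $\Delta w=0$ in $D_{k+1}$, $w=\psi$ on $\partial D_{k+1}=\Gamma_k\cup\Gamma_{k+1}$; and $\|\mathcal{R}_k\|$ is its operator norm. For odd $j$, $C^{(j)}$ is a trace constant for $D_j$: $\|v|_{\Gamma}\|_{H^{1/2}(\Gamma)}\le C^{(j)}\|v\|_{H^1(D_j)}$ for all $v\in H^1(D_j)$ and each sphere $\Gamma$ that is a component of $\partial D_j$. The norms on $H^{1/2}(\Gamma_i)$ are fixed, and those on $H^{1/2}(\partial D_{k+1})$ satisfy $\|\psi\|_{H^{1/2}(\partial D_{k+1})}^2\le\|\psi|_{\Gamma_k}\|_{H^{1/2}(\Gamma_k)}^2+\|\psi|_{\Gamma_{k+1}}\|_{H^{1/2}(\Gamma_{k+1})}^2$. *)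

theory Defs
  imports "HOL-Analysis.Analysis"
begin

section \<open>Smooth functions and test functions\<close>

definition partial :: "'n::finite \<Rightarrow> (real^'n \<Rightarrow> complex) \<Rightarrow> real^'n \<Rightarrow> complex" where
  "partial i f x = frechet_derivative f (at x) (axis i 1)"

definition laplacian :: "(real^'n::finite \<Rightarrow> complex) \<Rightarrow> real^'n \<Rightarrow> complex" where
  "laplacian f x = (\<Sum>i\<in>UNIV. partial i (partial i f) x)"

fun Ck :: "nat \<Rightarrow> (real^'n::finite \<Rightarrow> complex) \<Rightarrow> bool" where
  "Ck 0 f \<longleftrightarrow> continuous_on UNIV f"
| "Ck (Suc k) f \<longleftrightarrow> f differentiable_on UNIV \<and> (\<forall>i. Ck k (partial i f))"

definition test_fun :: "(real^'n::finite) set \<Rightarrow> (real^'n \<Rightarrow> complex) \<Rightarrow> bool" where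
  "test_fun \<Omega> \<phi> \<longleftrightarrow> (\<forall>k. Ck k \<phi>) \<and> compact (closure {x. \<phi> x \<noteq> 0}) \<and> closure {x. \<phi> x \<noteq> 0} \<subseteq> \<Omega>"

section \<open>The Sobolev space \<open>H\<^sup>1(\<Omega>)\<close>\<close>

text \<open>
  Elements of Lebesgue and Sobolev spaces are represented by functions, identified up to equality
  almost everywhere.
\<close>

definition L2 :: "'a measure \<Rightarrow> ('a \<Rightarrow> 'b::{real_normed_vector, second_countable_topology}) \<Rightarrow> bool" where
  "L2 M u \<longleftrightarrow> u \<in> borel_measurable M \<and> integrable M (\<lambda>x. (norm (u x))\<^sup>2)"

definition weak_gradient ::
  "(real^'n::finite) set \<Rightarrow> (real^'n \<Rightarrow> complex) \<Rightarrow> (real^'n \<Rightarrow> complex^'n) \<Rightarrow> bool" where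
  "weak_gradient \<Omega> u g \<longleftrightarrow> L2 (lebesgue_on \<Omega>) g \<and>
     (\<forall>\<phi> i. test_fun \<Omega> \<phi> \<longrightarrow>
        (LINT x|lebesgue_on \<Omega>. u x * partial i \<phi> x) = - (LINT x|lebesgue_on \<Omega>. g x $ i * \<phi> x))"

definition H1 :: "(real^'n::finite) set \<Rightarrow> (real^'n \<Rightarrow> complex) set" where
  "H1 \<Omega> = {u. L2 (lebesgue_on \<Omega>) u \<and> (\<exists>g. weak_gradient \<Omega> u g)}"

definition wgrad :: "(real^'n::finite) set \<Rightarrow> (real^'n \<Rightarrow> complex) \<Rightarrow> real^'n \<Rightarrow> complex^'n" where
  "wgrad \<Omega> u = (SOME g. weak_gradient \<Omega> u g)"

definition H1_norm :: "(real^'n::finite) set \<Rightarrow> (real^'n \<Rightarrow> complex) \<Rightarrow> real" where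
  "H1_norm \<Omega> u = sqrt (LINT x|lebesgue_on \<Omega>. (norm (u x))\<^sup>2 + (norm (wgrad \<Omega> u x))\<^sup>2)"

text \<open>\<open>\<Delta>u + q u = 0\<close> in the open set \<open>\<Omega>\<close>, in the sense of distributions.\<close>

definition helmholtz_on :: "(real^'n::finite) set \<Rightarrow> complex \<Rightarrow> (real^'n \<Rightarrow> complex) \<Rightarrow> bool" where
  "helmholtz_on \<Omega> q u \<longleftrightarrow>
     (\<forall>\<phi>. test_fun \<Omega> \<phi> \<longrightarrow> (LINT x|lebesgue_on \<Omega>. u x * (laplacian \<phi> x + q * \<phi> x)) = 0)"

section \<open>Spheres centred at the origin: surface measure, \<open>H\<^sup>1\<^sup>/\<^sup>2\<close>, traces\<close>

text \<open>
  Surface measure of the sphere of radius \<open>r\<close>, as a (completed Borel) measure on the whole space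
  carried by that sphere. It is the cone measure: the part \<open>A\<close> of the unit sphere has area
  \<open>d\<close> times the volume of the part of the unit ball that projects radially to \<open>A\<close>, and areas
  scale like \<open>r\<^sup>d\<^sup>-\<^sup>1\<close>.
\<close>

definition sphere_measure :: "real \<Rightarrow> (real^'n::finite) measure" where
  "sphere_measure r = completion
     (scale_measure (ennreal (real CARD('n) * r ^ (CARD('n) - 1)))
       (distr (restrict_space lborel (ball 0 1)) borel (\<lambda>x. (r / norm x) *\<^sub>R x)))"

text \<open>
  Square of the Sobolev--Slobodeckij norm of \<open>H\<^sup>s\<close> of the sphere of radius \<open>r\<close>, \<open>s = 1/2\<close>; the kernel
  exponent is \<open>(d - 1) + 2 s = d\<close>.
\<close>

definition slobodeckij_sq :: "real \<Rightarrow> (real^'n::finite \<Rightarrow> complex) \<Rightarrow> ennreal" where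
  "slobodeckij_sq r g =
     (\<integral>\<^sup>+ x. ennreal ((norm (g x))\<^sup>2) \<partial>sphere_measure r) +
     (\<integral>\<^sup>+ x. (\<integral>\<^sup>+ y. ennreal ((norm (g x - g y))\<^sup>2 / norm (x - y) ^ CARD('n)) \<partial>sphere_measure r)
        \<partial>sphere_measure r)"

definition Hhalf :: "real \<Rightarrow> (real^'n::finite \<Rightarrow> complex) set" where
  "Hhalf r = {g. g \<in> borel_measurable (sphere_measure r) \<and> slobodeckij_sq r g < \<infinity>}"

definition slobodeckij_norm :: "real \<Rightarrow> (real^'n::finite \<Rightarrow> complex) \<Rightarrow> real" where
  "slobodeckij_norm r g = sqrt (enn2real (slobodeckij_sq r g))"

text \<open>
  The trace on the sphere of radius \<open>r\<close>, a component of the boundary of \<open>\<Omega>\<close>: restriction of smooth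
  functions extended by continuity in the \<open>H\<^sup>1(\<Omega>)\<close> norm.
\<close>

definition has_trace ::
  "(real^'n::finite) set \<Rightarrow> real \<Rightarrow> (real^'n \<Rightarrow> complex) \<Rightarrow> (real^'n \<Rightarrow> complex) \<Rightarrow> bool" where
  "has_trace \<Omega> r v g \<longleftrightarrow> L2 (sphere_measure r) g \<and>
     (\<exists>\<phi>. (\<forall>k. test_fun UNIV (\<phi> k)) \<and>
        (\<lambda>k. H1_norm \<Omega> (\<lambda>x. \<phi> k x - v x)) \<longlonglongrightarrow> 0 \<and>
        (\<lambda>k::nat. LINT x|sphere_measure r. (norm (\<phi> k x - g x))\<^sup>2) \<longlonglongrightarrow> 0)"

text \<open>
  \<open>N\<close> is a norm on the function space \<open>V\<close>, equivalent to the reference norm \<open>P\<close>; in particular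
  \<open>N\<close> vanishes exactly where \<open>P\<close> does.
\<close>

definition equivalent_norm_on ::
  "('a \<Rightarrow> complex) set \<Rightarrow> (('a \<Rightarrow> complex) \<Rightarrow> real) \<Rightarrow> (('a \<Rightarrow> complex) \<Rightarrow> real) \<Rightarrow> bool" where
  "equivalent_norm_on V P N \<longleftrightarrow>
     (\<forall>g\<in>V. \<forall>h\<in>V. N (\<lambda>x. g x + h x) \<le> N g + N h) \<and>
     (\<forall>a. \<forall>g\<in>V. N (\<lambda>x. a * g x) = norm a * N g) \<and>
     (\<exists>c>0. \<exists>C>0. \<forall>g\<in>V. c * P g \<le> N g \<and> N g \<le> C * P g)"

definition Hhalf_norm :: "real \<Rightarrow> ((real^'n::finite \<Rightarrow> complex) \<Rightarrow> real) \<Rightarrow> bool" where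
  "Hhalf_norm r N \<longleftrightarrow> equivalent_norm_on (Hhalf r) (slobodeckij_norm r) N"

section \<open>Annuli and the harmonic lifting\<close>

definition annulus :: "real \<Rightarrow> real \<Rightarrow> (real^'n::finite) set" where
  "annulus a b = {x. a < norm x \<and> norm x < b}"

text \<open>
  The boundary of an annulus consists of two spheres at positive distance, so a function is in \<open>H\<^sup>1\<^sup>/\<^sup>2\<close>
  of the boundary iff its restrictions to both spheres are in \<open>H\<^sup>1\<^sup>/\<^sup>2\<close>.
\<close>

definition Hhalf2 :: "real \<Rightarrow> real \<Rightarrow> (real^'n::finite \<Rightarrow> complex) set" where
  "Hhalf2 a b = Hhalf a \<inter> Hhalf b"

definition Hhalf2_norm :: "real \<Rightarrow> real \<Rightarrow> ((real^'n::finite \<Rightarrow> complex) \<Rightarrow> real) \<Rightarrow> bool" where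
  "Hhalf2_norm a b N \<longleftrightarrow> equivalent_norm_on (Hhalf2 a b)
     (\<lambda>g. sqrt ((slobodeckij_norm a g)\<^sup>2 + (slobodeckij_norm b g)\<^sup>2)) N"

definition harmonic_lift ::
  "real \<Rightarrow> real \<Rightarrow> (real^'n::finite \<Rightarrow> complex) \<Rightarrow> real^'n \<Rightarrow> complex" where
  "harmonic_lift a b \<psi> = (SOME w. w \<in> H1 (annulus a b) \<and> helmholtz_on (annulus a b) 0 w \<and>
     has_trace (annulus a b) a w \<psi> \<and> has_trace (annulus a b) b w \<psi>)"

text \<open>The operator norm of the harmonic lifting when \<open>H\<^sup>1\<^sup>/\<^sup>2\<close> of the boundary carries the norm \<open>N\<close>.\<close>

definition lift_norm :: "real \<Rightarrow> real \<Rightarrow> ((real^'n::finite \<Rightarrow> complex) \<Rightarrow> real) \<Rightarrow> real" where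
  "lift_norm a b N = (SUP \<psi>\<in>Hhalf2 a b. H1_norm (annulus a b) (harmonic_lift a b \<psi>) / N \<psi>)"

section \<open>The layered medium\<close>

definition layer :: "nat \<Rightarrow> (nat \<Rightarrow> real) \<Rightarrow> nat \<Rightarrow> (real^'n::finite) set" where
  "layer n R i = (if i = 1 then {x. norm x < R 1}
     else if i = n then {x. norm x > R (n - 1)}
     else annulus (R (i - 1)) (R i))"

text \<open>The value of a piecewise constant coefficient on the null set of interfaces is immaterial.\<close>

definition piecewise :: "nat \<Rightarrow> (nat \<Rightarrow> real) \<Rightarrow> (nat \<Rightarrow> complex) \<Rightarrow> real^'n::finite \<Rightarrow> complex" where
  "piecewise n R c x = (\<Sum>i=1..n. if x \<in> layer n R i then c i else 0)"

definition eps_sigma :: "(nat \<Rightarrow> real) \<Rightarrow> real \<Rightarrow> real \<Rightarrow> nat \<Rightarrow> complex" where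
  "eps_sigma \<epsilon> \<sigma> \<omega> i = (if odd i then of_real (\<epsilon> i) else of_real (\<epsilon> i) + \<i> * of_real (\<sigma> / \<omega>))"

definition trace_constant ::
  "nat \<Rightarrow> (nat \<Rightarrow> real) \<Rightarrow> (nat \<Rightarrow> (real^'n::finite \<Rightarrow> complex) \<Rightarrow> real) \<Rightarrow> nat \<Rightarrow> real \<Rightarrow> bool" where
  "trace_constant n R N j C \<longleftrightarrow>
     (\<forall>i\<in>{j - 1, j} \<inter> {1..n - 1}. \<forall>v\<in>H1 (layer n R j). \<forall>g.
        has_trace (layer n R j) (R i) v g \<longrightarrow> N i g \<le> C * H1_norm (layer n R j) v)"

section \<open>The outgoing condition\<close>

text \<open>
  The Hankel function of the first kind and real order \<open>\<nu>\<close>, by the Mehler--Sommerfeld integral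
  (DLMF 10.9.10). It is meant for the upper half plane \<open>Im z > 0\<close> only, where the integral converges
  absolutely; the arguments \<open>\<kappa> r\<close> below lie there.
\<close>

definition hankel1 :: "real \<Rightarrow> complex \<Rightarrow> complex" where
  "hankel1 \<nu> z = exp (- \<i> * of_real (pi * \<nu> / 2)) / (\<i> * of_real pi) *
     (LINT t|lborel. exp (\<i> * z * of_real (cosh t) - of_real (\<nu> * t)))"

text \<open>Homogeneous harmonic polynomials; their restrictions to the unit sphere are the spherical
  harmonics of degree \<open>m\<close>.\<close>

definition solid_harmonic :: "nat \<Rightarrow> (real^'n::finite \<Rightarrow> complex) \<Rightarrow> bool" where
  "solid_harmonic m Y \<longleftrightarrow> polynomial_function Y \<and>
     (\<forall>t x. Y (t *\<^sub>R x) = of_real (t ^ m) * Y x) \<and> (\<forall>x. laplacian Y x = 0)"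

definition mode :: "(real^'n::finite \<Rightarrow> complex) \<Rightarrow> (real^'n \<Rightarrow> complex) \<Rightarrow> real \<Rightarrow> complex" where
  "mode u Y r = (LINT \<theta>|sphere_measure 1. u (r *\<^sub>R \<theta>) * cnj (Y \<theta>))"

text \<open>Since \<open>u\<close> is only given almost everywhere, its modes are prescribed for almost every radius.\<close>

definition outgoing :: "complex \<Rightarrow> (real^'n::finite \<Rightarrow> complex) \<Rightarrow> bool" where
  "outgoing \<kappa> u \<longleftrightarrow> (\<exists>\<rho>>0. helmholtz_on {x. norm x > \<rho>} (\<kappa>\<^sup>2) u \<and>
     (\<forall>m Y. solid_harmonic m Y \<longrightarrow>
        (\<exists>c. AE r in lborel. r > \<rho> \<longrightarrow>
           mode u Y r = c * of_real (r powr (- (real CARD('n) - 2) / 2)) *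
             hankel1 (real m + (real CARD('n) - 2) / 2) (\<kappa> * of_real r))))"

definition kappa :: "nat \<Rightarrow> (nat \<Rightarrow> real) \<Rightarrow> (nat \<Rightarrow> real) \<Rightarrow> real \<Rightarrow> real \<Rightarrow> complex" where
  "kappa n \<epsilon> \<mu> \<sigma> \<omega> = csqrt (Complex (\<omega>\<^sup>2 * \<epsilon> n * \<mu> n) (\<epsilon> n * \<sigma>))"

text \<open>The principal square root is the one with positive imaginary part.\<close>

lemma kappa_square: "(kappa n \<epsilon> \<mu> \<sigma> \<omega>)\<^sup>2 = Complex (\<omega>\<^sup>2 * \<epsilon> n * \<mu> n) (\<epsilon> n * \<sigma>)"
  by (simp add: kappa_def)

lemma Im_kappa_pos:
  assumes "\<epsilon> n > 0" "\<sigma> > 0"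
  shows "Im (kappa n \<epsilon> \<mu> \<sigma> \<omega>) > 0"
proof -
  let ?k = "kappa n \<epsilon> \<mu> \<sigma> \<omega>"
  have "2 * Re ?k * Im ?k = Im (?k\<^sup>2)"
    by (simp add: power2_eq_square)
  also have "\<dots> = \<epsilon> n * \<sigma>"
    by (simp add: kappa_square)
  finally have pos: "Re ?k * Im ?k > 0"
    using mult_pos_pos[OF assms] by linarith
  moreover have "Re ?k \<ge> 0"
    using csqrt_principal unfolding kappa_def by (metis less_eq_real_def)
  ultimately show ?thesis
    by (simp add: zero_less_mult_iff)
qed

section \<open>The transmission problem\<close>

definition ess_support :: "('a::euclidean_space \<Rightarrow> complex) \<Rightarrow> 'a set" where
  "ess_support f = - \<Union>{U. open U \<and> (AE x in lebesgue. x \<in> U \<longrightarrow> f x = 0)}"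

definition weak_solution ::
  "nat \<Rightarrow> (nat \<Rightarrow> real) \<Rightarrow> (nat \<Rightarrow> real) \<Rightarrow> (nat \<Rightarrow> real) \<Rightarrow> real \<Rightarrow> real \<Rightarrow>
   (real^'n::finite \<Rightarrow> complex) \<Rightarrow> (real^'n \<Rightarrow> complex) \<Rightarrow> bool" where
  "weak_solution n R \<epsilon> \<mu> \<sigma> \<omega> f u \<longleftrightarrow>
     (\<forall>\<phi>. test_fun UNIV \<phi> \<longrightarrow>
        (LINT x|lebesgue.
            - inverse (piecewise n R (eps_sigma \<epsilon> \<sigma> \<omega>) x) * (\<Sum>i\<in>UNIV. wgrad UNIV u x $ i * partial i \<phi> x)
            + (of_real (\<omega>\<^sup>2) * piecewise n R (\<lambda>i. of_real (\<mu> i)) x + \<i> * of_real \<sigma>) * u x * \<phi> x)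
        = (LINT x|lebesgue. f x * \<phi> x))"

definition solves ::
  "nat \<Rightarrow> (nat \<Rightarrow> real) \<Rightarrow> (nat \<Rightarrow> real) \<Rightarrow> (nat \<Rightarrow> real) \<Rightarrow> real \<Rightarrow> real \<Rightarrow>
   (real^'n::finite \<Rightarrow> complex) \<Rightarrow> (real^'n \<Rightarrow> complex) \<Rightarrow> bool" where
  "solves n R \<epsilon> \<mu> \<sigma> \<omega> f u \<longleftrightarrow>
     u \<in> H1 UNIV \<and> weak_solution n R \<epsilon> \<mu> \<sigma> \<omega> f u \<and> outgoing (kappa n \<epsilon> \<mu> \<sigma> \<omega>) u"

end

theory Submission
  imports Defs "HOL-Complex_Analysis.Complex_Analysis" "HOL-Real_Asymp.Real_Asymp"
begin

text \<open>
  Because of the absorption, the values of \<open>1 / \<epsilon>\<^sub>\<sigma>\<close> and of \<open>- (\<omega>\<^sup>2 \<mu> + \<i> \<sigma>)\<close> all lie, for every \<open>\<omega> > 0\<close>,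
  in the half plane \<open>Re (\<alpha> z) > 0\<close> for \<open>\<alpha> = 1 + \<i> K\<close> with suitable real \<open>K\<close>. Hence the form of the problem is
  coercive on \<open>H\<^sup>1\<close>, and Lax--Milgram gives exactly one weak solution \<open>u\<close>. It remains to see that \<open>u\<close> is
  outgoing. Testing the equation outside a large ball with \<open>F (|x|) cnj (Y x)\<close> shows that \<open>r\<^sup>-\<^sup>m\<close> times the mode of \<open>u\<close>
  along a solid harmonic \<open>Y\<close> of degree \<open>m\<close> satisfies \<open>(r\<^sup>M G')' + \<kappa>\<^sup>2 r\<^sup>M G = 0\<close>, \<open>M = 2 m + d - 1\<close>. As \<open>Im \<kappa>\<^sup>2 > 0\<close>,
  the solutions with finite \<open>\<integral> r\<^sup>M |G|\<^sup>2\<close> form a line. Both the mode, since \<open>u\<close> is square integrable, and the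
  Mehler--Sommerfeld integral, by its recurrences and exponential decay, belong to it.
\<close>

section \<open>Hilbert space methods in L2: completeness, projection, Lax-Milgram\<close>

section \<open>The space of square integrable functions\<close>

text \<open>Absorption gives the imaginary parts of all coefficients one sign, so a large
  \<open>K\<close> outweighs the negative real parts that come from the sign change of the medium.
  The main obstacle is that the equation is tested only with smooth compactly supported functions,
  whereas H^1 is defined by weak gradients; uniqueness therefore rests on density of test functions.
  It is shown by duality: an element of H^1 orthogonal to all of them solves
  \<open>z - \<Delta> z = 0\<close> weakly, its convolutions are bounded classical solutions, and a
  quadratic barrier forces these to vanish. Dividing a mode by \<open>r ^ m\<close> removes the
  angular term of the Laplacian; what is left is the radial Helmholtz equation in dimension
  \<open>2 m + d\<close>, hence the exponent \<open>M = 2 m + d - 1\<close>. A mode of a merely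
  square integrable function satisfies it only weakly, and a second order du Bois-Reymond argument
  provides the classical solution that can be compared with the Hankel function. That the Hankel
  function spans the line of decaying solutions needs a point of the ray where it does not vanish;
  analytic continuation to the imaginary axis, where the integrand is positive, supplies
  one.\<close>

lemma L2_dominated:
  assumes "f \<in> borel_measurable M" "L2 M g" "AE x in M. norm (f x) \<le> K * norm (g x)"
  shows "L2 M f"
proof -
  have "integrable M (\<lambda>x. (norm (f x))\<^sup>2)"
  proof (rule Bochner_Integration.integrable_bound)
    show "integrable M (\<lambda>x. K\<^sup>2 * (norm (g x))\<^sup>2)"
      using assms(2) unfolding L2_def by simp
    show "AE x in M. norm ((norm (f x))\<^sup>2) \<le> norm (K\<^sup>2 * (norm (g x))\<^sup>2)"
      using assms(3)
    proof eventually_elim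
      case (elim x)
      then have "(norm (f x))\<^sup>2 \<le> (K * norm (g x))\<^sup>2"
        by (intro power_mono) auto
      then show ?case by (simp add: power_mult_distrib)
    qed
  qed (use assms(1) in measurable)
  then show ?thesis using assms(1) by (simp add: L2_def)
qed

lemma L2_scaleR:
  assumes "L2 M f" shows "L2 M (\<lambda>x. c *\<^sub>R f x)"
proof (rule L2_dominated[OF _ assms, where K="\<bar>c\<bar>"])
  show "(\<lambda>x. c *\<^sub>R f x) \<in> borel_measurable M"
    using assms unfolding L2_def by (intro borel_measurable_scaleR) auto
qed simp

lemma L2_cong_AE:
  assumes "L2 M f" "g \<in> borel_measurable M" "AE x in M. g x = f x" shows "L2 M g"
  by (rule L2_dominated[OF assms(2,1), where K=1]) (use assms(3) in auto)

lemma norm_add_sq_le: "(norm (a + b))\<^sup>2 \<le> 2 * (norm a)\<^sup>2 + 2 * (norm b)\<^sup>2"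
  for a b :: "'b::real_normed_vector"
proof -
  have "(norm (a + b))\<^sup>2 \<le> (norm a + norm b)\<^sup>2"
    by (intro power_mono norm_triangle_ineq) auto
  also have "\<dots> \<le> 2 * (norm a)\<^sup>2 + 2 * (norm b)\<^sup>2"
    using sum_squares_bound[of "norm a" "norm b"] by (simp add: power2_sum)
  finally show ?thesis .
qed

lemma L2_add:
  fixes f g :: "'a \<Rightarrow> 'b::{real_normed_vector, second_countable_topology}"
  assumes f: "L2 M f" and g: "L2 M g" shows "L2 M (\<lambda>x. f x + g x)"
proof -
  have m: "(\<lambda>x. f x + g x) \<in> borel_measurable M"
    using f g unfolding L2_def by (intro borel_measurable_add) auto
  have "integrable M (\<lambda>x. (norm (f x + g x))\<^sup>2)"
  proof (rule Bochner_Integration.integrable_bound)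
    show "integrable M (\<lambda>x. 2 * (norm (f x))\<^sup>2 + 2 * (norm (g x))\<^sup>2)"
      using f g unfolding L2_def by simp
    show "AE x in M. norm ((norm (f x + g x))\<^sup>2) \<le> norm (2 * (norm (f x))\<^sup>2 + 2 * (norm (g x))\<^sup>2)"
      using norm_add_sq_le by auto
  qed (use m in measurable)
  with m show ?thesis by (simp add: L2_def)
qed

lemma L2_diff:
  fixes f g :: "'a \<Rightarrow> 'b::{real_normed_vector, second_countable_topology}"
  assumes f: "L2 M f" and g: "L2 M g" shows "L2 M (\<lambda>x. f x - g x)"
  using L2_add[OF f L2_scaleR[OF g, of "-1"]] by simp

lemma L2_zero: "L2 M (\<lambda>x. 0)"
  by (simp add: L2_def)

lemma L2_product_integrable:
  fixes f :: "'a \<Rightarrow> 'b::{real_normed_vector, second_countable_topology}"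
    and g :: "'a \<Rightarrow> 'c::{real_normed_vector, second_countable_topology}"
    and h :: "'a \<Rightarrow> 'd::{banach, second_countable_topology}"
  assumes "L2 M f" "L2 M g" "h \<in> borel_measurable M" "\<And>x. norm (h x) \<le> norm (f x) * norm (g x)"
  shows "integrable M h"
proof (rule Bochner_Integration.integrable_bound)
  show "integrable M (\<lambda>x. (norm (f x))\<^sup>2 + (norm (g x))\<^sup>2)"
    using assms(1,2) unfolding L2_def by simp
  have "norm (h x) \<le> norm ((norm (f x))\<^sup>2 + (norm (g x))\<^sup>2)" for x
  proof -
    have "norm (f x) * norm (g x) \<le> (norm (f x))\<^sup>2 + (norm (g x))\<^sup>2"
      using sum_squares_bound[of "norm (f x)" "norm (g x)"]
        mult_nonneg_nonneg[OF norm_ge_zero norm_ge_zero, of "f x" "g x"] by linarith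
    with assms(4)[of x] show ?thesis by simp
  qed
  then show "AE x in M. norm (h x) \<le> norm ((norm (f x))\<^sup>2 + (norm (g x))\<^sup>2)" by simp
qed fact

lemma L2_inner_integrable:
  fixes f g :: "'a \<Rightarrow> 'b::euclidean_space"
  assumes "L2 M f" "L2 M g" shows "integrable M (\<lambda>x. f x \<bullet> g x)"
  by (rule L2_product_integrable[OF assms])
    (use assms in \<open>auto simp: L2_def Cauchy_Schwarz_ineq2 intro!: borel_measurable_inner\<close>)

lemma L2_mult_integrable:
  fixes f g :: "'a \<Rightarrow> complex"
  assumes "L2 M f" "L2 M g" shows "integrable M (\<lambda>x. f x * g x)"
  by (rule L2_product_integrable[OF assms])
    (use assms in \<open>auto simp: L2_def norm_mult\<close>)

text \<open>The discriminant criterion: insert the minimiser \<open>s = b / c\<close>. If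
  \<open>c = 0\<close> the polynomial is affine in \<open>s\<close>, and the choice
  \<open>s = (a + 1) / (2 * b)\<close> would give the value -1.\<close>

lemma quadratic_nonneg_bound:
  fixes a b c :: real
  assumes "\<And>s. 0 \<le> a - 2 * s * b + s\<^sup>2 * c" "0 \<le> c"
  shows "b\<^sup>2 \<le> a * c"
proof (cases "c = 0")
  case True
  have "b = 0"
  proof (rule ccontr)
    assume "b \<noteq> 0"
    then show False using assms(1)[of "(a + 1) / (2 * b)"] True by simp
  qed
  then show ?thesis using True by simp
next
  case False
  have "0 \<le> (a - 2 * (b / c) * b + (b / c)\<^sup>2 * c) * c"
    by (intro mult_nonneg_nonneg assms)
  also have "\<dots> = a * c - b\<^sup>2"
    using False by (simp add: field_simps power2_eq_square)
  finally show ?thesis by simp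
qed

lemma L2_Cauchy_Schwarz:
  fixes f g :: "'a \<Rightarrow> 'b::euclidean_space"
  assumes f: "L2 M f" and g: "L2 M g"
  shows "(LINT x|M. f x \<bullet> g x)\<^sup>2 \<le> (LINT x|M. (norm (f x))\<^sup>2) * (LINT x|M. (norm (g x))\<^sup>2)"
proof (rule quadratic_nonneg_bound)
  fix s :: real
  have "0 \<le> (LINT x|M. (norm (f x - s *\<^sub>R g x))\<^sup>2)" by simp
  also have "\<dots> = (LINT x|M. (norm (f x))\<^sup>2 - 2 * s * (f x \<bullet> g x) + s\<^sup>2 * (norm (g x))\<^sup>2)"
    by (intro Bochner_Integration.integral_cong refl)
      (simp add: power2_norm_eq_inner inner_diff_left inner_diff_right inner_commute power2_eq_square[of s] algebra_simps)
  also have "\<dots> = (LINT x|M. (norm (f x))\<^sup>2) - 2 * s * (LINT x|M. f x \<bullet> g x) + s\<^sup>2 * (LINT x|M. (norm (g x))\<^sup>2)"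
    using f g L2_inner_integrable[OF f g] unfolding L2_def by simp
  finally show "0 \<le> \<dots>" .
qed simp

text \<open>Cauchy-Schwarz applied to \<open>f k - g\<close> against \<open>h\<close>.\<close>

lemma L2_weak_limit:
  fixes f :: "nat \<Rightarrow> 'a \<Rightarrow> 'b::euclidean_space"
  assumes f: "\<And>k. L2 M (f k)" and g: "L2 M g" and h: "L2 M h"
    and lim: "(\<lambda>k. LINT x|M. (norm (f k x - g x))\<^sup>2) \<longlonglongrightarrow> 0"
  shows "(\<lambda>k. LINT x|M. f k x \<bullet> h x) \<longlonglongrightarrow> (LINT x|M. g x \<bullet> h x)"
proof -
  have eq: "(LINT x|M. f k x \<bullet> h x) - (LINT x|M. g x \<bullet> h x) = (LINT x|M. (f k x - g x) \<bullet> h x)" for k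
    using L2_inner_integrable[OF f h] L2_inner_integrable[OF g h] by (simp add: inner_diff_left)
  have "(\<lambda>k. ((LINT x|M. f k x \<bullet> h x) - (LINT x|M. g x \<bullet> h x))\<^sup>2) \<longlonglongrightarrow> 0"
  proof (rule tendsto_sandwich[OF _ _ tendsto_const])
    show "\<forall>\<^sub>F k in sequentially. ((LINT x|M. f k x \<bullet> h x) - (LINT x|M. g x \<bullet> h x))\<^sup>2
        \<le> (LINT x|M. (norm (f k x - g x))\<^sup>2) * (LINT x|M. (norm (h x))\<^sup>2)"
      unfolding eq by (intro always_eventually allI L2_Cauchy_Schwarz L2_diff f g h)
    show "(\<lambda>k. (LINT x|M. (norm (f k x - g x))\<^sup>2) * (LINT x|M. (norm (h x))\<^sup>2)) \<longlonglongrightarrow> 0"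
      using tendsto_mult_left_zero[OF lim] .
  qed auto
  then have "(\<lambda>k. (LINT x|M. f k x \<bullet> h x) - (LINT x|M. g x \<bullet> h x)) \<longlonglongrightarrow> 0"
    using tendsto_real_sqrt[of "\<lambda>k. ((LINT x|M. f k x \<bullet> h x) - (LINT x|M. g x \<bullet> h x))\<^sup>2" 0]
    by (simp add: tendsto_rabs_zero_iff)
  then show ?thesis by (simp add: LIM_zero_iff)
qed

text \<open>Completeness in the form that iterations need. Dividing the squared increments by
  \<open>(q\<^sup>2) ^ k\<close> costs half of the decay and still leaves a convergent series of
  integrals, so the sum \<open>T\<close> of the rescaled increments is finite almost everywhere. It
  bounds each increment by \<open>q ^ k * sqrt (T x)\<close>: the sequence converges pointwise at a
  geometric rate, and the squared tails have an integrable majorant.\<close>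

lemma L2_geometric_limit:
  fixes f :: "nat \<Rightarrow> 'a \<Rightarrow> 'b::euclidean_space"
  assumes f: "\<And>k. L2 M (f k)" and q: "0 < q" "q < 1"
    and bound: "\<And>k. (LINT x|M. (norm (f (Suc k) x - f k x))\<^sup>2) \<le> K * (q ^ 4) ^ k"
  shows "\<exists>g. L2 M g \<and> (\<lambda>k. LINT x|M. (norm (f k x - g x))\<^sup>2) \<longlonglongrightarrow> 0"
proof -
  define S where "S k x = (norm (f (Suc k) x - f k x))\<^sup>2 / (q\<^sup>2) ^ k" for k x
  have fm[measurable]: "f k \<in> borel_measurable M" for k using f unfolding L2_def by auto
  have intS: "integrable M (S k)" for k
    using L2_diff[OF f[of "Suc k"] f[of k]] unfolding L2_def S_def by auto
  have S0: "0 \<le> S k x" for k x using q unfolding S_def by simp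
  have IS: "(LINT x|M. S k x) \<le> K * (q\<^sup>2) ^ k" for k
  proof -
    have "(LINT x|M. S k x) = (LINT x|M. (norm (f (Suc k) x - f k x))\<^sup>2) / (q\<^sup>2) ^ k"
      unfolding S_def by simp
    also have "\<dots> \<le> K * (q ^ 4) ^ k / (q\<^sup>2) ^ k"
      using bound[of k] q by (intro divide_right_mono) auto
    also have "\<dots> = K * (q\<^sup>2) ^ k"
      using q by (simp add: field_simps flip: power_mult power_add)
    finally show ?thesis .
  qed
  have q2: "q\<^sup>2 < 1" "0 \<le> q\<^sup>2" using q by (auto simp: power_less_one_iff)
  have sumI: "summable (\<lambda>k. LINT x|M. S k x)"
  proof (rule summable_comparison_test')
    show "summable (\<lambda>k. K * (q\<^sup>2) ^ k)" using q2 by (intro summable_mult summable_geometric) auto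
    show "norm (LINT x|M. S k x) \<le> K * (q\<^sup>2) ^ k" for k
      using IS[of k] S0 by simp
  qed
  have "(\<integral>\<^sup>+x. (\<Sum>k. ennreal (S k x)) \<partial>M) = (\<Sum>k. \<integral>\<^sup>+x. ennreal (S k x) \<partial>M)"
    using intS by (intro nn_integral_suminf) auto
  also have "\<dots> = (\<Sum>k. ennreal (LINT x|M. S k x))"
    using intS S0 by (subst nn_integral_eq_integral) auto
  also have "\<dots> = ennreal (\<Sum>k. LINT x|M. S k x)"
    by (rule suminf_ennreal2[OF _ sumI]) (simp add: S0)
  also have "\<dots> < \<infinity>" by simp
  finally have "AE x in M. (\<Sum>k. ennreal (S k x)) \<noteq> \<infinity>"
    using intS by (intro nn_integral_PInf_AE) auto
  then have AEsum: "AE x in M. summable (\<lambda>k. S k x)"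
    by eventually_elim (use S0 in \<open>auto intro: summable_suminf_not_top\<close>)
  define T where "T x = (\<Sum>k. S k x)" for x
  have intT: "integrable M T"
    unfolding T_def using AEsum sumI S0 intS by (intro integrable_suminf) (auto simp: abs_of_nonneg)
  define g where "g x = lim (\<lambda>k. f k x)" for x
  have gm[measurable]: "g \<in> borel_measurable M"
    unfolding g_def by (rule borel_measurable_lim_metric) simp
  have AEg: "AE x in M. \<forall>k. (norm (f k x - g x))\<^sup>2 \<le> T x / (1 - q)\<^sup>2 * (q\<^sup>2) ^ k"
    using AEsum
  proof eventually_elim
    case (elim x)
    \<comment> \<open>The tail of the geometric series of the bounds
      \<open>q ^ k * sqrt (T x)\<close>, so that increments of \<open>f\<close> are dominated by
      decrements of \<open>e\<close>.\<close>
    define e where "e k = q ^ k * sqrt (T x) / (1 - q)" for k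
    have T0: "0 \<le> T x" unfolding T_def using elim S0 by (intro suminf_nonneg) auto
    have step: "norm (f (Suc k) x - f k x) \<le> q ^ k * sqrt (T x)" for k
    proof -
      have "S k x \<le> T x"
        unfolding T_def using sum_le_suminf[OF elim, of "{k}"] S0 by simp
      then have "(norm (f (Suc k) x - f k x))\<^sup>2 \<le> (q ^ k)\<^sup>2 * T x"
        using q unfolding S_def by (simp add: field_simps flip: power_mult)
      then have "norm (f (Suc k) x - f k x) \<le> sqrt ((q ^ k)\<^sup>2 * T x)" by (rule real_le_rsqrt)
      then show ?thesis using q by (simp add: real_sqrt_mult)
    qed
    have ee: "q ^ k * sqrt (T x) = e k - e (Suc k)" for k
    proof -
      have "e k - e (Suc k) = q ^ k * sqrt (T x) * (1 - q) / (1 - q)"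
        unfolding e_def by (simp add: diff_divide_distrib algebra_simps)
      then show ?thesis using q by simp
    qed
    have e0: "e k \<ge> 0" for k unfolding e_def using q T0 by simp
    have diff: "norm (f (k + m) x - f k x) \<le> e k - e (k + m)" for k m
    proof (induction m)
      case (Suc m)
      have "norm (f (k + Suc m) x - f k x) \<le> norm (f (Suc (k + m)) x - f (k + m) x) + norm (f (k + m) x - f k x)"
        using norm_triangle_ineq[of "f (Suc (k + m)) x - f (k + m) x" "f (k + m) x - f k x"] by simp
      then show ?case using Suc step[of "k + m"] ee[of "k + m"] by simp
    qed simp
    have "summable (\<lambda>k. f (Suc k) x - f k x)"
    proof (rule summable_comparison_test')
      show "summable (\<lambda>k. q ^ k * sqrt (T x))" using q by (intro summable_mult2 summable_geometric) auto
    qed (use step in auto)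
    then have "convergent (\<lambda>n. \<Sum>k<n. f (Suc k) x - f k x)"
      using summable_iff_convergent by blast
    then have "convergent (\<lambda>n. f n x - f 0 x)"
      by (simp add: sum_lessThan_telescope[of "\<lambda>k. f k x"])
    then have "convergent (\<lambda>n. (f n x - f 0 x) + f 0 x)"
      by (intro convergent_add convergent_const)
    then have lim: "(\<lambda>n. f n x) \<longlonglongrightarrow> g x"
      unfolding g_def by (simp add: convergent_LIMSEQ_iff)
    show ?case
    proof
      fix k
      have "norm (g x - f k x) \<le> e k"
      proof (rule tendsto_upperbound)
        show "(\<lambda>m. norm (f (m + k) x - f k x)) \<longlonglongrightarrow> norm (g x - f k x)"
          by (intro tendsto_intros LIMSEQ_ignore_initial_segment lim)
        show "\<forall>\<^sub>F m in sequentially. norm (f (m + k) x - f k x) \<le> e k"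
        proof (intro always_eventually allI)
          show "norm (f (m + k) x - f k x) \<le> e k" for m
            using diff[of k m] e0[of "k + m"] by (simp add: add.commute)
        qed
      qed simp
      then have "(norm (g x - f k x))\<^sup>2 \<le> (e k)\<^sup>2" by (intro power_mono) auto
      also have "(e k)\<^sup>2 = T x / (1 - q)\<^sup>2 * (q\<^sup>2) ^ k"
        unfolding e_def using T0 by (simp add: power_divide power_mult_distrib mult.commute flip: power_mult)
      finally show "(norm (f k x - g x))\<^sup>2 \<le> T x / (1 - q)\<^sup>2 * (q\<^sup>2) ^ k"
        by (simp add: norm_minus_commute)
    qed
  qed
  have int_diff: "integrable M (\<lambda>x. (norm (f k x - g x))\<^sup>2)" for k
  proof (rule Bochner_Integration.integrable_bound[where f="\<lambda>x. T x / (1 - q)\<^sup>2 * (q\<^sup>2) ^ k"])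
    show "AE x in M. norm ((norm (f k x - g x))\<^sup>2) \<le> norm (T x / (1 - q)\<^sup>2 * (q\<^sup>2) ^ k)"
      using AEg by eventually_elim (metis abs_ge_self abs_of_nonneg order_trans real_norm_def zero_le_power2)
  qed (use intT in auto)
  have "L2 M (\<lambda>x. f 0 x - g x)" unfolding L2_def using int_diff[of 0] by simp
  from L2_diff[OF f[of 0] this] have "L2 M g" by simp
  moreover have "(\<lambda>k. LINT x|M. (norm (f k x - g x))\<^sup>2) \<longlonglongrightarrow> 0"
  proof (rule tendsto_sandwich[OF _ _ tendsto_const])
    show "\<forall>\<^sub>F k in sequentially. (LINT x|M. (norm (f k x - g x))\<^sup>2) \<le> (LINT x|M. T x / (1 - q)\<^sup>2) * (q\<^sup>2) ^ k"
    proof (intro always_eventually allI)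
      fix k
      have "(LINT x|M. (norm (f k x - g x))\<^sup>2) \<le> (LINT x|M. T x / (1 - q)\<^sup>2 * (q\<^sup>2) ^ k)"
        using AEg intT int_diff by (intro integral_mono_AE) (auto elim!: eventually_mono)
      then show "(LINT x|M. (norm (f k x - g x))\<^sup>2) \<le> (LINT x|M. T x / (1 - q)\<^sup>2) * (q\<^sup>2) ^ k" by simp
    qed
    show "(\<lambda>k. (LINT x|M. T x / (1 - q)\<^sup>2) * (q\<^sup>2) ^ k) \<longlonglongrightarrow> 0"
      using q2 by (intro tendsto_mult_right_zero LIMSEQ_power_zero) auto
  qed auto
  ultimately show ?thesis by blast
qed

section \<open>Orthogonal projection and the Lax--Milgram theorem\<close>

text \<open>A closed subspace is represented by the equations that cut it out, so that closedness is
  continuity of the pairing. Functions equal almost everywhere are not identified, and the inner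
  product is the real one, which for complex values is \<open>Re (z * cnj w)\<close>.\<close>

definition annihilator ::
  "'a measure \<Rightarrow> ('a \<Rightarrow> 'b::euclidean_space) set \<Rightarrow> ('a \<Rightarrow> 'b) set" where
  "annihilator M T = {f. L2 M f \<and> (\<forall>t\<in>T. (LINT x|M. f x \<bullet> t x) = 0)}"

lemma annihilator_lincomb:
  assumes T: "\<And>t. t \<in> T \<Longrightarrow> L2 M t" and f: "f \<in> annihilator M T" and g: "g \<in> annihilator M T"
  shows "(\<lambda>x. a *\<^sub>R f x + b *\<^sub>R g x) \<in> annihilator M T"
proof -
  have "(LINT x|M. (a *\<^sub>R f x + b *\<^sub>R g x) \<bullet> t x) = 0" if "t \<in> T" for t
  proof -
    have "integrable M (\<lambda>x. f x \<bullet> t x)" "integrable M (\<lambda>x. g x \<bullet> t x)"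
      using f g T[OF that] by (auto simp: annihilator_def intro: L2_inner_integrable)
    then have "(LINT x|M. (a *\<^sub>R f x + b *\<^sub>R g x) \<bullet> t x) = a * (LINT x|M. f x \<bullet> t x) + b * (LINT x|M. g x \<bullet> t x)"
      by (simp add: inner_add_left)
    then show ?thesis using f g that by (simp add: annihilator_def)
  qed
  then show ?thesis
    using f g by (auto simp: annihilator_def intro!: L2_add L2_scaleR)
qed

lemma annihilator_limit:
  assumes T: "\<And>t. t \<in> T \<Longrightarrow> L2 M t" and f: "\<And>k. f k \<in> annihilator M T" and g: "L2 M g"
    and lim: "(\<lambda>k. LINT x|M. (norm (f k x - g x))\<^sup>2) \<longlonglongrightarrow> 0"
  shows "g \<in> annihilator M T"
proof -
  have "(LINT x|M. g x \<bullet> t x) = 0" if "t \<in> T" for t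
  proof -
    have "(\<lambda>k. LINT x|M. f k x \<bullet> t x) \<longlonglongrightarrow> (LINT x|M. g x \<bullet> t x)"
      using f T[OF that] g lim by (intro L2_weak_limit) (auto simp: annihilator_def)
    moreover have "(\<lambda>k. LINT x|M. f k x \<bullet> t x) = (\<lambda>k. 0)"
      using f that by (auto simp: annihilator_def)
    ultimately show ?thesis by (simp add: LIMSEQ_const_iff)
  qed
  with g show ?thesis by (simp add: annihilator_def)
qed

text \<open>First order cannot be dominated by second order: put \<open>s = t * b\<close>, divide by
  \<open>t > 0\<close> and take \<open>t = 1 / (\<bar>c\<bar> + 1)\<close>, which is small enough to
  contradict \<open>b \<noteq> 0\<close>.\<close>

lemma quadratic_bound_zero:
  fixes b c :: real
  assumes "\<And>s. 2 * s * b \<le> s\<^sup>2 * c" shows "b = 0"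
proof (rule ccontr)
  assume "b \<noteq> 0"
  have "2 * b\<^sup>2 \<le> t * (b\<^sup>2 * c)" if "t > 0" for t
  proof -
    have "t * (2 * b\<^sup>2) \<le> t * (t * (b\<^sup>2 * c))"
      using assms[of "t * b"] by (simp add: power2_eq_square algebra_simps)
    then show ?thesis using that by (rule mult_left_le_imp_le)
  qed
  from this[of "1 / (\<bar>c\<bar> + 1)"] have "2 * b\<^sup>2 * (\<bar>c\<bar> + 1) \<le> b\<^sup>2 * c"
    by (simp add: field_simps)
  also have "\<dots> \<le> b\<^sup>2 * (\<bar>c\<bar> + 1)" by (intro mult_left_mono) auto
  finally have "b\<^sup>2 * (\<bar>c\<bar> + 1) \<le> 0" by (simp add: algebra_simps)
  then show False using \<open>b \<noteq> 0\<close> by (simp add: mult_le_0_iff)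
qed

text \<open>A minimising sequence for the distance from \<open>X\<close> is Cauchy by the
  parallelogram law, because the midpoint of two of its members lies again in the subspace. At the
  limit the first variation of the distance vanishes in every direction of the subspace.\<close>

lemma annihilator_projection:
  fixes X :: "'a \<Rightarrow> 'b::euclidean_space"
  assumes T: "\<And>t. t \<in> T \<Longrightarrow> L2 M t" and X: "L2 M X"
  shows "\<exists>P\<in>annihilator M T. \<forall>W\<in>annihilator M T. (LINT x|M. (X x - P x) \<bullet> W x) = 0"
proof -
  let ?V = "annihilator M T"
  define n where "n f = (LINT x|M. (norm (f x))\<^sup>2)" for f :: "'a \<Rightarrow> 'b"
  have n0: "0 \<le> n f" for f unfolding n_def by simp
  define \<delta> where "\<delta> = (INF W\<in>?V. n (\<lambda>x. X x - W x))"
  have "(\<lambda>x. 0) \<in> ?V" using L2_zero by (auto simp: annihilator_def)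
  then have ne: "?V \<noteq> {}" by blast
  have bdd: "bdd_below ((\<lambda>W. n (\<lambda>x. X x - W x)) ` ?V)" by (rule bdd_belowI[of _ 0]) (use n0 in auto)
  have low: "\<delta> \<le> n (\<lambda>x. X x - W x)" if "W \<in> ?V" for W
    unfolding \<delta>_def using bdd that by (rule cINF_lower)
  \<comment> \<open>The excess \<open>1/16 = (1/2) ^ 4\<close> is the rate that
    \<open>L2_geometric_limit\<close> asks for with \<open>q = 1/2\<close>.\<close>
  have "\<exists>W\<in>?V. n (\<lambda>x. X x - W x) < \<delta> + (1/16) ^ k" for k
    using cINF_less_iff[OF ne bdd, of "\<delta> + (1/16) ^ k"] unfolding \<delta>_def by simp
  then obtain W where W: "\<And>k. W k \<in> ?V" "\<And>k. n (\<lambda>x. X x - W k x) < \<delta> + (1/16) ^ k"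
    by metis
  have WL: "L2 M (W k)" for k using W(1) by (auto simp: annihilator_def)
  have "n (\<lambda>x. W (Suc k) x - W k x) \<le> 4 * (((1/2)::real) ^ 4) ^ k" for k
  proof -
    let ?m = "\<lambda>x. (1/2) *\<^sub>R W k x + (1/2) *\<^sub>R W (Suc k) x"
    have m: "?m \<in> ?V" by (intro annihilator_lincomb T W)
    have mL: "L2 M ?m" using m by (simp add: annihilator_def)
    have par: "(norm (b - a))\<^sup>2 = 2 * (norm (x - a))\<^sup>2 + 2 * (norm (x - b))\<^sup>2
        - 4 * (norm (x - ((1/2) *\<^sub>R a + (1/2) *\<^sub>R b)))\<^sup>2" for x a b :: 'b
      by (simp add: power2_norm_eq_inner inner_diff_left inner_diff_right inner_add_left inner_add_right
          inner_commute algebra_simps)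
    have "n (\<lambda>x. W (Suc k) x - W k x) = 2 * n (\<lambda>x. X x - W k x) + 2 * n (\<lambda>x. X x - W (Suc k) x)
        - 4 * n (\<lambda>x. X x - ?m x)"
    proof -
      have "n (\<lambda>x. W (Suc k) x - W k x) = (LINT x|M. 2 * (norm (X x - W k x))\<^sup>2 + 2 * (norm (X x - W (Suc k) x))\<^sup>2
          - 4 * (norm (X x - ?m x))\<^sup>2)"
        unfolding n_def by (intro Bochner_Integration.integral_cong refl par)
      then show ?thesis
        unfolding n_def using L2_diff[OF X WL[of k]] L2_diff[OF X WL[of "Suc k"]] L2_diff[OF X mL]
        by (simp add: L2_def)
    qed
    then have "n (\<lambda>x. W (Suc k) x - W k x) \<le> 2 * (1/16) ^ k + 2 * (1/16) ^ (Suc k)"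
      using W(2)[of k] W(2)[of "Suc k"] low[OF m] by linarith
    also have "\<dots> \<le> 4 * (1/16) ^ k" by simp
    finally show ?thesis by (simp add: power4_eq_xxxx)
  qed
  then have "\<exists>P. L2 M P \<and> (\<lambda>k. LINT x|M. (norm (W k x - P x))\<^sup>2) \<longlonglongrightarrow> 0"
    unfolding n_def by (intro L2_geometric_limit[where q="1/2" and K=4] WL) auto
  then obtain P where P: "L2 M P" "(\<lambda>k. LINT x|M. (norm (W k x - P x))\<^sup>2) \<longlonglongrightarrow> 0" by blast
  have PV: "P \<in> ?V" by (rule annihilator_limit[OF T W(1) P])
  moreover have "(LINT x|M. (X x - P x) \<bullet> Y x) = 0" if Y: "Y \<in> ?V" for Y
  proof (rule quadratic_bound_zero)
    fix s :: real
    have YL: "L2 M Y" using Y by (simp add: annihilator_def)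
    \<comment> \<open>Compare \<open>W k\<close> with the competitor \<open>W k + s Y\<close>.
      Minimality up to \<open>(1/16) ^ k\<close> becomes an inequality that is linear in
      \<open>s\<close> on the left and quadratic on the right, and it survives the limit in
      \<open>k\<close>.\<close>
    have le: "2 * s * (LINT x|M. (X x - W k x) \<bullet> Y x) \<le> (1/16) ^ k + s\<^sup>2 * n Y" for k
    proof -
      have XW: "L2 M (\<lambda>x. X x - W k x)" by (intro L2_diff X WL)
      have "(\<lambda>x. 1 *\<^sub>R W k x + s *\<^sub>R Y x) \<in> ?V" by (intro annihilator_lincomb T W Y)
      from low[OF this] have "\<delta> \<le> n (\<lambda>x. X x - W k x - s *\<^sub>R Y x)" by (simp add: diff_diff_add)
      also have "\<dots> = (LINT x|M. (norm (X x - W k x))\<^sup>2 - 2 * s * ((X x - W k x) \<bullet> Y x) + s\<^sup>2 * (norm (Y x))\<^sup>2)"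
        unfolding n_def
        by (intro Bochner_Integration.integral_cong refl, subst (1 2 3) power2_norm_eq_inner)
          (simp add: inner_diff_left inner_diff_right inner_commute power2_eq_square[of s] algebra_simps)
      also have "\<dots> = n (\<lambda>x. X x - W k x) - 2 * s * (LINT x|M. (X x - W k x) \<bullet> Y x) + s\<^sup>2 * n Y"
        unfolding n_def using XW YL L2_inner_integrable[OF XW YL] unfolding L2_def by simp
      finally show ?thesis using W(2)[of k] by linarith
    qed
    have "(\<lambda>k. LINT x|M. (X x - W k x) \<bullet> Y x) \<longlonglongrightarrow> (LINT x|M. (X x - P x) \<bullet> Y x)"
      by (rule L2_weak_limit) (use X WL P YL in \<open>auto intro!: L2_diff simp: norm_minus_commute\<close>)
    then have "(\<lambda>k. 2 * s * (LINT x|M. (X x - W k x) \<bullet> Y x)) \<longlonglongrightarrow> 2 * s * (LINT x|M. (X x - P x) \<bullet> Y x)"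
      by (intro tendsto_intros)
    moreover have "(\<lambda>k. (1/16) ^ k + s\<^sup>2 * n Y) \<longlonglongrightarrow> 0 + s\<^sup>2 * n Y"
      by (intro tendsto_intros LIMSEQ_power_zero) auto
    ultimately have "2 * s * (LINT x|M. (X x - P x) \<bullet> Y x) \<le> 0 + s\<^sup>2 * n Y"
      by (rule LIMSEQ_le) (use le in auto)
    then show "2 * s * (LINT x|M. (X x - P x) \<bullet> Y x) \<le> s\<^sup>2 * n Y" by simp
  qed
  ultimately show ?thesis by blast
qed

lemma L2_pointwise_bounded:
  assumes "\<And>f. f \<in> borel_measurable M \<Longrightarrow> (\<lambda>x. A x (f x)) \<in> borel_measurable M"
    and "AE x in M. \<forall>z. norm (A x z) \<le> K * norm z" and "L2 M f"
  shows "L2 M (\<lambda>x. A x (f x))"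
proof (rule L2_dominated[OF _ assms(3)])
  show "(\<lambda>x. A x (f x)) \<in> borel_measurable M" using assms(1,3) by (simp add: L2_def)
  show "AE x in M. norm (A x (f x)) \<le> K * norm (f x)" using assms(2) by eventually_elim auto
qed

text \<open>The operator acts through a linear map \<open>A x\<close> at each point, so boundedness
  and coercivity are pointwise conditions. The solution is a fixed point of
  \<open>U \<mapsto> P (U - t (A U - F))\<close>, where \<open>P\<close> is the orthogonal
  projection on the subspace: for \<open>t = c / L\<^sup>2\<close> the map \<open>1 - t A\<close>
  shrinks squared norms by \<open>\<theta> = 1 - (c / L)\<^sup>2\<close>, and projecting does not
  enlarge them.\<close>

theorem Lax_Milgram_pointwise:
  fixes A :: "'a \<Rightarrow> 'b \<Rightarrow> 'b::euclidean_space"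
  assumes T: "\<And>t. t \<in> T \<Longrightarrow> L2 M t"
    and lin: "\<And>x. linear (A x)"
    and meas: "\<And>f. f \<in> borel_measurable M \<Longrightarrow> (\<lambda>x. A x (f x)) \<in> borel_measurable M"
    and bdd: "AE x in M. \<forall>z. norm (A x z) \<le> K * norm z"
    and c: "c > 0" and coercive: "AE x in M. \<forall>z. c * (norm z)\<^sup>2 \<le> A x z \<bullet> z"
    and F: "L2 M F"
  shows "\<exists>U\<in>annihilator M T. \<forall>W\<in>annihilator M T. (LINT x|M. (A x (U x) - F x) \<bullet> W x) = 0"
proof -
  let ?V = "annihilator M T"
  define n where "n f = (LINT x|M. (norm (f x))\<^sup>2)" for f :: "'a \<Rightarrow> 'b"
  \<comment> \<open>The bound \<open>K\<close> is enlarged beyond \<open>c\<close>, so that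
    \<open>c / L < 1\<close> and \<open>\<theta>\<close> is strictly positive; the convergence lemma
    needs a positive ratio.\<close>
  define L where "L = max K (2 * c)"
  have L: "0 < L" "c < L" "AE x in M. \<forall>z. norm (A x z) \<le> L * norm z"
  proof -
    show "0 < L" "c < L" using c unfolding L_def by auto
    show "AE x in M. \<forall>z. norm (A x z) \<le> L * norm z"
      using bdd unfolding L_def
      by eventually_elim (meson max.cobounded1 mult_right_mono norm_ge_zero order_trans)
  qed
  define \<theta> where "\<theta> = 1 - (c / L)\<^sup>2"
  define t where "t = c / L\<^sup>2"
  have \<theta>: "0 < \<theta>" "\<theta> < 1"
    using c L unfolding \<theta>_def by (auto simp: power_less_one_iff)
  have contract: "AE x in M. \<forall>z. (norm (z - t *\<^sub>R A x z))\<^sup>2 \<le> \<theta> * (norm z)\<^sup>2"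
    using L(3) coercive
  proof eventually_elim
    case (elim x)
    show ?case
    proof
      fix z
      have "(norm (z - t *\<^sub>R A x z))\<^sup>2 = (norm z)\<^sup>2 - 2 * t * (A x z \<bullet> z) + t\<^sup>2 * (norm (A x z))\<^sup>2"
        by (subst (1 2 3) power2_norm_eq_inner)
          (simp add: inner_diff_left inner_diff_right inner_commute power2_eq_square[of t] algebra_simps)
      also have "\<dots> \<le> (norm z)\<^sup>2 - 2 * t * (c * (norm z)\<^sup>2) + t\<^sup>2 * (L * norm z)\<^sup>2"
        using elim c L unfolding t_def
        by (intro add_mono diff_mono mult_left_mono power_mono) auto
      also have "\<dots> = \<theta> * (norm z)\<^sup>2"
        using L(1) unfolding t_def \<theta>_def by (simp add: field_simps power2_eq_square)
      finally show "(norm (z - t *\<^sub>R A x z))\<^sup>2 \<le> \<theta> * (norm z)\<^sup>2" .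
    qed
  qed
  have AL: "L2 M (\<lambda>x. A x (f x))" if "L2 M f" for f
    using meas bdd that by (rule L2_pointwise_bounded)
  define pr where "pr X = (SOME P. P \<in> ?V \<and> (\<forall>W\<in>?V. (LINT x|M. (X x - P x) \<bullet> W x) = 0))" for X
  have pr: "pr X \<in> ?V" "\<And>W. W \<in> ?V \<Longrightarrow> (LINT x|M. (X x - pr X x) \<bullet> W x) = 0" if "L2 M X" for X
    using someI_ex[OF annihilator_projection[OF T that, unfolded Bex_def]] unfolding pr_def by blast+
  define step where "step U = (\<lambda>x. U x - t *\<^sub>R (A x (U x) - F x))" for U
  have stepL: "L2 M (step U)" if "L2 M U" for U
    unfolding step_def by (intro L2_diff L2_scaleR that AL F)
  define U where "U k = ((\<lambda>U. pr (step U)) ^^ k) (\<lambda>x. 0)" for k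
  have U_Suc: "U (Suc k) = pr (step (U k))" for k unfolding U_def by simp
  have U0: "(\<lambda>x. 0) \<in> ?V" using L2_zero by (auto simp: annihilator_def)
  have UV: "U k \<in> ?V" for k
  proof (induction k)
    case (Suc k)
    then show ?case unfolding U_Suc by (intro pr stepL) (simp add: annihilator_def)
  qed (simp add: U0 U_def)
  have UL: "L2 M (U k)" for k using UV by (simp add: annihilator_def)
  define D where "D k = (\<lambda>x. U (Suc k) x - U k x)" for k
  have DL: "L2 M (D k)" for k unfolding D_def by (intro L2_diff UL)
  have DV: "D k \<in> ?V" for k
    using annihilator_lincomb[OF T UV[of "Suc k"] UV[of k], of 1 "-1"] unfolding D_def by simp
  have nD: "n (D (Suc k)) \<le> \<theta> * n (D k)" for k
  proof -
    let ?Y = "\<lambda>x. D k x - t *\<^sub>R A x (D k x)"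
    have YL: "L2 M ?Y" by (intro L2_diff L2_scaleR AL DL)
    have i1: "integrable M (\<lambda>x. (step (U j) x - U (Suc j) x) \<bullet> D (Suc k) x)" for j
      by (intro L2_inner_integrable L2_diff stepL UL DL)
    have z: "(LINT x|M. (step (U j) x - U (Suc j) x) \<bullet> D (Suc k) x) = 0" for j
      unfolding U_Suc by (intro pr stepL UL DV)
    \<comment> \<open>Both projection residuals \<open>step (U j) - U (Suc j)\<close> are orthogonal
      to \<open>D (Suc k)\<close>, which lies in the subspace. Subtracting the two relations
      exhibits \<open>n (D (Suc k))\<close> as the inner product of \<open>D (Suc k)\<close> with
      \<open>D k - t A (D k)\<close>, and Cauchy-Schwarz turns this into the contraction
      estimate.\<close>
    have pt: "?Y x \<bullet> D (Suc k) x - (norm (D (Suc k) x))\<^sup>2 = (step (U (Suc k)) x - U (Suc (Suc k)) x) \<bullet> D (Suc k) x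
        - (step (U k) x - U (Suc k) x) \<bullet> D (Suc k) x" for x
      unfolding step_def D_def linear_diff[OF lin] power2_norm_eq_inner
      by (simp add: inner_diff_left inner_diff_right algebra_simps)
    have "(LINT x|M. ?Y x \<bullet> D (Suc k) x) - n (D (Suc k)) = (LINT x|M. ?Y x \<bullet> D (Suc k) x - (norm (D (Suc k) x))\<^sup>2)"
      unfolding n_def using L2_inner_integrable[OF YL DL[of "Suc k"]] DL[of "Suc k"] by (simp add: L2_def)
    also have "\<dots> = 0" unfolding pt using i1 z by simp
    finally have eq: "n (D (Suc k)) = (LINT x|M. ?Y x \<bullet> D (Suc k) x)" by simp
    have "n (D (Suc k)) * n (D (Suc k)) \<le> n ?Y * n (D (Suc k))"
      using L2_Cauchy_Schwarz[OF YL DL[of "Suc k"], folded eq] by (simp add: n_def power2_eq_square)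
    moreover have "0 \<le> n (D (Suc k))" "0 \<le> n ?Y" unfolding n_def by auto
    ultimately have "n (D (Suc k)) \<le> n ?Y"
      by (cases "n (D (Suc k)) = 0") (auto simp: mult_le_cancel_right)
    also have "n ?Y \<le> (LINT x|M. \<theta> * (norm (D k x))\<^sup>2)"
      unfolding n_def using YL DL[of k] contract
      by (intro integral_mono_AE) (auto simp: L2_def elim!: eventually_mono)
    finally show ?thesis unfolding n_def by simp
  qed
  have geo: "n (D k) \<le> n (D 0) * \<theta> ^ k" for k
  proof (induction k)
    case (Suc k)
    have "n (D (Suc k)) \<le> \<theta> * n (D k)" by (rule nD)
    also have "\<dots> \<le> \<theta> * (n (D 0) * \<theta> ^ k)" using Suc \<theta> by (intro mult_left_mono) auto
    finally show ?case by (simp add: mult_ac)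
  qed simp
  \<comment> \<open>Squared increments decay like \<open>\<theta> ^ k\<close>, and the convergence
    lemma expects the rate \<open>(q ^ 4) ^ k\<close>.\<close>
  define q where "q = root 4 \<theta>"
  have q: "0 < q" "q < 1" "q ^ 4 = \<theta>" using \<theta> unfolding q_def by auto
  obtain Ul where Ul: "L2 M Ul" "(\<lambda>k. n (\<lambda>x. U k x - Ul x)) \<longlonglongrightarrow> 0"
    using L2_geometric_limit[of M U q "n (D 0)"] UL q geo unfolding n_def D_def by auto
  have UlV: "Ul \<in> ?V" by (rule annihilator_limit[OF T UV Ul(1)]) (use Ul(2) in \<open>simp_all add: n_def\<close>)
  moreover have "(LINT x|M. (A x (Ul x) - F x) \<bullet> W x) = 0" if W: "W \<in> ?V" for W
  proof -
    have WL: "L2 M W" using W by (simp add: annihilator_def)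
    have "(\<lambda>k. n (\<lambda>x. A x (U k x) - A x (Ul x))) \<longlonglongrightarrow> 0"
    proof (rule tendsto_sandwich[OF _ _ tendsto_const])
      have "n (\<lambda>x. A x (U k x) - A x (Ul x)) \<le> (LINT x|M. L\<^sup>2 * (norm (U k x - Ul x))\<^sup>2)" for k
      proof (unfold n_def, rule integral_mono_AE)
        show "integrable M (\<lambda>x. (norm (A x (U k x) - A x (Ul x)))\<^sup>2)"
          using L2_diff[OF AL[OF UL[of k]] AL[OF Ul(1)]] by (simp add: L2_def)
        show "integrable M (\<lambda>x. L\<^sup>2 * (norm (U k x - Ul x))\<^sup>2)"
          using L2_diff[OF UL[of k] Ul(1)] by (simp add: L2_def)
        show "AE x in M. (norm (A x (U k x) - A x (Ul x)))\<^sup>2 \<le> L\<^sup>2 * (norm (U k x - Ul x))\<^sup>2"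
          using L(3)
        proof eventually_elim
          case (elim x)
          have "(norm (A x (U k x - Ul x)))\<^sup>2 \<le> (L * norm (U k x - Ul x))\<^sup>2"
            using elim by (intro power_mono) auto
          then show ?case by (simp add: linear_diff[OF lin] power_mult_distrib)
        qed
      qed
      then show "\<forall>\<^sub>F k in sequentially. n (\<lambda>x. A x (U k x) - A x (Ul x)) \<le> L\<^sup>2 * n (\<lambda>x. U k x - Ul x)"
        by (simp add: n_def)
      show "(\<lambda>k. L\<^sup>2 * n (\<lambda>x. U k x - Ul x)) \<longlonglongrightarrow> 0"
        using Ul(2) by (rule tendsto_mult_right_zero)
    qed (simp add: n_def)
    then have l1: "(\<lambda>k. LINT x|M. A x (U k x) \<bullet> W x) \<longlonglongrightarrow> (LINT x|M. A x (Ul x) \<bullet> W x)"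
      unfolding n_def by (intro L2_weak_limit AL UL Ul WL)
    have l2: "(\<lambda>k. LINT x|M. U k x \<bullet> W x) \<longlonglongrightarrow> (LINT x|M. Ul x \<bullet> W x)"
      using Ul(2) unfolding n_def by (intro L2_weak_limit UL Ul WL)
    have i: "integrable M (\<lambda>x. f x \<bullet> W x)" if "L2 M f" for f
      using that WL by (rule L2_inner_integrable)
    \<comment> \<open>Orthogonality of one residual, solved for the operator term; in the limit the
      two neighbouring iterates cancel and \<open>t\<close> can be divided out.\<close>
    have "t * (LINT x|M. (A x (U k x)) \<bullet> W x) = (LINT x|M. U k x \<bullet> W x) - (LINT x|M. U (Suc k) x \<bullet> W x)
       + t * (LINT x|M. F x \<bullet> W x)" for k
    proof -
      have "0 = (LINT x|M. (step (U k) x - U (Suc k) x) \<bullet> W x)"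
        unfolding U_Suc using pr(2)[OF stepL[OF UL] W] by simp
      also have "\<dots> = (LINT x|M. U k x \<bullet> W x - t * (A x (U k x) \<bullet> W x) + t * (F x \<bullet> W x) - U (Suc k) x \<bullet> W x)"
        unfolding step_def by (simp add: inner_diff_left algebra_simps)
      also have "\<dots> = (LINT x|M. U k x \<bullet> W x) - t * (LINT x|M. A x (U k x) \<bullet> W x) + t * (LINT x|M. F x \<bullet> W x)
          - (LINT x|M. U (Suc k) x \<bullet> W x)"
        using i[OF UL[of k]] i[OF AL[OF UL[of k]]] i[OF F] i[OF UL[of "Suc k"]] by simp
      finally show ?thesis by simp
    qed
    then have "(\<lambda>k. t * (LINT x|M. (A x (U k x)) \<bullet> W x)) = (\<lambda>k. (LINT x|M. U k x \<bullet> W x) - (LINT x|M. U (Suc k) x \<bullet> W x)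
       + t * (LINT x|M. F x \<bullet> W x))" by blast
    moreover have "(\<lambda>k. (LINT x|M. U k x \<bullet> W x) - (LINT x|M. U (Suc k) x \<bullet> W x)
       + t * (LINT x|M. F x \<bullet> W x)) \<longlonglongrightarrow> (LINT x|M. Ul x \<bullet> W x) - (LINT x|M. Ul x \<bullet> W x) + t * (LINT x|M. F x \<bullet> W x)"
      by (intro tendsto_intros l2 LIMSEQ_Suc)
    moreover have "(\<lambda>k. t * (LINT x|M. (A x (U k x)) \<bullet> W x)) \<longlonglongrightarrow> t * (LINT x|M. A x (Ul x) \<bullet> W x)"
      by (intro tendsto_intros l1)
    ultimately have "t * (LINT x|M. A x (Ul x) \<bullet> W x) = t * (LINT x|M. F x \<bullet> W x)"
      using LIMSEQ_unique by fastforce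
    then have "(LINT x|M. A x (Ul x) \<bullet> W x) = (LINT x|M. F x \<bullet> W x)"
      using c L(1) unfolding t_def by simp
    then show ?thesis
      using i[OF AL[OF Ul(1)]] i[OF F] by (simp add: inner_diff_left)
  qed
  ultimately show ?thesis by blast
qed

section \<open>Calculus of test functions, fundamental lemma, convolution\<close>

section \<open>Smooth functions of several variables\<close>

lemma partial_unique:
  assumes "(f has_derivative D) (at x)" shows "partial i f x = D (axis i 1)"
  using frechet_derivative_at[OF assms] by (simp add: partial_def)

lemma differentiable_on_UNIV_D:
  "f differentiable_on UNIV \<Longrightarrow> (f has_derivative frechet_derivative f (at x)) (at x)"
  by (simp add: differentiable_on_def frechet_derivative_works)

lemma partial_const: "partial i (\<lambda>x. c) = (\<lambda>x. 0)"
  by (rule ext, subst partial_unique[OF has_derivative_const]) simp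

lemma partial_add:
  assumes "f differentiable_on UNIV" "g differentiable_on UNIV"
  shows "partial i (\<lambda>x. f x + g x) = (\<lambda>x. partial i f x + partial i g x)"
proof
  fix x
  show "partial i (\<lambda>x. f x + g x) x = partial i f x + partial i g x"
    using partial_unique[OF has_derivative_add[OF assms[THEN differentiable_on_UNIV_D]]]
    by (simp add: partial_def)
qed

lemma partial_mult:
  assumes "f differentiable_on UNIV" "g differentiable_on UNIV"
  shows "partial i (\<lambda>x. f x * g x) = (\<lambda>x. f x * partial i g x + partial i f x * g x)"
proof
  fix x
  show "partial i (\<lambda>x. f x * g x) x = f x * partial i g x + partial i f x * g x"
    using partial_unique[OF has_derivative_mult[OF assms[THEN differentiable_on_UNIV_D]]]
    by (simp add: partial_def)
qed

lemma Ck_imp_continuous: "Ck k f \<Longrightarrow> continuous_on UNIV f"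
  by (cases k) (auto intro: differentiable_imp_continuous_on)

lemma Ck_Suc_imp: "Ck (Suc k) f \<Longrightarrow> Ck k f"
  by (induction k arbitrary: f) (auto intro: differentiable_imp_continuous_on)

lemma Ck_const: "Ck k (\<lambda>x. c)"
  by (induction k arbitrary: c) (auto simp: partial_const)

lemma Ck_add: "Ck k f \<Longrightarrow> Ck k g \<Longrightarrow> Ck k (\<lambda>x. f x + g x)"
  by (induction k arbitrary: f g) (auto simp: partial_add intro: continuous_intros)

lemma Ck_mult: "Ck k f \<Longrightarrow> Ck k g \<Longrightarrow> Ck k (\<lambda>x. f x * g x)"
proof (induction k arbitrary: f g)
  case (Suc k)
  then have "Ck k f" "Ck k g" by (auto intro: Ck_Suc_imp simp del: Ck.simps)
  with Suc show ?case by (auto simp: partial_mult intro!: Ck_add)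
qed (auto intro: continuous_intros)

lemma Ck_exp: "Ck k f \<Longrightarrow> Ck k (\<lambda>x. exp (f x))"
proof (induction k arbitrary: f)
  case (Suc k)
  have f: "f differentiable_on UNIV" using Suc.prems by simp
  have D: "((\<lambda>x. exp (f x)) has_derivative (\<lambda>h. exp (f x) * frechet_derivative f (at x) h)) (at x)" for x
    by (rule has_derivative_compose[OF differentiable_on_UNIV_D[OF f]])
      (use DERIV_exp[of "f x"] in \<open>simp add: has_field_derivative_def\<close>)
  have "partial i (\<lambda>x. exp (f x)) = (\<lambda>x. exp (f x) * partial i f x)" for i
    by (rule ext, subst partial_unique[OF D]) (simp add: partial_def)
  moreover have "Ck k (\<lambda>x. exp (f x) * partial i f x)" for i
    using Suc.prems by (intro Ck_mult Suc.IH) (auto intro: Ck_Suc_imp simp del: Ck.simps simp: Ck.simps(2))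
  ultimately show ?case using D by (auto simp: differentiable_on_def differentiable_def)
qed (auto intro: continuous_intros)

lemma Ck_cnj: "Ck k f \<Longrightarrow> Ck k (\<lambda>x. cnj (f x))"
  and partial_cnj: "f differentiable_on UNIV \<Longrightarrow> partial i (\<lambda>x. cnj (f x)) = (\<lambda>x. cnj (partial i f x))"
proof -
  have D: "((\<lambda>x. cnj (f x)) has_derivative (\<lambda>h. cnj (frechet_derivative f (at x) h))) (at x)"
    if "f differentiable_on UNIV" for x and f :: "real^'n \<Rightarrow> complex"
    by (rule bounded_linear.has_derivative[OF bounded_linear_cnj differentiable_on_UNIV_D[OF that]])
  have p: "f differentiable_on UNIV \<Longrightarrow> partial i (\<lambda>x. cnj (f x)) = (\<lambda>x. cnj (partial i f x))"
    for f :: "real^'n \<Rightarrow> complex" and i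
    by (rule ext) (simp add: partial_unique[OF D] partial_def[of i f])
  show "f differentiable_on UNIV \<Longrightarrow> partial i (\<lambda>x. cnj (f x)) = (\<lambda>x. cnj (partial i f x))" by (rule p)
  show "Ck k f \<Longrightarrow> Ck k (\<lambda>x. cnj (f x))"
  proof (induction k arbitrary: f)
    case (Suc k)
    then have f: "f differentiable_on UNIV" by simp
    have "(\<lambda>x. cnj (f x)) differentiable_on UNIV"
      using D[OF f] by (auto simp: differentiable_on_def differentiable_def)
    with Suc show ?case by (simp add: p[OF f])
  qed (auto intro: continuous_intros)
qed

lemma partial_affine:
  assumes "f differentiable_on UNIV"
  shows "partial i (\<lambda>x. f (a + s *\<^sub>R x)) = (\<lambda>x. of_real s * partial i f (a + s *\<^sub>R x))"
    and "(\<lambda>x. f (a + s *\<^sub>R x)) differentiable_on UNIV"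
proof -
  have D: "((\<lambda>x. f (a + s *\<^sub>R x)) has_derivative (\<lambda>h. frechet_derivative f (at (a + s *\<^sub>R x)) (s *\<^sub>R h))) (at x)" for x
    by (rule has_derivative_compose[of "\<lambda>x. a + s *\<^sub>R x" "\<lambda>h. s *\<^sub>R h", OF _ differentiable_on_UNIV_D[OF assms]])
      (auto intro!: derivative_eq_intros)
  have lin: "linear (frechet_derivative f (at y))" for y
    using differentiable_on_UNIV_D[OF assms] has_derivative_linear by blast
  show "partial i (\<lambda>x. f (a + s *\<^sub>R x)) = (\<lambda>x. of_real s * partial i f (a + s *\<^sub>R x))"
  proof
    fix x
    show "partial i (\<lambda>x. f (a + s *\<^sub>R x)) x = of_real s * partial i f (a + s *\<^sub>R x)"
      by (subst partial_unique[OF D], subst linear_scale[OF lin], unfold partial_def) (rule scaleR_conv_of_real)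
  qed
  show "(\<lambda>x. f (a + s *\<^sub>R x)) differentiable_on UNIV"
    using D by (auto simp: differentiable_on_def differentiable_def)
qed

lemma Ck_affine: "Ck k f \<Longrightarrow> Ck k (\<lambda>x. f (a + s *\<^sub>R x))"
proof (induction k arbitrary: f)
  case 0
  then show ?case
    by (auto intro!: continuous_on_compose2[of UNIV f] continuous_intros)
next
  case (Suc k)
  then have f: "f differentiable_on UNIV" by simp
  have "Ck k (\<lambda>x. of_real s * partial i f (a + s *\<^sub>R x))" for i
    using Suc by (intro Ck_mult Ck_const) auto
  then show ?case using partial_affine[OF f] by simp
qed

lemma Ck_bounded_linear: "bounded_linear f \<Longrightarrow> Ck k f"
proof (cases k)
  case (Suc j)
  assume bl: "bounded_linear f"
  have "partial i f = (\<lambda>x. f (axis i 1))" for i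
    using partial_unique[OF bounded_linear_imp_has_derivative[OF bl]] by auto
  then show ?thesis
    using bl Suc by (auto simp: Ck_const differentiable_on_def
        intro: bounded_linear_imp_differentiable bounded_linear.linear linear_imp_differentiable)
qed (simp add: linear_continuous_on)

lemma Ck_prod: "finite I \<Longrightarrow> (\<And>i. i \<in> I \<Longrightarrow> Ck k (f i)) \<Longrightarrow> Ck k (\<lambda>x. \<Prod>i\<in>I. f i x)"
  by (induction I rule: finite_induct) (auto intro: Ck_const Ck_mult)

section \<open>Smooth functions of one variable and bump functions\<close>

fun Cr :: "nat \<Rightarrow> (real \<Rightarrow> real) \<Rightarrow> bool" where
  "Cr 0 F \<longleftrightarrow> continuous_on UNIV F"
| "Cr (Suc k) F \<longleftrightarrow> (\<forall>x. (F has_real_derivative deriv F x) (at x)) \<and> Cr k (deriv F)"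

lemma Cr_SucI:
  assumes "\<And>x. (F has_real_derivative F' x) (at x)" "Cr k F'" shows "Cr (Suc k) F"
proof -
  have "deriv F = F'" using assms(1) by (auto intro: DERIV_imp_deriv)
  with assms show ?thesis by simp
qed

lemma Cr_imp_continuous: "Cr k F \<Longrightarrow> continuous_on UNIV F"
  by (cases k) (auto intro: DERIV_continuous_on)

lemma Cr_Suc_imp: "Cr (Suc k) F \<Longrightarrow> Cr k F"
  by (induction k arbitrary: F) (auto intro: DERIV_continuous_on)

lemma Cr_const: "Cr k (\<lambda>x. c)"
  by (induction k arbitrary: c) (auto intro!: Cr_SucI[OF DERIV_const] simp del: Cr.simps(2))

lemma Cr_add: "Cr k F \<Longrightarrow> Cr k G \<Longrightarrow> Cr k (\<lambda>x. F x + G x)"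
proof (induction k arbitrary: F G)
  case (Suc k)
  then show ?case by (intro Cr_SucI[where F'="\<lambda>x. deriv F x + deriv G x"]) (auto intro: DERIV_add)
qed (auto intro: continuous_intros)

lemma Cr_mult: "Cr k F \<Longrightarrow> Cr k G \<Longrightarrow> Cr k (\<lambda>x. F x * G x)"
proof (induction k arbitrary: F G)
  case (Suc k)
  then have "Cr k F" "Cr k G" by (auto intro: Cr_Suc_imp simp del: Cr.simps)
  with Suc show ?case
    by (intro Cr_SucI[where F'="\<lambda>x. deriv F x * G x + deriv G x * F x"] Cr_add) (auto intro: DERIV_mult)
qed (auto intro: continuous_intros)

lemma Cr_affine: "Cr k F \<Longrightarrow> Cr k (\<lambda>x. F (a + s * x))"
proof (induction k arbitrary: F)
  case 0
  then show ?case by (auto intro!: continuous_on_compose2[of UNIV F] continuous_intros)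
next
  case (Suc k)
  show ?case
  proof (rule Cr_SucI)
    show "((\<lambda>x. F (a + s * x)) has_real_derivative deriv F (a + s * x) * s) (at x)" for x
      using Suc.prems by (intro DERIV_chain2[where g="\<lambda>x. a + s * x"]) (auto intro!: derivative_eq_intros)
    show "Cr k (\<lambda>x. deriv F (a + s * x) * s)" using Suc by (intro Cr_mult Cr_const) auto
  qed
qed

lemma Cr_exp: "Cr k F \<Longrightarrow> Cr k (\<lambda>x. exp (F x))"
proof (induction k arbitrary: F)
  case (Suc k)
  then have "Cr k F" by (auto intro: Cr_Suc_imp simp del: Cr.simps)
  with Suc show ?case
    by (intro Cr_SucI[where F'="\<lambda>x. exp (F x) * deriv F x"] Cr_mult)
      (auto intro!: derivative_eq_intros)
qed (auto intro: continuous_intros)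

text \<open>The functions \<open>x ^ (- k) * exp (- 1 / x)\<close> on the positive axis, extended by
  zero. Derivatives of members are linear combinations of members, so smoothness of all of them
  follows from one derivative formula.\<close>

definition flat :: "nat \<Rightarrow> real \<Rightarrow> real" where
  "flat k x = (if x > 0 then (1 / x) ^ k * exp (- 1 / x) else 0)"

lemma flat_tendsto_0: "((flat k) \<longlongrightarrow> 0) (at_right 0)"
proof -
  have "((\<lambda>x. x ^ k / exp x) \<longlongrightarrow> (0::real)) at_top" by (rule tendsto_power_div_exp_0)
  then have "((\<lambda>x. (inverse x) ^ k / exp (inverse x)) \<longlongrightarrow> (0::real)) (at_right 0)"
    by (rule filterlim_compose[OF _ filterlim_inverse_at_top_right])
  then show ?thesis
    by (rule Lim_transform_eventually)
      (auto simp: eventually_at_right_less flat_def divide_inverse exp_minus intro!: eventually_at_rightI[of 0 1])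
qed

text \<open>Only \<open>x = 0\<close> is delicate: there the right difference quotient of
  \<open>flat k\<close> is \<open>flat (k + 1)\<close>, which tends to 0.\<close>

lemma flat_deriv: "(flat k has_real_derivative (flat (k + 2) x - real k * flat (k + 1) x)) (at x)"
proof -
  consider "x < 0" | "x = 0" | "x > 0" by linarith
  then show ?thesis
  proof cases
    case 1
    have "((\<lambda>x. 0) has_real_derivative 0) (at x)" by simp
    then have "(flat k has_real_derivative 0) (at x)"
      by (rule has_field_derivative_transform_within_open[of _ _ _ "{..<0}"]) (use 1 in \<open>auto simp: flat_def\<close>)
    then show ?thesis using 1 by (simp add: flat_def)
  next
    case 3
    have "((\<lambda>x. (1 / x) ^ k * exp (- 1 / x)) has_real_derivative
        (flat (k + 2) x - real k * flat (k + 1) x)) (at x)"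
    proof -
      have 1: "((\<lambda>x. 1 / x) has_real_derivative - ((1 / x)\<^sup>2)) (at x)"
        using 3 by (auto intro!: derivative_eq_intros simp: power2_eq_square)
      have "((\<lambda>x. (1 / x) ^ k * exp (- (1 / x))) has_real_derivative
          (real k * (1 / x) ^ (k - 1) * - ((1 / x)\<^sup>2)) * exp (- (1 / x)) + exp (- (1 / x)) * (1 / x)\<^sup>2 * (1 / x) ^ k) (at x)"
        using DERIV_mult[OF DERIV_power[OF 1, of k] DERIV_chain2[OF DERIV_exp DERIV_minus[OF 1]]]
        by (simp add: algebra_simps)
      moreover have "(real k * (1 / x) ^ (k - 1) * - ((1 / x)\<^sup>2)) * exp (- (1 / x)) + exp (- (1 / x)) * (1 / x)\<^sup>2 * (1 / x) ^ k
          = flat (k + 2) x - real k * flat (k + 1) x"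
        using 3 by (cases k) (simp_all add: flat_def power2_eq_square algebra_simps add_divide_distrib)
      ultimately show ?thesis by simp
    qed
    then show ?thesis
      by (rule has_field_derivative_transform_within_open[of _ _ _ "{0<..}"]) (use 3 in \<open>auto simp: flat_def\<close>)
  next
    case 2
    have "((\<lambda>y. (flat k y - flat k 0) / (y - 0)) \<longlongrightarrow> 0) (at 0)"
      unfolding filterlim_at_split
    proof (intro conjI)
      have "\<forall>\<^sub>F y in at_left 0. 0 = (flat k y - flat k 0) / (y - 0)"
        by (auto simp: flat_def intro!: eventually_at_leftI[of "-1"])
      then show "((\<lambda>y. (flat k y - flat k 0) / (y - 0)) \<longlongrightarrow> 0) (at_left 0)"
        by (rule Lim_transform_eventually[OF tendsto_const])
      have "\<forall>\<^sub>F y in at_right 0. flat (k + 1) y = (flat k y - flat k 0) / (y - 0)"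
        by (auto simp: flat_def intro!: eventually_at_rightI[of _ 1])
      then show "((\<lambda>y. (flat k y - flat k 0) / (y - 0)) \<longlongrightarrow> 0) (at_right 0)"
        by (rule Lim_transform_eventually[OF flat_tendsto_0])
    qed
    then show ?thesis using 2 by (simp add: has_field_derivative_iff flat_def)
  qed
qed

lemma Cr_flat: "Cr j (flat k)"
proof (induction j arbitrary: k)
  case 0
  then show ?case using flat_deriv by (auto intro!: DERIV_continuous_on)
next
  case (Suc j)
  show ?case
  proof (rule Cr_SucI[OF flat_deriv])
    have "Cr j (\<lambda>x. flat (k + 2) x + (- real k) * flat (k + 1) x)"
      by (intro Cr_add Cr_mult Cr_const Suc)
    then show "Cr j (\<lambda>x. flat (k + 2) x - real k * flat (k + 1) x)" by simp
  qed
qed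

definition bump :: "real \<Rightarrow> real \<Rightarrow> real \<Rightarrow> real" where
  "bump a b x = flat 0 (x - a) * flat 0 (b - x)"

lemma Cr_bump: "Cr k (bump a b)"
proof -
  have "Cr k (\<lambda>x. flat 0 (- a + 1 * x) * flat 0 (b + (-1) * x))"
    by (intro Cr_mult Cr_affine Cr_flat)
  moreover have "(\<lambda>x. flat 0 (- a + 1 * x) * flat 0 (b + (-1) * x)) = bump a b"
    by (auto simp: bump_def)
  ultimately show ?thesis by simp
qed

lemma bump_nonneg: "0 \<le> bump a b x"
  by (simp add: bump_def flat_def)

lemma bump_eq_0_iff: "bump a b x = 0 \<longleftrightarrow> \<not> (a < x \<and> x < b)"
  by (auto simp: bump_def flat_def)

lemma Ck_coordinate: "Cr k F \<Longrightarrow> Ck k (\<lambda>x::real^'n::finite. of_real (F (x $ i)))"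
proof (induction k arbitrary: F)
  case 0
  then have "continuous_on UNIV F" by simp
  then show ?case by (auto intro!: continuous_on_of_real continuous_on_compose2[of UNIV F] continuous_intros)
next
  case (Suc k)
  have D: "((\<lambda>x::real^'n. complex_of_real (F (x $ i))) has_derivative (\<lambda>h. of_real (deriv F (x $ i)) * of_real (h $ i))) (at x)" for x
  proof -
    have F: "(F has_derivative (\<lambda>h. h * deriv F (x $ i))) (at (x $ i))"
      using Suc.prems by (simp add: has_field_derivative_def mult.commute[of _ "deriv F (x $ i)"])
    have "((\<lambda>x::real^'n. F (x $ i)) has_derivative (\<lambda>h. h $ i * deriv F (x $ i))) (at x)"
      by (rule has_derivative_compose[OF bounded_linear_imp_has_derivative[OF bounded_linear_vec_nth] F])
    from has_derivative_of_real[OF this] show ?thesis by (simp add: mult.commute)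
  qed
  have "partial j (\<lambda>x::real^'n. complex_of_real (F (x $ i))) = (\<lambda>x. of_real (deriv F (x $ i)) * of_real (axis j 1 $ i))" for j
    using partial_unique[OF D] by auto
  moreover have "Ck k (\<lambda>x::real^'n. complex_of_real (deriv F (x $ i)) * of_real (axis j 1 $ i))" for j
    using Suc by (intro Ck_mult Ck_const) auto
  ultimately show ?case using D by (auto simp: differentiable_on_def differentiable_def)
qed

section \<open>The fundamental lemma of the calculus of variations\<close>

text \<open>Lebesgue differentiation along the cubes with corner \<open>x\<close> and side
  \<open>h\<close>. Integrals are known only for boxes inside \<open>\<Omega>\<close>, so
  \<open>\<Omega>\<close> is covered by countably many closed boxes and \<open>H\<close> is cut off
  to one of them; as the intersection of two boxes is a box, the cut-off function has vanishing
  integral over all boxes.\<close>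

lemma AE_zero_if_box_integrals_zero:
  fixes H :: "'a::euclidean_space \<Rightarrow> 'b::euclidean_space"
  assumes "open \<Omega>" and int: "\<And>a b. cbox a b \<subseteq> \<Omega> \<Longrightarrow> (H has_integral 0) (cbox a b)"
  shows "AE x in lebesgue. x \<in> \<Omega> \<longrightarrow> H x = 0"
proof -
  obtain \<D> where D: "countable \<D>" "\<D> \<subseteq> Pow \<Omega>" "\<And>X. X \<in> \<D> \<Longrightarrow> \<exists>a b. X = cbox a b" "\<Union>\<D> = \<Omega>"
    using open_countable_Union_open_cbox[OF assms(1)] by metis
  have "AE x in lebesgue. x \<in> X \<longrightarrow> H x = 0" if X: "X \<in> \<D>" for X
  proof -
    obtain c d where cd: "X = cbox c d" using D(3)[OF X] by blast
    define f where "f x = (if x \<in> cbox c d then H x else 0)" for x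
    have f0: "(f has_integral 0) (cbox a b)" for a b
    proof -
      obtain a' b' where "cbox c d \<inter> cbox a b = cbox a' b'" using Int_interval by blast
      moreover have "cbox c d \<subseteq> \<Omega>" using D(2) X cd by blast
      ultimately have "(H has_integral 0) (cbox c d \<inter> cbox a b)" using int[of a' b'] by auto
      then show ?thesis unfolding f_def has_integral_restrict_Int .
    qed
    obtain N where N: "negligible N" "\<And>x e. x \<notin> N \<Longrightarrow> 0 < e \<Longrightarrow> \<exists>d>0. \<forall>h. 0 < h \<and> h < d \<longrightarrow>
         norm(integral (cbox x (x + h *\<^sub>R One)) f /\<^sub>R h ^ DIM('a) - f x) < e"
      using integrable_ccontinuous_explicit[of f] f0 by (metis has_integral_integrable)
    have "f x = 0" if xN: "x \<notin> N" for x
    proof (rule ccontr)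
      assume "f x \<noteq> 0"
      then obtain d where "d > 0" "\<forall>h. 0 < h \<and> h < d \<longrightarrow> norm(integral (cbox x (x + h *\<^sub>R One)) f /\<^sub>R h ^ DIM('a) - f x) < norm (f x)"
        using N(2)[OF xN, of "norm (f x)"] by (auto simp del: norm_scaleR)
      then show False using integral_unique[OF f0] by (metis dense diff_0 less_irrefl norm_minus_cancel scaleR_zero_right)
    qed
    then have "x \<in> N" if "x \<in> cbox c d" "H x \<noteq> 0" for x using that unfolding f_def by metis
    then have "{x. \<not> (x \<in> X \<longrightarrow> H x = 0)} \<subseteq> N" by (auto simp: cd)
    then show ?thesis
      using N(1) by (auto simp: eventually_ae_filter negligible_iff_null_sets intro!: exI[of _ N])
  qed
  then have "AE x in lebesgue. \<forall>X\<in>\<D>. x \<in> X \<longrightarrow> H x = 0" by (subst AE_ball_countable[OF D(1)]) blast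
  then show ?thesis by eventually_elim (use D(4) in auto)
qed

text \<open>\<open>1 - exp (- k \<beta>)\<close> increases to the indicator of the open box as
  \<open>k\<close> grows, so dominated convergence yields the integrals over boxes without any
  mollification. The profile \<open>\<beta>\<close> is left abstract because the argument serves
  both test functions on Euclidean space and those on a half line.\<close>

lemma AE_zero_if_bump_integrals_zero:
  fixes u :: "'a::euclidean_space \<Rightarrow> complex"
  assumes "open \<Omega>" and int: "\<And>a b. cbox a b \<subseteq> \<Omega> \<Longrightarrow> set_integrable lebesgue (cbox a b) u"
    and bump: "\<And>a b. cbox a b \<subseteq> \<Omega> \<Longrightarrow> box a b \<noteq> {} \<Longrightarrow> \<exists>\<beta>. continuous_on UNIV \<beta> \<and> (\<forall>x. \<beta> x \<ge> 0) \<and> {x. \<beta> x \<noteq> 0} = box a b \<and>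
       (\<forall>k::nat. (LINT x|lebesgue. u x * of_real (1 - exp (- real k * \<beta> x))) = 0)"
  shows "AE x in lebesgue. x \<in> \<Omega> \<longrightarrow> u x = 0"
proof (rule AE_zero_if_box_integrals_zero[OF assms(1)])
  fix a b assume ab: "cbox a b \<subseteq> \<Omega>"
  show "(u has_integral 0) (cbox a b)"
  proof (cases "box a b = {}")
    case True
    then show ?thesis by (intro has_integral_null) (simp add: content_eq_0_interior)
  next
    case False
    obtain \<beta> where \<beta>: "continuous_on UNIV \<beta>" "\<And>x. \<beta> x \<ge> 0" "{x. \<beta> x \<noteq> 0} = box a b"
       "\<And>k::nat. (LINT x|lebesgue. u x * of_real (1 - exp (- real k * \<beta> x))) = 0"
      using bump[OF ab False] by blast
    have sub: "box a b \<subseteq> cbox a b" by (rule box_subset_cbox)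
    have iB: "integrable lebesgue (\<lambda>x. indicator (box a b) x *\<^sub>R u x)"
      using set_integrable_subset[OF int[OF ab] _ sub] by (simp add: set_integrable_def)
    have \<beta>0: "x \<notin> box a b \<Longrightarrow> \<beta> x = 0" for x using \<beta>(3) by blast
    have eq: "u x * of_real (1 - exp (- real k * \<beta> x)) = (1 - exp (- real k * \<beta> x)) *\<^sub>R (indicator (box a b) x *\<^sub>R u x)" for k x
      using \<beta>0[of x] by (auto simp: indicator_def scaleR_conv_of_real)
    have \<beta>m[measurable]: "\<beta> \<in> borel_measurable lebesgue"
      using borel_measurable_continuous_onI[OF \<beta>(1)] by (simp add: borel_measurable_if_I measurable_completion)
    have "(\<lambda>k. LINT x|lebesgue. (1 - exp (- real k * \<beta> x)) *\<^sub>R (indicator (box a b) x *\<^sub>R u x))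
        \<longlonglongrightarrow> (LINT x|lebesgue. indicator (box a b) x *\<^sub>R u x)"
    proof (rule integral_dominated_convergence)
      show "(\<lambda>x. indicator (box a b) x *\<^sub>R u x) \<in> borel_measurable lebesgue" using iB by auto
      then show "(\<lambda>x. (1 - exp (- real k * \<beta> x)) *\<^sub>R (indicator (box a b) x *\<^sub>R u x)) \<in> borel_measurable lebesgue" for k
        by measurable
      show "integrable lebesgue (\<lambda>x. norm (indicator (box a b) x *\<^sub>R u x))" using iB by (rule integrable_norm)
      show "AE x in lebesgue. (\<lambda>k. (1 - exp (- real k * \<beta> x)) *\<^sub>R (indicator (box a b) x *\<^sub>R u x))
          \<longlonglongrightarrow> indicator (box a b) x *\<^sub>R u x"
      proof (intro always_eventually allI)
        fix x
        show "(\<lambda>k. (1 - exp (- real k * \<beta> x)) *\<^sub>R (indicator (box a b) x *\<^sub>R u x)) \<longlonglongrightarrow> indicator (box a b) x *\<^sub>R u x"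
        proof (cases "x \<in> box a b")
          case True
          then have pos: "\<beta> x > 0" using \<beta>(2)[of x] \<beta>(3) by (metis less_le mem_Collect_eq)
          have "(\<lambda>k. exp (- real k * \<beta> x)) \<longlonglongrightarrow> 0" using pos by real_asymp
          then have "(\<lambda>k. (1 - exp (- real k * \<beta> x)) *\<^sub>R (indicator (box a b) x *\<^sub>R u x)) \<longlonglongrightarrow> (1 - 0) *\<^sub>R (indicator (box a b) x *\<^sub>R u x)"
            by (intro tendsto_intros)
          then show ?thesis by simp
        qed simp
      qed
      show "AE x in lebesgue. norm ((1 - exp (- real k * \<beta> x)) *\<^sub>R (indicator (box a b) x *\<^sub>R u x)) \<le> norm (indicator (box a b) x *\<^sub>R u x)" for k
      proof (intro always_eventually allI)
        fix x
        have "\<bar>1 - exp (- real k * \<beta> x)\<bar> \<le> 1" using \<beta>(2)[of x] by auto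
        then show "norm ((1 - exp (- real k * \<beta> x)) *\<^sub>R (indicator (box a b) x *\<^sub>R u x)) \<le> norm (indicator (box a b) x *\<^sub>R u x)"
          unfolding norm_scaleR[of "1 - _"] by (rule mult_left_le_one_le[OF norm_ge_zero abs_ge_zero])
      qed
    qed
    then have "(LINT x|lebesgue. indicator (box a b) x *\<^sub>R u x) = 0"
      unfolding eq[symmetric] \<beta>(4) by (simp add: LIMSEQ_const_iff)
    then have "(u has_integral 0) (box a b)"
      using has_integral_set_lebesgue[of "box a b" u] iB by (simp add: set_integrable_def set_lebesgue_integral_def)
    then show ?thesis using has_integral_open_interval by blast
  qed
qed

text \<open>A product of one-dimensional bumps has exactly the open box as its set of nonzero
  values, and \<open>1 - exp (- k \<beta>)\<close> vanishes wherever \<open>\<beta>\<close> does, so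
  its support stays in the closed box.\<close>

lemma test_fun_bump_indicator:
  fixes a b :: "real^'n::finite"
  assumes "cbox a b \<subseteq> \<Omega>" "box a b \<noteq> {}"
  defines "\<beta> \<equiv> \<lambda>x::real^'n. \<Prod>i\<in>UNIV. bump (a $ i) (b $ i) (x $ i)"
  shows "continuous_on UNIV \<beta>" "\<beta> x \<ge> 0" "{x. \<beta> x \<noteq> 0} = box a b"
    "test_fun \<Omega> (\<lambda>x. of_real (1 - exp (- real k * \<beta> x)))"
proof -
  have C: "Ck j (\<lambda>x. complex_of_real (\<beta> x))" for j
    unfolding \<beta>_def of_real_prod by (intro Ck_prod Ck_coordinate Cr_bump) auto
  show "continuous_on UNIV \<beta>"
    using Ck_imp_continuous[OF C[of 0]] by (simp add: continuous_on_of_real_o_iff o_def)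
  show "\<beta> x \<ge> 0" unfolding \<beta>_def by (intro prod_nonneg) (simp add: bump_nonneg)
  show supp: "{x. \<beta> x \<noteq> 0} = box a b"
    unfolding \<beta>_def by (auto simp: bump_eq_0_iff mem_box_cart)
  have "Ck j (\<lambda>x. 1 + (-1) * exp (of_real (- real k) * complex_of_real (\<beta> x)))" for j
    by (intro Ck_add Ck_mult Ck_exp Ck_const C)
  then have CC: "Ck j (\<lambda>x. of_real (1 - exp (- real k * \<beta> x)))" for j
    by (simp add: exp_of_real[symmetric])
  have "{x. complex_of_real (1 - exp (- real k * \<beta> x)) \<noteq> 0} \<subseteq> box a b" using supp by auto
  then have cl: "closure {x. complex_of_real (1 - exp (- real k * \<beta> x)) \<noteq> 0} \<subseteq> cbox a b"
    by (meson box_subset_cbox closed_cbox closure_minimal order_trans)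
  have "compact (closure {x. complex_of_real (1 - exp (- real k * \<beta> x)) \<noteq> 0})"
    using cl by (meson bounded_cbox bounded_subset closed_closure compact_eq_bounded_closed)
  then show "test_fun \<Omega> (\<lambda>x. of_real (1 - exp (- real k * \<beta> x)))"
    using CC cl assms(1) by (auto simp: test_fun_def)
qed

lemma fundamental_lemma:
  fixes u :: "real^'n::finite \<Rightarrow> complex"
  assumes "open \<Omega>" and int: "\<And>a b. cbox a b \<subseteq> \<Omega> \<Longrightarrow> set_integrable lebesgue (cbox a b) u"
    and zero: "\<And>\<phi>. test_fun \<Omega> \<phi> \<Longrightarrow> (LINT x|lebesgue. u x * \<phi> x) = 0"
  shows "AE x in lebesgue. x \<in> \<Omega> \<longrightarrow> u x = 0"
  using assms(1) int
proof (rule AE_zero_if_bump_integrals_zero)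
  fix a b :: "real^'n" assume ab: "cbox a b \<subseteq> \<Omega>" "box a b \<noteq> {}"
  show "\<exists>\<beta>. continuous_on UNIV \<beta> \<and> (\<forall>x. \<beta> x \<ge> 0) \<and> {x. \<beta> x \<noteq> 0} = box a b \<and>
       (\<forall>k::nat. (LINT x|lebesgue. u x * of_real (1 - exp (- real k * \<beta> x))) = 0)"
    by (rule exI[of _ "\<lambda>x::real^'n. \<Prod>i\<in>UNIV. bump (a $ i) (b $ i) (x $ i)"])
      (use test_fun_bump_indicator[OF ab] zero in blast)
qed

section \<open>Test functions\<close>

text \<open>Differentiation under the integral sign. The mean value inequality bounds increments by
  \<open>w y * norm (t - s)\<close>, so the remainder quotients are dominated by
  \<open>2 * w\<close> and dominated convergence applies along sequences. The parameter ranges over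
  an arbitrary normed space, since both convolutions on \<open>real^'n\<close> and an integral with
  complex parameter are differentiated with it.\<close>

lemma has_derivative_integral:
  fixes f :: "'e::real_normed_vector \<Rightarrow> 'a \<Rightarrow> complex"
  assumes d: "d > 0" and int: "\<And>t. t \<in> ball s d \<Longrightarrow> integrable M (f t)"
    and der: "\<And>t y. t \<in> ball s d \<Longrightarrow> ((\<lambda>t. f t y) has_derivative f' t y) (at t)"
    and bound: "\<And>t y h. t \<in> ball s d \<Longrightarrow> norm (f' t y h) \<le> w y * norm h"
    and w: "integrable M w" and w0: "\<And>y. 0 \<le> w y" and meas: "\<And>h. (\<lambda>y. f' s y h) \<in> borel_measurable M"
  shows "((\<lambda>t. LINT y|M. f t y) has_derivative (\<lambda>h. LINT y|M. f' s y h)) (at s)"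
proof -
  have s: "s \<in> ball s d" using d by simp
  have lin: "bounded_linear (f' s y)" for y
    by (rule has_derivative_bounded_linear[OF der[OF s]])
  have if': "integrable M (\<lambda>y. f' s y h)" for h
  proof (rule Bochner_Integration.integrable_bound)
    show "integrable M (\<lambda>y. w y * norm h)" using w by simp
    show "AE y in M. norm (f' s y h) \<le> norm (w y * norm h)"
      by (intro always_eventually allI order_trans[OF bound[OF s]]) simp
  qed (rule meas)
  have bl: "bounded_linear (\<lambda>h. LINT y|M. f' s y h)"
  proof (rule bounded_linear_intro[where K="LINT y|M. w y"])
    fix h k :: 'e and r :: real
    show "(LINT y|M. f' s y (h + k)) = (LINT y|M. f' s y h) + (LINT y|M. f' s y k)"
      using if' by (simp add: linear_add[OF bounded_linear.linear[OF lin]])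
    show "(LINT y|M. f' s y (r *\<^sub>R h)) = r *\<^sub>R (LINT y|M. f' s y h)"
      by (simp add: linear_scale[OF bounded_linear.linear[OF lin]])
    have "norm (LINT y|M. f' s y h) \<le> (LINT y|M. norm (f' s y h))"
      by (rule integral_norm_bound)
    also have "\<dots> \<le> (LINT y|M. w y * norm h)"
    proof (rule integral_mono)
      show "integrable M (\<lambda>y. w y * norm h)" using w by (rule integrable_mult_left)
      show "integrable M (\<lambda>y. norm (f' s y h))" using if'[of h] by (rule integrable_norm)
      show "norm (f' s y h) \<le> w y * norm h" for y using bound[OF s] .
    qed
    also have "\<dots> = norm h * (LINT y|M. w y)" by (subst mult.commute) (rule integral_mult_right_zero)
    finally show "norm (LINT y|M. f' s y h) \<le> norm h * (LINT y|M. w y)" .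
  qed
  have incr: "norm (f t y - f s y) \<le> w y * norm (t - s)" if t: "t \<in> ball s d" for t y
  proof (rule differentiable_bound[OF convex_ball _ _ t s])
    show "((\<lambda>t. f t y) has_derivative f' t y) (at t within ball s d)" if "t \<in> ball s d" for t
      using der[OF that] by (rule has_derivative_at_withinI)
    show "onorm (f' t y) \<le> w y" if "t \<in> ball s d" for t
      by (rule onorm_bound[OF w0 bound[OF that]])
  qed
  have "((\<lambda>h. norm ((LINT y|M. f (s + h) y) - (LINT y|M. f s y) - (LINT y|M. f' s y h)) / norm h) \<longlongrightarrow> 0) (at 0)"
    unfolding tendsto_at_iff_sequentially
  proof (intro allI impI)
    fix X :: "nat \<Rightarrow> 'e" assume X0: "\<forall>i. X i \<in> UNIV - {0}" and X: "X \<longlonglongrightarrow> 0"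
    have "\<forall>\<^sub>F i in sequentially. norm (X i) < d" using tendstoD[OF X d] by (simp add: dist_norm)
    then obtain N where N: "\<And>i. i \<ge> N \<Longrightarrow> norm (X i) < d" by (auto simp: eventually_sequentially)
    \<comment> \<open>Dropping the first \<open>N\<close> terms keeps \<open>s + Z i\<close> inside
      the ball where the majorant is valid.\<close>
    define Z where "Z i = X (i + N)" for i
    have Z: "Z i \<noteq> 0" "s + Z i \<in> ball s d" for i using X0 N[of "i + N"] by (auto simp: Z_def dist_norm)
    have Zl: "Z \<longlonglongrightarrow> 0" unfolding Z_def using X by (rule LIMSEQ_ignore_initial_segment)
    define q where "q i y = norm (f (s + Z i) y - f s y - f' s y (Z i)) / norm (Z i)" for i y
    have iq: "integrable M (\<lambda>y. f (s + Z i) y - f s y - f' s y (Z i))" for i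
      by (intro Bochner_Integration.integrable_diff int Z s if')
    have "(\<lambda>i. LINT y|M. q i y) \<longlonglongrightarrow> (LINT y|M. 0)"
    proof (rule integral_dominated_convergence[where w="\<lambda>y. 2 * w y"])
      show "q i \<in> borel_measurable M" for i
        unfolding q_def using borel_measurable_integrable[OF iq[of i]] by measurable
      show "AE y in M. (\<lambda>i. q i y) \<longlonglongrightarrow> 0"
      proof (intro always_eventually allI)
        fix y
        have "((\<lambda>h. norm (f (s + h) y - f s y - f' s y h) / norm h) \<longlongrightarrow> 0) (at 0)"
          using der[OF s, of y] by (simp add: has_derivative_at)
        then show "(\<lambda>i. q i y) \<longlonglongrightarrow> 0"
          unfolding tendsto_at_iff_sequentially q_def using Z Zl by (auto simp: o_def)
      qed
      show "AE y in M. norm (q i y) \<le> 2 * w y" for i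
      proof (intro always_eventually allI)
        fix y
        have "norm (f (s + Z i) y - f s y - f' s y (Z i)) \<le> norm (f (s + Z i) y - f s y) + norm (f' s y (Z i))"
          by (rule norm_triangle_ineq4)
        also have "\<dots> \<le> w y * norm (Z i) + w y * norm (Z i)"
          using incr[OF Z(2)[of i], of y] bound[OF s, of y "Z i"] by (intro add_mono) (simp_all only: add_diff_cancel_left')
        finally show "norm (q i y) \<le> 2 * w y" unfolding q_def using Z(1)[of i] by (simp add: divide_le_eq)
      qed
    qed (use w in auto)
    then have ql: "(\<lambda>i. LINT y|M. q i y) \<longlonglongrightarrow> 0" by simp
    have "(\<lambda>i. norm ((LINT y|M. f (s + Z i) y) - (LINT y|M. f s y) - (LINT y|M. f' s y (Z i))) / norm (Z i)) \<longlonglongrightarrow> 0"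
    proof (rule tendsto_sandwich[OF _ _ tendsto_const ql])
      have "norm ((LINT y|M. f (s + Z i) y) - (LINT y|M. f s y) - (LINT y|M. f' s y (Z i))) / norm (Z i) \<le> (LINT y|M. q i y)" for i
      proof -
        have "(LINT y|M. f (s + Z i) y) - (LINT y|M. f s y) - (LINT y|M. f' s y (Z i)) = (LINT y|M. f (s + Z i) y - f s y - f' s y (Z i))"
          using int[OF Z(2)] int[OF s] if' by simp
        also have "norm \<dots> \<le> (LINT y|M. norm (f (s + Z i) y - f s y - f' s y (Z i)))" by (rule integral_norm_bound)
        finally show ?thesis unfolding q_def by (simp add: divide_right_mono)
      qed
      then show "\<forall>\<^sub>F i in sequentially. norm ((LINT y|M. f (s + Z i) y) - (LINT y|M. f s y) - (LINT y|M. f' s y (Z i))) / norm (Z i) \<le> (LINT y|M. q i y)"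
        by simp
    qed simp
    then show "((\<lambda>h. norm ((LINT y|M. f (s + h) y) - (LINT y|M. f s y) - (LINT y|M. f' s y h)) / norm h) \<circ> X) \<longlonglongrightarrow> 0"
      unfolding Z_def o_def by (rule LIMSEQ_offset)
  qed
  then show ?thesis using bl by (simp add: has_derivative_at)
qed

lemma test_fun_mono: "test_fun \<Omega> \<phi> \<Longrightarrow> \<Omega> \<subseteq> \<Omega>' \<Longrightarrow> test_fun \<Omega>' \<phi>"
  by (auto simp: test_fun_def)

lemma test_fun_support:
  assumes "test_fun \<Omega> \<phi>" "\<And>k. Ck k \<psi>" "{x. \<psi> x \<noteq> 0} \<subseteq> closure {x. \<phi> x \<noteq> 0}"
  shows "test_fun \<Omega> \<psi>"
proof -
  have "closure {x. \<psi> x \<noteq> 0} \<subseteq> closure {x. \<phi> x \<noteq> 0}" using assms(3) by (simp add: closure_minimal)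
  then show ?thesis
    using assms(1,2) unfolding test_fun_def
    by (meson bounded_subset closed_closure compact_eq_bounded_closed order_trans)
qed

lemma test_fun_Ck: "test_fun \<Omega> \<phi> \<Longrightarrow> Ck k \<phi>"
  by (simp add: test_fun_def)

lemma test_fun_differentiable: "test_fun \<Omega> \<phi> \<Longrightarrow> \<phi> differentiable_on UNIV"
  using test_fun_Ck[of \<Omega> \<phi> "Suc 0"] by simp

lemma test_fun_zero_outside: "test_fun \<Omega> \<phi> \<Longrightarrow> x \<notin> \<Omega> \<Longrightarrow> \<phi> x = 0"
  unfolding test_fun_def using closure_subset[of "{x. \<phi> x \<noteq> 0}"] by blast

lemma partial_eq_0_off_support:
  assumes "x \<notin> closure {x. \<phi> x \<noteq> 0}" shows "partial i \<phi> x = 0"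
proof -
  have "(\<phi> has_derivative (\<lambda>h. 0)) (at x)"
    by (rule has_derivative_transform_within_open[OF has_derivative_const[of 0], of "- closure {x. \<phi> x \<noteq> 0}"])
      (use assms closure_subset[of "{x. \<phi> x \<noteq> 0}"] in auto)
  from partial_unique[OF this] show ?thesis .
qed

lemma test_fun_partial: "test_fun \<Omega> \<phi> \<Longrightarrow> test_fun \<Omega> (partial i \<phi>)"
  by (rule test_fun_support) (use partial_eq_0_off_support test_fun_Ck[of \<Omega> \<phi> "Suc _"] in auto)

lemma test_fun_vanish:
  assumes "test_fun \<Omega> \<phi>" "\<And>k. Ck k \<psi>" "\<And>x. \<phi> x = 0 \<Longrightarrow> \<psi> x = 0"
  shows "test_fun \<Omega> \<psi>"
proof (rule test_fun_support[OF assms(1,2)])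
  have "{x. \<psi> x \<noteq> 0} \<subseteq> {x. \<phi> x \<noteq> 0}" using assms(3) by blast
  then show "{x. \<psi> x \<noteq> 0} \<subseteq> closure {x. \<phi> x \<noteq> 0}" by (rule order_trans[OF _ closure_subset])
qed

lemma test_fun_cnj: "test_fun \<Omega> \<phi> \<Longrightarrow> test_fun \<Omega> (\<lambda>x. cnj (\<phi> x))"
  by (rule test_fun_vanish[of \<Omega> \<phi>]) (auto intro: Ck_cnj test_fun_Ck)

lemma test_fun_cmult: "test_fun \<Omega> \<phi> \<Longrightarrow> test_fun \<Omega> (\<lambda>x. c * \<phi> x)"
  by (rule test_fun_vanish[of \<Omega> \<phi>]) (auto intro: Ck_mult Ck_const test_fun_Ck)

lemma test_fun_mult: "test_fun \<Omega> \<phi> \<Longrightarrow> test_fun \<Omega> \<psi> \<Longrightarrow> test_fun \<Omega> (\<lambda>x. \<phi> x * \<psi> x)"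
  by (rule test_fun_vanish[of \<Omega> \<phi>]) (auto intro: Ck_mult test_fun_Ck)

lemma partial_cmult: "test_fun \<Omega> \<phi> \<Longrightarrow> partial i (\<lambda>x. c * \<phi> x) = (\<lambda>x. c * partial i \<phi> x)"
  by (subst partial_mult) (auto intro: test_fun_differentiable simp: partial_const)

lemma test_fun_supportE:
  assumes "test_fun \<Omega> \<phi>" obtains r where "r > 0" "\<forall>x. norm x \<ge> r \<longrightarrow> \<phi> x = 0"
proof -
  have "bounded {x. \<phi> x \<noteq> 0}"
    using assms closure_subset unfolding test_fun_def by (meson bounded_subset compact_imp_bounded)
  then obtain r where "r > 0" "\<And>x. \<phi> x \<noteq> 0 \<Longrightarrow> norm x \<le> r" unfolding bounded_pos by auto
  then show thesis using that[of "r + 1"] by force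
qed

lemma test_fun_boundE:
  assumes "test_fun \<Omega> \<phi>" obtains B where "B > 0" "\<forall>x. norm (\<phi> x) \<le> B"
proof -
  have "compact (\<phi> ` closure {x. \<phi> x \<noteq> 0})"
    using assms unfolding test_fun_def
    by (meson Ck_imp_continuous compact_continuous_image continuous_on_subset subset_UNIV)
  then have "bounded (\<phi> ` closure {x. \<phi> x \<noteq> 0})" by (rule compact_imp_bounded)
  then obtain B where B0: "B > 0" "\<forall>y\<in>\<phi> ` closure {x. \<phi> x \<noteq> 0}. norm y \<le> B"
    unfolding bounded_pos by (elim exE conjE)
  have B: "B > 0" "\<And>x. x \<in> closure {x. \<phi> x \<noteq> 0} \<Longrightarrow> norm (\<phi> x) \<le> B"
    using B0 by simp_all
  show thesis
  proof (rule that[OF B(1)], rule allI)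
    fix x
    show "norm (\<phi> x) \<le> B"
    proof (cases "x \<in> closure {x. \<phi> x \<noteq> 0}")
      case False
      then have "\<phi> x = 0" using closure_subset[of "{x. \<phi> x \<noteq> 0}"] by blast
      then show ?thesis using B(1) by simp
    qed (rule B)
  qed
qed

lemma borel_measurable_lebesgue_continuous: "continuous_on UNIV f \<Longrightarrow> f \<in> borel_measurable lebesgue"
  using borel_measurable_continuous_onI[of f] by (simp add: measurable_completion)

lemma test_fun_measurable: "test_fun \<Omega> \<phi> \<Longrightarrow> \<phi> \<in> borel_measurable lebesgue"
  by (rule borel_measurable_lebesgue_continuous) (rule Ck_imp_continuous[OF test_fun_Ck])

lemma test_fun_product_integrable:
  fixes z :: "real^'n::finite \<Rightarrow> complex"
  assumes "test_fun \<Omega> \<phi>" and z: "\<And>r. set_integrable lebesgue (cball 0 r) z"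
  shows "integrable lebesgue (\<lambda>x. z x * \<phi> x)"
proof -
  obtain r where r: "r > 0" "\<forall>x. norm x \<ge> r \<longrightarrow> \<phi> x = 0" by (rule test_fun_supportE[OF assms(1)])
  obtain B where B: "B > 0" "\<forall>x. norm (\<phi> x) \<le> B" by (rule test_fun_boundE[OF assms(1)])
  have eq: "z x * \<phi> x = (indicator (cball 0 r) x *\<^sub>R z x) * \<phi> x" for x
    using r(2)[rule_format, of x] by (auto simp: indicator_def)
  have m: "(\<lambda>x. (indicator (cball 0 r) x *\<^sub>R z x) * \<phi> x) \<in> borel_measurable lebesgue"
    using z[of r] test_fun_measurable[OF assms(1)] unfolding set_integrable_def by measurable
  show ?thesis unfolding eq
  proof (rule Bochner_Integration.integrable_bound[OF _ m])
    show "integrable lebesgue (\<lambda>x. B * norm (indicator (cball 0 r) x *\<^sub>R z x))"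
      using z[of r] unfolding set_integrable_def by (intro integrable_mult_right integrable_norm)
    show "AE x in lebesgue. norm ((indicator (cball 0 r) x *\<^sub>R z x) * \<phi> x) \<le> norm (B * norm (indicator (cball 0 r) x *\<^sub>R z x))"
    proof (intro always_eventually allI)
      fix x
      have "norm (indicator (cball 0 r) x *\<^sub>R z x) * norm (\<phi> x) \<le> norm (indicator (cball 0 r) x *\<^sub>R z x) * B"
        by (rule mult_left_mono) (simp_all add: B)
      then show "norm ((indicator (cball 0 r) x *\<^sub>R z x) * \<phi> x) \<le> norm (B * norm (indicator (cball 0 r) x *\<^sub>R z x))"
        unfolding norm_mult using B(1) by (simp add: mult.commute)
    qed
  qed
qed

lemma integrable_indicator_cball: "integrable lebesgue (indicator (cball (0::real^'n::finite) r) :: _ \<Rightarrow> real)"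
  by (rule integrable_real_indicator)
    (auto simp: emeasure_completion intro!: emeasure_bounded_finite[unfolded infinity_ennreal_def])

lemma set_integrable_const_cball: "set_integrable lebesgue (cball (0::real^'n::finite) r) (\<lambda>x. c::complex)"
  unfolding set_integrable_def by (intro integrable_scaleR_left integrable_indicator_cball)

lemma test_fun_integrable: "test_fun \<Omega> \<phi> \<Longrightarrow> integrable lebesgue \<phi>"
  using test_fun_product_integrable[OF _ set_integrable_const_cball, of \<Omega> \<phi> 1] by simp

lemma test_fun_L2: "test_fun \<Omega> \<phi> \<Longrightarrow> L2 lebesgue \<phi>"
proof -
  assume \<phi>: "test_fun \<Omega> \<phi>"
  from test_fun_integrable[OF test_fun_mult[OF \<phi> test_fun_cnj[OF \<phi>]]]
  have "integrable lebesgue (\<lambda>x. complex_of_real ((norm (\<phi> x))\<^sup>2))" by (simp only: complex_norm_square)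
  then have "integrable lebesgue (\<lambda>x. (norm (\<phi> x))\<^sup>2)" by (simp only: complex_of_real_integrable_eq)
  then show ?thesis using test_fun_measurable[OF \<phi>] by (simp add: L2_def)
qed

lemma L2_locally_integrable:
  fixes z :: "real^'n::finite \<Rightarrow> complex"
  assumes "L2 lebesgue z" shows "set_integrable lebesgue (cball 0 r) z"
proof -
  have "L2 lebesgue (\<lambda>x::real^'n. complex_of_real (indicator (cball 0 r) x))"
  proof -
    have "(\<lambda>x::real^'n. (norm (complex_of_real (indicator (cball 0 r) x)))\<^sup>2) = indicator (cball 0 r)"
      by (auto simp: indicator_def)
    moreover have "(\<lambda>x::real^'n. complex_of_real (indicator (cball 0 r) x)) \<in> borel_measurable lebesgue"
      using integrable_indicator_cball[of r] by measurable
    ultimately show ?thesis unfolding L2_def using integrable_indicator_cball[of r] by simp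
  qed
  from L2_mult_integrable[OF this assms] show ?thesis
    by (simp add: set_integrable_def scaleR_conv_of_real)
qed

lemma frechet_derivative_partial:
  assumes "f differentiable_on UNIV"
  shows "frechet_derivative f (at x) h = (\<Sum>i\<in>UNIV. of_real (h $ i) * partial i f x)"
proof -
  have lin: "linear (frechet_derivative f (at x))"
    using differentiable_on_UNIV_D[OF assms] has_derivative_linear by blast
  have "h = (\<Sum>i\<in>UNIV. (h $ i) *\<^sub>R axis i 1)"
    using basis_expansion[of h] by (simp add: scalar_mult_eq_scaleR)
  then have "frechet_derivative f (at x) h = frechet_derivative f (at x) (\<Sum>i\<in>UNIV. (h $ i) *\<^sub>R axis i 1)" by simp
  also have "\<dots> = (\<Sum>i\<in>UNIV. (h $ i) *\<^sub>R partial i f x)"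
    by (simp add: linear_sum[OF lin] linear_scale[OF lin] partial_def)
  finally show ?thesis by (simp add: scaleR_conv_of_real)
qed

section \<open>Convolution and integration by parts\<close>

lemma test_fun_UNIV_iff: "test_fun UNIV \<phi> \<longleftrightarrow> (\<forall>k. Ck k \<phi>) \<and> bounded {x. \<phi> x \<noteq> 0}"
  by (simp add: test_fun_def compact_closure)

lemma test_fun_reflect:
  assumes "test_fun UNIV \<phi>" shows "test_fun UNIV (\<lambda>y. \<phi> (t - y))"
proof -
  have "Ck k (\<lambda>y. \<phi> (t + (-1) *\<^sub>R y))" for k
    by (rule Ck_affine) (rule test_fun_Ck[OF assms])
  moreover obtain r where r: "r > 0" "\<forall>x. norm x \<ge> r \<longrightarrow> \<phi> x = 0" by (rule test_fun_supportE[OF assms])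
  have "{y. \<phi> (t - y) \<noteq> 0} \<subseteq> cball t r"
    using r(2) by (force simp: dist_norm)
  then have "bounded {y. \<phi> (t - y) \<noteq> 0}" using bounded_subset bounded_cball by blast
  ultimately show ?thesis by (simp add: test_fun_UNIV_iff)
qed

lemma partial_reflect:
  assumes "test_fun UNIV \<phi>" shows "partial i (\<lambda>y. \<phi> (t - y)) = (\<lambda>y. - partial i \<phi> (t - y))"
  using partial_affine(1)[OF test_fun_differentiable[OF assms], of i t "-1"] by simp

text \<open>The derivative falls on the kernel \<open>\<rho>\<close>, so local integrability of
  \<open>z\<close> suffices.\<close>

lemma convolution_has_derivative:
  fixes z :: "real^'n::finite \<Rightarrow> complex"
  assumes \<rho>: "test_fun UNIV \<rho>" and z: "\<And>r. set_integrable lebesgue (cball 0 r) z"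
  shows "((\<lambda>x. LINT y|lebesgue. z y * \<rho> (x - y)) has_derivative
    (\<lambda>h. LINT y|lebesgue. z y * frechet_derivative \<rho> (at (x - y)) h)) (at x)"
proof -
  obtain r where r: "r > 0" "\<forall>x. norm x \<ge> r \<longrightarrow> \<rho> x = 0" by (rule test_fun_supportE[OF \<rho>])
  have cl: "closure {x. \<rho> x \<noteq> 0} \<subseteq> cball 0 r"
    by (rule closure_minimal) (use r(2) in \<open>auto, metis linear\<close>)
  have "\<exists>B. \<forall>x. norm (partial i \<rho> x) \<le> B" for i
    by (rule test_fun_boundE[OF test_fun_partial[OF \<rho>, of i]]) blast
  then obtain B where B: "\<And>i x. norm (partial i \<rho> x) \<le> B i" by metis
  have B0: "0 \<le> B i" for i using B[of i undefined] norm_ge_zero order_trans by blast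
  define K where "K = (\<Sum>i\<in>UNIV. B i)"
  have K0: "0 \<le> K" unfolding K_def using B0 by (simp add: sum_nonneg)
  have fr: "frechet_derivative \<rho> (at x) h = (\<Sum>i\<in>UNIV. of_real (h $ i) * partial i \<rho> x)" for x h
    by (rule frechet_derivative_partial[OF test_fun_differentiable[OF \<rho>]])
  have frb: "norm (frechet_derivative \<rho> (at x) h) \<le> K * norm h * indicator (cball 0 r) x" for x h
  proof (cases "x \<in> cball 0 r")
    case True
    have "norm (frechet_derivative \<rho> (at x) h) \<le> (\<Sum>i\<in>UNIV. norm (of_real (h $ i) * partial i \<rho> x))"
      unfolding fr by (rule norm_sum)
    also have "\<dots> \<le> (\<Sum>i\<in>UNIV. norm h * B i)"
      unfolding norm_mult norm_of_real
      by (intro sum_mono mult_mono component_le_norm_cart B) auto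
    also have "\<dots> = K * norm h" unfolding K_def by (simp add: sum_distrib_left mult.commute)
    finally show ?thesis using True by simp
  next
    case False
    then have "x \<notin> closure {x. \<rho> x \<noteq> 0}" using cl by blast
    then have "partial i \<rho> x = 0" for i by (rule partial_eq_0_off_support)
    then show ?thesis using K0 unfolding fr by simp
  qed
  \<comment> \<open>A majorant for all \<open>t\<close> within distance 1 of \<open>x\<close>: the
    derivative of \<open>\<rho>\<close> at \<open>t - y\<close> is nonzero only if
    \<open>norm y \<le> r + norm x + 1\<close>.\<close>
  define w where "w y = K * norm (indicator (cball 0 (r + norm x + 1)) y *\<^sub>R z y)" for y
  show ?thesis
  proof (rule has_derivative_integral[where d=1 and w=w])
    show "integrable lebesgue (\<lambda>y. z y * \<rho> (t - y))" for t
      by (rule test_fun_product_integrable[OF test_fun_reflect[OF \<rho>] z])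
    show "((\<lambda>t. z y * \<rho> (t - y)) has_derivative (\<lambda>h. z y * frechet_derivative \<rho> (at (t - y)) h)) (at t)" for t y
    proof (rule has_derivative_mult_right, rule has_derivative_compose[of "\<lambda>t. t - y" "\<lambda>h. h"])
      show "((\<lambda>t. t - y) has_derivative (\<lambda>h. h)) (at t)" by (auto intro!: derivative_eq_intros)
      show "(\<rho> has_derivative frechet_derivative \<rho> (at (t - y))) (at (t - y))"
        by (rule differentiable_on_UNIV_D[OF test_fun_differentiable[OF \<rho>]])
    qed
    show "norm (z y * frechet_derivative \<rho> (at (t - y)) h) \<le> w y * norm h" if t: "t \<in> ball x 1" for t y h
    proof -
      have "norm t \<le> norm x + 1"
        using t norm_triangle_ineq2[of t x] by (simp add: dist_norm norm_minus_commute)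
      moreover have "norm y \<le> norm (t - y) + norm t" by (metis add.commute norm_minus_commute norm_triangle_sub)
      ultimately have ind: "indicator (cball 0 r) (t - y) \<le> (indicator (cball 0 (r + norm x + 1)) y :: real)"
        by (auto simp: indicator_def)
      have "norm (z y * frechet_derivative \<rho> (at (t - y)) h) \<le> norm (z y) * (K * norm h * indicator (cball 0 r) (t - y))"
        unfolding norm_mult by (intro mult_left_mono frb norm_ge_zero)
      also have "\<dots> \<le> norm (z y) * (K * norm h * indicator (cball 0 (r + norm x + 1)) y)"
        using K0 by (intro mult_left_mono ind) auto
      also have "\<dots> = w y * norm h" by (simp add: w_def)
      finally show ?thesis .
    qed
    show "integrable lebesgue w"
      unfolding w_def using z[of "r + norm x + 1"] unfolding set_integrable_def
      by (intro integrable_mult_right integrable_norm)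
    show "0 \<le> w y" for y using K0 by (simp add: w_def)
    show "(\<lambda>y. z y * frechet_derivative \<rho> (at (x - y)) h) \<in> borel_measurable lebesgue" for h
    proof -
      have "integrable lebesgue (\<lambda>y. of_real (h $ i) * (z y * partial i \<rho> (x - y)))" for i
        by (intro integrable_mult_right test_fun_product_integrable[of UNIV] z test_fun_reflect test_fun_partial \<rho>)
      then have "(\<lambda>y. \<Sum>i\<in>UNIV. of_real (h $ i) * (z y * partial i \<rho> (x - y))) \<in> borel_measurable lebesgue"
        by (intro borel_measurable_sum borel_measurable_integrable)
      moreover have "(\<lambda>y. \<Sum>i\<in>UNIV. of_real (h $ i) * (z y * partial i \<rho> (x - y))) = (\<lambda>y. z y * frechet_derivative \<rho> (at (x - y)) h)"
        unfolding fr by (simp add: sum_distrib_left mult_ac)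
      ultimately show ?thesis by simp
    qed
  qed simp
qed

lemma convolution_differentiable:
  fixes z :: "real^'n::finite \<Rightarrow> complex"
  assumes "test_fun UNIV \<rho>" "\<And>r. set_integrable lebesgue (cball 0 r) z"
  shows "(\<lambda>x. LINT y|lebesgue. z y * \<rho> (x - y)) differentiable_on UNIV"
  using convolution_has_derivative[OF assms] by (auto simp: differentiable_on_def differentiable_def)

lemma partial_convolution:
  fixes z :: "real^'n::finite \<Rightarrow> complex"
  assumes "test_fun UNIV \<rho>" "\<And>r. set_integrable lebesgue (cball 0 r) z"
  shows "partial i (\<lambda>x. LINT y|lebesgue. z y * \<rho> (x - y)) = (\<lambda>x. LINT y|lebesgue. z y * partial i \<rho> (x - y))"
  by (rule ext, subst partial_unique[OF convolution_has_derivative[OF assms]]) (simp_all add: partial_def)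

lemma lebesgue_integral_translate:
  fixes f :: "'a::euclidean_space \<Rightarrow> complex"
  assumes "f \<in> borel_measurable borel" shows "(LINT x|lebesgue. f (x + c)) = (LINT x|lebesgue. f x)"
proof -
  have m: "(\<lambda>x. f (c + x)) \<in> borel_measurable borel" using assms by measurable
  have "(LINT x|lebesgue. f x) = (LINT x|distr lborel borel ((+) c). f x)"
    using assms by (simp add: integral_completion lborel_distr_plus)
  also have "\<dots> = (LINT x|lborel. f (c + x))" using assms by (subst integral_distr) auto
  also have "\<dots> = (LINT x|lebesgue. f (x + c))" using m by (simp add: integral_completion add.commute)
  finally show ?thesis by simp
qed

text \<open>The convolution of the constant 1 with the reflected function is constant by translation
  invariance, so its partial derivative, computed under the integral, is zero. No iterated
  integration over single coordinates is involved.\<close>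

lemma integral_partial_zero:
  assumes \<phi>: "test_fun UNIV \<phi>" shows "(LINT x|lebesgue. partial i \<phi> x) = 0"
proof -
  define \<rho> where "\<rho> = (\<lambda>y. \<phi> (0 - y))"
  have \<rho>: "test_fun UNIV \<rho>" unfolding \<rho>_def by (rule test_fun_reflect[OF \<phi>])
  have fm: "\<phi> \<in> borel_measurable borel"
    by (rule borel_measurable_continuous_onI) (rule Ck_imp_continuous[OF test_fun_Ck[OF \<phi>]])
  have const: "(\<lambda>x. LINT y|lebesgue. 1 * \<rho> (x - y)) = (\<lambda>x. LINT y|lebesgue. \<phi> y)"
    using lebesgue_integral_translate[OF fm, of "- _"] by (simp add: \<rho>_def)
  have "partial i (\<lambda>x. LINT y|lebesgue. 1 * \<rho> (x - y)) 0 = (LINT y|lebesgue. 1 * partial i \<rho> (0 - y))"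
    by (subst partial_convolution[OF \<rho> set_integrable_const_cball]) simp
  then have "(LINT y|lebesgue. 1 * partial i \<rho> (0 - y)) = 0" unfolding const partial_const by simp
  then show ?thesis unfolding \<rho>_def partial_reflect[OF \<phi>] by simp
qed

lemma test_fun_integral_by_parts:
  assumes "test_fun UNIV \<phi>" "test_fun UNIV \<psi>"
  shows "(LINT x|lebesgue. \<phi> x * partial i \<psi> x) = - (LINT x|lebesgue. partial i \<phi> x * \<psi> x)"
proof -
  have "0 = (LINT x|lebesgue. partial i (\<lambda>x. \<phi> x * \<psi> x) x)"
    by (rule integral_partial_zero[symmetric]) (rule test_fun_mult[OF assms])
  also have "\<dots> = (LINT x|lebesgue. \<phi> x * partial i \<psi> x + partial i \<phi> x * \<psi> x)"
    by (subst partial_mult) (auto intro: test_fun_differentiable assms)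
  also have "\<dots> = (LINT x|lebesgue. \<phi> x * partial i \<psi> x) + (LINT x|lebesgue. partial i \<phi> x * \<psi> x)"
    by (intro Bochner_Integration.integral_add test_fun_integrable[of UNIV] test_fun_mult test_fun_partial assms)
  finally show ?thesis by (simp add: eq_neg_iff_add_eq_0)
qed

section \<open>H^1 on the whole space and density of test functions\<close>

section \<open>Functions paired with their weak gradients\<close>

lemma L2_bounded_linear:
  assumes "bounded_linear F" "L2 M f" shows "L2 M (\<lambda>x. F (f x))"
proof -
  obtain K where K: "\<And>y. norm (F y) \<le> norm y * K" using bounded_linear.bounded[OF assms(1)] by blast
  show ?thesis
  proof (rule L2_dominated[OF _ assms(2)])
    show "(\<lambda>x. F (f x)) \<in> borel_measurable M"
      by (rule borel_measurable_continuous_on[OF linear_continuous_on[OF assms(1)]])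
        (use assms(2) in \<open>simp add: L2_def\<close>)
    show "AE x in M. norm (F (f x)) \<le> K * norm (f x)"
      by (intro always_eventually allI) (subst mult.commute, rule K)
  qed
qed

lemma L2_sum: "finite I \<Longrightarrow> (\<And>i. i \<in> I \<Longrightarrow> L2 M (f i)) \<Longrightarrow> L2 M (\<lambda>x. \<Sum>i\<in>I. f i x)"
  by (induction I rule: finite_induct) (auto intro: L2_add L2_zero)

lemma bounded_linear_axis: "bounded_linear (axis i :: 'a::euclidean_space \<Rightarrow> 'a^'n::finite)"
proof (rule bounded_linear_intro[where K=1])
  show "axis i (x + y) = axis i x + (axis i y :: 'a^'n)" for x y
    by (simp add: vec_eq_iff axis_def)
  show "axis i (r *\<^sub>R x) = r *\<^sub>R (axis i x :: 'a^'n)" for r x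
    by (simp add: vec_eq_iff axis_def)
  show "norm (axis i x :: 'a^'n) \<le> norm x * 1" for x
    by (simp add: norm_eq_sqrt_inner inner_axis_axis)
qed

lemma L2_vec_lambda:
  fixes g :: "'i::finite \<Rightarrow> 'a \<Rightarrow> complex"
  assumes "\<And>i. L2 M (g i)" shows "L2 M (\<lambda>x. \<chi> i. g i x)"
proof -
  have "(\<lambda>x. \<chi> i. g i x) = (\<lambda>x. \<Sum>i\<in>UNIV. axis i (g i x))"
    by (auto simp: vec_eq_iff axis_def if_distrib cong: if_cong)
  then show ?thesis
    using assms by (auto intro!: L2_sum L2_bounded_linear[OF bounded_linear_axis])
qed

lemma L2_vec_nth: "L2 M g \<Longrightarrow> L2 M (\<lambda>x. g x $ i)"
  by (rule L2_bounded_linear[OF bounded_linear_vec_nth])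

lemma L2_Pair:
  fixes u :: "'a \<Rightarrow> 'b::euclidean_space" and g :: "'a \<Rightarrow> 'c::euclidean_space"
  assumes "L2 M u" "L2 M g" shows "L2 M (\<lambda>x. (u x, g x))"
proof -
  have "bounded_linear (\<lambda>y::'b. (y, 0::'c))" "bounded_linear (\<lambda>y::'c. (0::'b, y))"
    by (intro bounded_linear_Pair bounded_linear_ident bounded_linear_zero)+
  from L2_add[OF L2_bounded_linear[OF this(1) assms(1)] L2_bounded_linear[OF this(2) assms(2)]]
  show ?thesis by simp
qed

lemma inner_cnj: "z \<bullet> cnj w = Re (z * w)"
  by (simp add: inner_complex_def)

text \<open>Annihilating these fields means that the integral of
  \<open>u * partial i \<phi> + g $ i * \<phi>\<close> has vanishing real part. Thus the pairs of an
  H^1 function and its weak gradient form an annihilator, that is, a closed subspace. The conjugates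
  compensate the conjugation in the real inner product.\<close>

definition gradient_tests :: "(real^'n::finite \<Rightarrow> complex \<times> (complex^'n)) set" where
  "gradient_tests = {t. \<exists>\<phi> i. test_fun UNIV \<phi> \<and> t = (\<lambda>x. (cnj (partial i \<phi> x), axis i (cnj (\<phi> x))))}"

abbreviation H1_pairs :: "(real^'n::finite \<Rightarrow> complex \<times> (complex^'n)) set" where
  "H1_pairs \<equiv> annihilator lebesgue gradient_tests"

lemma gradient_tests_L2: "t \<in> gradient_tests \<Longrightarrow> L2 lebesgue t"
  by (auto simp: gradient_tests_def intro!: L2_Pair L2_bounded_linear[OF bounded_linear_axis]
      test_fun_L2[of UNIV] test_fun_cnj test_fun_partial)

lemma complex_eq_0_by_Re: "Re z = 0 \<Longrightarrow> Re (\<i> * z) = 0 \<Longrightarrow> z = 0"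
  by (simp add: complex_eq_iff)

lemma weak_gradient_UNIV_integrable:
  fixes u :: "real^'n::finite \<Rightarrow> complex" and g :: "real^'n \<Rightarrow> complex^'n"
  assumes "L2 lebesgue u" "L2 lebesgue g" "test_fun UNIV \<phi>"
  shows "integrable lebesgue (\<lambda>x. u x * partial i \<phi> x)" "integrable lebesgue (\<lambda>x. g x $ i * \<phi> x)"
  by (rule L2_mult_integrable[OF assms(1) test_fun_L2[OF test_fun_partial[OF assms(3)]]])
    (rule L2_mult_integrable[OF L2_vec_nth[OF assms(2)] test_fun_L2[OF assms(3)]])

text \<open>The real inner product sees only the real part of the weak gradient identity; replacing
  \<open>\<phi>\<close> by \<open>\<i> * \<phi>\<close> recovers the imaginary part.\<close>

lemma H1_pairs_iff:
  fixes u :: "real^'n::finite \<Rightarrow> complex"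
  shows "(\<lambda>x. (u x, g x)) \<in> H1_pairs \<longleftrightarrow> L2 lebesgue u \<and> weak_gradient UNIV u g"
proof -
  have L: "L2 lebesgue (\<lambda>x. (u x, g x)) \<longleftrightarrow> L2 lebesgue u \<and> L2 lebesgue g"
    using L2_Pair[of lebesgue u g] L2_bounded_linear[OF bounded_linear_fst, of lebesgue "\<lambda>x. (u x, g x)"]
      L2_bounded_linear[OF bounded_linear_snd, of lebesgue "\<lambda>x. (u x, g x)"] by auto
  have key: "(LINT x|lebesgue. (u x, g x) \<bullet> (cnj (partial i \<phi> x), axis i (cnj (\<phi> x))))
      = Re ((LINT x|lebesgue. u x * partial i \<phi> x) + (LINT x|lebesgue. g x $ i * \<phi> x))"
    if "L2 lebesgue u" "L2 lebesgue g" "test_fun UNIV \<phi>" for \<phi> i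
  proof -
    note int = weak_gradient_UNIV_integrable[OF that]
    have "(LINT x|lebesgue. (u x, g x) \<bullet> (cnj (partial i \<phi> x), axis i (cnj (\<phi> x))))
       = (LINT x|lebesgue. Re (u x * partial i \<phi> x + g x $ i * \<phi> x))"
      by (intro Bochner_Integration.integral_cong refl)
        (simp only: inner_prod_def fst_conv snd_conv inner_axis inner_cnj plus_complex.sel)
    also have "\<dots> = Re (LINT x|lebesgue. u x * partial i \<phi> x + g x $ i * \<phi> x)"
      by (intro integral_Re Bochner_Integration.integrable_add int)
    finally show ?thesis using int by simp
  qed
  show ?thesis
  proof
    assume U: "(\<lambda>x. (u x, g x)) \<in> H1_pairs"
    then have uL: "L2 lebesgue u" "L2 lebesgue g" using L by (auto simp: annihilator_def)
    have "(LINT x|lebesgue. u x * partial i \<phi> x) + (LINT x|lebesgue. g x $ i * \<phi> x) = 0"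
      if \<phi>: "test_fun UNIV \<phi>" for \<phi> i
    proof (rule complex_eq_0_by_Re)
      have z: "Re ((LINT x|lebesgue. u x * partial i \<psi> x) + (LINT x|lebesgue. g x $ i * \<psi> x)) = 0"
        if \<psi>: "test_fun UNIV \<psi>" for \<psi>
      proof -
        have "(\<lambda>x. (cnj (partial i \<psi> x), axis i (cnj (\<psi> x)))) \<in> gradient_tests"
          using \<psi> by (auto simp: gradient_tests_def)
        then have "(LINT x|lebesgue. (u x, g x) \<bullet> (cnj (partial i \<psi> x), axis i (cnj (\<psi> x)))) = 0"
          using U unfolding annihilator_def by fast
        then show ?thesis unfolding key[OF uL \<psi>] .
      qed
      show "Re ((LINT x|lebesgue. u x * partial i \<phi> x) + (LINT x|lebesgue. g x $ i * \<phi> x)) = 0"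
        by (rule z[OF \<phi>])
      have "(\<i> * ((LINT x|lebesgue. u x * partial i \<phi> x) + (LINT x|lebesgue. g x $ i * \<phi> x))) =
          (LINT x|lebesgue. u x * partial i (\<lambda>x. \<i> * \<phi> x) x) + (LINT x|lebesgue. g x $ i * (\<i> * \<phi> x))"
        unfolding partial_cmult[OF \<phi>] by (simp add: mult.left_commute[of _ \<i>] distrib_left)
      then show "Re (\<i> * ((LINT x|lebesgue. u x * partial i \<phi> x) + (LINT x|lebesgue. g x $ i * \<phi> x))) = 0"
        using z[OF test_fun_cmult[OF \<phi>]] by simp
    qed
    then show "L2 lebesgue u \<and> weak_gradient UNIV u g"
      using uL by (auto simp: weak_gradient_def lebesgue_on_UNIV_eq eq_neg_iff_add_eq_0)
  next
    assume "L2 lebesgue u \<and> weak_gradient UNIV u g"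
    then have uL: "L2 lebesgue u" "L2 lebesgue g" and w: "\<And>\<phi> i. test_fun UNIV \<phi> \<Longrightarrow>
        (LINT x|lebesgue. u x * partial i \<phi> x) + (LINT x|lebesgue. g x $ i * \<phi> x) = 0"
      by (auto simp: weak_gradient_def lebesgue_on_UNIV_eq)
    have "(LINT x|lebesgue. (u x, g x) \<bullet> t x) = 0" if t: "t \<in> gradient_tests" for t
    proof -
      obtain \<phi> i where \<phi>: "test_fun UNIV \<phi>" "t = (\<lambda>x. (cnj (partial i \<phi> x), axis i (cnj (\<phi> x))))"
        using t by (auto simp: gradient_tests_def)
      show ?thesis unfolding \<phi>(2) key[OF uL \<phi>(1)] w[OF \<phi>(1)] by simp
    qed
    then show "(\<lambda>x. (u x, g x)) \<in> H1_pairs" using uL L by (simp add: annihilator_def)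
  qed
qed

lemma weak_gradient_test_fun:
  assumes "test_fun UNIV \<phi>" shows "weak_gradient UNIV \<phi> (\<lambda>x. \<chi> i. partial i \<phi> x)"
  using test_fun_integral_by_parts[OF assms]
  by (auto simp: weak_gradient_def lebesgue_on_UNIV_eq intro!: L2_vec_lambda test_fun_L2[of UNIV] test_fun_partial assms)

lemma set_integrable_cbox_of_cball:
  fixes z :: "real^'n::finite \<Rightarrow> complex"
  assumes "\<And>r. set_integrable lebesgue (cball 0 r) z" shows "set_integrable lebesgue (cbox a b) z"
proof -
  obtain r where "\<forall>x\<in>cbox a b. norm x \<le> r"
    using bounded_cbox[of a b] unfolding bounded_iff by (elim exE)
  then have "cbox a b \<subseteq> cball 0 r" by auto
  then show ?thesis by (rule set_integrable_subset[OF assms, rotated]) auto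
qed

lemma fundamental_lemma_L2:
  fixes u :: "real^'n::finite \<Rightarrow> complex"
  assumes "L2 lebesgue u" "\<And>\<phi>. test_fun UNIV \<phi> \<Longrightarrow> (LINT x|lebesgue. u x * \<phi> x) = 0"
  shows "AE x in lebesgue. u x = 0"
  using fundamental_lemma[OF open_UNIV set_integrable_cbox_of_cball[OF L2_locally_integrable[OF assms(1)]] assms(2)]
  by simp

text \<open>\<open>wgrad\<close> is obtained by choice and hence is determined only up to null sets.
  This result, the fundamental lemma for each component of the difference, allows a constructed
  gradient to be exchanged for the chosen one.\<close>

lemma weak_gradient_unique:
  fixes u :: "real^'n::finite \<Rightarrow> complex"
  assumes "weak_gradient UNIV u g" "weak_gradient UNIV v h" "AE x in lebesgue. u x = v x"
    and L: "L2 lebesgue u" "L2 lebesgue v"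
  shows "AE x in lebesgue. g x = h x"
proof -
  have gh: "L2 lebesgue g" "L2 lebesgue h"
    using assms(1,2) by (auto simp: weak_gradient_def lebesgue_on_UNIV_eq)
  have "AE x in lebesgue. g x $ i - h x $ i = 0" for i
  proof (rule fundamental_lemma_L2)
    show "L2 lebesgue (\<lambda>x. g x $ i - h x $ i)" by (intro L2_diff L2_vec_nth gh)
    fix \<phi> :: "real^'n \<Rightarrow> complex" assume \<phi>: "test_fun UNIV \<phi>"
    have eq: "(LINT x|lebesgue. u x * partial i \<phi> x) = (LINT x|lebesgue. v x * partial i \<phi> x)"
      by (rule integral_cong_AE)
        (use weak_gradient_UNIV_integrable(1)[OF L(1) gh(1) \<phi>] weak_gradient_UNIV_integrable(1)[OF L(2) gh(2) \<phi>] assms(3)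
          in \<open>auto elim!: eventually_mono\<close>)
    have "(LINT x|lebesgue. (g x $ i - h x $ i) * \<phi> x) = (LINT x|lebesgue. g x $ i * \<phi> x) - (LINT x|lebesgue. h x $ i * \<phi> x)"
      using weak_gradient_UNIV_integrable(2)[OF L(1) gh(1) \<phi>] weak_gradient_UNIV_integrable(2)[OF L(2) gh(2) \<phi>]
      by (simp add: left_diff_distrib)
    also have "\<dots> = - (LINT x|lebesgue. u x * partial i \<phi> x) + (LINT x|lebesgue. v x * partial i \<phi> x)"
      using assms(1,2) \<phi> unfolding weak_gradient_def lebesgue_on_UNIV_eq by simp
    also have "\<dots> = 0" using eq by simp
    finally show "(LINT x|lebesgue. (g x $ i - h x $ i) * \<phi> x) = 0" .
  qed
  then have "AE x in lebesgue. \<forall>i\<in>UNIV. g x $ i - h x $ i = 0"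
    by (subst AE_ball_countable) auto
  then show ?thesis by eventually_elim (simp add: vec_eq_iff)
qed

section \<open>Density of test functions, by the maximum principle\<close>

text \<open>At a maximum \<open>v' 0 = 0\<close>, so \<open>L > 0\<close> would make
  \<open>v'\<close> positive immediately to the right, and the mean value theorem would produce a
  larger value.\<close>

lemma second_derivative_at_max:
  fixes v :: "real \<Rightarrow> real"
  assumes d1: "\<And>t. (v has_real_derivative v' t) (at t)" and d2: "(v' has_real_derivative L) (at 0)"
    and max: "\<And>t. v t \<le> v 0"
  shows "L \<le> 0"
proof (rule ccontr)
  assume "\<not> L \<le> 0"
  then have L: "L > 0" by simp
  have v0: "v' 0 = 0"
    by (rule DERIV_local_max[OF d1, of 1]) (use max in auto)
  obtain d where d: "d > 0" "\<forall>h>0. h < d \<longrightarrow> v' 0 < v' (0 + h)"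
    using DERIV_pos_inc_right[OF d2 L] by auto
  obtain \<xi> where \<xi>: "0 < \<xi>" "\<xi> < d / 2" "v (d / 2) - v 0 = (d / 2 - 0) * v' \<xi>"
    using MVT2[of 0 "d / 2" v v'] d1 d(1) by auto
  have "v' \<xi> > 0" using d(2) \<xi>(1,2) v0 by auto
  then have "(d / 2 - 0) * v' \<xi> > 0" using d(1) by simp
  then show False using \<xi>(3) max[of "d / 2"] by simp
qed

lemma line_derivative:
  assumes "f differentiable_on UNIV"
  shows "((\<lambda>t. Re (f (x + t *\<^sub>R axis i 1))) has_real_derivative Re (partial i f (x + t *\<^sub>R axis i 1))) (at t)"
proof -
  let ?y = "x + t *\<^sub>R axis i 1"
  have lin: "linear (frechet_derivative f (at ?y))"
    using differentiable_on_UNIV_D[OF assms] has_derivative_linear by blast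
  have "((\<lambda>t. f (x + t *\<^sub>R axis i 1)) has_derivative (\<lambda>h. frechet_derivative f (at ?y) (h *\<^sub>R axis i 1))) (at t)"
    by (rule has_derivative_compose[of "\<lambda>t. x + t *\<^sub>R axis i 1", OF _ differentiable_on_UNIV_D[OF assms]])
      (auto intro!: derivative_eq_intros)
  then have "((\<lambda>t. Re (f (x + t *\<^sub>R axis i 1))) has_derivative (\<lambda>h. Re (frechet_derivative f (at ?y) (h *\<^sub>R axis i 1)))) (at t)"
    by (rule bounded_linear.has_derivative[OF bounded_linear_Re])
  moreover have "Re (frechet_derivative f (at ?y) (h *\<^sub>R axis i 1)) = Re (partial i f ?y) * h" for h
    by (simp add: linear_scale[OF lin] partial_def)
  ultimately show ?thesis by (simp add: has_field_derivative_def)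
qed

lemma laplacian_reflect:
  assumes "test_fun UNIV \<phi>" shows "laplacian (\<lambda>y. \<phi> (t - y)) = (\<lambda>y. laplacian \<phi> (t - y))"
proof -
  have "partial i (partial i (\<lambda>y. \<phi> (t - y))) = (\<lambda>y. partial i (partial i \<phi>) (t - y))" for i
  proof -
    have "partial i (partial i (\<lambda>y. \<phi> (t - y))) = partial i (\<lambda>y. (-1) * partial i \<phi> (t - y))"
      by (simp add: partial_reflect[OF assms])
    also have "\<dots> = (\<lambda>y. (-1) * (- partial i (partial i \<phi>) (t - y)))"
      by (subst partial_cmult[OF test_fun_reflect[OF test_fun_partial[OF assms]]])
        (simp add: partial_reflect[OF test_fun_partial[OF assms]])
    finally show ?thesis by simp
  qed
  then show ?thesis by (simp add: laplacian_def fun_eq_iff)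
qed

text \<open>Bound the product by the sum of the squares; by translation invariance the part of the
  kernel does not depend on \<open>x\<close>. Boundedness is what lets a quadratic barrier win at
  infinity.\<close>

lemma convolution_bounded:
  fixes z :: "real^'n::finite \<Rightarrow> complex"
  assumes z: "L2 lebesgue z" and \<rho>: "test_fun UNIV \<rho>"
  shows "\<exists>B. \<forall>x. norm (LINT y|lebesgue. z y * \<rho> (x - y)) \<le> B"
proof (intro exI allI)
  fix x
  let ?\<rho> = "\<lambda>y. \<rho> (x - y)"
  have \<rho>x: "test_fun UNIV ?\<rho>" by (rule test_fun_reflect[OF \<rho>])
  have \<rho>L: "L2 lebesgue ?\<rho>" by (rule test_fun_L2[OF \<rho>x])
  have "norm (LINT y|lebesgue. z y * ?\<rho> y) \<le> (LINT y|lebesgue. norm (z y * ?\<rho> y))"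
    by (rule integral_norm_bound)
  also have "\<dots> \<le> (LINT y|lebesgue. (norm (z y))\<^sup>2 + (norm (?\<rho> y))\<^sup>2)"
  proof (rule integral_mono)
    show "integrable lebesgue (\<lambda>y. norm (z y * ?\<rho> y))" by (rule integrable_norm[OF L2_mult_integrable[OF z \<rho>L]])
    show "integrable lebesgue (\<lambda>y. (norm (z y))\<^sup>2 + (norm (?\<rho> y))\<^sup>2)" using z \<rho>L by (simp add: L2_def)
    show "norm (z y * ?\<rho> y) \<le> (norm (z y))\<^sup>2 + (norm (?\<rho> y))\<^sup>2" for y
      using sum_squares_bound[of "norm (z y)" "norm (?\<rho> y)"]
        mult_nonneg_nonneg[OF norm_ge_zero norm_ge_zero, of "z y" "?\<rho> y"] unfolding norm_mult by linarith
  qed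
  also have "\<dots> = (LINT y|lebesgue. (norm (z y))\<^sup>2) + (LINT y|lebesgue. (norm (?\<rho> y))\<^sup>2)"
    using z \<rho>L by (simp add: L2_def)
  also have "(LINT y|lebesgue. (norm (?\<rho> y))\<^sup>2) = (LINT y|lebesgue. (norm (\<rho> (0 - y)))\<^sup>2)"
  proof -
    have "continuous_on UNIV (\<lambda>y. complex_of_real ((norm (\<rho> (0 - y)))\<^sup>2))"
      by (intro continuous_intros Ck_imp_continuous[OF test_fun_Ck[OF test_fun_reflect[OF \<rho>]]])
    from lebesgue_integral_translate[OF borel_measurable_continuous_onI[OF this], of "- x"]
    have "complex_of_real (LINT y|lebesgue. (norm (?\<rho> y))\<^sup>2) = complex_of_real (LINT y|lebesgue. (norm (\<rho> (0 - y)))\<^sup>2)"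
      unfolding integral_complex_of_real[symmetric] by simp
    then show ?thesis by (simp only: of_real_eq_iff)
  qed
  finally show "norm (LINT y|lebesgue. z y * \<rho> (x - y)) \<le>
    (LINT y|lebesgue. (norm (z y))\<^sup>2) + (LINT y|lebesgue. (norm (\<rho> (0 - y)))\<^sup>2)" .
qed

text \<open>Convolved with a test function, \<open>z\<close> becomes a bounded classical solution of
  \<open>V = \<Delta> V\<close>. The barrier \<open>x \<bullet> x + 2 d\<close> dominates its own
  Laplacian \<open>2 d\<close> and grows at infinity. If the real part of the solution were positive
  somewhere, subtracting a small multiple of the barrier would leave a positive maximum, and the
  second derivatives there contradict the equation.\<close>

lemma weak_modified_helmholtz_zero:
  fixes z :: "real^'n::finite \<Rightarrow> complex"
  assumes z: "L2 lebesgue z"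
    and eq: "\<And>\<phi>. test_fun UNIV \<phi> \<Longrightarrow> (LINT x|lebesgue. z x * (\<phi> x - laplacian \<phi> x)) = 0"
  shows "AE x in lebesgue. z x = 0"
proof (rule fundamental_lemma_L2[OF z])
  define conv where "conv \<rho> x = (LINT y|lebesgue. z y * \<rho> (x - y))" for \<rho> x
  note zl = L2_locally_integrable[OF z]
  have conv_diff: "conv \<rho> differentiable_on UNIV" if "test_fun UNIV \<rho>" for \<rho>
    unfolding conv_def by (rule convolution_differentiable[OF that zl])
  have conv_partial: "partial i (conv \<rho>) = conv (partial i \<rho>)" if "test_fun UNIV \<rho>" for \<rho> i
    unfolding conv_def by (rule partial_convolution[OF that zl])
  have conv_eq: "conv \<rho> x = (\<Sum>i\<in>UNIV. conv (partial i (partial i \<rho>)) x)" if \<rho>: "test_fun UNIV \<rho>" for \<rho> x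
  proof -
    have i1: "integrable lebesgue (\<lambda>y. z y * \<psi> (x - y))" if "test_fun UNIV \<psi>" for \<psi>
      by (rule test_fun_product_integrable[OF test_fun_reflect[OF that] zl])
    have pp: "test_fun UNIV (partial i (partial i \<rho>))" for i by (intro test_fun_partial \<rho>)
    have "0 = (LINT y|lebesgue. z y * (\<rho> (x - y) - laplacian \<rho> (x - y)))"
      using eq[OF test_fun_reflect[OF \<rho>, of x]] by (simp add: laplacian_reflect[OF \<rho>])
    also have "\<dots> = (LINT y|lebesgue. z y * \<rho> (x - y) - (\<Sum>i\<in>UNIV. z y * partial i (partial i \<rho>) (x - y)))"
      by (simp add: laplacian_def right_diff_distrib sum_distrib_left)
    also have "\<dots> = conv \<rho> x - (\<Sum>i\<in>UNIV. conv (partial i (partial i \<rho>)) x)"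
      unfolding conv_def using i1[OF \<rho>] i1[OF pp] by simp
    finally show ?thesis by simp
  qed
  have main: "Re (conv \<rho> x1) \<le> 0" if \<rho>: "test_fun UNIV \<rho>" for \<rho> x1
  proof (rule ccontr)
    assume "\<not> Re (conv \<rho> x1) \<le> 0"
    then have pos: "Re (conv \<rho> x1) > 0" by simp
    \<comment> \<open>The Laplacian of \<open>x \<bullet> x\<close>.\<close>
    let ?N = "2 * real CARD('n)"
    \<comment> \<open>This \<open>\<eta>\<close> makes the barrier term at \<open>x1\<close> exactly
      half of \<open>Re (conv \<rho> x1)\<close>, hence \<open>V x1 > 0\<close>.\<close>
    define \<eta> where "\<eta> = Re (conv \<rho> x1) / (2 * (x1 \<bullet> x1 + ?N))"
    have N: "x1 \<bullet> x1 + ?N > 0" by (simp add: add_nonneg_pos)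
    then have \<eta>: "\<eta> > 0" unfolding \<eta>_def using pos by simp
    define V where "V x = Re (conv \<rho> x) - \<eta> * (x \<bullet> x + ?N)" for x
    have Vx1: "V x1 > 0"
    proof -
      have "\<eta> * (x1 \<bullet> x1 + ?N) = Re (conv \<rho> x1) / 2" unfolding \<eta>_def using N by (simp add: field_simps)
      then show ?thesis unfolding V_def using pos by simp
    qed
    obtain B where B: "\<forall>x. norm (conv \<rho> x) \<le> B"
      using convolution_bounded[OF z \<rho>] unfolding conv_def by (elim exE)
    \<comment> \<open>Beyond this radius the quadratic barrier exceeds the bound \<open>B\<close>;
      the summand \<open>norm x1\<close> keeps \<open>x1\<close> inside the ball.\<close>
    define r where "r = norm x1 + sqrt (\<bar>B\<bar> / \<eta>)"
    have far: "V y \<le> 0" if y: "norm y > r" for y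
    proof -
      have "sqrt (\<bar>B\<bar> / \<eta>) \<le> norm y" using y unfolding r_def using norm_ge_zero[of x1] by linarith
      then have "(sqrt (\<bar>B\<bar> / \<eta>))\<^sup>2 \<le> (norm y)\<^sup>2" using \<eta> by (intro power_mono) auto
      then have "\<bar>B\<bar> \<le> \<eta> * (y \<bullet> y)" using \<eta> by (simp add: power2_norm_eq_inner field_simps)
      moreover have "Re (conv \<rho> y) \<le> \<bar>B\<bar>"
        using B[rule_format, of y] complex_Re_le_cmod[of "conv \<rho> y"] by linarith
      moreover have "0 \<le> \<eta> * ?N" using \<eta> by simp
      ultimately show ?thesis unfolding V_def distrib_left by linarith
    qed
    have cV: "continuous_on (cball 0 r) V"
      unfolding V_def
      by (intro continuous_intros continuous_on_subset[OF differentiable_imp_continuous_on[OF conv_diff[OF \<rho>]]]) auto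
    have x1r: "x1 \<in> cball 0 r" unfolding r_def using \<eta> by simp
    then have "cball 0 r \<noteq> ({} :: (real^'n) set)" by blast
    from continuous_attains_sup[OF compact_cball this cV]
    obtain x0 where x0: "x0 \<in> cball 0 r" "\<forall>y\<in>cball 0 r. V y \<le> V x0" by (elim bexE)
    have Vx0: "V x0 > 0" using x0(2) x1r Vx1 by fastforce
    have max: "V y \<le> V x0" for y
    proof (cases "y \<in> cball 0 r")
      case False
      then show ?thesis using far[of y] Vx0 by simp
    qed (use x0(2) in blast)
    have sec: "Re (conv (partial i (partial i \<rho>)) x0) \<le> 2 * \<eta>" for i
    proof -
      let ?e = "axis i (1::real)"
      have d: "((\<lambda>t. Re (conv \<psi> (x0 + t *\<^sub>R ?e))) has_real_derivative Re (conv (partial i \<psi>) (x0 + t *\<^sub>R ?e))) (at t)"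
        if "test_fun UNIV \<psi>" for \<psi> t
        using line_derivative[OF conv_diff[OF that], of x0 i t] by (simp add: conv_partial[OF that])
      have Vl: "V (x0 + t *\<^sub>R ?e) = Re (conv \<rho> (x0 + t *\<^sub>R ?e)) - \<eta> * (x0 \<bullet> x0 + 2 * t * (x0 $ i) + t\<^sup>2 + ?N)" for t
        unfolding V_def
        by (simp add: inner_add_left inner_add_right inner_axis inner_axis' inner_axis_axis power2_eq_square algebra_simps)
      have "Re (conv (partial i (partial i \<rho>)) x0) - \<eta> * 2 \<le> 0"
      proof (rule second_derivative_at_max)
        show "((\<lambda>t. V (x0 + t *\<^sub>R ?e)) has_real_derivative
            (Re (conv (partial i \<rho>) (x0 + t *\<^sub>R ?e)) - \<eta> * (2 * (x0 $ i) + 2 * t))) (at t)" for t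
          unfolding Vl by (rule DERIV_diff[OF d[OF \<rho>]]) (auto intro!: derivative_eq_intros)
        show "((\<lambda>t. Re (conv (partial i \<rho>) (x0 + t *\<^sub>R ?e)) - \<eta> * (2 * (x0 $ i) + 2 * t)) has_real_derivative
            (Re (conv (partial i (partial i \<rho>)) x0) - \<eta> * 2)) (at 0)"
        proof (rule DERIV_diff)
          show "((\<lambda>t. Re (conv (partial i \<rho>) (x0 + t *\<^sub>R ?e))) has_real_derivative
              Re (conv (partial i (partial i \<rho>)) x0)) (at 0)"
            using d[of "partial i \<rho>" 0, OF test_fun_partial[OF \<rho>]] by simp
        qed (auto intro!: derivative_eq_intros)
        show "V (x0 + t *\<^sub>R ?e) \<le> V (x0 + 0 *\<^sub>R ?e)" for t using max by simp
      qed
      then show ?thesis by simp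
    qed
    have "Re (conv \<rho> x0) = (\<Sum>i\<in>UNIV. Re (conv (partial i (partial i \<rho>)) x0))"
      by (subst conv_eq[OF \<rho>]) simp
    also have "\<dots> \<le> (\<Sum>i\<in>(UNIV::'n set). 2 * \<eta>)" by (intro sum_mono sec)
    also have "\<dots> = \<eta> * ?N" by simp
    also have "\<dots> \<le> \<eta> * (x0 \<bullet> x0 + ?N)" using \<eta> by (intro mult_left_mono) auto
    finally show False using Vx0 unfolding V_def by simp
  qed
  fix \<phi> :: "real^'n \<Rightarrow> complex" assume \<phi>: "test_fun UNIV \<phi>"
  \<comment> \<open>At the origin, convolution with the reflected function is the plain pairing. The
    one-sided bound for the factors 1, -1, \<open>\<i>\<close> and \<open>-\<i>\<close> annihilates
    real and imaginary part.\<close>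
  have le: "Re (c * (LINT y|lebesgue. z y * \<phi> y)) \<le> 0" for c
  proof -
    have "test_fun UNIV (\<lambda>y. c * \<phi> (0 - y))" by (intro test_fun_cmult test_fun_reflect \<phi>)
    from main[OF this, of 0] show ?thesis unfolding conv_def by (simp add: mult.left_commute[of _ c])
  qed
  from le[of 1] le[of "-1"] le[of \<i>] le[of "-\<i>"] show "(LINT y|lebesgue. z y * \<phi> y) = 0"
    by (simp add: complex_eq_iff)
qed

lemma weak_gradient_zero: "weak_gradient UNIV (\<lambda>x. 0) (\<lambda>x. 0)"
  by (simp add: weak_gradient_def lebesgue_on_UNIV_eq L2_zero)

definition jet :: "(real^'n::finite \<Rightarrow> complex) \<Rightarrow> real^'n \<Rightarrow> complex \<times> (complex^'n)" where
  "jet \<phi> x = (\<phi> x, \<chi> i. partial i \<phi> x)"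

lemma jet_in_H1_pairs: "test_fun UNIV \<phi> \<Longrightarrow> jet \<phi> \<in> H1_pairs"
  using H1_pairs_iff[of \<phi> "\<lambda>x. \<chi> i. partial i \<phi> x"] weak_gradient_test_fun test_fun_L2
  unfolding jet_def[abs_def] by blast

lemma inner_jet_cnj:
  assumes "test_fun UNIV \<phi>"
  shows "(a, b) \<bullet> jet (\<lambda>x. cnj (\<phi> x)) x = Re (a * \<phi> x + (\<Sum>i\<in>UNIV. b $ i * partial i \<phi> x))"
  unfolding jet_def partial_cnj[OF test_fun_differentiable[OF assms]]
  by (simp only: inner_prod_def fst_conv snd_conv inner_vec_def vec_lambda_beta inner_cnj plus_complex.sel Re_sum)

text \<open>Density of test functions in H^1, in dual form: orthogonality in the H^1 inner product
  becomes the weak equation \<open>z - \<Delta> z = 0\<close> once the weak gradient moves a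
  derivative onto the test function.\<close>

lemma H1_pairs_orthogonal_to_tests:
  fixes z :: "real^'n::finite \<Rightarrow> complex"
  assumes Z: "(\<lambda>x. (z x, g x)) \<in> H1_pairs"
    and orth: "\<And>\<phi>. test_fun UNIV \<phi> \<Longrightarrow> (LINT x|lebesgue. (z x, g x) \<bullet> jet \<phi> x) = 0"
  shows "AE x in lebesgue. (z x, g x) = 0"
proof -
  have zL: "L2 lebesgue z" and w: "weak_gradient UNIV z g" using Z by (auto simp: H1_pairs_iff)
  then have gL: "L2 lebesgue g" by (simp add: weak_gradient_def lebesgue_on_UNIV_eq)
  have "(LINT x|lebesgue. z x * (\<phi> x - laplacian \<phi> x)) = 0" if \<phi>: "test_fun UNIV \<phi>" for \<phi>
  proof -
    define E where "E \<psi> = (LINT x|lebesgue. z x * \<psi> x) + (\<Sum>i\<in>UNIV. LINT x|lebesgue. g x $ i * partial i \<psi> x)" for \<psi>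
    have i0: "integrable lebesgue (\<lambda>x. z x * \<psi> x)" if "test_fun UNIV \<psi>" for \<psi>
      by (rule L2_mult_integrable[OF zL test_fun_L2[OF that]])
    have ig: "integrable lebesgue (\<lambda>x. g x $ i * \<psi> x)" if "test_fun UNIV \<psi>" for \<psi> i
      by (rule L2_mult_integrable[OF L2_vec_nth[OF gL] test_fun_L2[OF that]])
    have ReE: "Re (E \<psi>) = 0" if \<psi>: "test_fun UNIV \<psi>" for \<psi>
    proof -
      have i1: "integrable lebesgue (\<lambda>x. \<Sum>i\<in>UNIV. g x $ i * partial i \<psi> x)"
        by (intro Bochner_Integration.integrable_sum ig test_fun_partial \<psi>)
      have "0 = (LINT x|lebesgue. Re (z x * \<psi> x + (\<Sum>i\<in>UNIV. g x $ i * partial i \<psi> x)))"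
        using orth[OF test_fun_cnj[OF \<psi>]] unfolding inner_jet_cnj[OF \<psi>] by simp
      also have "\<dots> = Re (LINT x|lebesgue. z x * \<psi> x + (\<Sum>i\<in>UNIV. g x $ i * partial i \<psi> x))"
        by (intro integral_Re Bochner_Integration.integrable_add i0 i1 \<psi>)
      also have "\<dots> = Re (E \<psi>)"
        unfolding E_def using i0[OF \<psi>] i1 ig[OF test_fun_partial[OF \<psi>]] by simp
      finally show ?thesis by simp
    qed
    have "E \<phi> = 0"
    proof (rule complex_eq_0_by_Re)
      show "Re (E \<phi>) = 0" by (rule ReE[OF \<phi>])
      have "\<i> * E \<phi> = E (\<lambda>x. \<i> * \<phi> x)"
        unfolding E_def partial_cmult[OF \<phi>] by (simp add: mult.left_commute[of _ \<i>] distrib_left sum_distrib_left)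
      then show "Re (\<i> * E \<phi>) = 0" using ReE[OF test_fun_cmult[OF \<phi>]] by simp
    qed
    moreover have "(LINT x|lebesgue. g x $ i * partial i \<phi> x) = - (LINT x|lebesgue. z x * partial i (partial i \<phi>) x)" for i
      using w test_fun_partial[OF \<phi>] by (simp add: weak_gradient_def lebesgue_on_UNIV_eq)
    ultimately have "(LINT x|lebesgue. z x * \<phi> x) - (\<Sum>i\<in>UNIV. LINT x|lebesgue. z x * partial i (partial i \<phi>) x) = 0"
      unfolding E_def by (simp add: sum_negf)
    moreover have "(LINT x|lebesgue. z x * (\<phi> x - laplacian \<phi> x)) =
        (LINT x|lebesgue. z x * \<phi> x - (\<Sum>i\<in>UNIV. z x * partial i (partial i \<phi>) x))"
      by (simp add: laplacian_def right_diff_distrib sum_distrib_left)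
    moreover have "\<dots> = (LINT x|lebesgue. z x * \<phi> x) - (\<Sum>i\<in>UNIV. LINT x|lebesgue. z x * partial i (partial i \<phi>) x)"
      using i0[OF \<phi>] i0[OF test_fun_partial[OF test_fun_partial[OF \<phi>]]] by simp
    ultimately show ?thesis by simp
  qed
  from weak_modified_helmholtz_zero[OF zL this] have z0: "AE x in lebesgue. z x = 0" .
  from weak_gradient_unique[OF w weak_gradient_zero this zL L2_zero] have "AE x in lebesgue. g x = 0" .
  with z0 show ?thesis by eventually_elim (simp add: zero_prod_def)
qed

section \<open>Solvability of the transmission problem by coercivity\<close>

section \<open>A coercive second order equation on the whole space\<close>

lemma L2_bounded_mult:
  fixes u :: "'a \<Rightarrow> complex"
  assumes "a \<in> borel_measurable M" "AE x in M. norm (a x) \<le> K" "L2 M u"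
  shows "L2 M (\<lambda>x. a x * u x)"
proof (rule L2_dominated[OF _ assms(3)])
  show "(\<lambda>x. a x * u x) \<in> borel_measurable M"
    using assms(1,3) unfolding L2_def by (intro borel_measurable_times) auto
  show "AE x in M. norm (a x * u x) \<le> K * norm (u x)"
    using assms(2) unfolding norm_mult by eventually_elim (rule mult_right_mono, auto)
qed

lemma borel_measurable_vec_lambda:
  fixes g :: "'i::finite \<Rightarrow> 'a \<Rightarrow> complex"
  assumes "\<And>i. g i \<in> borel_measurable M" shows "(\<lambda>x. \<chi> i. g i x) \<in> borel_measurable M"
proof -
  have "(\<lambda>x. \<chi> i. g i x) = (\<lambda>x. \<Sum>i\<in>UNIV. axis i (g i x))"
    by (auto simp: vec_eq_iff axis_def if_distrib cong: if_cong)
  moreover have "(\<lambda>x. \<Sum>i\<in>UNIV. axis i (g i x)) \<in> borel_measurable M"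
    by (intro borel_measurable_sum borel_measurable_continuous_on[OF linear_continuous_on[OF bounded_linear_axis]] assms)
  ultimately show ?thesis by simp
qed

lemma inner_mult_self: "(b * z) \<bullet> z = Re b * (norm z)\<^sup>2" for b z :: complex
  by (simp add: inner_complex_def cmod_power2 power2_eq_square[of "Re z"] power2_eq_square[of "Im z"] algebra_simps)

definition block_mult :: "complex \<Rightarrow> complex \<Rightarrow> complex \<times> (complex^'n::finite) \<Rightarrow> complex \<times> (complex^'n)" where
  "block_mult b c U = (b * fst U, \<chi> i. c * snd U $ i)"

lemma block_mult_linear: "linear (block_mult b c)"
  by (rule linearI) (auto simp: block_mult_def vec_eq_iff algebra_simps)

lemma block_mult_norm:
  fixes U :: "complex \<times> (complex^'n::finite)"
  assumes "norm b \<le> K" "norm c \<le> K" shows "norm (block_mult b c U) \<le> K * norm U"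
proof -
  have K: "0 \<le> K" using assms(1) norm_ge_zero order_trans by blast
  have vec: "norm (\<chi> i. c * snd U $ i) = norm c * norm (snd U)"
    unfolding norm_vec_def by (simp add: norm_mult L2_set_right_distrib)
  have "(norm (block_mult b c U))\<^sup>2 = (norm b * norm (fst U))\<^sup>2 + (norm c * norm (snd U))\<^sup>2"
    unfolding block_mult_def norm_Pair vec norm_mult by simp
  also have "\<dots> \<le> (K * norm (fst U))\<^sup>2 + (K * norm (snd U))\<^sup>2"
    by (intro add_mono power_mono mult_right_mono assms) auto
  also have "\<dots> = (K * norm U)\<^sup>2"
    by (simp add: norm_prod_def power_mult_distrib distrib_left)
  finally show ?thesis by (rule power2_le_imp_le) (simp add: K)
qed

lemma block_mult_coercive:
  fixes U :: "complex \<times> (complex^'n::finite)"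
  assumes "k \<le> Re b" "k \<le> Re c" shows "k * (norm U)\<^sup>2 \<le> block_mult b c U \<bullet> U"
proof -
  have "k * (norm U)\<^sup>2 = k * (norm (fst U))\<^sup>2 + (\<Sum>i\<in>UNIV. k * (norm (snd U $ i))\<^sup>2)"
    by (simp add: norm_prod_def norm_vec_def L2_set_def sum_nonneg distrib_left sum_distrib_left)
  also have "\<dots> \<le> Re b * (norm (fst U))\<^sup>2 + (\<Sum>i\<in>UNIV. Re c * (norm (snd U $ i))\<^sup>2)"
    by (intro add_mono sum_mono mult_right_mono assms) auto
  also have "\<dots> = block_mult b c U \<bullet> U"
    by (simp add: block_mult_def inner_prod_def inner_vec_def inner_mult_self)
  finally show ?thesis .
qed

lemma block_mult_measurable:
  fixes U :: "'a \<Rightarrow> complex \<times> (complex^'n::finite)"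
  assumes b: "b \<in> borel_measurable M" and c: "c \<in> borel_measurable M" and U: "U \<in> borel_measurable M"
  shows "(\<lambda>x. block_mult (b x) (c x) (U x)) \<in> borel_measurable M"
proof -
  have f: "(\<lambda>x. fst (U x)) \<in> borel_measurable M" and s: "(\<lambda>x. snd (U x)) \<in> borel_measurable M"
    by (intro borel_measurable_continuous_on[OF _ U] continuous_intros)+
  have "(\<lambda>x. snd (U x) $ i) \<in> borel_measurable M" for i
    by (intro borel_measurable_continuous_on[OF _ s] linear_continuous_on bounded_linear_vec_nth)
  then show ?thesis
    unfolding block_mult_def
    by (intro borel_measurable_Pair borel_measurable_times borel_measurable_vec_lambda b c f)
qed

lemma AE_eq_0_of_integral_norm_sq:
  assumes "L2 M f" "(LINT x|M. (norm (f x))\<^sup>2) \<le> 0" shows "AE x in M. f x = 0"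
proof -
  have "(LINT x|M. (norm (f x))\<^sup>2) = 0" using assms(2) by (intro antisym) auto
  then have "AE x in M. (norm (f x))\<^sup>2 = 0"
    using assms(1) by (subst (asm) integral_nonneg_eq_0_iff_AE) (auto simp: L2_def)
  then show ?thesis by eventually_elim simp
qed

context
  fixes a q f :: "real^'n::finite \<Rightarrow> complex" and \<alpha> :: complex and K k :: real
  assumes am: "a \<in> borel_measurable lebesgue" and qm: "q \<in> borel_measurable lebesgue"
    and ab: "AE x in lebesgue. norm (a x) \<le> K" and qb: "AE x in lebesgue. norm (q x) \<le> K"
    and \<alpha>: "\<alpha> \<noteq> 0" and k: "k > 0" and ac: "AE x in lebesgue. k \<le> Re (\<alpha> * a x)" and qc: "AE x in lebesgue. k \<le> Re (- \<alpha> * q x)"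
    and f: "L2 lebesgue f"
begin

private definition weak_eq :: "(real^'n \<Rightarrow> complex) \<Rightarrow> (real^'n \<Rightarrow> complex^'n) \<Rightarrow> bool" where
  "weak_eq u g \<longleftrightarrow> (\<forall>\<phi>. test_fun UNIV \<phi> \<longrightarrow>
     (LINT x|lebesgue. - a x * (\<Sum>i\<in>UNIV. g x $ i * partial i \<phi> x) + q x * u x * \<phi> x) = (LINT x|lebesgue. f x * \<phi> x))"

text \<open>The left side of the equation multiplied by \<open>- \<alpha>\<close>: the sign turns
  \<open>- a\<close> and \<open>q\<close> into the coefficients \<open>\<alpha> * a\<close> on
  gradients and \<open>- \<alpha> * q\<close> on functions, whose real parts are bounded below by
  \<open>k\<close>.\<close>

private definition form :: "real^'n \<Rightarrow> complex \<times> (complex^'n) \<Rightarrow> complex \<times> (complex^'n)" where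
  "form x = block_mult (- \<alpha> * q x) (\<alpha> * a x)"

private definition source :: "real^'n \<Rightarrow> complex \<times> (complex^'n)" where
  "source x = (- \<alpha> * f x, 0)"

private lemma form_measurable: "U \<in> borel_measurable lebesgue \<Longrightarrow> (\<lambda>x. form x (U x)) \<in> borel_measurable lebesgue"
  unfolding form_def by (intro block_mult_measurable borel_measurable_times borel_measurable_const am qm)

private lemma form_bounded: "AE x in lebesgue. \<forall>z. norm (form x z) \<le> norm \<alpha> * K * norm z"
  using ab qb unfolding form_def
  by eventually_elim (intro allI block_mult_norm, simp_all add: norm_mult mult_left_mono)

private lemma form_coercive: "AE x in lebesgue. \<forall>z. k * (norm z)\<^sup>2 \<le> form x z \<bullet> z"
  using ac qc unfolding form_def by eventually_elim (intro allI block_mult_coercive)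

private lemma form_L2: "L2 lebesgue U \<Longrightarrow> L2 lebesgue (\<lambda>x. form x (U x))"
  by (rule L2_pointwise_bounded[OF form_measurable form_bounded])

private lemma form_linear: "linear (form x)"
  unfolding form_def by (rule block_mult_linear)

private lemma source_L2: "L2 lebesgue source"
  unfolding source_def[abs_def]
  by (intro L2_Pair L2_zero L2_bounded_linear[OF bounded_linear_mult_right f])

text \<open>Jets of conjugated test functions convert the real inner product into the real part of a
  complex bilinear pairing; the minus sign is the one built into \<open>form\<close>.\<close>

private lemma form_tested:
  assumes u: "L2 lebesgue u" and g: "L2 lebesgue g" and \<phi>: "test_fun UNIV \<phi>"
  shows "(LINT x|lebesgue. (form x (u x, g x) - source x) \<bullet> jet (\<lambda>x. cnj (\<phi> x)) x) =
    - Re (\<alpha> * ((LINT x|lebesgue. - a x * (\<Sum>i\<in>UNIV. g x $ i * partial i \<phi> x) + q x * u x * \<phi> x) - (LINT x|lebesgue. f x * \<phi> x)))"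
proof -
  have i1: "integrable lebesgue (\<lambda>x. (a x * g x $ i) * partial i \<phi> x)" for i
    by (intro L2_mult_integrable L2_bounded_mult[OF am ab] L2_vec_nth g test_fun_L2[of UNIV] test_fun_partial \<phi>)
  have i2: "integrable lebesgue (\<lambda>x. (q x * u x) * \<phi> x)"
    by (intro L2_mult_integrable L2_bounded_mult[OF qm qb] u test_fun_L2[of UNIV] \<phi>)
  have i3: "integrable lebesgue (\<lambda>x. f x * \<phi> x)"
    by (intro L2_mult_integrable f test_fun_L2[of UNIV] \<phi>)
  have "integrable lebesgue (\<lambda>x. - (\<Sum>i\<in>UNIV. (a x * g x $ i) * partial i \<phi> x) + q x * u x * \<phi> x)"
    by (intro Bochner_Integration.integrable_add Bochner_Integration.integrable_minus Bochner_Integration.integrable_sum i1 i2)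
  then have i4: "integrable lebesgue (\<lambda>x. - a x * (\<Sum>i\<in>UNIV. g x $ i * partial i \<phi> x) + q x * u x * \<phi> x)"
    by (simp add: sum_distrib_left mult.assoc sum_negf)
  have "(form x (u x, g x) - source x) \<bullet> jet (\<lambda>x. cnj (\<phi> x)) x =
      - Re (\<alpha> * ((- a x * (\<Sum>i\<in>UNIV. g x $ i * partial i \<phi> x) + q x * u x * \<phi> x) - f x * \<phi> x))" for x
  proof -
    have "form x (u x, g x) - source x = (- \<alpha> * q x * u x + \<alpha> * f x, \<chi> i. \<alpha> * a x * g x $ i)"
      by (simp add: form_def source_def block_mult_def minus_prod_def)
    then have "(form x (u x, g x) - source x) \<bullet> jet (\<lambda>x. cnj (\<phi> x)) x =
      Re ((- \<alpha> * q x * u x + \<alpha> * f x) * \<phi> x + (\<Sum>i\<in>UNIV. (\<alpha> * a x * g x $ i) * partial i \<phi> x))"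
      by (simp only: inner_jet_cnj[OF \<phi>] vec_lambda_beta)
    also have "(- \<alpha> * q x * u x + \<alpha> * f x) * \<phi> x + (\<Sum>i\<in>UNIV. (\<alpha> * a x * g x $ i) * partial i \<phi> x)
      = - (\<alpha> * ((- a x * (\<Sum>i\<in>UNIV. g x $ i * partial i \<phi> x) + q x * u x * \<phi> x) - f x * \<phi> x))"
      by (simp add: algebra_simps sum_distrib_left sum_negf)
    finally show ?thesis by (simp only: uminus_complex.sel)
  qed
  then have "(LINT x|lebesgue. (form x (u x, g x) - source x) \<bullet> jet (\<lambda>x. cnj (\<phi> x)) x) =
    (LINT x|lebesgue. - Re (\<alpha> * ((- a x * (\<Sum>i\<in>UNIV. g x $ i * partial i \<phi> x) + q x * u x * \<phi> x) - f x * \<phi> x)))"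
    by (simp only:)
  also have "\<dots> = - Re (LINT x|lebesgue. \<alpha> * ((- a x * (\<Sum>i\<in>UNIV. g x $ i * partial i \<phi> x) + q x * u x * \<phi> x) - f x * \<phi> x))"
    by (subst integral_minus, subst integral_Re) (intro integrable_mult_right Bochner_Integration.integrable_diff i3 i4, rule refl)
  also have "(LINT x|lebesgue. \<alpha> * ((- a x * (\<Sum>i\<in>UNIV. g x $ i * partial i \<phi> x) + q x * u x * \<phi> x) - f x * \<phi> x))
      = \<alpha> * ((LINT x|lebesgue. - a x * (\<Sum>i\<in>UNIV. g x $ i * partial i \<phi> x) + q x * u x * \<phi> x) - (LINT x|lebesgue. f x * \<phi> x))"
    by (subst integral_mult_right_zero, subst Bochner_Integration.integral_diff[OF i4 i3]) (rule refl)
  finally show ?thesis .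
qed

text \<open>Testing gives only the real part of \<open>\<alpha>\<close> times the residual. The
  factor \<open>\<i>\<close> in the test function provides the imaginary part, and
  \<open>\<alpha> \<noteq> 0\<close> can be cancelled.\<close>

private lemma weak_eq_iff:
  assumes u: "L2 lebesgue u" and g: "L2 lebesgue g"
  shows "weak_eq u g \<longleftrightarrow> (\<forall>\<phi>. test_fun UNIV \<phi> \<longrightarrow> (LINT x|lebesgue. (form x (u x, g x) - source x) \<bullet> jet \<phi> x) = 0)"
proof
  assume w: "weak_eq u g"
  show "\<forall>\<phi>. test_fun UNIV \<phi> \<longrightarrow> (LINT x|lebesgue. (form x (u x, g x) - source x) \<bullet> jet \<phi> x) = 0"
  proof (intro allI impI)
    fix \<phi> :: "real^'n \<Rightarrow> complex" assume \<phi>: "test_fun UNIV \<phi>"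
    show "(LINT x|lebesgue. (form x (u x, g x) - source x) \<bullet> jet \<phi> x) = 0"
      using form_tested[OF u g test_fun_cnj[OF \<phi>]] w test_fun_cnj[OF \<phi>] by (simp add: weak_eq_def)
  qed
next
  assume R: "\<forall>\<phi>. test_fun UNIV \<phi> \<longrightarrow> (LINT x|lebesgue. (form x (u x, g x) - source x) \<bullet> jet \<phi> x) = 0"
  define E where "E \<phi> = (LINT x|lebesgue. - a x * (\<Sum>i\<in>UNIV. g x $ i * partial i \<phi> x) + q x * u x * \<phi> x)
     - (LINT x|lebesgue. f x * \<phi> x)" for \<phi>
  have ReE: "Re (\<alpha> * E \<phi>) = 0" if \<phi>: "test_fun UNIV \<phi>" for \<phi>
    using form_tested[OF u g \<phi>] R[rule_format, OF test_fun_cnj[OF \<phi>]] unfolding E_def by simp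
  have "E \<phi> = 0" if \<phi>: "test_fun UNIV \<phi>" for \<phi>
  proof -
    have "\<i> * E \<phi> = (LINT x|lebesgue. \<i> * (- a x * (\<Sum>i\<in>UNIV. g x $ i * partial i \<phi> x) + q x * u x * \<phi> x))
       - (LINT x|lebesgue. \<i> * (f x * \<phi> x))"
      unfolding E_def by (simp only: right_diff_distrib integral_mult_right_zero)
    also have "\<dots> = E (\<lambda>x. \<i> * \<phi> x)"
      unfolding E_def partial_cmult[OF \<phi>] by (simp add: algebra_simps sum_distrib_left)
    finally have "Re (\<i> * (\<alpha> * E \<phi>)) = 0"
      using ReE[OF test_fun_cmult[OF \<phi>, of \<i>]] by (simp only: mult.left_commute[of \<i> \<alpha>])
    with ReE[OF \<phi>] have "\<alpha> * E \<phi> = 0" by (rule complex_eq_0_by_Re)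
    then show ?thesis using \<alpha> by simp
  qed
  then show "weak_eq u g" unfolding weak_eq_def E_def by simp
qed

lemma coercive_equation_exists:
  "\<exists>u\<in>H1 UNIV. \<forall>\<phi>. test_fun UNIV \<phi> \<longrightarrow>
     (LINT x|lebesgue. - a x * (\<Sum>i\<in>UNIV. wgrad UNIV u x $ i * partial i \<phi> x) + q x * u x * \<phi> x) = (LINT x|lebesgue. f x * \<phi> x)"
proof -
  have "\<exists>U\<in>H1_pairs. \<forall>W\<in>H1_pairs. (LINT x|lebesgue. (form x (U x) - source x) \<bullet> W x) = 0"
    by (rule Lax_Milgram_pointwise[where A=form and T=gradient_tests, OF _ form_linear _ form_bounded k form_coercive source_L2])
      (auto intro: gradient_tests_L2 form_measurable)
  then obtain U where U: "U \<in> H1_pairs" "\<forall>W\<in>H1_pairs. (LINT x|lebesgue. (form x (U x) - source x) \<bullet> W x) = 0"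
    by (elim bexE)
  define u where "u x = fst (U x)" for x
  define g where "g x = snd (U x)" for x
  have Ueq: "U = (\<lambda>x. (u x, g x))" by (simp add: u_def g_def)
  have u: "L2 lebesgue u" and w: "weak_gradient UNIV u g"
    using U(1) unfolding Ueq H1_pairs_iff by auto
  then have uH: "u \<in> H1 UNIV" by (auto simp: H1_def lebesgue_on_UNIV_eq)
  have w': "weak_gradient UNIV u (wgrad UNIV u)" unfolding wgrad_def by (rule someI[of _ g]) (rule w)
  have gL: "L2 lebesgue g" "L2 lebesgue (wgrad UNIV u)"
    using w w' by (auto simp: weak_gradient_def lebesgue_on_UNIV_eq)
  \<comment> \<open>Lax-Milgram produces some weak gradient \<open>g\<close>, while the equation is
    stated with the chosen \<open>wgrad\<close>; the two agree almost everywhere.\<close>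
  have eq: "AE x in lebesgue. wgrad UNIV u x = g x"
    by (rule weak_gradient_unique[OF w' w _ u u]) simp
  have "(LINT x|lebesgue. (form x (u x, wgrad UNIV u x) - source x) \<bullet> jet \<phi> x) = 0" if \<phi>: "test_fun UNIV \<phi>" for \<phi>
  proof -
    have jL: "L2 lebesgue (jet \<phi>)" using jet_in_H1_pairs[OF \<phi>] by (simp add: annihilator_def)
    have m: "integrable lebesgue (\<lambda>x. (form x (u x, h x) - source x) \<bullet> jet \<phi> x)" if "L2 lebesgue h" for h
      by (intro L2_inner_integrable L2_diff form_L2 L2_Pair u that source_L2 jL)
    have "(LINT x|lebesgue. (form x (u x, wgrad UNIV u x) - source x) \<bullet> jet \<phi> x) = (LINT x|lebesgue. (form x (u x, g x) - source x) \<bullet> jet \<phi> x)"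
      by (rule integral_cong_AE) (use m[OF gL(1)] m[OF gL(2)] eq in \<open>auto elim!: eventually_mono\<close>)
    also have "\<dots> = 0" using U(2)[rule_format, OF jet_in_H1_pairs[OF \<phi>]] unfolding Ueq .
    finally show ?thesis .
  qed
  then have "weak_eq u (wgrad UNIV u)" using weak_eq_iff[OF u gL(2)] by blast
  then show ?thesis using uH unfolding weak_eq_def by blast
qed

text \<open>The difference \<open>D\<close> is not a test function and cannot be inserted into the
  equation directly. Projecting the image of \<open>D\<close> under \<open>form\<close> onto the H^1
  pairs gives \<open>Z\<close>, which represents the same functional there; \<open>Z\<close> is
  orthogonal to all jets, hence zero by density. Thus the form vanishes at \<open>D\<close> itself,
  and coercivity gives \<open>D = 0\<close>.\<close>

lemma coercive_equation_unique:
  assumes u: "u \<in> H1 UNIV" and v: "v \<in> H1 UNIV"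
    and eu: "\<And>\<phi>. test_fun UNIV \<phi> \<Longrightarrow>
     (LINT x|lebesgue. - a x * (\<Sum>i\<in>UNIV. wgrad UNIV u x $ i * partial i \<phi> x) + q x * u x * \<phi> x) = (LINT x|lebesgue. f x * \<phi> x)"
    and ev: "\<And>\<phi>. test_fun UNIV \<phi> \<Longrightarrow>
     (LINT x|lebesgue. - a x * (\<Sum>i\<in>UNIV. wgrad UNIV v x $ i * partial i \<phi> x) + q x * v x * \<phi> x) = (LINT x|lebesgue. f x * \<phi> x)"
  shows "AE x in lebesgue. v x = u x"
proof -
  define P where "P w = (\<lambda>x. (w x, wgrad UNIV w x))" for w :: "real^'n \<Rightarrow> complex"
  have H: "L2 lebesgue w \<and> weak_gradient UNIV w (wgrad UNIV w)" if w: "w \<in> H1 UNIV" for w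
  proof -
    have wL: "L2 lebesgue w" and ex: "\<exists>g. weak_gradient UNIV w g"
      using w by (simp_all add: H1_def lebesgue_on_UNIV_eq)
    have "weak_gradient UNIV w (wgrad UNIV w)" unfolding wgrad_def using ex by (rule someI_ex)
    with wL show ?thesis by simp
  qed
  have PH: "P w \<in> H1_pairs" if "w \<in> H1 UNIV" for w
    unfolding P_def H1_pairs_iff by (rule H[OF that])
  then have PL: "L2 lebesgue (P w)" if "w \<in> H1 UNIV" for w using that by (simp add: annihilator_def)
  have gL: "L2 lebesgue (wgrad UNIV w)" if "w \<in> H1 UNIV" for w
    using H[OF that] by (simp add: weak_gradient_def lebesgue_on_UNIV_eq)
  have zu: "(LINT x|lebesgue. (form x (P u x) - source x) \<bullet> jet \<phi> x) = 0" if "test_fun UNIV \<phi>" for \<phi>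
    using weak_eq_iff[OF conjunct1[OF H[OF u]] gL[OF u]] eu that unfolding weak_eq_def P_def by blast
  have zv: "(LINT x|lebesgue. (form x (P v x) - source x) \<bullet> jet \<phi> x) = 0" if "test_fun UNIV \<phi>" for \<phi>
    using weak_eq_iff[OF conjunct1[OF H[OF v]] gL[OF v]] ev that unfolding weak_eq_def P_def by blast
  define D where "D x = P v x - P u x" for x
  have DH: "D \<in> H1_pairs"
    using annihilator_lincomb[OF gradient_tests_L2 PH[OF v] PH[OF u], of 1 "-1"] by (simp add: D_def[abs_def])
  then have DL: "L2 lebesgue D" by (simp add: annihilator_def)
  have AD: "L2 lebesgue (\<lambda>x. form x (D x))" by (rule form_L2[OF DL])
  have D0: "(LINT x|lebesgue. form x (D x) \<bullet> jet \<phi> x) = 0" if \<phi>: "test_fun UNIV \<phi>" for \<phi>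
  proof -
    have jL: "L2 lebesgue (jet \<phi>)" using jet_in_H1_pairs[OF \<phi>] by (simp add: annihilator_def)
    have m: "integrable lebesgue (\<lambda>x. (form x (P w x) - source x) \<bullet> jet \<phi> x)" if "w \<in> H1 UNIV" for w
      by (intro L2_inner_integrable L2_diff form_L2 PL that source_L2 jL)
    have "(LINT x|lebesgue. form x (D x) \<bullet> jet \<phi> x) =
      (LINT x|lebesgue. (form x (P v x) - source x) \<bullet> jet \<phi> x - (form x (P u x) - source x) \<bullet> jet \<phi> x)"
      by (intro Bochner_Integration.integral_cong refl) (simp add: D_def linear_diff[OF form_linear] inner_diff_left)
    also have "\<dots> = 0" using m[OF u] m[OF v] zu[OF \<phi>] zv[OF \<phi>] by simp
    finally show ?thesis .
  qed
  have "\<exists>Z\<in>H1_pairs. \<forall>W\<in>H1_pairs. (LINT x|lebesgue. (form x (D x) - Z x) \<bullet> W x) = 0"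
    by (rule annihilator_projection[where T=gradient_tests, OF _ AD]) (rule gradient_tests_L2)
  then obtain Z where Z: "Z \<in> H1_pairs" "\<forall>W\<in>H1_pairs. (LINT x|lebesgue. (form x (D x) - Z x) \<bullet> W x) = 0"
    by (elim bexE)
  have ZL: "L2 lebesgue Z" using Z(1) by (simp add: annihilator_def)
  have ADZ: "(LINT x|lebesgue. form x (D x) \<bullet> W x) = (LINT x|lebesgue. Z x \<bullet> W x)" if W: "W \<in> H1_pairs" for W
  proof -
    have WL: "L2 lebesgue W" using W by (simp add: annihilator_def)
    show ?thesis using Z(2)[rule_format, OF W] L2_inner_integrable[OF AD WL] L2_inner_integrable[OF ZL WL]
      by (simp add: inner_diff_left)
  qed
  have "AE x in lebesgue. (fst (Z x), snd (Z x)) = 0"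
  proof (rule H1_pairs_orthogonal_to_tests)
    show "(\<lambda>x. (fst (Z x), snd (Z x))) \<in> H1_pairs" using Z(1) by simp
    show "(LINT x|lebesgue. (fst (Z x), snd (Z x)) \<bullet> jet \<phi> x) = 0" if \<phi>: "test_fun UNIV \<phi>" for \<phi>
      using ADZ[OF jet_in_H1_pairs[OF \<phi>]] D0[OF \<phi>] by simp
  qed
  then have "AE x in lebesgue. Z x \<bullet> D x = 0"
    unfolding prod.collapse by eventually_elim (simp only: inner_zero_left)
  then have "(LINT x|lebesgue. Z x \<bullet> D x) = 0" by (rule integral_eq_zero_AE)
  then have "(LINT x|lebesgue. form x (D x) \<bullet> D x) = 0" using ADZ[OF DH] by simp
  moreover have "(LINT x|lebesgue. k * (norm (D x))\<^sup>2) \<le> (LINT x|lebesgue. form x (D x) \<bullet> D x)"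
  proof (rule integral_mono_AE)
    show "integrable lebesgue (\<lambda>x. k * (norm (D x))\<^sup>2)" using DL by (simp add: L2_def)
    show "AE x in lebesgue. k * (norm (D x))\<^sup>2 \<le> form x (D x) \<bullet> D x"
      using form_coercive by eventually_elim (rule spec)
  qed (rule L2_inner_integrable[OF AD DL])
  ultimately have "(LINT x|lebesgue. (norm (D x))\<^sup>2) \<le> 0" using k by (simp add: mult_le_0_iff)
  with DL have "AE x in lebesgue. D x = 0" by (rule AE_eq_0_of_integral_norm_sq)
  then show ?thesis by eventually_elim (simp add: D_def P_def zero_prod_def)
qed

end

section \<open>The layered medium\<close>

lemma finite_positive_lower_bound:
  fixes r :: "'i \<Rightarrow> real"
  assumes "finite I" "\<And>i. i \<in> I \<Longrightarrow> r i > 0" shows "\<exists>c>0. \<forall>i\<in>I. c \<le> r i"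
  using assms
proof (induction I rule: finite_induct)
  case empty
  show ?case by (rule exI[of _ 1]) simp
next
  case (insert j I)
  then obtain c where "c > 0" "\<forall>i\<in>I. c \<le> r i" by auto
  then show ?case using insert.prems[of j] by (intro exI[of _ "min c (r j)"]) auto
qed

lemma finite_norm_bound: "finite I \<Longrightarrow> \<exists>B. \<forall>i\<in>I. norm (c i) \<le> (B::real)"
  by (rule exI[of _ "\<Sum>i\<in>I. norm (c i)"]) (auto intro: member_le_sum)

context
  fixes n :: nat and R :: "nat \<Rightarrow> real"
  assumes n: "n \<ge> 3" and R1: "0 < R 1" and R: "\<forall>i\<in>{1..<n - 1}. R i < R (i + 1)"
begin

private lemma radii_mono: "1 \<le> i \<Longrightarrow> i \<le> j \<Longrightarrow> j \<le> n - 1 \<Longrightarrow> R i \<le> R j"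
proof (induction j)
  case (Suc j)
  show ?case
  proof (cases "i = Suc j")
    case False
    then have "R i \<le> R j" using Suc by simp
    also have "R j \<le> R (Suc j)" using R[rule_format, of j] Suc False by auto
    finally show ?thesis .
  qed simp
qed simp

lemma piecewise_eq:
  fixes x :: "real^'n::finite"
  assumes x: "\<forall>i\<in>{1..n-1}. norm x \<noteq> R i"
  shows "\<exists>i\<in>{1..n}. \<forall>c. piecewise n R c x = c i"
proof -
  \<comment> \<open>The least index with this property is the layer of \<open>x\<close>;
    \<open>n\<close> always qualifies, as the unbounded layer has no outer radius.\<close>
  define Q where "Q i \<longleftrightarrow> i \<ge> 1 \<and> (i = n \<or> norm x < R i)" for i
  define i where "i = (LEAST i. Q i)"
  have "Q n" using n by (simp add: Q_def)
  then have Qi: "Q i" and i_le: "i \<le> n" unfolding i_def by (auto intro: LeastI Least_le)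
  have notQ: "\<not> Q j" if "j < i" for j using that not_less_Least unfolding i_def by blast
  have i1: "1 \<le> i" using Qi by (simp add: Q_def)
  have lower: "R j < norm x" if "1 \<le> j" "j < i" for j
  proof -
    have "j \<in> {1..n-1}" using that i_le by auto
    then have "norm x \<noteq> R j" using x by blast
    moreover have "\<not> norm x < R j" using notQ[OF that(2)] that(1) by (simp add: Q_def)
    ultimately show ?thesis by simp
  qed
  have upper: "norm x < R j" if "i \<le> j" "j \<le> n - 1" for j
  proof -
    have "i \<noteq> n" using that n by simp
    then have "norm x < R i" using Qi by (simp add: Q_def)
    then show ?thesis using radii_mono[OF i1 that] by simp
  qed
  have mem: "x \<in> layer n R j \<longleftrightarrow> j = i" if j: "j \<in> {1..n}" for j
  proof
    assume "j = i"
    then show "x \<in> layer n R j"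
      using n i1 i_le lower[of "i - 1"] upper[of i] by (auto simp: layer_def annulus_def)
  next
    assume xj: "x \<in> layer n R j"
    show "j = i"
    proof (rule linorder_cases[of j i])
      assume "j < i"
      then have "R j < norm x" using lower[of j] j by simp
      moreover have "norm x < R j" using xj \<open>j < i\<close> i_le by (auto simp: layer_def annulus_def split: if_splits)
      ultimately show ?thesis by simp
    next
      assume "i < j"
      then have "norm x < R (j - 1)" using upper[of "j - 1"] j by simp
      moreover have "R (j - 1) < norm x" using xj \<open>i < j\<close> i1 by (auto simp: layer_def annulus_def split: if_splits)
      ultimately show ?thesis by simp
    qed
  qed
  have "piecewise n R c x = c i" for c
  proof -
    have "piecewise n R c x = (\<Sum>j=1..n. if j = i then c j else 0)"
      unfolding piecewise_def by (intro sum.cong refl) (simp add: mem)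
    then show ?thesis using i1 i_le by simp
  qed
  then show ?thesis using i1 i_le by auto
qed

lemma AE_piecewise_eq:
  "AE x in (lebesgue :: (real^'n::finite) measure). \<exists>i\<in>{1..n}. \<forall>c. piecewise n R c x = c i"
proof -
  have "AE x in (lebesgue :: (real^'n) measure). norm x \<noteq> r" for r
  proof (rule AE_I')
    show "sphere (0::real^'n) r \<in> null_sets lebesgue" by (simp add: negligible_sphere flip: negligible_iff_null_sets)
  qed auto
  then have "AE x in (lebesgue :: (real^'n) measure). \<forall>i\<in>{1..n-1}. norm x \<noteq> R i"
    by (subst AE_ball_countable) auto
  then show ?thesis by eventually_elim (rule piecewise_eq)
qed

lemma piecewise_outer:
  fixes x :: "real^'n::finite"
  assumes "R (n - 1) < norm x" shows "piecewise n R c x = c n"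
proof -
  have "norm x \<noteq> R i" if "i \<in> {1..n-1}" for i using radii_mono[of i "n - 1"] that n assms by auto
  \<comment> \<open>\<open>piecewise_eq\<close> provides an index without saying which one. The
    coefficients that are 1 at \<open>n\<close> and 0 elsewhere identify it.\<close>
  moreover have False if "piecewise n R (\<lambda>j. if j = n then 1 else 0) x = 0"
  proof -
    have "x \<in> layer n R n" using assms n by (simp add: layer_def)
    then have "1 \<le> (\<Sum>j=1..n. if x \<in> layer n R j then (if j = n then 1 else 0) else (0::real))"
      using n by (intro order_trans[OF _ member_le_sum[of n]]) auto
    moreover have "complex_of_real (\<Sum>j=1..n. if x \<in> layer n R j then (if j = n then 1 else 0) else 0)
        = piecewise n R (\<lambda>j. if j = n then 1 else 0) x"
      unfolding piecewise_def of_real_sum by (intro sum.cong refl) auto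
    ultimately show False using that by (metis not_one_le_zero of_real_eq_0_iff)
  qed
  ultimately obtain i where "i \<in> {1..n}" "\<And>c. piecewise n R c x = c i" using piecewise_eq[of x] by blast
  moreover from this have "i = n" using \<open>piecewise n R (\<lambda>j. if j = n then 1 else 0) x = 0 \<Longrightarrow> False\<close> by (cases "i = n") simp_all
  ultimately show ?thesis by simp
qed

lemma piecewise_measurable: "(piecewise n R c :: real^'n::finite \<Rightarrow> complex) \<in> borel_measurable lebesgue"
proof -
  have "open (layer n R i :: (real^'n) set)" for i
  proof -
    have "open {x::real^'n. norm x < r}" "open {x::real^'n. norm x > r}" for r
      by (intro open_Collect_less continuous_intros)+
    moreover have "annulus r s = {x::real^'n. norm x > r} \<inter> {x. norm x < s}" for r s by (auto simp: annulus_def)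
    ultimately show ?thesis unfolding layer_def by (auto intro: open_Int)
  qed
  then have "layer n R i \<in> sets (lebesgue :: (real^'n) measure)" for i by (simp add: borel_open)
  then show ?thesis
    unfolding piecewise_def[abs_def] by (intro borel_measurable_sum measurable_If_set borel_measurable_const) auto
qed

text \<open>For \<open>\<alpha> = 1 + \<i> t\<close> one has
  \<open>Re (\<alpha> * z) = Re z - t * Im z\<close>. In odd layers \<open>1 / \<epsilon>\<close> is
  real and positive, so \<open>t\<close> has no effect; in even layers
  \<open>1 / (\<epsilon> + \<i> \<tau>)\<close> has negative imaginary part; the zeroth order
  coefficient contributes \<open>\<sigma> * t\<close>. All of these finitely many quantities are
  therefore positive for large \<open>t\<close>.\<close>

lemma coercivity_constants:
  fixes \<epsilon> \<mu> :: "nat \<Rightarrow> real" and \<sigma> \<omega> :: real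
  assumes odd: "\<forall>i\<in>{1..n}. odd i \<longrightarrow> \<epsilon> i > 0" and even: "\<forall>i\<in>{1..n}. even i \<longrightarrow> \<epsilon> i < 0"
    and \<sigma>: "\<sigma> > 0" and \<omega>: "\<omega> > 0"
  shows "\<exists>\<alpha> k. k > 0 \<and> \<alpha> \<noteq> 0 \<and> (\<forall>i\<in>{1..n}. k \<le> Re (\<alpha> * inverse (eps_sigma \<epsilon> \<sigma> \<omega> i)) \<and>
      k \<le> Re (- \<alpha> * (of_real (\<omega>\<^sup>2) * of_real (\<mu> i) + \<i> * of_real \<sigma>)))"
proof -
  define A where "A t i = Re (Complex 1 t * inverse (eps_sigma \<epsilon> \<sigma> \<omega> i))" for t i
  define B where "B t i = Re (- Complex 1 t * (of_real (\<omega>\<^sup>2) * of_real (\<mu> i) + \<i> * of_real \<sigma>))" for t i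
  have "\<forall>\<^sub>F t in at_top. A t i > 0 \<and> B t i > 0" if i: "i \<in> {1..n}" for i
  proof (rule eventually_conj)
    have "B t i = \<sigma> * t - \<omega>\<^sup>2 * \<mu> i" for t unfolding B_def by (simp add: algebra_simps)
    moreover have "\<forall>\<^sub>F t in at_top. \<sigma> * t - \<omega>\<^sup>2 * \<mu> i > 0" using \<sigma> by real_asymp
    ultimately show "\<forall>\<^sub>F t in at_top. B t i > 0" by simp
    show "\<forall>\<^sub>F t in at_top. A t i > 0"
    proof (cases "odd i")
      case True
      then have "A t i = inverse (\<epsilon> i)" for t
        unfolding A_def eps_sigma_def by (simp flip: of_real_inverse)
      moreover have "\<epsilon> i > 0" using odd i True by blast
      ultimately show ?thesis by simp
    next
      case False
      define \<tau> where "\<tau> = \<sigma> / \<omega>"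
      have \<tau>: "\<tau> > 0" using \<sigma> \<omega> by (simp add: \<tau>_def)
      have e: "eps_sigma \<epsilon> \<sigma> \<omega> i = Complex (\<epsilon> i) \<tau>"
        using False by (simp add: eps_sigma_def \<tau>_def complex_eq_iff)
      have "A t i = (\<epsilon> i + t * \<tau>) / ((\<epsilon> i)\<^sup>2 + \<tau>\<^sup>2)" for t
        unfolding A_def e by (simp add: complex_inverse add_divide_distrib)
      moreover have "\<forall>\<^sub>F t in at_top. (\<epsilon> i + t * \<tau>) / ((\<epsilon> i)\<^sup>2 + \<tau>\<^sup>2) > 0"
      proof -
        have d: "(\<epsilon> i)\<^sup>2 + \<tau>\<^sup>2 > 0" using \<tau> by (simp add: add_nonneg_pos)
        have "\<forall>\<^sub>F t in at_top. \<epsilon> i + t * \<tau> > 0" using \<tau> by real_asymp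
        then show ?thesis by eventually_elim (use d in simp)
      qed
      ultimately show ?thesis by simp
    qed
  qed
  then have "\<forall>\<^sub>F t in at_top. \<forall>i\<in>{1..n}. A t i > 0 \<and> B t i > 0"
    by (intro eventually_ball_finite) auto
  then obtain t where t: "\<forall>i\<in>{1..n}. A t i > 0 \<and> B t i > 0"
    by (auto simp: eventually_at_top_linorder)
  obtain k where "k > 0" "\<forall>i\<in>{1..n}. k \<le> min (A t i) (B t i)"
    using finite_positive_lower_bound[of "{1..n}" "\<lambda>i. min (A t i) (B t i)"] t by auto
  moreover have "Complex 1 t \<noteq> 0" by (simp add: complex_eq_iff)
  ultimately show ?thesis unfolding A_def B_def by (intro exI[of _ "Complex 1 t"] exI[of _ k]) auto
qed

text \<open>Off the interfaces, which have measure zero, the coefficients take finitely many values,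
  so bounds that hold in each layer are bounds almost everywhere.\<close>

lemma transmission_problem_well_posed:
  fixes \<epsilon> \<mu> :: "nat \<Rightarrow> real" and \<sigma> \<omega> :: real and f :: "real^'n::finite \<Rightarrow> complex"
  assumes odd: "\<forall>i\<in>{1..n}. odd i \<longrightarrow> \<epsilon> i > 0" and even: "\<forall>i\<in>{1..n}. even i \<longrightarrow> \<epsilon> i < 0"
    and \<sigma>: "\<sigma> > 0" and \<omega>: "\<omega> > 0" and f: "L2 lebesgue f"
  shows "\<exists>u\<in>H1 UNIV. weak_solution n R \<epsilon> \<mu> \<sigma> \<omega> f u"
    and "u \<in> H1 UNIV \<Longrightarrow> weak_solution n R \<epsilon> \<mu> \<sigma> \<omega> f u \<Longrightarrow>
      v \<in> H1 UNIV \<Longrightarrow> weak_solution n R \<epsilon> \<mu> \<sigma> \<omega> f v \<Longrightarrow> AE x in lebesgue. v x = u x"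
proof -
  obtain \<alpha> k where k: "k > 0" "\<alpha> \<noteq> 0"
    "\<forall>i\<in>{1..n}. k \<le> Re (\<alpha> * inverse (eps_sigma \<epsilon> \<sigma> \<omega> i)) \<and>
      k \<le> Re (- \<alpha> * (of_real (\<omega>\<^sup>2) * of_real (\<mu> i) + \<i> * of_real \<sigma>))"
    using coercivity_constants[OF odd even \<sigma> \<omega>, of \<mu>] by blast
  define a :: "real^'n \<Rightarrow> complex" where "a x = inverse (piecewise n R (eps_sigma \<epsilon> \<sigma> \<omega>) x)" for x
  define q :: "real^'n \<Rightarrow> complex"
    where "q x = of_real (\<omega>\<^sup>2) * piecewise n R (\<lambda>i. of_real (\<mu> i)) x + \<i> * of_real \<sigma>" for x
  have am: "a \<in> borel_measurable lebesgue"
    unfolding a_def by (intro borel_measurable_inverse piecewise_measurable)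
  have qm: "q \<in> borel_measurable lebesgue"
    unfolding q_def by (intro borel_measurable_add borel_measurable_times borel_measurable_const piecewise_measurable)
  have ex: "AE x in lebesgue. \<exists>i\<in>{1..n}. a x = inverse (eps_sigma \<epsilon> \<sigma> \<omega> i) \<and>
      q x = of_real (\<omega>\<^sup>2) * of_real (\<mu> i) + \<i> * of_real \<sigma>"
    using AE_piecewise_eq by eventually_elim (auto simp: a_def q_def)
  obtain B1 where B1: "\<forall>i\<in>{1..n}. norm (inverse (eps_sigma \<epsilon> \<sigma> \<omega> i)) \<le> B1"
    using finite_norm_bound[of "{1..n}" "\<lambda>i. inverse (eps_sigma \<epsilon> \<sigma> \<omega> i)"] by blast
  obtain B2 where B2: "\<forall>i\<in>{1..n}. norm (of_real (\<omega>\<^sup>2) * of_real (\<mu> i) + \<i> * of_real \<sigma> :: complex) \<le> B2"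
    using finite_norm_bound[of "{1..n}" "\<lambda>i. of_real (\<omega>\<^sup>2) * of_real (\<mu> i) + \<i> * of_real \<sigma> :: complex"] by blast
  have ab: "AE x in lebesgue. norm (a x) \<le> max B1 B2"
    using ex by eventually_elim (use B1 in \<open>auto simp: le_max_iff_disj\<close>)
  have qb: "AE x in lebesgue. norm (q x) \<le> max B1 B2"
    using ex by eventually_elim (use B2 in \<open>auto simp: le_max_iff_disj\<close>)
  have ac: "AE x in lebesgue. k \<le> Re (\<alpha> * a x)"
    using ex by eventually_elim (use k(3) in \<open>auto simp del: times_complex.sel\<close>)
  have qc: "AE x in lebesgue. k \<le> Re (- \<alpha> * q x)"
    using ex by eventually_elim (use k(3) in \<open>auto simp del: times_complex.sel\<close>)
  have ws: "weak_solution n R \<epsilon> \<mu> \<sigma> \<omega> f u \<longleftrightarrow> (\<forall>\<phi>. test_fun UNIV \<phi> \<longrightarrow>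
     (LINT x|lebesgue. - a x * (\<Sum>i\<in>UNIV. wgrad UNIV u x $ i * partial i \<phi> x) + q x * u x * \<phi> x) = (LINT x|lebesgue. f x * \<phi> x))" for u
    by (simp only: weak_solution_def a_def q_def)
  show "\<exists>u\<in>H1 UNIV. weak_solution n R \<epsilon> \<mu> \<sigma> \<omega> f u"
    unfolding ws by (rule coercive_equation_exists[OF am qm ab qb k(2,1) ac qc f])
  show "AE x in lebesgue. v x = u x" if "u \<in> H1 UNIV" "weak_solution n R \<epsilon> \<mu> \<sigma> \<omega> f u"
      "v \<in> H1 UNIV" "weak_solution n R \<epsilon> \<mu> \<sigma> \<omega> f v"
    by (rule coercive_equation_unique[OF am qm ab qb k(2,1) ac qc f that(1,3)])
      (use that(2,4) in \<open>simp_all only: ws\<close>)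
qed

end

section \<open>Hankel functions in the upper half plane\<close>

section \<open>The Mehler--Sommerfeld integral\<close>

lemma set_integrable_exp_atLeast:
  fixes a c :: real
  assumes "a > 0" shows "set_integrable lborel {c..} (\<lambda>x. exp (- a * x))"
proof -
  have "(\<lambda>x. exp (- a * x)) absolutely_integrable_on {c..}"
    using assms by (intro nonnegative_absolutely_integrable_1 integrable_on_exp_minus_to_infinity) auto
  then have "integrable lebesgue (\<lambda>x. indicator {c..} x *\<^sub>R exp (- a * x))" by (simp add: set_integrable_def)
  then show ?thesis unfolding set_integrable_def by (subst (asm) integrable_completion) auto
qed

lemma integrable_exp_minus_abs: "integrable lborel (\<lambda>t::real. exp (- \<bar>t\<bar>))"
proof -
  define g where "g t = indicator {0..} t *\<^sub>R exp (- 1 * t)" for t :: real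
  have g: "integrable lborel g" unfolding g_def[abs_def] using set_integrable_exp_atLeast[of 1 0] by (simp add: set_integrable_def)
  have "integrable lborel (\<lambda>t. g (0 + (-1) * t))" by (rule lborel_integrable_real_affine[OF g]) simp
  then have s: "integrable lborel (\<lambda>t. g t + g (- t))" using g by simp
  show ?thesis
    by (rule Bochner_Integration.integrable_bound[OF s])
      (auto simp: g_def indicator_def)
qed

lemma cosh_lower_bound: "t\<^sup>2 / 4 \<le> cosh (t::real)"
proof -
  have "\<bar>t\<bar>\<^sup>2 / 4 \<le> cosh \<bar>t\<bar>"
  proof -
    have "1 + \<bar>t\<bar> + \<bar>t\<bar>\<^sup>2 / 2 \<le> exp \<bar>t\<bar>" by (rule exp_lower_Taylor_quadratic) simp
    moreover have "1 + (- \<bar>t\<bar>) \<le> exp (- \<bar>t\<bar>)" by (rule exp_ge_add_one_self)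
    moreover have "cosh \<bar>t\<bar> = (exp \<bar>t\<bar> + exp (- \<bar>t\<bar>)) / 2" by (rule cosh_field_def)
    ultimately have "\<bar>t\<bar>\<^sup>2 / 4 * 2 + 2 \<le> cosh \<bar>t\<bar> * 2" by simp
    then show ?thesis by simp
  qed
  then show ?thesis by (simp add: cosh_real_abs)
qed

text \<open>From \<open>cosh t \<ge> t\<^sup>2 / 4\<close> and the square
  \<open>(b * \<bar>t\<bar> / 2 - (c + 1))\<^sup>2 \<ge> 0\<close>. Working with
  \<open>c + 1\<close> instead of \<open>c\<close> leaves the integrable factor
  \<open>exp (- \<bar>t\<bar>)\<close>.\<close>

lemma exp_cosh_bound:
  fixes b c t :: real
  assumes b: "b > 0"
  shows "exp (c * \<bar>t\<bar> - b * cosh t) \<le> exp ((c + 1)\<^sup>2 / b) * exp (- \<bar>t\<bar>)"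
proof -
  have "0 \<le> (b * \<bar>t\<bar> / 2 - (c + 1))\<^sup>2" by simp
  also have "\<dots> = b * (b * (t\<^sup>2 / 4) - (c + 1) * \<bar>t\<bar> + (c + 1)\<^sup>2 / b)"
    using b by (simp add: power2_diff power_mult_distrib power_divide power2_eq_square[of b] algebra_simps)
  finally have "(c + 1) * \<bar>t\<bar> \<le> b * (t\<^sup>2 / 4) + (c + 1)\<^sup>2 / b"
    using b by (simp add: zero_le_mult_iff)
  also have "\<dots> \<le> b * cosh t + (c + 1)\<^sup>2 / b"
    using b cosh_lower_bound[of t] by simp
  finally show ?thesis by (simp add: algebra_simps flip: exp_add)
qed

lemma cosh_le_exp_abs: "cosh t \<le> exp \<bar>t::real\<bar>"
proof -
  have "(exp t + exp (- t)) / 2 \<le> (exp \<bar>t\<bar> + exp \<bar>t\<bar>) / 2"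
    by (intro divide_right_mono add_mono) auto
  then show ?thesis unfolding cosh_field_def by simp
qed

lemma abs_sinh_le_exp_abs: "\<bar>sinh t\<bar> \<le> exp \<bar>t::real\<bar>"
proof -
  have "\<bar>sinh t\<bar> \<le> cosh t" using sinh_less_cosh_real[of t] sinh_less_cosh_real[of "- t"] by auto
  then show ?thesis using cosh_le_exp_abs[of t] by linarith
qed

definition ms_kernel :: "real \<Rightarrow> complex \<Rightarrow> real \<Rightarrow> complex" where
  "ms_kernel \<nu> z t = exp (\<i> * z * of_real (cosh t) - of_real (\<nu> * t))"

text \<open>\<open>hankel1\<close> without its prefactor, which for each order is a nonzero
  constant; derivative and recurrences can be read off from this integral directly.\<close>

definition ms_integral :: "real \<Rightarrow> complex \<Rightarrow> complex" where
  "ms_integral \<nu> z = (LINT t|lborel. ms_kernel \<nu> z t)"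

lemma norm_ms_kernel: "norm (ms_kernel \<nu> z t) = exp (- (\<nu> * t) - Im z * cosh t)"
  by (simp add: ms_kernel_def norm_exp_eq_Re)

lemma norm_ms_kernel_le: 
  assumes "b \<le> Im z" shows "norm (ms_kernel \<nu> z t) \<le> exp (\<bar>\<nu>\<bar> * \<bar>t\<bar> - b * cosh t)"
proof -
  have "- (\<nu> * t) \<le> \<bar>\<nu>\<bar> * \<bar>t\<bar>" by (metis abs_ge_minus_self abs_mult)
  moreover have "b * cosh t \<le> Im z * cosh t" using assms by (intro mult_right_mono) auto
  ultimately show ?thesis unfolding norm_ms_kernel exp_le_cancel_iff by linarith
qed

lemma ms_kernel_continuous: "continuous_on UNIV (ms_kernel \<nu> z)"
  unfolding ms_kernel_def by (intro continuous_intros)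

lemma ms_kernel_measurable [measurable]: "ms_kernel \<nu> z \<in> borel_measurable borel"
  by (rule borel_measurable_continuous_onI[OF ms_kernel_continuous])

lemma integrable_exp_cosh:
  fixes b c :: real assumes "b > 0" shows "integrable lborel (\<lambda>t. exp (c * \<bar>t\<bar> - b * cosh t))"
proof (rule Bochner_Integration.integrable_bound)
  show "integrable lborel (\<lambda>t. exp ((c + 1)\<^sup>2 / b) * exp (- \<bar>t\<bar>))"
    by (intro integrable_mult_right integrable_exp_minus_abs)
  show "AE t in lborel. norm (exp (c * \<bar>t\<bar> - b * cosh t)) \<le> norm (exp ((c + 1)\<^sup>2 / b) * exp (- \<bar>t\<bar>))"
    by (intro always_eventually allI) (simp only: real_norm_def abs_mult abs_exp_cancel exp_cosh_bound[OF assms])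
  have "continuous_on UNIV (\<lambda>t::real. exp (c * \<bar>t\<bar> - b * cosh t))" by (intro continuous_intros)
  then show "(\<lambda>t. exp (c * \<bar>t\<bar> - b * cosh t)) \<in> borel_measurable lborel"
    by (simp add: borel_measurable_continuous_onI)
qed

lemma integrable_ms_kernel_mult:
  assumes z: "Im z > 0" and h: "continuous_on UNIV h" "\<And>t. norm (h t) \<le> K * exp \<bar>t\<bar>"
  shows "integrable lborel (\<lambda>t. h t * ms_kernel \<nu> z t)"
proof (rule Bochner_Integration.integrable_bound)
  show "integrable lborel (\<lambda>t. K * exp ((\<bar>\<nu>\<bar> + 1) * \<bar>t\<bar> - Im z * cosh t))"
    by (intro integrable_mult_right integrable_exp_cosh z)
  show "AE t in lborel. norm (h t * ms_kernel \<nu> z t) \<le> norm (K * exp ((\<bar>\<nu>\<bar> + 1) * \<bar>t\<bar> - Im z * cosh t))"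
  proof (intro always_eventually allI)
    fix t
    have "norm (h t * ms_kernel \<nu> z t) \<le> (K * exp \<bar>t\<bar>) * exp (\<bar>\<nu>\<bar> * \<bar>t\<bar> - Im z * cosh t)"
      unfolding norm_mult
      by (intro mult_mono h(2) norm_ms_kernel_le order_refl norm_ge_zero order_trans[OF norm_ge_zero h(2)])
    also have "\<dots> = K * exp ((\<bar>\<nu>\<bar> + 1) * \<bar>t\<bar> - Im z * cosh t)"
      by (simp add: exp_diff exp_add distrib_right)
    finally show "norm (h t * ms_kernel \<nu> z t) \<le> norm (K * exp ((\<bar>\<nu>\<bar> + 1) * \<bar>t\<bar> - Im z * cosh t))" by simp
  qed
  show "(\<lambda>t. h t * ms_kernel \<nu> z t) \<in> borel_measurable lborel"
    using borel_measurable_continuous_onI[OF h(1)] by measurable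
qed

lemma integrable_ms_kernel:
  assumes "Im z > 0" shows "integrable lborel (ms_kernel \<nu> z)"
  using integrable_ms_kernel_mult[OF assms, of "\<lambda>t. 1" 1 \<nu>] by simp

lemma continuous_of_real_cosh: "continuous_on UNIV (\<lambda>t. complex_of_real (cosh t))"
    "continuous_on UNIV (\<lambda>t. complex_of_real (sinh t))"
  by (intro continuous_intros)+

lemma integrable_cosh_ms_kernel:
  assumes "Im z > 0"
  shows "integrable lborel (\<lambda>t. of_real (cosh t) * ms_kernel \<nu> z t)"
    "integrable lborel (\<lambda>t. of_real (sinh t) * ms_kernel \<nu> z t)"
  by (rule integrable_ms_kernel_mult[OF assms continuous_of_real_cosh(1), of 1],
      simp add: cosh_le_exp_abs,
      rule integrable_ms_kernel_mult[OF assms continuous_of_real_cosh(2), of 1],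
      simp add: abs_sinh_le_exp_abs)

lemma ms_integral_deriv:
  assumes z: "Im z > 0"
  shows "(ms_integral \<nu> has_field_derivative \<i> * (LINT t|lborel. of_real (cosh t) * ms_kernel \<nu> z t)) (at z)"
proof -
  \<comment> \<open>On the ball of radius \<open>Im z / 2\<close> the imaginary part stays at least
    \<open>d\<close>, so a single majorant serves all its points.\<close>
  define d where "d = Im z / 2"
  have d: "d > 0" using z by (simp add: d_def)
  have ball: "d \<le> Im w" if "w \<in> ball z d" for w
  proof -
    have "\<bar>Im (z - w)\<bar> \<le> norm (z - w)" by (rule abs_Im_le_cmod)
    then show ?thesis using that unfolding d_def by (simp add: dist_norm)
  qed
  have "((\<lambda>z. LINT t|lborel. ms_kernel \<nu> z t) has_derivative
      (\<lambda>h. LINT t|lborel. \<i> * of_real (cosh t) * ms_kernel \<nu> z t * h)) (at z)"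
  proof (rule has_derivative_integral[OF d, where w="\<lambda>t. exp ((\<bar>\<nu>\<bar> + 1) * \<bar>t\<bar> - d * cosh t)"])
    show "integrable lborel (ms_kernel \<nu> w)" if "w \<in> ball z d" for w
      using integrable_ms_kernel[of w] ball[OF that] d by simp
    show "((\<lambda>z. ms_kernel \<nu> z t) has_derivative (\<lambda>h. \<i> * of_real (cosh t) * ms_kernel \<nu> w t * h)) (at w)" for w t
    proof -
      have "((\<lambda>z. ms_kernel \<nu> z t) has_field_derivative \<i> * of_real (cosh t) * ms_kernel \<nu> w t) (at w)"
        unfolding ms_kernel_def by (auto intro!: derivative_eq_intros)
      then show ?thesis by (simp add: has_field_derivative_def)
    qed
    show "norm (\<i> * of_real (cosh t) * ms_kernel \<nu> w t * h) \<le> exp ((\<bar>\<nu>\<bar> + 1) * \<bar>t\<bar> - d * cosh t) * norm h"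
      if "w \<in> ball z d" for w t h
    proof -
      have "norm (\<i> * of_real (cosh t) * ms_kernel \<nu> w t) \<le> exp \<bar>t\<bar> * exp (\<bar>\<nu>\<bar> * \<bar>t\<bar> - d * cosh t)"
        using norm_ms_kernel_le[OF ball[OF that], of \<nu> t] cosh_le_exp_abs[of t]
        by (simp add: norm_mult mult_mono)
      also have "\<dots> = exp ((\<bar>\<nu>\<bar> + 1) * \<bar>t\<bar> - d * cosh t)"
        by (simp add: algebra_simps flip: exp_add)
      finally show ?thesis unfolding norm_mult[of _ h] by (rule mult_right_mono) simp
    qed
    show "integrable lborel (\<lambda>t. exp ((\<bar>\<nu>\<bar> + 1) * \<bar>t\<bar> - d * cosh t))" by (rule integrable_exp_cosh[OF d])
    show "(\<lambda>t. \<i> * of_real (cosh t) * ms_kernel \<nu> z t * h) \<in> borel_measurable lborel" for h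
      using borel_measurable_continuous_onI[OF continuous_of_real_cosh(1)] by measurable
  qed simp
  moreover have "(LINT t|lborel. \<i> * of_real (cosh t) * ms_kernel \<nu> z t * h) = \<i> * (LINT t|lborel. of_real (cosh t) * ms_kernel \<nu> z t) * h" for h
  proof -
    have "\<i> * of_real (cosh t) * ms_kernel \<nu> z t * h = (\<i> * (of_real (cosh t) * ms_kernel \<nu> z t)) * h" for t
      by (simp only: mult.assoc)
    then show ?thesis by (simp only: integral_mult_left_zero integral_mult_right_zero)
  qed
  ultimately show ?thesis
    unfolding has_field_derivative_def ms_integral_def[abs_def] by (simp only:)
qed

text \<open>The \<open>t\<close>-derivative of the kernel is
  \<open>\<i> * z * sinh t - \<nu>\<close> times the kernel, and it integrates to zero because
  \<open>Im z > 0\<close> makes the kernel vanish at both ends.\<close>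

lemma ms_integral_by_parts:
  assumes z: "Im z > 0"
  shows "\<i> * z * (LINT t|lborel. of_real (sinh t) * ms_kernel \<nu> z t) = of_real \<nu> * ms_integral \<nu> z"
proof -
  let ?D = "\<lambda>t. \<i> * z * (of_real (sinh t) * ms_kernel \<nu> z t) - of_real \<nu> * ms_kernel \<nu> z t"
  have int: "integrable lborel ?D"
    by (intro Bochner_Integration.integrable_diff integrable_mult_right integrable_cosh_ms_kernel integrable_ms_kernel z)
  have lim: "((\<lambda>t. ms_kernel \<nu> z t) \<longlongrightarrow> 0) F" if F: "((\<lambda>t. exp (- \<bar>t::real\<bar>)) \<longlongrightarrow> 0) F" for F
  proof (rule tendsto_norm_zero_cancel, rule tendsto_sandwich[OF _ _ tendsto_const])
    have "norm (ms_kernel \<nu> z t) \<le> exp ((\<bar>\<nu>\<bar> + 1)\<^sup>2 / Im z) * exp (- \<bar>t\<bar>)" for t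
      using norm_ms_kernel_le[of "Im z" z \<nu> t] exp_cosh_bound[OF z, of "\<bar>\<nu>\<bar>" t] by simp
    then show "\<forall>\<^sub>F t in F. norm (ms_kernel \<nu> z t) \<le> exp ((\<bar>\<nu>\<bar> + 1)\<^sup>2 / Im z) * exp (- \<bar>t\<bar>)"
      by simp
    show "((\<lambda>t. exp ((\<bar>\<nu>\<bar> + 1)\<^sup>2 / Im z) * exp (- \<bar>t\<bar>)) \<longlongrightarrow> 0) F"
      using tendsto_mult_right_zero[OF F] .
  qed auto
  have "(LBINT t=-\<infinity>..\<infinity>. ?D t) = 0 - 0"
  proof (rule interval_integral_FTC_integrable)
    have "((\<lambda>t. ms_kernel \<nu> z t) has_vector_derivative ?D t) (at t)" for t
      unfolding ms_kernel_def
      by (rule has_vector_derivative_eq_rhs[OF field_vector_diff_chain_at[OF _ DERIV_exp, unfolded o_def]])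
        (auto intro!: derivative_eq_intros simp: algebra_simps)
    then show "(ms_kernel \<nu> z has_vector_derivative ?D t) (at t)" for t by simp
    have "continuous_on UNIV ?D" by (intro continuous_intros ms_kernel_continuous)
    then show "isCont ?D t" for t by (simp add: continuous_on_eq_continuous_at)
    show "set_integrable lborel (einterval (-\<infinity>) \<infinity>) ?D"
      using int by (simp add: set_integrable_def)
    have "((\<lambda>t::real. exp (- \<bar>t\<bar>)) \<longlongrightarrow> 0) at_bot" "((\<lambda>t::real. exp (- \<bar>t\<bar>)) \<longlongrightarrow> 0) at_top"
      by real_asymp+
    then show "((ms_kernel \<nu> z \<circ> real_of_ereal) \<longlongrightarrow> 0) (at_right (-\<infinity>))"
      "((ms_kernel \<nu> z \<circ> real_of_ereal) \<longlongrightarrow> 0) (at_left \<infinity>)"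
      using lim[of at_bot] lim[of at_top]
      unfolding ereal_tendsto_simps by auto
  qed simp
  then have "(LINT t|lborel. ?D t) = 0"
    by (simp add: interval_lebesgue_integral_def einterval_def set_lebesgue_integral_def)
  also have "(LINT t|lborel. ?D t) = \<i> * z * (LINT t|lborel. of_real (sinh t) * ms_kernel \<nu> z t) - of_real \<nu> * (LINT t|lborel. ms_kernel \<nu> z t)"
    using integrable_cosh_ms_kernel(2)[OF z, of \<nu>] integrable_ms_kernel[OF z, of \<nu>] by simp
  finally show ?thesis by (simp add: ms_integral_def)
qed

lemma ms_kernel_shift:
  "of_real (exp (- t)) * ms_kernel \<nu> z t = ms_kernel (\<nu> + 1) z t"
  "of_real (exp t) * ms_kernel \<nu> z t = ms_kernel (\<nu> - 1) z t"
  unfolding ms_kernel_def exp_of_real[symmetric] mult_exp_exp by (simp_all add: algebra_simps)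

text \<open>Both come from \<open>cosh t = exp (- t) + sinh t = exp t - sinh t\<close>: an
  exponential factor shifts the order by one, and integration by parts evaluates the
  \<open>sinh\<close> term. They are the raising and lowering relations of the Hankel functions,
  written without the prefactor.\<close>

lemma ms_integral_recurrence:
  assumes z: "Im z > 0"
  shows "(ms_integral \<nu> has_field_derivative \<i> * ms_integral (\<nu> + 1) z + of_real \<nu> / z * ms_integral \<nu> z) (at z)"
    and "(ms_integral \<nu> has_field_derivative \<i> * ms_integral (\<nu> - 1) z - of_real \<nu> / z * ms_integral \<nu> z) (at z)"
proof -
  have z0: "z \<noteq> 0" using z by auto
  let ?S = "LINT t|lborel. of_real (sinh t) * ms_kernel \<nu> z t"
  have S: "\<i> * ?S = of_real \<nu> / z * ms_integral \<nu> z"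
    using ms_integral_by_parts[OF z, of \<nu>] z0 by (simp add: field_simps)
  have "of_real (cosh t) * ms_kernel \<nu> z t = ms_kernel (\<nu> + 1) z t + of_real (sinh t) * ms_kernel \<nu> z t" for t
    unfolding ms_kernel_shift(1)[symmetric] distrib_right[symmetric] of_real_add[symmetric]
    by (simp add: cosh_field_def sinh_field_def field_simps)
  then have "(LINT t|lborel. of_real (cosh t) * ms_kernel \<nu> z t) = ms_integral (\<nu> + 1) z + ?S"
    using integrable_cosh_ms_kernel(2)[OF z, of \<nu>] integrable_ms_kernel[OF z, of "\<nu> + 1"] by (simp add: ms_integral_def)
  then show "(ms_integral \<nu> has_field_derivative \<i> * ms_integral (\<nu> + 1) z + of_real \<nu> / z * ms_integral \<nu> z) (at z)"
    using ms_integral_deriv[OF z, of \<nu>] by (simp add: distrib_left S)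
  have "of_real (cosh t) * ms_kernel \<nu> z t = ms_kernel (\<nu> - 1) z t - of_real (sinh t) * ms_kernel \<nu> z t" for t
    unfolding ms_kernel_shift(2)[symmetric] left_diff_distrib[symmetric] of_real_diff[symmetric]
    by (simp add: cosh_field_def sinh_field_def field_simps)
  then have "(LINT t|lborel. of_real (cosh t) * ms_kernel \<nu> z t) = ms_integral (\<nu> - 1) z - ?S"
    using integrable_cosh_ms_kernel(2)[OF z, of \<nu>] integrable_ms_kernel[OF z, of "\<nu> - 1"] by (simp add: ms_integral_def)
  then show "(ms_integral \<nu> has_field_derivative \<i> * ms_integral (\<nu> - 1) z - of_real \<nu> / z * ms_integral \<nu> z) (at z)"
    using ms_integral_deriv[OF z, of \<nu>] by (simp add: right_diff_distrib S)
qed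

text \<open>At \<open>\<i>\<close> the integrand is the positive function
  \<open>exp (- \<nu> * t - cosh t)\<close>, and the integral is twice the modified Bessel function
  of the second kind at 1. A lower bound on the unit interval is enough.\<close>

lemma ms_integral_i_neq_0: "ms_integral \<nu> \<i> \<noteq> 0"
proof
  assume z: "ms_integral \<nu> \<i> = 0"
  define h where "h t = exp (- (\<nu> * t) - cosh t)" for t :: real
  have k: "ms_kernel \<nu> \<i> t = of_real (h t)" for t
    by (simp add: ms_kernel_def h_def exp_of_real[symmetric]) (rule arg_cong[where f=exp], simp)
  have ih: "integrable lborel h"
  proof -
    have "integrable lborel (\<lambda>t. complex_of_real (h t))"
      using integrable_ms_kernel[of \<i> \<nu>] unfolding k[symmetric] by simp
    then show ?thesis by (simp only: complex_of_real_integrable_eq)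
  qed
  have "(LINT t|lborel. exp (- \<bar>\<nu>\<bar> - cosh 1) * indicator {0..1::real} t) \<le> (LINT t|lborel. h t)"
  proof (rule integral_mono[OF _ ih])
    show "integrable lborel (\<lambda>t. exp (- \<bar>\<nu>\<bar> - cosh 1) * indicator {0..1::real} t)" by simp
    show "exp (- \<bar>\<nu>\<bar> - cosh 1) * indicator {0..1} t \<le> h t" for t
    proof (cases "t \<in> {0..1}")
      case True
      then have "\<nu> * t \<le> \<bar>\<nu>\<bar>"
        by (metis abs_ge_self abs_ge_zero abs_mult abs_of_nonneg atLeastAtMost_iff mult_left_le order_trans)
      moreover have "cosh t \<le> cosh 1" using True by (simp add: cosh_real_nonneg_le_iff)
      ultimately show ?thesis using True by (simp add: h_def)
    qed (simp add: h_def)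
  qed
  also have "(LINT t|lborel. h t) = 0"
    using z unfolding ms_integral_def k by simp
  finally show False by (simp add: not_le)
qed

text \<open>Vanishing along the ray would spread to the whole upper half plane by the identity
  theorem and contradict the value at \<open>\<i>\<close>. The point found here allows the constant
  of proportionality between decaying solutions to be computed by division.\<close>

lemma ms_integral_ray_nonzero:
  assumes \<kappa>: "Im \<kappa> > 0" and \<rho>: "\<rho> > 0"
  shows "\<exists>r>\<rho>. ms_integral \<nu> (\<kappa> * of_real r) \<noteq> 0"
proof (rule ccontr)
  assume "\<not> ?thesis"
  then have z: "ms_integral \<nu> (\<kappa> * of_real r) = 0" if "r > \<rho>" for r using that by blast
  let ?S = "{w. 0 < Im w}"
  let ?U = "(\<lambda>r. \<kappa> * of_real r) ` {\<rho><..}"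
  have "ms_integral \<nu> \<i> = 0"
  proof (rule analytic_continuation[where f="ms_integral \<nu>" and w=\<i> and S="?S" and U="?U" and \<xi>="\<kappa> * of_real (\<rho> + 1)"])
    show "ms_integral \<nu> holomorphic_on ?S"
      using ms_integral_deriv by (auto simp: holomorphic_on_def field_differentiable_def intro: has_field_derivative_at_within)
    show "open ?S" by (rule open_halfspace_Im_gt)
    show "connected ?S" by (rule convex_connected[OF convex_halfspace_Im_gt])
    show "?U \<subseteq> ?S" using \<kappa> \<rho> by auto
    show "\<kappa> * of_real (\<rho> + 1) \<in> ?S" using \<kappa> \<rho> by simp
    \<comment> \<open>The zeros are known on a ray only, so they enter the identity theorem through
      one of their accumulation points.\<close>
    show "\<kappa> * of_real (\<rho> + 1) islimpt ?U"
      unfolding islimpt_sequential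
    proof (intro exI[of _ "\<lambda>n. \<kappa> * of_real (\<rho> + 1 + 1 / real (Suc n))"] conjI allI)
      fix n :: nat
      have "\<kappa> * of_real (\<rho> + 1 + 1 / real (Suc n)) \<noteq> \<kappa> * of_real (\<rho> + 1)"
      proof -
        have "complex_of_real (\<rho> + 1 + 1 / real (Suc n)) \<noteq> of_real (\<rho> + 1)" by (subst of_real_eq_iff) simp
        moreover have "\<kappa> \<noteq> 0" using \<kappa> by auto
        ultimately show ?thesis by (simp only: mult_cancel_left) simp
      qed
      moreover have "\<rho> + 1 + 1 / real (Suc n) \<in> {\<rho><..}" by (simp add: add_pos_nonneg)
      ultimately show "\<kappa> * of_real (\<rho> + 1 + 1 / real (Suc n)) \<in> ?U - {\<kappa> * of_real (\<rho> + 1)}" by blast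
    next
      have "(\<lambda>n. \<rho> + 1 + 1 / real (Suc n)) \<longlonglongrightarrow> \<rho> + 1 + 0"
        by (intro tendsto_intros LIMSEQ_Suc[OF lim_1_over_n, unfolded o_def])
      then show "(\<lambda>n. \<kappa> * of_real (\<rho> + 1 + 1 / real (Suc n))) \<longlonglongrightarrow> \<kappa> * of_real (\<rho> + 1)"
        unfolding add_0_right by (intro tendsto_mult tendsto_const tendsto_of_real)
    qed
    show "ms_integral \<nu> w = 0" if "w \<in> ?U" for w using that z by auto
  qed simp
  then show False using ms_integral_i_neq_0 by blast
qed

text \<open>Split \<open>r * cosh t = \<rho> * cosh t + (r - \<rho>) * cosh t\<close> and use
  \<open>cosh t \<ge> 1\<close> in the second term only: that term supplies the decay in
  \<open>r\<close>, while the first keeps the integral finite.\<close>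

lemma norm_ms_integral_le:
  assumes z: "Im \<kappa> > 0" and \<rho>: "\<rho> > 0"
  shows "\<exists>K. \<forall>r\<ge>\<rho>. norm (ms_integral \<nu> (\<kappa> * of_real r)) \<le> K * exp (- Im \<kappa> * r)"
proof (intro exI allI impI)
  fix r assume r: "\<rho> \<le> r"
  let ?b = "Im \<kappa>"
  let ?w = "\<lambda>t. exp (?b * \<rho>) * exp (- ?b * r) * exp (\<bar>\<nu>\<bar> * \<bar>t\<bar> - ?b * \<rho> * cosh t)"
  have b\<rho>: "?b * \<rho> > 0" using z \<rho> by simp
  have "norm (ms_integral \<nu> (\<kappa> * of_real r)) \<le> (LINT t|lborel. norm (ms_kernel \<nu> (\<kappa> * of_real r) t))"
    unfolding ms_integral_def by (rule integral_norm_bound)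
  also have "\<dots> \<le> (LINT t|lborel. ?w t)"
  proof (rule integral_mono)
    show "integrable lborel (\<lambda>t. norm (ms_kernel \<nu> (\<kappa> * of_real r) t))"
      by (rule integrable_norm[OF integrable_ms_kernel]) (use z \<rho> r in simp)
    show "integrable lborel ?w" by (intro integrable_mult_right integrable_exp_cosh b\<rho>)
    show "norm (ms_kernel \<nu> (\<kappa> * of_real r) t) \<le> ?w t" for t
    proof -
      have "(r - \<rho>) * 1 \<le> (r - \<rho>) * cosh t" using r cosh_real_ge_1[of t] by (intro mult_left_mono) auto
      then have "?b * (r - \<rho>) \<le> ?b * ((r - \<rho>) * cosh t)" using z by (intro mult_left_mono) auto
      then have "\<bar>\<nu>\<bar> * \<bar>t\<bar> - ?b * r * cosh t \<le> ?b * \<rho> + (- ?b * r) + (\<bar>\<nu>\<bar> * \<bar>t\<bar> - ?b * \<rho> * cosh t)"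
        by (simp add: algebra_simps)
      then have "exp (\<bar>\<nu>\<bar> * \<bar>t\<bar> - ?b * r * cosh t) \<le> ?w t" unfolding mult_exp_exp by simp
      then show ?thesis using norm_ms_kernel_le[of "?b * r" "\<kappa> * of_real r" \<nu> t] by simp
    qed
  qed
  also have "\<dots> = (exp (?b * \<rho>) * (LINT t|lborel. exp (\<bar>\<nu>\<bar> * \<bar>t\<bar> - ?b * \<rho> * cosh t))) * exp (- ?b * r)"
    by simp
  finally show "norm (ms_integral \<nu> (\<kappa> * of_real r)) \<le>
    (exp (?b * \<rho>) * (LINT t|lborel. exp (\<bar>\<nu>\<bar> * \<bar>t\<bar> - ?b * \<rho> * cosh t))) * exp (- ?b * r)" .
qed

section \<open>Radial differential equation: uniqueness and regularity\<close>

section \<open>The radial equation\<close>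

text \<open>With \<open>F = Re (\<alpha> z cnj w)\<close> for a suitable \<open>\<alpha>\<close>, one has \<open>F' = p |w|\<^sup>2 + |z|\<^sup>2 / p\<close>, where
  \<open>p r = r ^ M\<close>, hence \<open>F\<^sup>2 \<le> |\<alpha>|\<^sup>2 F' p |w|\<^sup>2\<close>. If \<open>F\<close> were positive somewhere,
  \<open>2 \<le> |\<alpha>|\<^sup>2 p |w|\<^sup>2 + F' / F\<^sup>2\<close> from there on, which is impossible since the right hand side is integrable.\<close>

lemma radial_solution_zero:
  fixes w z :: "real \<Rightarrow> complex"
  assumes \<rho>: "\<rho> \<ge> 0" and q: "Im q > 0"
    and dw: "\<And>r. r > \<rho> \<Longrightarrow> (w has_vector_derivative z r / of_real (r ^ M)) (at r)"
    and dz: "\<And>r. r > \<rho> \<Longrightarrow> (z has_vector_derivative - q * of_real (r ^ M) * w r) (at r)"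
    and int: "set_integrable lborel {\<rho><..} (\<lambda>r. r ^ M * (norm (w r))\<^sup>2)"
    and r0: "r0 > \<rho>" "w r0 = 0" and r1: "r1 > r0"
  shows "w r1 = 0"
proof (rule ccontr)
  assume w1: "w r1 \<noteq> 0"
  \<comment> \<open>\<open>Re \<alpha> = 1\<close> and \<open>Re (\<alpha> * q) = -1\<close> give
    both terms of \<open>D\<close> the coefficient 1; this is where \<open>Im q > 0\<close>
    enters.\<close>
  define \<alpha> where "\<alpha> = Complex 1 ((Re q + 1) / Im q)"
  have \<alpha>: "Re \<alpha> = 1" "Re (\<alpha> * q) = -1" using q by (simp_all add: \<alpha>_def)
  define y where "y r = r ^ M * (norm (w r))\<^sup>2" for r
  define D where "D r = y r + (norm (z r))\<^sup>2 / r ^ M" for r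
  define F where "F r = Re (\<alpha> * (z r * cnj (w r)))" for r
  have y0: "0 \<le> y r" if "r > \<rho>" for r using that \<rho> by (simp add: y_def)
  have D0: "0 \<le> D r" if "r > \<rho>" for r using that \<rho> y0[OF that] by (simp add: D_def)
  have dF: "(F has_real_derivative D r) (at r)" if r: "r > \<rho>" for r
  proof -
    have p: "r ^ M > 0" using r \<rho> by simp
    have "((\<lambda>r. cnj (w r)) has_vector_derivative cnj (z r / of_real (r ^ M))) (at r)"
      by (rule bounded_linear.has_vector_derivative[OF bounded_linear_cnj dw[OF r]])
    from has_vector_derivative_mult[OF dz[OF r] this]
    have "((\<lambda>r. \<alpha> * (z r * cnj (w r))) has_vector_derivative
      \<alpha> * (z r * cnj (z r / of_real (r ^ M)) + - q * of_real (r ^ M) * w r * cnj (w r))) (at r)"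
      by (rule has_vector_derivative_mult_right)
    from bounded_linear.has_vector_derivative[OF bounded_linear_Re this]
    have "(F has_vector_derivative
      Re (\<alpha> * (z r * cnj (z r / of_real (r ^ M)) + - q * of_real (r ^ M) * w r * cnj (w r)))) (at r)"
      unfolding F_def .
    moreover have "Re (\<alpha> * (z r * cnj (z r / of_real (r ^ M)) + - q * of_real (r ^ M) * w r * cnj (w r))) = D r"
    proof -
      have nz: "z r * cnj (z r) = of_real ((norm (z r))\<^sup>2)" and nw: "w r * cnj (w r) = of_real ((norm (w r))\<^sup>2)"
        by (simp_all only: complex_norm_square)
      have Re: "Re (c * complex_of_real x) = Re c * x" for c x by simp
      have "\<alpha> * (z r * cnj (z r / of_real (r ^ M)) + - q * of_real (r ^ M) * w r * cnj (w r))
         = \<alpha> * ((z r * cnj (z r)) / of_real (r ^ M)) - (\<alpha> * q) * (of_real (r ^ M) * (w r * cnj (w r)))"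
        by (simp add: algebra_simps)
      also have "\<dots> = \<alpha> * of_real ((norm (z r))\<^sup>2 / r ^ M) - (\<alpha> * q) * of_real (y r)"
        unfolding nz nw y_def by (simp only: of_real_divide of_real_mult)
      finally show ?thesis by (simp only: minus_complex.sel Re \<alpha> D_def)
    qed
    ultimately show ?thesis by (simp add: has_real_derivative_iff_has_vector_derivative)
  qed
  have mono: "F a \<le> F b" if "\<rho> < a" "a \<le> b" for a b
  proof (rule DERIV_nonneg_imp_nondecreasing[OF that(2)])
    fix x assume "a \<le> x" "x \<le> b"
    then have x: "x > \<rho>" using that by simp
    show "\<exists>y. (F has_real_derivative y) (at x) \<and> 0 \<le> y" using dF[OF x] D0[OF x] by blast
  qed
  have r1': "r1 > \<rho>" using r0 r1 by simp
  \<comment> \<open>\<open>F\<close> vanishes at \<open>r0\<close> and is so far only nondecreasing;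
    \<open>w r1 \<noteq> 0\<close> makes it increase strictly just beyond \<open>r1\<close>, hence
    positive at some \<open>r2\<close>.\<close>
  have "D r1 > 0" using w1 r1' \<rho> unfolding D_def y_def by (intro add_pos_nonneg) auto
  from DERIV_pos_inc_right[OF dF[OF r1'] this]
  obtain d where d: "d > 0" "\<forall>h>0. h < d \<longrightarrow> F r1 < F (r1 + h)" by blast
  define r2 where "r2 = r1 + d / 2"
  have r2: "r2 > \<rho>" using d r1' by (simp add: r2_def)
  have "F r0 = 0" using r0 by (simp add: F_def)
  moreover have "F r0 \<le> F r1" using r0 r1 by (intro mono) auto
  moreover have "F r1 < F r2" using d unfolding r2_def by simp
  ultimately have F2: "F r2 > 0" by simp
  have Fpos: "F r > 0" if "r \<ge> r2" for r using mono[OF r2 that] F2 by simp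
  define K where "K = (LINT r|lborel. indicator {\<rho><..} r *\<^sub>R y r)"
  have iy: "integrable lborel (\<lambda>r. indicator {\<rho><..} r *\<^sub>R y r)"
    using int unfolding set_integrable_def y_def .
  have cy: "continuous_on {r2..b} y" for b
  proof -
    have "continuous_on {r2..b} w"
    proof (rule continuous_at_imp_continuous_on, rule ballI)
      fix r assume "r \<in> {r2..b}"
      then have "r > \<rho>" using r2 by simp
      from has_vector_derivative_continuous[OF dw[OF this]] show "isCont w r" .
    qed
    then show ?thesis unfolding y_def by (intro continuous_intros)
  qed
  have bound: "2 * (b - r2) \<le> (norm \<alpha>)\<^sup>2 * K + 1 / F r2" if b: "b \<ge> r2" for b
  proof -
    have "((\<lambda>r. D r / (F r)\<^sup>2) has_integral (- (1 / F b) - - (1 / F r2))) {r2..b}"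
    proof (rule fundamental_theorem_of_calculus[OF b])
      fix r assume r: "r \<in> {r2..b}"
      have "((\<lambda>r. - (1 / F r)) has_real_derivative D r / (F r)\<^sup>2) (at r)"
        using Fpos[of r] r r2 dF[of r] by (auto intro!: derivative_eq_intros simp: power2_eq_square)
      then show "((\<lambda>r. - (1 / F r)) has_vector_derivative D r / (F r)\<^sup>2) (at r within {r2..b})"
        by (simp add: has_real_derivative_iff_has_vector_derivative has_vector_derivative_at_within)
    qed
    moreover have yi: "(y has_integral integral {r2..b} y) {r2..b}"
      using integrable_continuous_interval[OF cy[of b]] by (rule integrable_integral)
    ultimately have I1: "((\<lambda>r. (norm \<alpha>)\<^sup>2 * y r + D r / (F r)\<^sup>2) has_integral
        ((norm \<alpha>)\<^sup>2 * integral {r2..b} y + (- (1 / F b) - - (1 / F r2)))) {r2..b}"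
      by (intro has_integral_add has_integral_mult_right)
    have I2: "((\<lambda>r. 2) has_integral 2 * (b - r2)) {r2..b}"
      using has_integral_const_real[of "2::real" r2 b] b by (simp add: algebra_simps)
    have "2 * (b - r2) \<le> (norm \<alpha>)\<^sup>2 * integral {r2..b} y + (- (1 / F b) - - (1 / F r2))"
    proof (rule has_integral_le[OF I2 I1])
      fix r assume r: "r \<in> {r2..b}"
      then have r\<rho>: "r > \<rho>" and Fr: "F r > 0" using r2 Fpos[of r] by auto
      have p: "r ^ M > 0" using r\<rho> \<rho> by simp
      have "F r \<le> norm (\<alpha> * (z r * cnj (w r)))" unfolding F_def by (rule complex_Re_le_cmod)
      then have "(F r)\<^sup>2 \<le> (norm (\<alpha> * (z r * cnj (w r))))\<^sup>2" using Fr by (intro power_mono) auto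
      also have "\<dots> = (norm \<alpha>)\<^sup>2 * (y r * ((norm (z r))\<^sup>2 / r ^ M))"
        using r\<rho> \<rho> by (simp add: y_def norm_mult power_mult_distrib field_simps)
      also have "\<dots> \<le> (norm \<alpha>)\<^sup>2 * (y r * D r)"
        using y0[OF r\<rho>] by (intro mult_left_mono) (auto simp: D_def)
      finally have "1 \<le> ((norm \<alpha>)\<^sup>2 * y r) * (D r / (F r)\<^sup>2)"
        using Fr by (simp add: field_simps)
      moreover define X where "X = (norm \<alpha>)\<^sup>2 * y r"
      moreover define Y where "Y = D r / (F r)\<^sup>2"
      moreover have "0 \<le> X" "0 \<le> Y" using y0[OF r\<rho>] D0[OF r\<rho>] by (auto simp: X_def Y_def)
      ultimately have XY: "1 \<le> X * Y" "0 \<le> X" "0 \<le> Y" by auto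
      have "(X + Y)\<^sup>2 = (X - Y)\<^sup>2 + 4 * (X * Y)" by (simp add: power2_sum power2_diff)
      then have "2\<^sup>2 \<le> (X + Y)\<^sup>2"
        using XY(1) zero_le_power2[of "X - Y"] unfolding power2_eq_square[of "2::real"] by linarith
      then have "2 \<le> X + Y" by (rule power2_le_imp_le) (use XY in simp)
      then show "2 \<le> (norm \<alpha>)\<^sup>2 * y r + D r / (F r)\<^sup>2" by (simp add: X_def Y_def)
    qed
    moreover have "integral {r2..b} y \<le> K"
    proof -
      have sub: "set_integrable lborel {r2..b} y"
        by (rule set_integrable_subset[of _ "{\<rho><..}"]) (use iy r2 in \<open>auto simp: set_integrable_def\<close>)
      have "integral {r2..b} y = (LINT r|lborel. indicator {r2..b} r *\<^sub>R y r)"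
        using set_borel_integral_eq_integral(2)[OF sub] by (simp add: set_lebesgue_integral_def)
      also have "\<dots> \<le> K" unfolding K_def
        by (rule integral_mono[OF sub[unfolded set_integrable_def] iy]) (use r2 y0 in \<open>auto simp: indicator_def\<close>)
      finally show ?thesis .
    qed
    moreover have "1 / F b > 0" using Fpos[OF b] by simp
    ultimately show ?thesis
      using mult_left_mono[of "integral {r2..b} y" K "(norm \<alpha>)\<^sup>2", OF _ zero_le_power2] by linarith
  qed
  \<comment> \<open>An interval so long that twice its length exceeds the upper bound;
    \<open>\<bar>K\<bar>\<close> avoids discussing the sign of \<open>K\<close>.\<close>
  define b where "b = r2 + ((norm \<alpha>)\<^sup>2 * \<bar>K\<bar> + 1 / F r2)"
  have e: "(norm \<alpha>)\<^sup>2 * K \<le> (norm \<alpha>)\<^sup>2 * \<bar>K\<bar>" "0 \<le> (norm \<alpha>)\<^sup>2 * \<bar>K\<bar>" by (auto intro: mult_left_mono)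
  have F2': "1 / F r2 > 0" using F2 by simp
  then have "b \<ge> r2" using e unfolding b_def by linarith
  from bound[OF this] have "2 * ((norm \<alpha>)\<^sup>2 * \<bar>K\<bar> + 1 / F r2) \<le> (norm \<alpha>)\<^sup>2 * K + 1 / F r2"
    unfolding b_def by simp
  moreover have "\<And>X Y Z::real. 2 * (X + Y) \<le> Z + Y \<Longrightarrow> Z \<le> X \<Longrightarrow> 0 \<le> X \<Longrightarrow> 0 < Y \<Longrightarrow> False" by simp
  ultimately show False using e F2' by blast
qed

text \<open>For fixed \<open>a\<close> the combination \<open>g a * h - h a * g\<close> is a square
  integrable solution vanishing at \<open>a\<close>, hence beyond \<open>a\<close> by
  \<open>radial_solution_zero\<close>. Points to the left of \<open>r1\<close> are reached by
  exchanging the roles, that is, with \<open>a = r\<close>.\<close>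

lemma radial_solutions_proportional:
  fixes g h zg zh :: "real \<Rightarrow> complex"
  assumes \<rho>: "\<rho> \<ge> 0" and q: "Im q > 0"
    and dg: "\<And>r. r > \<rho> \<Longrightarrow> (g has_vector_derivative zg r / of_real (r ^ M)) (at r)"
    and dzg: "\<And>r. r > \<rho> \<Longrightarrow> (zg has_vector_derivative - q * of_real (r ^ M) * g r) (at r)"
    and dh: "\<And>r. r > \<rho> \<Longrightarrow> (h has_vector_derivative zh r / of_real (r ^ M)) (at r)"
    and dzh: "\<And>r. r > \<rho> \<Longrightarrow> (zh has_vector_derivative - q * of_real (r ^ M) * h r) (at r)"
    and ig: "set_integrable lborel {\<rho><..} (\<lambda>r. r ^ M * (norm (g r))\<^sup>2)"
    and ih: "set_integrable lborel {\<rho><..} (\<lambda>r. r ^ M * (norm (h r))\<^sup>2)"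
    and h1: "r1 > \<rho>" "h r1 \<noteq> 0"
  shows "\<exists>c. \<forall>r>\<rho>. g r = c * h r"
proof -
  have key: "g a * h r = h a * g r" if a: "a > \<rho>" "r > a" for a r
  proof -
    define w where "w r = g a * h r - h a * g r" for r
    have cont: "continuous_on {\<rho><..} g" "continuous_on {\<rho><..} h"
      by (rule continuous_at_imp_continuous_on, use dg dh has_vector_derivative_continuous in force)+
    have "w r = 0"
    proof (rule radial_solution_zero[OF \<rho> q _ _ _ a(1) _ a(2), where z="\<lambda>r. g a * zh r - h a * zg r" and M=M])
      show "(w has_vector_derivative (g a * zh r - h a * zg r) / of_real (r ^ M)) (at r)" if r: "r > \<rho>" for r
        using has_vector_derivative_diff[OF has_vector_derivative_mult_right[OF dh[OF r], of "g a"] has_vector_derivative_mult_right[OF dg[OF r], of "h a"]]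
        unfolding w_def by (simp add: diff_divide_distrib)
      show "((\<lambda>r. g a * zh r - h a * zg r) has_vector_derivative - q * of_real (r ^ M) * w r) (at r)" if r: "r > \<rho>" for r
        using has_vector_derivative_diff[OF has_vector_derivative_mult_right[OF dzh[OF r], of "g a"] has_vector_derivative_mult_right[OF dzg[OF r], of "h a"]]
        unfolding w_def by (simp add: algebra_simps)
      show "set_integrable lborel {\<rho><..} (\<lambda>r. r ^ M * (norm (w r))\<^sup>2)"
        unfolding set_integrable_def
      proof (rule Bochner_Integration.integrable_bound)
        let ?B = "\<lambda>r. 2 * (norm (g a))\<^sup>2 * (indicator {\<rho><..} r *\<^sub>R (r ^ M * (norm (h r))\<^sup>2)) +
            2 * (norm (h a))\<^sup>2 * (indicator {\<rho><..} r *\<^sub>R (r ^ M * (norm (g r))\<^sup>2))"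
        show "integrable lborel ?B" using ig ih unfolding set_integrable_def by simp
        have "continuous_on {\<rho><..} (\<lambda>r. r ^ M * (norm (w r))\<^sup>2)"
          unfolding w_def using cont by (intro continuous_intros)
        then have "(\<lambda>r. indicator {\<rho><..} r *\<^sub>R (r ^ M * (norm (w r))\<^sup>2)) \<in> borel_measurable borel"
          by (rule borel_measurable_continuous_on_indicator[rotated]) simp
        then show "(\<lambda>r. indicator {\<rho><..} r *\<^sub>R (r ^ M * (norm (w r))\<^sup>2)) \<in> borel_measurable lborel"
          by simp
        show "AE r in lborel. norm (indicator {\<rho><..} r *\<^sub>R (r ^ M * (norm (w r))\<^sup>2)) \<le> norm (?B r)"
        proof (intro always_eventually allI)
          fix r
          show "norm (indicator {\<rho><..} r *\<^sub>R (r ^ M * (norm (w r))\<^sup>2)) \<le> norm (?B r)"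
          proof (cases "r > \<rho>")
            case True
            then have p: "0 \<le> r ^ M" using \<rho> by simp
            have "(norm (w r))\<^sup>2 \<le> 2 * (norm (g a * h r))\<^sup>2 + 2 * (norm (h a * g r))\<^sup>2"
              unfolding w_def using norm_add_sq_le[of "g a * h r" "- (h a * g r)"] by simp
            from mult_left_mono[OF this p]
            have "r ^ M * (norm (w r))\<^sup>2 \<le> ?B r"
              using True by (simp add: norm_mult power_mult_distrib algebra_simps)
            then show ?thesis using True p by simp
          qed simp
        qed
      qed
      show "w a = 0" by (simp add: w_def)
    qed
    then show ?thesis by (simp add: w_def)
  qed
  have "g r = (g r1 / h r1) * h r" if r: "r > \<rho>" for r
  proof -
    consider "r = r1" | "r > r1" | "r < r1" by linarith
    then have "g r * h r1 = g r1 * h r"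
      by cases (use key[of r1 r] key[of r r1] h1 r in \<open>auto simp: mult.commute\<close>)
    then show ?thesis using h1 by (simp add: field_simps)
  qed
  then show ?thesis by blast
qed

section \<open>From weak to classical solutions of the radial equation\<close>

text \<open>Real profiles suffice, because they are paired with complex functions and so control
  real and imaginary part together. The support stays away from \<open>\<rho>\<close>, which for
  \<open>\<rho> \<ge> 0\<close> makes division by the radius harmless.\<close>

definition halfline_test :: "real \<Rightarrow> (real \<Rightarrow> real) \<Rightarrow> bool" where
  "halfline_test \<rho> F \<longleftrightarrow> (\<forall>k. Cr k F) \<and> (\<exists>a b. \<rho> < a \<and> a < b \<and> (\<forall>x. x < a \<or> b < x \<longrightarrow> F x = 0))"

lemma halfline_test_Cr: "halfline_test \<rho> F \<Longrightarrow> Cr k F"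
  by (simp add: halfline_test_def)

lemma halfline_test_DERIV: "halfline_test \<rho> F \<Longrightarrow> (F has_real_derivative deriv F x) (at x)"
  using halfline_test_Cr[of \<rho> F "Suc 0"] by simp

lemma halfline_test_continuous: "halfline_test \<rho> F \<Longrightarrow> continuous_on S F"
  using Cr_imp_continuous[OF halfline_test_Cr] continuous_on_subset by blast

lemma halfline_testI:
  assumes "\<And>k. Cr k F" "\<rho> < a" "a < b" "\<And>x. x < a \<or> b < x \<Longrightarrow> F x = 0" shows "halfline_test \<rho> F"
  unfolding halfline_test_def using assms by blast

lemma halfline_test_mult:
  assumes "\<And>k. Cr k G" "halfline_test \<rho> F" shows "halfline_test \<rho> (\<lambda>x. G x * F x)"
proof -
  obtain a b where "\<rho> < a" "a < b" "\<forall>x. x < a \<or> b < x \<longrightarrow> F x = 0"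
    using assms(2) unfolding halfline_test_def by (elim conjE exE)
  then show ?thesis
    by (intro halfline_testI[where a=a and b=b] Cr_mult assms(1) halfline_test_Cr[OF assms(2)]) auto
qed

lemma halfline_test_diff:
  assumes "halfline_test \<rho> F" "halfline_test \<rho> G" shows "halfline_test \<rho> (\<lambda>x. F x - m * G x)"
proof -
  obtain a b where ab: "\<rho> < a" "a < b" "\<forall>x. x < a \<or> b < x \<longrightarrow> F x = 0"
    using assms(1) unfolding halfline_test_def by (elim conjE exE)
  obtain c d where cd: "\<rho> < c" "c < d" "\<forall>x. x < c \<or> d < x \<longrightarrow> G x = 0"
    using assms(2) unfolding halfline_test_def by (elim conjE exE)
  have "Cr k (\<lambda>x. F x + (- m) * G x)" for k
    by (intro Cr_add Cr_mult Cr_const halfline_test_Cr[OF assms(1)] halfline_test_Cr[OF assms(2)])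
  then show ?thesis
    by (intro halfline_testI[where a="min a c" and b="max b d"]) (use ab cd in auto)
qed

lemma halfline_test_deriv:
  assumes "halfline_test \<rho> F" shows "halfline_test \<rho> (deriv F)"
proof -
  obtain a b where ab: "\<rho> < a" "a < b" "\<forall>x. x < a \<or> b < x \<longrightarrow> F x = 0"
    using assms unfolding halfline_test_def by (elim conjE exE)
  have "deriv F x = 0" if "x < a \<or> b < x" for x
  proof -
    have "(F has_real_derivative 0) (at x)"
      by (rule has_field_derivative_transform_within_open[OF DERIV_const[of 0], of "- {a..b}"])
        (use that ab in \<open>auto simp: open_Compl\<close>)
    then show ?thesis by (rule DERIV_imp_deriv)
  qed
  moreover have "Cr k (deriv F)" for k using halfline_test_Cr[OF assms, of "Suc k"] by simp
  ultimately show ?thesis using ab(1,2) by (intro halfline_testI[where a=a and b=b])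
qed

lemma halfline_test_bump: "\<rho> < a \<Longrightarrow> a < b \<Longrightarrow> halfline_test \<rho> (bump a b)"
  by (rule halfline_testI[OF Cr_bump, where a=a and b=b]) (auto simp: bump_eq_0_iff)

lemma halfline_test_integrable:
  fixes H :: "real \<Rightarrow> complex"
  assumes F: "halfline_test \<rho> F" and H: "H \<in> borel_measurable borel" "\<And>a b. \<rho> < a \<Longrightarrow> set_integrable lborel {a..b} H"
  shows "integrable lborel (\<lambda>r. of_real (F r) * H r)"
proof -
  obtain a b where ab: "\<rho> < a" "a < b" "\<forall>x. x < a \<or> b < x \<longrightarrow> F x = 0"
    using F unfolding halfline_test_def by (elim conjE exE)
  have "compact (F ` {a..b})"
    by (rule compact_continuous_image[OF halfline_test_continuous[OF F] compact_Icc])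
  then have "bounded (F ` {a..b})" by (rule compact_imp_bounded)
  then obtain B where B: "\<forall>y\<in>F ` {a..b}. norm y \<le> B" unfolding bounded_iff by (elim exE)
  have Fm: "F \<in> borel_measurable borel" by (rule borel_measurable_continuous_onI[OF halfline_test_continuous[OF F]])
  show ?thesis
  proof (rule Bochner_Integration.integrable_bound)
    show "integrable lborel (\<lambda>r. B * norm (indicator {a..b} r *\<^sub>R H r))"
      using H(2)[OF ab(1), of b] unfolding set_integrable_def by (intro integrable_mult_right integrable_norm)
    show "(\<lambda>r. of_real (F r) * H r) \<in> borel_measurable lborel" using Fm H(1) by measurable
    show "AE r in lborel. norm (of_real (F r) * H r) \<le> norm (B * norm (indicator {a..b} r *\<^sub>R H r))"
    proof (intro always_eventually allI)
      fix r
      show "norm (of_real (F r) * H r) \<le> norm (B * norm (indicator {a..b} r *\<^sub>R H r))"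
      proof (cases "r < a \<or> b < r")
        case False
        then have True: "r \<in> {a..b}" by auto
        then have "\<bar>F r\<bar> \<le> B" using B by auto
        then have "\<bar>F r\<bar> * norm (H r) \<le> \<bar>B\<bar> * norm (H r)" by (intro mult_right_mono) auto
        then show ?thesis using True by (simp add: norm_mult)
      qed (use ab(3) in auto)
    qed
  qed
qed

lemma halfline_test_integrable1: "halfline_test \<rho> F \<Longrightarrow> integrable lborel (\<lambda>r. complex_of_real (F r))"
  using halfline_test_integrable[of \<rho> F "\<lambda>_. 1"] borel_integrable_atLeastAtMost'[of _ _ "\<lambda>_. 1::complex"] by simp

lemma halfline_test_integral_deriv:
  assumes F: "halfline_test \<rho> F" shows "(LINT r|lborel. complex_of_real (deriv F r)) = 0"
proof -
  obtain a b where ab: "\<rho> < a" "a < b" "\<forall>x. x < a \<or> b < x \<longrightarrow> F x = 0"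
    using F unfolding halfline_test_def by (elim conjE exE)
  have d0: "deriv F x = 0" if "x < a \<or> b < x" for x
  proof -
    have "(F has_real_derivative 0) (at x)"
      by (rule has_field_derivative_transform_within_open[OF DERIV_const[of 0], of "- {a..b}"])
        (use that ab in \<open>auto simp: open_Compl\<close>)
    then show ?thesis by (rule DERIV_imp_deriv)
  qed
  have "(LINT r|lborel. deriv F r) = (LINT r|lborel. deriv F r * indicator {a - 1..b + 1} r)"
  proof (intro Bochner_Integration.integral_cong refl)
    show "deriv F r = deriv F r * indicator {a - 1..b + 1} r" for r
      by (cases "r < a \<or> b < r") (use d0 in auto)
  qed
  also have "\<dots> = F (b + 1) - F (a - 1)"
    by (rule integral_FTC_Icc_real)
      (use ab halfline_test_DERIV[OF F] halfline_test_continuous[OF halfline_test_deriv[OF F], of UNIV]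
        in \<open>auto simp: continuous_on_eq_continuous_at\<close>)
  also have "\<dots> = 0" using ab by simp
  finally show ?thesis by (simp add: integral_complex_of_real)
qed

text \<open>Zero mean is what makes the antiderivative vanish again to the right of the
  support.\<close>

lemma halfline_test_antiderivative:
  assumes F: "halfline_test \<rho> F" and zero: "(LINT r|lborel. F r) = 0"
  shows "\<exists>G. halfline_test \<rho> G \<and> deriv G = F"
proof -
  obtain a b where ab: "\<rho> < a" "a < b" "\<forall>x. x < a \<or> b < x \<longrightarrow> F x = 0"
    using F unfolding halfline_test_def by (elim conjE exE)
  \<comment> \<open>Integration starts strictly to the left of the support, so that every
    \<open>r \<ge> a\<close> lies inside the interval of integration and \<open>G\<close> is
    differentiable there from both sides.\<close>
  define a' where "a' = (\<rho> + a) / 2"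
  have a': "\<rho> < a'" "a' < a" using ab by (auto simp: a'_def)
  define G where "G r = integral {a'..r} F" for r
  have cF: "continuous_on S F" for S by (rule halfline_test_continuous[OF F])
  have Gl: "G r = 0" if "r < a" for r
  proof -
    have "integral {a'..r} F = integral {a'..r} (\<lambda>x. 0)"
      by (intro Henstock_Kurzweil_Integration.integral_cong) (use that ab in auto)
    then show ?thesis by (simp add: G_def)
  qed
  have dG: "(G has_real_derivative F r) (at r)" for r
  proof (cases "r < a")
    case True
    have "(G has_real_derivative 0) (at r)"
      by (rule has_field_derivative_transform_within_open[OF DERIV_const[of 0], of "{..<a}"])
        (use True Gl in auto)
    moreover have "F r = 0" using ab True by simp
    ultimately show ?thesis by simp
  next
    case False
    then have r: "r \<in> {a'<..<r + 1}" using a' by simp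
    have "(G has_vector_derivative F r) (at r within {a'..r + 1})"
      unfolding G_def by (rule integral_has_vector_derivative[OF cF]) (use r in auto)
    then have "(G has_vector_derivative F r) (at r)"
      using at_within_interior[of r "{a'..r+1}"] r by simp
    then show ?thesis by (simp add: has_real_derivative_iff_has_vector_derivative)
  qed
  have Gr: "G r = 0" if "b < r" for r
  proof -
    have si: "set_integrable lborel {a'..r} F" by (rule borel_integrable_atLeastAtMost') (rule cF)
    have "G r = (LINT x|lborel. indicator {a'..r} x *\<^sub>R F x)"
      using set_borel_integral_eq_integral(2)[OF si] by (simp add: G_def set_lebesgue_integral_def)
    also have "\<dots> = (LINT x|lborel. F x)"
    proof (intro Bochner_Integration.integral_cong refl)
      show "indicator {a'..r} x *\<^sub>R F x = F x" for x
        by (cases "x < a \<or> b < x") (use ab a' that in auto)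
    qed
    finally show ?thesis using zero by simp
  qed
  have dG': "deriv G = F" using dG by (auto intro: DERIV_imp_deriv)
  have "Cr k G" for k by (rule Cr_Suc_imp[OF Cr_SucI[OF dG halfline_test_Cr[OF F]]])
  then have "halfline_test \<rho> G" by (rule halfline_testI[OF _ ab(1,2)]) (use Gl Gr in force)
  with dG' show ?thesis by blast
qed

lemma halfline_fundamental:
  fixes H :: "real \<Rightarrow> complex"
  assumes H: "H \<in> borel_measurable borel" "\<And>a b. \<rho> < a \<Longrightarrow> set_integrable lborel {a..b} H"
    and zero: "\<And>\<psi>. halfline_test \<rho> \<psi> \<Longrightarrow> (LINT r|lborel. of_real (\<psi> r) * H r) = 0"
  shows "AE r in lborel. r > \<rho> \<longrightarrow> H r = 0"
proof -
  have "AE r in lebesgue. r \<in> {\<rho><..} \<longrightarrow> H r = 0"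
  proof (rule AE_zero_if_bump_integrals_zero)
    fix a b :: real assume ab: "cbox a b \<subseteq> {\<rho><..}"
    show "set_integrable lebesgue (cbox a b) H"
    proof (cases "a \<le> b")
      case True
      then have "a \<in> cbox a b" by simp
      then have "\<rho> < a" using ab by blast
      from H(2)[OF this, of b] show ?thesis
        using H(1) unfolding set_integrable_def by (subst integrable_completion) auto
    qed (simp add: set_integrable_def)
    assume "box a b \<noteq> {}"
    then have "a < b" by simp
    then have "a \<in> cbox a b" by simp
    then have \<rho>a: "\<rho> < a" using ab by blast
    show "\<exists>\<beta>. continuous_on UNIV \<beta> \<and> (\<forall>x. \<beta> x \<ge> 0) \<and> {x. \<beta> x \<noteq> 0} = box a b \<and>
       (\<forall>k::nat. (LINT x|lebesgue. H x * of_real (1 - exp (- real k * \<beta> x))) = 0)"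
    proof (intro exI[of _ "bump a b"] conjI allI)
      show "continuous_on UNIV (bump a b)" by (rule Cr_imp_continuous[OF Cr_bump[of 0]])
      show "bump a b x \<ge> 0" for x by (rule bump_nonneg)
      show "{x. bump a b x \<noteq> 0} = box a b" by (auto simp: bump_eq_0_iff)
      fix k :: nat
      have C: "Cr j (\<lambda>x. 1 + (-1) * exp ((- real k) * bump a b x))" for j
        by (intro Cr_add Cr_mult Cr_exp Cr_const Cr_bump)
      have t: "halfline_test \<rho> (\<lambda>x. 1 - exp (- real k * bump a b x))"
        by (rule halfline_testI[OF _ \<rho>a \<open>a < b\<close>]) (use C bump_eq_0_iff[of a b] in \<open>auto\<close>)
      have "(\<lambda>x. 1 - exp (- real k * bump a b x)) \<in> borel_measurable borel"
        by (rule borel_measurable_continuous_onI[OF halfline_test_continuous[OF t]])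
      then have "(\<lambda>x. H x * of_real (1 - exp (- real k * bump a b x))) \<in> borel_measurable borel" using H(1) by measurable
      then have "(LINT x|lebesgue. H x * of_real (1 - exp (- real k * bump a b x))) = (LINT x|lborel. H x * of_real (1 - exp (- real k * bump a b x)))"
        by (simp add: integral_completion)
      also have "\<dots> = 0" using zero[OF t] by (simp only: mult.commute)
      finally show "(LINT x|lebesgue. H x * of_real (1 - exp (- real k * bump a b x))) = 0" .
    qed
  qed auto
  then show ?thesis by (simp add: AE_completion_iff)
qed

lemma du_Bois_Reymond_aux:
  obtains \<eta> where "halfline_test \<rho> \<eta>" "(LINT r|lborel. \<eta> r) = (1::real)"
proof -
  let ?b = "bump (\<rho> + 1) (\<rho> + 2)"
  have b: "halfline_test \<rho> ?b" by (rule halfline_test_bump) auto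
  have ib: "integrable lborel ?b" using halfline_test_integrable1[OF b] by (simp only: complex_of_real_integrable_eq)
  have "(LINT r|lborel. ?b r) \<noteq> 0"
  proof
    assume "(LINT r|lborel. ?b r) = 0"
    then have "AE r in lborel. ?b r = 0"
      by (subst (asm) integral_nonneg_eq_0_iff_AE[OF ib]) (auto simp: bump_nonneg)
    then have "AE r in lborel. r \<notin> {\<rho> + 1<..<\<rho> + 2}" by eventually_elim (auto simp: bump_eq_0_iff)
    then have "{\<rho> + 1<..<\<rho> + 2} \<in> null_sets lborel" by (subst AE_iff_null_sets) auto
    then show False by (simp add: null_sets_def)
  qed
  then have "(LINT r|lborel. (1 / (LINT r|lborel. ?b r)) * ?b r) = 1" by simp
  moreover have "halfline_test \<rho> (\<lambda>r. (1 / (LINT r|lborel. ?b r)) * ?b r)"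
    by (rule halfline_test_mult[OF Cr_const b])
  ultimately show thesis using that by blast
qed

text \<open>Modulo derivatives, every test function is a multiple of one \<open>\<eta>\<close> of
  integral 1: with \<open>m\<close> the integral of \<open>\<psi>\<close>, the difference
  \<open>\<psi> - m * \<eta>\<close> has a test function as antiderivative. So the pairing with
  \<open>H\<close> depends on \<open>\<psi>\<close> only through its integral, exactly as for a
  constant.\<close>

lemma du_Bois_Reymond:
  fixes H :: "real \<Rightarrow> complex"
  assumes H: "H \<in> borel_measurable borel" "\<And>a b. \<rho> < a \<Longrightarrow> set_integrable lborel {a..b} H"
    and zero: "\<And>\<psi>. halfline_test \<rho> \<psi> \<Longrightarrow> (LINT r|lborel. of_real (deriv \<psi> r) * H r) = 0"
  shows "\<exists>c. AE r in lborel. r > \<rho> \<longrightarrow> H r = c"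
proof -
  obtain \<eta> where \<eta>: "halfline_test \<rho> \<eta>" "(LINT r|lborel. \<eta> r) = (1::real)"
    by (rule du_Bois_Reymond_aux)
  define c where "c = (LINT r|lborel. of_real (\<eta> r) * H r)"
  have "AE r in lborel. r > \<rho> \<longrightarrow> H r - c = 0"
  proof (rule halfline_fundamental)
    show "(\<lambda>r. H r - c) \<in> borel_measurable borel" using H(1) by measurable
    show "set_integrable lborel {a..b} (\<lambda>r. H r - c)" if "\<rho> < a" for a b
      by (intro set_integral_diff(1) H(2)[OF that] borel_integrable_atLeastAtMost' continuous_intros)
    fix \<psi> assume \<psi>: "halfline_test \<rho> \<psi>"
    have i\<psi>: "integrable lborel \<psi>" "integrable lborel \<eta>"
      using halfline_test_integrable1[OF \<psi>] halfline_test_integrable1[OF \<eta>(1)] by (simp_all only: complex_of_real_integrable_eq)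
    define m where "m = (LINT r|lborel. \<psi> r)"
    have "(LINT r|lborel. \<psi> r - m * \<eta> r) = 0" using i\<psi> \<eta>(2) by (simp add: m_def)
    from halfline_test_antiderivative[OF halfline_test_diff[OF \<psi> \<eta>(1)] this]
    obtain \<xi> where \<xi>: "halfline_test \<rho> \<xi>" "deriv \<xi> = (\<lambda>r. \<psi> r - m * \<eta> r)" by blast
    note i = halfline_test_integrable[OF \<psi> H] halfline_test_integrable[OF \<eta>(1) H]
    have "0 = (LINT r|lborel. of_real (\<psi> r) * H r - of_real m * (of_real (\<eta> r) * H r))"
      using zero[OF \<xi>(1)] by (simp add: \<xi>(2) left_diff_distrib mult.assoc)
    also have "\<dots> = (LINT r|lborel. of_real (\<psi> r) * H r) - of_real m * c"
      using i by (simp add: c_def)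
    also have "of_real m * c = (LINT r|lborel. of_real (\<psi> r) * c)"
      by (simp add: m_def integral_complex_of_real)
    also have "(LINT r|lborel. of_real (\<psi> r) * H r) - (LINT r|lborel. of_real (\<psi> r) * c) = (LINT r|lborel. of_real (\<psi> r) * (H r - c))"
      using i(1) halfline_test_integrable1[OF \<psi>] by (simp add: right_diff_distrib)
    finally show "(LINT r|lborel. of_real (\<psi> r) * (H r - c)) = 0" by simp
  qed
  then show ?thesis by (intro exI[of _ c]) (auto elim!: eventually_mono)
qed

text \<open>Adding \<open>K * r\<close> reduces this to the first order case: the same decomposition
  of \<open>\<psi>\<close> gives \<open>m * K\<close> for the pairing of its derivative with
  \<open>H\<close>, and integrating the derivative of \<open>r * \<psi> r\<close> shows that
  \<open>K * r\<close> contributes \<open>- m * K\<close>.\<close>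

lemma du_Bois_Reymond_second:
  fixes H :: "real \<Rightarrow> complex"
  assumes H: "H \<in> borel_measurable borel" "\<And>a b. \<rho> < a \<Longrightarrow> set_integrable lborel {a..b} H"
    and zero: "\<And>\<psi>. halfline_test \<rho> \<psi> \<Longrightarrow> (LINT r|lborel. of_real (deriv (deriv \<psi>) r) * H r) = 0"
  shows "\<exists>A B. AE r in lborel. r > \<rho> \<longrightarrow> H r = A + B * of_real r"
proof -
  obtain \<eta> where \<eta>: "halfline_test \<rho> \<eta>" "(LINT r|lborel. \<eta> r) = (1::real)"
    by (rule du_Bois_Reymond_aux)
  define K where "K = (LINT r|lborel. of_real (deriv \<eta> r) * H r)"
  have si: "set_integrable lborel {a..b} (\<lambda>r. K * of_real r)" for a b
    by (rule borel_integrable_atLeastAtMost') (intro continuous_intros)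
  have "\<exists>c. AE r in lborel. r > \<rho> \<longrightarrow> H r + K * of_real r = c"
  proof (rule du_Bois_Reymond)
    show "(\<lambda>r. H r + K * of_real r) \<in> borel_measurable borel" using H(1) by measurable
    show "set_integrable lborel {a..b} (\<lambda>r. H r + K * of_real r)" if "\<rho> < a" for a b
      by (intro set_integral_add(1) H(2)[OF that] si)
    fix \<psi> assume \<psi>: "halfline_test \<rho> \<psi>"
    have i\<psi>: "integrable lborel \<psi>" "integrable lborel \<eta>"
      using halfline_test_integrable1[OF \<psi>] halfline_test_integrable1[OF \<eta>(1)] by (simp_all only: complex_of_real_integrable_eq)
    define m where "m = (LINT r|lborel. \<psi> r)"
    have "(LINT r|lborel. \<psi> r - m * \<eta> r) = 0" using i\<psi> \<eta>(2) by (simp add: m_def)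
    from halfline_test_antiderivative[OF halfline_test_diff[OF \<psi> \<eta>(1)] this]
    obtain \<xi> where \<xi>: "halfline_test \<rho> \<xi>" "deriv \<xi> = (\<lambda>r. \<psi> r - m * \<eta> r)" by blast
    have dd: "deriv (\<lambda>r. \<psi> r - m * \<eta> r) = (\<lambda>r. deriv \<psi> r - m * deriv \<eta> r)"
    proof
      fix r
      show "deriv (\<lambda>r. \<psi> r - m * \<eta> r) r = deriv \<psi> r - m * deriv \<eta> r"
        by (rule DERIV_imp_deriv)
          (intro DERIV_diff DERIV_cmult halfline_test_DERIV[OF \<psi>] halfline_test_DERIV[OF \<eta>(1)])
    qed
    note i = halfline_test_integrable[OF halfline_test_deriv[OF \<psi>] H] halfline_test_integrable[OF halfline_test_deriv[OF \<eta>(1)] H]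
    have ir: "integrable lborel (\<lambda>r. of_real (deriv \<psi> r) * (K * of_real r))"
      by (rule halfline_test_integrable[OF halfline_test_deriv[OF \<psi>]]) (measurable, rule si)
    have "0 = (LINT r|lborel. of_real (deriv \<psi> r) * H r - of_real m * (of_real (deriv \<eta> r) * H r))"
      using zero[OF \<xi>(1)] by (simp add: \<xi>(2) dd left_diff_distrib mult.assoc)
    also have "\<dots> = (LINT r|lborel. of_real (deriv \<psi> r) * H r) - of_real m * K"
      using i by (simp add: K_def)
    also have "of_real m * K = - (LINT r|lborel. of_real (deriv \<psi> r) * (K * of_real r))"
    proof -
      have t: "halfline_test \<rho> (\<lambda>r. r * \<psi> r)"
      proof (rule halfline_test_mult[OF _ \<psi>])
        show "Cr k (\<lambda>x. x)" for k using Cr_SucI[of "\<lambda>x. x" "\<lambda>x. 1" k] Cr_const[of k 1] Cr_Suc_imp[of k "\<lambda>x. x"]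
          by (auto intro!: derivative_eq_intros simp del: Cr.simps)
      qed
      have d: "deriv (\<lambda>r. r * \<psi> r) = (\<lambda>r. \<psi> r + r * deriv \<psi> r)"
      proof
        fix r
        show "deriv (\<lambda>r. r * \<psi> r) r = \<psi> r + r * deriv \<psi> r"
          by (rule DERIV_imp_deriv) (auto intro!: derivative_eq_intros halfline_test_DERIV[OF \<psi>])
      qed
      have "0 = K * (LINT r|lborel. complex_of_real (deriv (\<lambda>r. r * \<psi> r) r))"
        using halfline_test_integral_deriv[OF t] by simp
      also have "\<dots> = (LINT r|lborel. K * complex_of_real (\<psi> r) + of_real (deriv \<psi> r) * (K * of_real r))"
        unfolding d integral_mult_right_zero[symmetric] by (simp add: algebra_simps)
      also have "\<dots> = K * of_real m + (LINT r|lborel. of_real (deriv \<psi> r) * (K * of_real r))"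
        using ir halfline_test_integrable1[OF \<psi>] by (simp add: m_def integral_complex_of_real)
      finally show ?thesis by (simp add: eq_neg_iff_add_eq_0 mult.commute)
    qed
    finally show "(LINT r|lborel. of_real (deriv \<psi> r) * (H r + K * of_real r)) = 0"
      using i(1) ir by (simp add: distrib_left)
  qed
  then obtain c where "AE r in lborel. r > \<rho> \<longrightarrow> H r + K * of_real r = c" by blast
  then have "AE r in lborel. r > \<rho> \<longrightarrow> H r = c + (- K) * of_real r"
    by eventually_elim (auto simp: algebra_simps)
  then show ?thesis by blast
qed

text \<open>Measurability on the whole line holds because the primitive is continuous on
  \<open>{\<rho><..}\<close> and the integral over an empty or one-point interval is zero.\<close>

lemma set_integrable_imp_has_indefinite_integral:
  fixes \<alpha> :: "real \<Rightarrow> complex"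
  assumes "\<And>b. set_integrable lborel {\<rho>..b} \<alpha>"
  shows "integral {\<rho>..r} \<alpha> = (LINT t|lborel. indicator {\<rho>..r} t *\<^sub>R \<alpha> t)"
    and "continuous_on {\<rho>..b} (\<lambda>r. integral {\<rho>..r} \<alpha>)"
    and "(\<lambda>r. integral {\<rho>..r} \<alpha>) \<in> borel_measurable borel"
    and "set_integrable lborel {\<rho>..b} (\<lambda>r. integral {\<rho>..r} \<alpha>)"
proof -
  show "integral {\<rho>..r} \<alpha> = (LINT t|lborel. indicator {\<rho>..r} t *\<^sub>R \<alpha> t)"
    using set_borel_integral_eq_integral(2)[OF assms[of r]] by (simp add: set_lebesgue_integral_def)
  have c: "continuous_on {\<rho>..b} (\<lambda>r. integral {\<rho>..r} \<alpha>)" for b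
    by (rule indefinite_integral_continuous_1[OF set_borel_integral_eq_integral(1)[OF assms]])
  then show "continuous_on {\<rho>..b} (\<lambda>r. integral {\<rho>..r} \<alpha>)" .
  show "set_integrable lborel {\<rho>..b} (\<lambda>r. integral {\<rho>..r} \<alpha>)"
    by (rule borel_integrable_atLeastAtMost') (rule c)
  have "continuous_on {\<rho><..} (\<lambda>r. integral {\<rho>..r} \<alpha>)"
  proof (rule continuous_at_imp_continuous_on, rule ballI)
    fix r assume "r \<in> {\<rho><..}"
    then have "r \<in> interior {\<rho>..r + 1}" by simp
    with c[of "r + 1"] show "isCont (\<lambda>r. integral {\<rho>..r} \<alpha>) r" by (rule continuous_on_interior)
  qed
  then have "(\<lambda>r. indicator {\<rho><..} r *\<^sub>R integral {\<rho>..r} \<alpha>) \<in> borel_measurable borel"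
    by (rule borel_measurable_continuous_on_indicator[rotated]) simp
  moreover have "(\<lambda>r. indicator {\<rho><..} r *\<^sub>R integral {\<rho>..r} \<alpha>) = (\<lambda>r. integral {\<rho>..r} \<alpha>)"
  proof
    fix r
    show "indicator {\<rho><..} r *\<^sub>R integral {\<rho>..r} \<alpha> = integral {\<rho>..r} \<alpha>"
      by (cases r \<rho> rule: linorder_cases) auto
  qed
  ultimately show "(\<lambda>r. integral {\<rho>..r} \<alpha>) \<in> borel_measurable borel" by simp
qed

text \<open>\<open>\<alpha>\<close> is only locally integrable, so its primitive need not be
  differentiable everywhere. Instead the double integral of \<open>deriv F r * \<alpha> t\<close>
  over \<open>t \<le> r\<close> is evaluated in both orders; integrating in \<open>r\<close> leaves
  \<open>- F t\<close>.\<close>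

lemma halfline_test_by_parts:
  fixes \<alpha> :: "real \<Rightarrow> complex"
  assumes F: "halfline_test \<rho> F" and \<alpha>: "\<alpha> \<in> borel_measurable borel" "\<And>b. set_integrable lborel {\<rho>..b} \<alpha>"
  shows "(LINT r|lborel. of_real (deriv F r) * integral {\<rho>..r} \<alpha>) = - (LINT r|lborel. of_real (F r) * \<alpha> r)"
proof -
  obtain a b where ab: "\<rho> < a" "a < b" "\<forall>x. x < a \<or> b < x \<longrightarrow> F x = 0"
    using F unfolding halfline_test_def by (elim conjE exE)
  have d0: "deriv F x = 0" if "x < a \<or> b < x" for x
  proof -
    have "(F has_real_derivative 0) (at x)"
      by (rule has_field_derivative_transform_within_open[OF DERIV_const[of 0], of "- {a..b}"])
        (use that ab in \<open>auto simp: open_Compl\<close>)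
    then show ?thesis by (rule DERIV_imp_deriv)
  qed
  note F' = halfline_test_deriv[OF F]
  have F'm[measurable]: "deriv F \<in> borel_measurable borel"
    by (rule borel_measurable_continuous_onI[OF halfline_test_continuous[OF F']])
  note \<alpha>(1)[measurable]
  \<comment> \<open>The cut at \<open>b + 1\<close> makes the kernel integrable without changing the
    result, since \<open>deriv F\<close> vanishes beyond \<open>b\<close>; moreover
    \<open>F (b + 1) = 0\<close> is immediate from the support condition.\<close>
  define k where "k r t = of_real (deriv F r * indicator {t..} r) * (indicator {\<rho>..b + 1} t *\<^sub>R \<alpha> t)" for r t
  have i\<alpha>: "integrable lborel (\<lambda>t. indicator {\<rho>..b + 1} t *\<^sub>R \<alpha> t)" using \<alpha>(2)[of "b + 1"] by (simp add: set_integrable_def)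
  have km: "(\<lambda>(r, t). k r t) \<in> borel_measurable (lborel \<Otimes>\<^sub>M lborel)"
  proof -
    have "(\<lambda>p. k (fst p) (snd p)) = (\<lambda>p. (if snd p \<le> fst p then of_real (deriv F (fst p)) else 0) * (indicator {\<rho>..b + 1} (snd p) *\<^sub>R \<alpha> (snd p)))"
      by (auto simp: k_def indicator_def)
    also have "\<dots> \<in> borel_measurable (lborel \<Otimes>\<^sub>M lborel)" by measurable
    finally show ?thesis by (simp add: split_beta)
  qed
  have kb: "norm (k r t) \<le> \<bar>deriv F r\<bar> * norm (indicator {\<rho>..b + 1} t *\<^sub>R \<alpha> t)" for r t
    unfolding k_def norm_mult norm_of_real by (intro mult_right_mono) (auto simp: indicator_def)
  have ik: "integrable lborel (k r)" for r
  proof (rule Bochner_Integration.integrable_bound)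
    show "integrable lborel (\<lambda>t. \<bar>deriv F r\<bar> * norm (indicator {\<rho>..b + 1} t *\<^sub>R \<alpha> t))"
      by (intro integrable_mult_right integrable_norm i\<alpha>)
    show "k r \<in> borel_measurable lborel"
    proof -
      have "k r = (\<lambda>t. (if t \<le> r then of_real (deriv F r) else 0) * (indicator {\<rho>..b + 1} t *\<^sub>R \<alpha> t))"
        by (auto simp: k_def indicator_def)
      then show ?thesis by simp
    qed
    show "AE t in lborel. norm (k r t) \<le> norm (\<bar>deriv F r\<bar> * norm (indicator {\<rho>..b + 1} t *\<^sub>R \<alpha> t))"
      by (intro always_eventually allI order_trans[OF kb]) simp
  qed
  have int: "integrable (lborel \<Otimes>\<^sub>M lborel) (\<lambda>(r, t). k r t)"
  proof (rule lborel_pair.Fubini_integrable[OF km])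
    show "AE r in lborel. integrable lborel (\<lambda>t. case (r, t) of (r, t) \<Rightarrow> k r t)" using ik by simp
    show "integrable lborel (\<lambda>r. LINT t|lborel. norm (case (r, t) of (r, t) \<Rightarrow> k r t))"
    proof (rule Bochner_Integration.integrable_bound)
      show "integrable lborel (\<lambda>r. \<bar>deriv F r\<bar> * (LINT t|lborel. norm (indicator {\<rho>..b + 1} t *\<^sub>R \<alpha> t)))"
        using integrable_norm[OF halfline_test_integrable1[OF F']] by (intro integrable_mult_left) simp
      show "(\<lambda>r. LINT t|lborel. norm (case (r, t) of (r, t) \<Rightarrow> k r t)) \<in> borel_measurable lborel"
        using km by measurable
      show "AE r in lborel. norm (LINT t|lborel. norm (case (r, t) of (r, t) \<Rightarrow> k r t))
          \<le> norm (\<bar>deriv F r\<bar> * (LINT t|lborel. norm (indicator {\<rho>..b + 1} t *\<^sub>R \<alpha> t)))"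
      proof (intro always_eventually allI)
        fix r
        have "(LINT t|lborel. norm (k r t)) \<le> (LINT t|lborel. \<bar>deriv F r\<bar> * norm (indicator {\<rho>..b + 1} t *\<^sub>R \<alpha> t))"
          by (intro integral_mono integrable_norm ik integrable_mult_right i\<alpha> kb)
        also have "\<dots> = \<bar>deriv F r\<bar> * (LINT t|lborel. norm (indicator {\<rho>..b + 1} t *\<^sub>R \<alpha> t))"
          by (rule integral_mult_right_zero)
        finally show "norm (LINT t|lborel. norm (case (r, t) of (r, t) \<Rightarrow> k r t))
          \<le> norm (\<bar>deriv F r\<bar> * (LINT t|lborel. norm (indicator {\<rho>..b + 1} t *\<^sub>R \<alpha> t)))" by simp
      qed
    qed
  qed
  have inner1: "(LINT t|lborel. k r t) = of_real (deriv F r) * integral {\<rho>..r} \<alpha>" for r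
  proof (cases "r < a \<or> b < r")
    case True
    then show ?thesis using d0[OF True] by (simp add: k_def)
  next
    case False
    have "k r t = of_real (deriv F r) * (indicator {\<rho>..r} t *\<^sub>R \<alpha> t)" for t
      using False by (auto simp: k_def indicator_def)
    then show ?thesis
      unfolding set_integrable_imp_has_indefinite_integral(1)[OF \<alpha>(2)] by (simp only: integral_mult_right_zero)
  qed
  have inner2: "(LINT r|lborel. k r t) = - (of_real (F t) * \<alpha> t)" for t
  proof (cases "t \<in> {\<rho>..b + 1}")
    case True
    have "(LINT r|lborel. deriv F r * indicator {t..} r) = (LINT r|lborel. deriv F r * indicator {t..b + 1} r)"
    proof (intro Bochner_Integration.integral_cong refl)
      show "deriv F r * indicator {t..} r = deriv F r * indicator {t..b + 1} r" for r
        using d0[of r] by (cases "b < r") (auto simp: indicator_def)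
    qed
    also have "\<dots> = F (b + 1) - F t"
      by (rule integral_FTC_Icc_real)
        (use True halfline_test_DERIV[OF F] halfline_test_continuous[OF F', of UNIV]
          in \<open>auto simp: continuous_on_eq_continuous_at\<close>)
    also have "\<dots> = - F t" using ab by simp
    finally have "(LINT r|lborel. complex_of_real (deriv F r * indicator {t..} r)) = of_real (- F t)"
      by (simp only: integral_complex_of_real)
    then show ?thesis using True unfolding k_def integral_mult_left_zero by simp
  next
    case False
    then have "t < a \<or> b < t" using ab by auto
    then have "F t = 0" using ab by blast
    then show ?thesis using False by (simp add: k_def)
  qed
  have "(LINT r|lborel. of_real (deriv F r) * integral {\<rho>..r} \<alpha>) = (LINT r|lborel. LINT t|lborel. k r t)"
    by (simp only: inner1)
  also have "\<dots> = (LINT t|lborel. LINT r|lborel. k r t)"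
    using lborel_pair.Fubini_integral[OF int] by simp
  also have "\<dots> = - (LINT t|lborel. of_real (F t) * \<alpha> t)" by (simp add: inner2)
  finally show ?thesis .
qed

lemma indefinite_integral_has_vector_derivative:
  fixes f :: "real \<Rightarrow> complex"
  assumes "continuous_on {\<rho>..r + 1} f" "r > \<rho>" "\<And>x. x \<ge> \<rho> \<Longrightarrow> A x = integral {\<rho>..x} f"
  shows "(A has_vector_derivative f r) (at r)"
proof -
  have "((\<lambda>u. integral {\<rho>..u} f) has_vector_derivative f r) (at r within {\<rho>..r + 1})"
    by (rule integral_has_vector_derivative[OF assms(1)]) (use assms(2) in auto)
  then have "((\<lambda>u. integral {\<rho>..u} f) has_vector_derivative f r) (at r)"
    using at_within_interior[of r "{\<rho>..r+1}"] assms(2) by simp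
  then show ?thesis
    by (rule has_vector_derivative_transform_within_open[of _ _ _ "{\<rho><..}"]) (use assms(2,3) in auto)
qed

text \<open>Integration by parts moves all derivatives onto the second one:
  \<open>\<gamma> - A1 + q * G2\<close> is annihilated by second derivatives of test functions,
  hence affine almost everywhere. This expresses \<open>\<gamma>\<close> through its own integrals
  and gives it a continuous version \<open>g\<close>. Differentiating yields
  \<open>g' - (M / r) * g = B - q * G1\<close>, whose left side is \<open>r ^ M\<close> times the
  derivative of \<open>g / r ^ M\<close>.\<close>

lemma weak_radial_solution_regular:
  fixes \<gamma> :: "real \<Rightarrow> complex"
  assumes \<rho>: "\<rho> > 0" and \<gamma>: "\<gamma> \<in> borel_measurable borel" "\<And>b. set_integrable lborel {\<rho>..b} \<gamma>"
    and eq: "\<And>F. halfline_test \<rho> F \<Longrightarrow>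
      (LINT r|lborel. of_real (deriv (deriv F) r + real M / r * deriv F r) * \<gamma> r + q * (of_real (F r) * \<gamma> r)) = 0"
  shows "\<exists>G Z. (\<forall>r>\<rho>. (G has_vector_derivative Z r / of_real (r ^ M)) (at r)) \<and>
    (\<forall>r>\<rho>. (Z has_vector_derivative - q * of_real (r ^ M) * G r) (at r)) \<and>
    (AE r in lborel. r > \<rho> \<longrightarrow> \<gamma> r = of_real (r ^ M) * G r)"
proof -
  note \<gamma>(1)[measurable]
  define a1 where "a1 r = of_real (real M / r) * \<gamma> r" for r
  have a1m[measurable]: "a1 \<in> borel_measurable borel" unfolding a1_def by measurable
  have a1i: "set_integrable lborel {\<rho>..b} a1" for b
    unfolding set_integrable_def
  proof (rule Bochner_Integration.integrable_bound)
    show "integrable lborel (\<lambda>r. real M / \<rho> * norm (indicator {\<rho>..b} r *\<^sub>R \<gamma> r))"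
      using \<gamma>(2)[of b] unfolding set_integrable_def by (intro integrable_mult_right integrable_norm)
    show "AE r in lborel. norm (indicator {\<rho>..b} r *\<^sub>R a1 r) \<le> norm (real M / \<rho> * norm (indicator {\<rho>..b} r *\<^sub>R \<gamma> r))"
    proof (intro always_eventually allI)
      fix r
      show "norm (indicator {\<rho>..b} r *\<^sub>R a1 r) \<le> norm (real M / \<rho> * norm (indicator {\<rho>..b} r *\<^sub>R \<gamma> r))"
      proof (cases "r \<in> {\<rho>..b}")
        case True
        then have "real M / r * norm (\<gamma> r) \<le> real M / \<rho> * norm (\<gamma> r)"
          using \<rho> by (intro mult_right_mono divide_left_mono) auto
        then show ?thesis using True \<rho> by (simp add: a1_def norm_mult norm_divide)
      qed simp
    qed
  qed measurable
  define A1 where "A1 r = integral {\<rho>..r} a1" for r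
  define G1 where "G1 r = integral {\<rho>..r} \<gamma>" for r
  define G2 where "G2 r = integral {\<rho>..r} G1" for r
  note A1 = set_integrable_imp_has_indefinite_integral(2-4)[OF a1i, folded A1_def]
  note G1 = set_integrable_imp_has_indefinite_integral(2-4)[OF \<gamma>(2), folded G1_def]
  note G2 = set_integrable_imp_has_indefinite_integral(2-4)[OF G1(3), folded G2_def]
  note [measurable] = A1(2) G1(2) G2(2)
  define H where "H r = \<gamma> r - A1 r + q * G2 r" for r
  have sub: "set_integrable lborel {a..b} f" if "\<rho> < a" "set_integrable lborel {\<rho>..b} f" for a b and f :: "real \<Rightarrow> complex"
    by (rule set_integrable_subset[OF that(2)]) (use that(1) in auto)
  have "\<exists>A B. AE r in lborel. r > \<rho> \<longrightarrow> H r = A + B * of_real r"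
  proof (rule du_Bois_Reymond_second)
    show "H \<in> borel_measurable borel" unfolding H_def by measurable
    show "set_integrable lborel {a..b} H" if "\<rho> < a" for a b
      unfolding H_def
      by (intro set_integral_add(1) set_integral_diff(1) set_integrable_mult_right sub[OF that] \<gamma>(2) A1(3) G2(3))
    fix F assume F: "halfline_test \<rho> F"
    note F' = halfline_test_deriv[OF F]
    note F'' = halfline_test_deriv[OF F']
    have i: "integrable lborel (\<lambda>r. of_real (K r) * f r)"
      if "halfline_test \<rho> K" "f \<in> borel_measurable borel" "\<And>b. set_integrable lborel {\<rho>..b} f" for K and f :: "real \<Rightarrow> complex"
      by (rule halfline_test_integrable[OF that(1,2)]) (rule sub[OF _ that(3)])
    note i1 = i[OF F'' \<gamma>] i[OF F' a1m a1i] i[OF F \<gamma>] i[OF F'' A1(2,3)] i[OF F'' G2(2,3)]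
    have p1: "(LINT r|lborel. of_real (deriv (deriv F) r) * A1 r) = - (LINT r|lborel. of_real (deriv F r) * a1 r)"
      unfolding A1_def by (rule halfline_test_by_parts[OF F' a1m a1i])
    have p2: "(LINT r|lborel. of_real (deriv (deriv F) r) * G2 r) = (LINT r|lborel. of_real (F r) * \<gamma> r)"
      using halfline_test_by_parts[OF F' G1(2,3)] halfline_test_by_parts[OF F \<gamma>]
      unfolding G2_def[symmetric] G1_def[symmetric] by simp
    have "(LINT r|lborel. of_real (deriv (deriv F) r) * H r) = (LINT r|lborel. of_real (deriv (deriv F) r) * \<gamma> r
      - of_real (deriv (deriv F) r) * A1 r + q * (of_real (deriv (deriv F) r) * G2 r))"
      unfolding H_def by (simp add: algebra_simps)
    also have "\<dots> = (LINT r|lborel. of_real (deriv (deriv F) r) * \<gamma> r) + (LINT r|lborel. of_real (deriv F r) * a1 r)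
      + q * (LINT r|lborel. of_real (F r) * \<gamma> r)"
      using i1 p1 p2 by simp
    also have "\<dots> = (LINT r|lborel. of_real (deriv (deriv F) r + real M / r * deriv F r) * \<gamma> r + q * (of_real (F r) * \<gamma> r))"
    proof -
      have "of_real (deriv (deriv F) r + real M / r * deriv F r) * \<gamma> r = of_real (deriv (deriv F) r) * \<gamma> r + of_real (deriv F r) * a1 r" for r
        by (simp add: a1_def algebra_simps)
      then show ?thesis using i1 by simp
    qed
    also have "\<dots> = 0" by (rule eq[OF F])
    finally show "(LINT r|lborel. of_real (deriv (deriv F) r) * H r) = 0" .
  qed
  then obtain A B where AB: "AE r in lborel. r > \<rho> \<longrightarrow> H r = A + B * of_real r" by blast
  define g where "g r = A + B * of_real r + A1 r - q * G2 r" for r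
  have AEg: "AE r in lborel. r > \<rho> \<longrightarrow> \<gamma> r = g r"
    using AB by eventually_elim (auto simp: H_def g_def algebra_simps)
  then have "AE r in lebesgue. r > \<rho> \<longrightarrow> \<gamma> r = g r" by (simp add: AE_completion_iff)
  then obtain N where N: "negligible N" "{r. \<not> (r > \<rho> \<longrightarrow> \<gamma> r = g r)} \<subseteq> N"
    by (auto simp: eventually_ae_filter negligible_iff_null_sets)
  \<comment> \<open>The endpoint joins the exceptional set because equality is claimed for
    \<open>r > \<rho>\<close> only.\<close>
  have N': "negligible (insert \<rho> N)" using N(1) by simp
  have Neq: "g r = \<gamma> r" if "r > \<rho>" "r \<notin> N" for r using N(2) that by auto
  have cg: "continuous_on {\<rho>..b} g" for b unfolding g_def by (intro continuous_intros A1(1) G2(1))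
  \<comment> \<open>Changing the integrand on a null set turns integrals of \<open>\<gamma>\<close>
    into integrals of the continuous \<open>g\<close>, to which the fundamental theorem of calculus
    applies.\<close>
  have G1g: "G1 r = integral {\<rho>..r} g" for r
    unfolding G1_def by (rule integral_spike[OF N']) (simp add: Neq)
  have A1g: "A1 r = integral {\<rho>..r} (\<lambda>t. of_real (real M / t) * g t)" for r
    unfolding A1_def by (rule integral_spike[OF N']) (simp add: Neq a1_def)
  have dG1: "(G1 has_vector_derivative g r) (at r)" if "r > \<rho>" for r
    by (rule indefinite_integral_has_vector_derivative[OF cg that G1g])
  have dG2: "(G2 has_vector_derivative G1 r) (at r)" if "r > \<rho>" for r
    by (rule indefinite_integral_has_vector_derivative[OF G1(1) that]) (simp add: G2_def)
  have dA1: "(A1 has_vector_derivative of_real (real M / r) * g r) (at r)" if "r > \<rho>" for r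
    by (rule indefinite_integral_has_vector_derivative[OF _ that A1g]) (use \<rho> in \<open>auto intro!: continuous_intros cg\<close>)
  have dg: "(g has_vector_derivative B + of_real (real M / r) * g r - q * G1 r) (at r)" if r: "r > \<rho>" for r
  proof -
    have "((\<lambda>r. A + B * of_real r) has_vector_derivative B) (at r)"
      by (auto intro!: derivative_eq_intros)
    from has_vector_derivative_diff[OF has_vector_derivative_add[OF this dA1[OF r]] has_vector_derivative_mult_right[OF dG2[OF r], of q]]
    show ?thesis unfolding g_def[abs_def] .
  qed
  define G where "G r = g r * of_real (inverse (r ^ M))" for r
  \<comment> \<open>The flux, \<open>r ^ M\<close> times the derivative of \<open>G\<close>.\<close>
  define Z where "Z r = B - q * G1 r" for r
  have "(G has_vector_derivative Z r / of_real (r ^ M)) (at r)" if r: "r > \<rho>" for r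
  proof -
    have r0: "r > 0" using r \<rho> by simp
    have "((\<lambda>r. inverse (r ^ M)) has_real_derivative - (real M / r) * inverse (r ^ M)) (at r)"
    proof -
      have "((\<lambda>r. inverse (r ^ M)) has_real_derivative - (real M * r ^ (M - Suc 0) * inverse ((r ^ M) ^ Suc (Suc 0)))) (at r)"
        by (rule DERIV_inverse_fun[OF DERIV_pow[of M]]) (use r0 in simp)
      moreover have "- (real M * r ^ (M - Suc 0) * inverse ((r ^ M) ^ Suc (Suc 0))) = - (real M / r) * inverse (r ^ M)"
        using r0 by (cases M) (simp_all add: divide_inverse)
      ultimately show ?thesis by simp
    qed
    then have "((\<lambda>r. complex_of_real (inverse (r ^ M))) has_vector_derivative of_real (- (real M / r) * inverse (r ^ M))) (at r)"
      unfolding has_real_derivative_iff_has_vector_derivative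
      by (rule bounded_linear.has_vector_derivative[OF bounded_linear_of_real])
    from has_vector_derivative_mult[OF dg[OF r] this]
    have "(G has_vector_derivative (g r * of_real (- (real M / r) * inverse (r ^ M)) +
       (B + of_real (real M / r) * g r - q * G1 r) * of_real (inverse (r ^ M)))) (at r)"
      unfolding G_def[abs_def] .
    moreover have "g r * of_real (- (real M / r) * inverse (r ^ M)) +
       (B + of_real (real M / r) * g r - q * G1 r) * of_real (inverse (r ^ M)) = Z r / of_real (r ^ M)"
      by (simp add: Z_def divide_inverse algebra_simps)
    ultimately show ?thesis by simp
  qed
  moreover have "(Z has_vector_derivative - q * of_real (r ^ M) * G r) (at r)" if r: "r > \<rho>" for r
  proof -
    have "((\<lambda>r. B) has_vector_derivative 0) (at r)" by (rule has_vector_derivative_const)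
    from has_vector_derivative_diff[OF this has_vector_derivative_mult_right[OF dG1[OF r], of q]]
    have "(Z has_vector_derivative 0 - q * g r) (at r)" unfolding Z_def[abs_def] .
    moreover have "0 - q * g r = - q * of_real (r ^ M) * G r" using r \<rho> by (simp add: G_def)
    ultimately show ?thesis by (simp only:)
  qed
  moreover have "AE r in lborel. r > \<rho> \<longrightarrow> \<gamma> r = of_real (r ^ M) * G r"
    using AEg by eventually_elim (use \<rho> in \<open>auto simp: G_def\<close>)
  ultimately show ?thesis by blast
qed

section \<open>Separation of variables in polar coordinates\<close>

section \<open>Polar coordinates\<close>

text \<open>The cone measure before completion, because the product with Lebesgue measure and the
  theorems of Fubini work with Borel sets.\<close>

definition unit_sphere_measure :: "(real^'n::finite) measure" where
  "unit_sphere_measure = scale_measure (ennreal (real CARD('n)))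
     (distr (restrict_space lborel (ball 0 1)) borel (\<lambda>x. (1 / norm x) *\<^sub>R x))"

lemma sphere_measure_1: "sphere_measure 1 = completion unit_sphere_measure"
  by (simp add: sphere_measure_def unit_sphere_measure_def)

lemma sets_unit_sphere_measure [measurable_cong]: "sets unit_sphere_measure = sets borel"
  by (simp add: unit_sphere_measure_def)

lemma nn_integral_unit_sphere:
  fixes f :: "real^'n::finite \<Rightarrow> ennreal"
  assumes [measurable]: "f \<in> borel_measurable borel"
  shows "(\<integral>\<^sup>+\<theta>. f \<theta> \<partial>unit_sphere_measure) =
    ennreal (real CARD('n)) * (\<integral>\<^sup>+y. f ((1 / norm y) *\<^sub>R y) * indicator (ball 0 1) y \<partial>lborel)"
proof -
  have m: "(\<lambda>x::real^'n. (1 / norm x) *\<^sub>R x) \<in> restrict_space lborel (ball 0 1) \<rightarrow>\<^sub>M borel"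
    by (intro measurable_restrict_space1) simp
  show ?thesis
    unfolding unit_sphere_measure_def
    by (subst nn_integral_scale_measure, simp, subst nn_integral_distr[OF m], simp,
        subst nn_integral_restrict_space) simp_all
qed

lemma finite_unit_sphere_measure: "finite_measure (unit_sphere_measure :: (real^'n::finite) measure)"
proof
  have "emeasure unit_sphere_measure (space (unit_sphere_measure :: (real^'n) measure)) = (\<integral>\<^sup>+\<theta>. 1 \<partial>(unit_sphere_measure :: (real^'n) measure))"
    by simp
  also have "\<dots> = ennreal (real CARD('n)) * emeasure lborel (ball (0::real^'n) 1)"
    by (subst nn_integral_unit_sphere) simp_all
  also have "\<dots> < \<infinity>" 
    using emeasure_lborel_ball_finite[of "0::real^'n" 1] by (simp add: ennreal_mult_less_top)
  finally show "emeasure unit_sphere_measure (space (unit_sphere_measure :: (real^'n) measure)) \<noteq> \<infinity>" by simp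
qed

lemma AE_unit_sphere_norm: "AE \<theta> in (unit_sphere_measure :: (real^'n::finite) measure). norm \<theta> = 1"
proof -
  let ?f = "indicator {\<theta>::real^'n. norm \<theta> \<noteq> 1} :: _ \<Rightarrow> ennreal"
  have "AE y in lborel. y \<noteq> (0::real^'n)" by (rule AE_lborel_singleton)
  then have "AE y in lborel. ?f ((1 / norm y) *\<^sub>R y) * indicator (ball 0 1) y = 0"
    by eventually_elim simp
  then have "(\<integral>\<^sup>+y. ?f ((1 / norm y) *\<^sub>R y) * indicator (ball 0 1) y \<partial>lborel) = (\<integral>\<^sup>+(y::real^'n). 0 \<partial>lborel)"
    by (rule nn_integral_cong_AE)
  then have "(\<integral>\<^sup>+\<theta>. ?f \<theta> \<partial>unit_sphere_measure) = 0"
    by (subst nn_integral_unit_sphere) simp_all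
  then have "AE \<theta> in unit_sphere_measure. ?f \<theta> = 0"
    by (subst (asm) nn_integral_0_iff_AE) simp_all
  then show ?thesis by eventually_elim (auto simp: indicator_def split: if_splits)
qed

text \<open>Supplies the weight in \<open>t\<close> on \<open>{norm x..}\<close> whose integral
  cancels the factor \<open>norm x ^ d\<close> left over by the substitutions in polar
  coordinates.\<close>

lemma nn_integral_inverse_power_tail:
  fixes s :: real
  assumes s: "s > 0" and n: "n > 0"
  shows "(\<integral>\<^sup>+t. ennreal (real n * (1 / t) ^ (n + 1)) * indicator {s..} t \<partial>lborel) = ennreal ((1 / s) ^ n)"
proof -
  define f where "f t = real n * (1 / t) ^ (n + 1)" for t :: real
  have "(\<integral>\<^sup>+t. ennreal (f t) * indicator {s..} t \<partial>lborel) = ennreal (0 - - ((1 / s) ^ n))"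
  proof (rule nn_integral_FTC_atLeast)
    show "f \<in> borel_measurable borel" unfolding f_def by measurable
    fix t assume t: "s \<le> t"
    then have t0: "t > 0" using s by simp
    have "((\<lambda>t. 1 / t) has_real_derivative - ((1 / t)\<^sup>2)) (at t)"
      using t0 by (auto intro!: derivative_eq_intros simp: power2_eq_square)
    from DERIV_minus[OF DERIV_power[OF this, of n]]
    have "((\<lambda>t. - ((1 / t) ^ n)) has_real_derivative - (real n * ((1 / t) ^ (n - Suc 0) * - ((1 / t)\<^sup>2)))) (at t)"
      by (simp add: mult_ac)
    moreover have "- (real n * ((1 / t) ^ (n - Suc 0) * - ((1 / t)\<^sup>2))) = f t"
      using n by (cases n) (simp_all add: f_def power2_eq_square)
    ultimately show "((\<lambda>t. - ((1 / t) ^ n)) has_real_derivative f t) (at t)" by simp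
    show "0 \<le> f t" using t0 by (simp add: f_def)
  next
    have "((\<lambda>t::real. 1 / t) \<longlongrightarrow> 0) at_top" by real_asymp
    from tendsto_minus[OF tendsto_power[OF this, of n]]
    show "((\<lambda>t::real. - ((1 / t) ^ n)) \<longlongrightarrow> 0) at_top" unfolding zero_power[OF n] minus_zero .
  qed
  then show ?thesis unfolding f_def by simp
qed

lemma nn_integral_scaling:
  fixes f :: "'a::euclidean_space \<Rightarrow> ennreal"
  assumes [measurable]: "f \<in> borel_measurable borel" and t: "t > 0"
  shows "(\<integral>\<^sup>+x. f x \<partial>lborel) = ennreal (t ^ DIM('a)) * (\<integral>\<^sup>+y. f (t *\<^sub>R y) \<partial>lborel)"
proof -
  have "t \<noteq> 0" using t by simp
  from lborel_affine[OF this, of "0::'a"]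
  have "(\<integral>\<^sup>+x. f x \<partial>lborel) = (\<integral>\<^sup>+x. f x \<partial>density (distr lborel borel (\<lambda>x::'a. 0 + t *\<^sub>R x)) (\<lambda>_. \<bar>t\<bar> ^ DIM('a)))"
    by simp
  also have "\<dots> = ennreal (t ^ DIM('a)) * (\<integral>\<^sup>+y. f (t *\<^sub>R y) \<partial>lborel)"
    using t by (simp add: nn_integral_density nn_integral_distr nn_integral_cmult)
  finally show ?thesis .
qed

text \<open>Both sides are turned into integrals over pairs \<open>(y, t)\<close> with \<open>y\<close> in the unit ball and \<open>x = t y\<close>.\<close>

theorem nn_integral_polar:
  fixes f :: "real^'n::finite \<Rightarrow> ennreal"
  assumes f[measurable]: "f \<in> borel_measurable borel"
  shows "(\<integral>\<^sup>+x. f x \<partial>lborel) = (\<integral>\<^sup>+r. indicator {0<..} r * ennreal (r ^ (CARD('n) - 1)) *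
    (\<integral>\<^sup>+\<theta>. f (r *\<^sub>R \<theta>) \<partial>unit_sphere_measure) \<partial>lborel)"
proof -
  let ?d = "CARD('n)"
  have d: "?d > 0" by simp
  \<comment> \<open>One integrand in three pairs of variables: \<open>h\<close> in the radius
    \<open>r\<close> and \<open>y\<close>, \<open>k\<close> after \<open>r = norm y * t\<close> for
    fixed \<open>y\<close>, and \<open>l\<close> after \<open>x = t *\<^sub>R y\<close> for fixed
    \<open>t\<close>. In \<open>l\<close>, the condition \<open>norm x < t\<close> says that
    \<open>y\<close> lies in the unit ball.\<close>
  define k :: "real \<Rightarrow> real^'n \<Rightarrow> ennreal" where
    "k t y = indicator {0<..} t * ennreal (real ?d * t ^ (?d - 1) * norm y ^ ?d) * indicator (ball 0 1) y * f (t *\<^sub>R y)" for t y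
  define h :: "real \<Rightarrow> real^'n \<Rightarrow> ennreal" where
    "h r y = indicator {0<..} r * ennreal (real ?d * r ^ (?d - 1)) * indicator (ball 0 1) y * f ((r / norm y) *\<^sub>R y)" for r y
  define l :: "real \<Rightarrow> real^'n \<Rightarrow> ennreal" where
    "l t x = indicator {0<..} t * ennreal (real ?d * (1 / t) ^ (?d + 1) * norm x ^ ?d) * indicator {z. norm z < t} x * f x" for t x
  have eqm: "(borel_measurable (lborel \<Otimes>\<^sub>M lborel) :: (real \<times> (real^'n) \<Rightarrow> ennreal) set) = borel_measurable (borel \<Otimes>\<^sub>M borel)"
    by (intro measurable_cong_sets sets_pair_measure_cong sets_lborel refl)
  have mk: "case_prod k \<in> borel_measurable (lborel \<Otimes>\<^sub>M lborel)"
    unfolding eqm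
  proof -
    have "case_prod k = (\<lambda>p. (if 0 < fst p then 1 else 0) * ennreal (real ?d * fst p ^ (?d - 1) * norm (snd p) ^ ?d)
        * (if norm (snd p) < 1 then 1 else 0) * f (fst p *\<^sub>R snd p))"
      by (auto simp: k_def indicator_def split_beta)
    also have "\<dots> \<in> borel_measurable (borel \<Otimes>\<^sub>M borel)" by measurable
    finally show "case_prod k \<in> borel_measurable (borel \<Otimes>\<^sub>M borel)" .
  qed
  have mh: "case_prod h \<in> borel_measurable (lborel \<Otimes>\<^sub>M lborel)"
    unfolding eqm
  proof -
    have "case_prod h = (\<lambda>p. (if 0 < fst p then 1 else 0) * ennreal (real ?d * fst p ^ (?d - 1))
        * (if norm (snd p) < 1 then 1 else 0) * f ((fst p / norm (snd p)) *\<^sub>R snd p))"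
      by (auto simp: h_def indicator_def split_beta)
    also have "\<dots> \<in> borel_measurable (borel \<Otimes>\<^sub>M borel)" by measurable
    finally show "case_prod h \<in> borel_measurable (borel \<Otimes>\<^sub>M borel)" .
  qed
  have ml: "case_prod l \<in> borel_measurable (lborel \<Otimes>\<^sub>M lborel)"
    unfolding eqm
  proof -
    have "case_prod l = (\<lambda>p. (if 0 < fst p then 1 else 0) * ennreal (real ?d * (1 / fst p) ^ (?d + 1) * norm (snd p) ^ ?d)
        * (if norm (snd p) < fst p then 1 else 0) * f (snd p))"
      by (auto simp: l_def indicator_def split_beta)
    also have "\<dots> \<in> borel_measurable (borel \<Otimes>\<^sub>M borel)" by measurable
    finally show "case_prod l \<in> borel_measurable (borel \<Otimes>\<^sub>M borel)" .
  qed
  have AE0: "AE y in lborel. y \<noteq> (0::real^'n)" by (rule AE_lborel_singleton)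
  have "(\<integral>\<^sup>+r. indicator {0<..} r * ennreal (r ^ (?d - 1)) * (\<integral>\<^sup>+\<theta>. f (r *\<^sub>R \<theta>) \<partial>unit_sphere_measure) \<partial>lborel)
      = (\<integral>\<^sup>+r. \<integral>\<^sup>+y. h r y \<partial>lborel \<partial>lborel)"
  proof (rule nn_integral_cong)
    fix r :: real
    have "(\<integral>\<^sup>+\<theta>. f (r *\<^sub>R \<theta>) \<partial>unit_sphere_measure) =
      ennreal (real ?d) * (\<integral>\<^sup>+y. f (r *\<^sub>R ((1 / norm y) *\<^sub>R y)) * indicator (ball 0 1) y \<partial>lborel)"
      by (rule nn_integral_unit_sphere) measurable
    moreover have "(\<lambda>y. f (r *\<^sub>R ((1 / norm y) *\<^sub>R y)) * indicator (ball 0 1) y) \<in> borel_measurable lborel"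
    proof -
      have "(\<lambda>y. f (r *\<^sub>R ((1 / norm y) *\<^sub>R y)) * indicator (ball 0 1) y) = (\<lambda>y. if norm y < 1 then f (r *\<^sub>R ((1 / norm y) *\<^sub>R y)) else 0)"
        by (auto simp: indicator_def)
      also have "\<dots> \<in> borel_measurable borel" by measurable
      finally show ?thesis by (simp only: measurable_lborel2)
    qed
    ultimately have "indicator {0<..} r * ennreal (r ^ (?d - 1)) * (\<integral>\<^sup>+\<theta>. f (r *\<^sub>R \<theta>) \<partial>unit_sphere_measure)
       = (\<integral>\<^sup>+y. (indicator {0<..} r * ennreal (r ^ (?d - 1)) * ennreal (real ?d)) * (f (r *\<^sub>R ((1 / norm y) *\<^sub>R y)) * indicator (ball 0 1) y) \<partial>lborel)"
      by (subst nn_integral_cmult) (simp_all only: mult.assoc)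
    also have "\<dots> = (\<integral>\<^sup>+y. h r y \<partial>lborel)"
      by (intro nn_integral_cong) (auto simp: h_def indicator_def ennreal_mult' mult_ac)
    finally show "indicator {0<..} r * ennreal (r ^ (?d - 1)) * (\<integral>\<^sup>+\<theta>. f (r *\<^sub>R \<theta>) \<partial>unit_sphere_measure)
      = (\<integral>\<^sup>+y. h r y \<partial>lborel)" .
  qed
  also have "\<dots> = (\<integral>\<^sup>+y. \<integral>\<^sup>+r. h r y \<partial>lborel \<partial>lborel)" by (rule lborel_pair.Fubini'[OF mh, symmetric])
  also have "\<dots> = (\<integral>\<^sup>+y. \<integral>\<^sup>+t. k t y \<partial>lborel \<partial>lborel)"
  proof (rule nn_integral_cong_AE, use AE0 in eventually_elim)
    fix y :: "real^'n" assume y: "y \<noteq> 0"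
    have "(\<integral>\<^sup>+r. h r y \<partial>lborel) = ennreal \<bar>norm y\<bar> * (\<integral>\<^sup>+t. h (0 + norm y * t) y \<partial>lborel)"
      using y unfolding h_def by (intro nn_integral_real_affine) measurable
    also have "\<dots> = (\<integral>\<^sup>+t. ennreal \<bar>norm y\<bar> * h (0 + norm y * t) y \<partial>lborel)"
      unfolding h_def by (rule nn_integral_cmult[symmetric]) measurable
    also have "\<dots> = (\<integral>\<^sup>+t. k t y \<partial>lborel)"
    proof (rule nn_integral_cong)
      fix t :: real
      show "ennreal \<bar>norm y\<bar> * h (0 + norm y * t) y = k t y"
      proof (cases "t > 0")
        case True
        have "norm y ^ ?d = norm y * norm y ^ (?d - 1)" using d by (metis power_eq_if zero_less_iff_neq_zero)
        then have E: "norm y * (real ?d * (norm y * t) ^ (?d - 1)) = real ?d * t ^ (?d - 1) * norm y ^ ?d"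
          by (simp add: power_mult_distrib mult_ac)
        have "ennreal \<bar>norm y\<bar> * ennreal (real ?d * (norm y * t) ^ (?d - 1)) = ennreal (real ?d * t ^ (?d - 1) * norm y ^ ?d)"
          unfolding abs_norm_cancel E[symmetric] by (rule ennreal_mult'[symmetric]) simp
        then show ?thesis using True y
          by (simp add: h_def k_def mult.assoc[symmetric])
      next
        case False
        then have "\<not> 0 < norm y * t" using y by (simp add: zero_less_mult_iff)
        then show ?thesis using False by (simp add: h_def k_def)
      qed
    qed
    finally show "(\<integral>\<^sup>+r. h r y \<partial>lborel) = (\<integral>\<^sup>+t. k t y \<partial>lborel)" .
  qed
  also have "\<dots> = (\<integral>\<^sup>+t. \<integral>\<^sup>+y. k t y \<partial>lborel \<partial>lborel)" by (rule lborel_pair.Fubini'[OF mk])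
  also have "\<dots> = (\<integral>\<^sup>+t. \<integral>\<^sup>+x. l t x \<partial>lborel \<partial>lborel)"
  proof (rule nn_integral_cong)
    fix t :: real
    show "(\<integral>\<^sup>+y. k t y \<partial>lborel) = (\<integral>\<^sup>+x. l t x \<partial>lborel)"
    proof (cases "t > 0")
      case True
      have ml': "l t \<in> borel_measurable borel" unfolding l_def by measurable
      have "(\<integral>\<^sup>+x. l t x \<partial>lborel) = ennreal (t ^ DIM(real^'n)) * (\<integral>\<^sup>+y. l t (t *\<^sub>R y) \<partial>lborel)"
        by (rule nn_integral_scaling[OF ml' True])
      also have "\<dots> = (\<integral>\<^sup>+y. ennreal (t ^ DIM(real^'n)) * l t (t *\<^sub>R y) \<partial>lborel)"
        by (rule nn_integral_cmult[symmetric]) (use ml' in measurable)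
      also have "\<dots> = (\<integral>\<^sup>+y. k t y \<partial>lborel)"
      proof (rule nn_integral_cong)
        fix y :: "real^'n"
        have ind: "indicator {z. norm z < t} (t *\<^sub>R y) = (indicator (ball 0 1) y :: ennreal)"
          using True by (simp add: indicator_def)
        have "t ^ ?d * (1 / t) ^ (?d + 1) * t ^ ?d = t ^ (?d - 1)"
          using True d by (cases ?d) (simp_all add: power_one_over field_simps)
        then have "(real ?d * norm y ^ ?d) * (t ^ ?d * (1 / t) ^ (?d + 1) * t ^ ?d) = (real ?d * norm y ^ ?d) * t ^ (?d - 1)"
          by (simp only:)
        moreover have "norm (t *\<^sub>R y) ^ ?d = t ^ ?d * norm y ^ ?d" using True by (simp add: power_mult_distrib)
        ultimately have E: "t ^ ?d * (real ?d * (1 / t) ^ (?d + 1) * norm (t *\<^sub>R y) ^ ?d) = real ?d * t ^ (?d - 1) * norm y ^ ?d"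
          by (simp only: mult_ac)
        have "ennreal (t ^ ?d) * ennreal (real ?d * (1 / t) ^ (?d + 1) * norm (t *\<^sub>R y) ^ ?d) = ennreal (real ?d * t ^ (?d - 1) * norm y ^ ?d)"
          unfolding E[symmetric] using True by (intro ennreal_mult'[symmetric]) simp
        then show "ennreal (t ^ DIM(real^'n)) * l t (t *\<^sub>R y) = k t y"
          unfolding l_def k_def ind using True by (simp add: mult.assoc[symmetric] del: norm_scaleR)
      qed
      finally show ?thesis by simp
    next
      case False
      then show ?thesis by (simp add: k_def l_def)
    qed
  qed
  also have "\<dots> = (\<integral>\<^sup>+x. \<integral>\<^sup>+t. l t x \<partial>lborel \<partial>lborel)" by (rule lborel_pair.Fubini'[OF ml, symmetric])
  also have "\<dots> = (\<integral>\<^sup>+x. f x \<partial>lborel)"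
  proof (rule nn_integral_cong_AE, use AE0 in eventually_elim)
    fix x :: "real^'n" assume x: "x \<noteq> 0"
    \<comment> \<open>\<open>l\<close> carries the strict condition \<open>norm x < t\<close>, the
      tail integral the closed half line; they differ at this one point.\<close>
    have AE1: "AE t in lborel. t \<noteq> norm x" by (rule AE_lborel_singleton)
    have "(\<integral>\<^sup>+t. l t x \<partial>lborel) = (\<integral>\<^sup>+t. (ennreal (norm x ^ ?d) * f x) * (ennreal (real ?d * (1 / t) ^ (?d + 1)) * indicator {norm x..} t) \<partial>lborel)"
    proof (rule nn_integral_cong_AE, use AE1 in eventually_elim)
      fix t assume t: "t \<noteq> norm x"
      show "l t x = (ennreal (norm x ^ ?d) * f x) * (ennreal (real ?d * (1 / t) ^ (?d + 1)) * indicator {norm x..} t)"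
      proof (cases "norm x < t")
        case True
        then have t0: "t > 0" using norm_ge_zero[of x] by linarith
        have "ennreal (real ?d * (1 / t) ^ (?d + 1) * norm x ^ ?d) = ennreal (norm x ^ ?d) * ennreal (real ?d * (1 / t) ^ (?d + 1))"
          by (subst ennreal_mult'[symmetric]) (simp_all add: mult.commute)
        then show ?thesis using True t0 by (simp add: l_def mult_ac)
      next
        case False
        then show ?thesis using t by (simp add: l_def)
      qed
    qed
    also have "\<dots> = (ennreal (norm x ^ ?d) * f x) * ennreal ((1 / norm x) ^ ?d)"
      by (subst nn_integral_cmult, measurable, subst nn_integral_inverse_power_tail) (use x in simp_all)
    also have "\<dots> = f x * ennreal (norm x ^ ?d * (1 / norm x) ^ ?d)"
      by (subst ennreal_mult') (simp_all add: mult_ac)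
    also have "norm x ^ ?d * (1 / norm x) ^ ?d = 1" using x by (simp add: power_one_over)
    finally show "(\<integral>\<^sup>+t. l t x \<partial>lborel) = f x" by simp
  qed
  finally show ?thesis by simp
qed

text \<open>Stated as an equality of measures, the formula for nonnegative functions carries over to
  integrable ones through \<open>distr\<close> and \<open>density\<close>.\<close>

lemma lborel_polar:
  "(lborel :: (real^'n::finite) measure) = distr
     (density (lborel \<Otimes>\<^sub>M unit_sphere_measure) (\<lambda>(r, \<theta>). ennreal (indicator {0<..} r * r ^ (CARD('n) - 1)))) borel (\<lambda>(r, \<theta>). r *\<^sub>R \<theta>)"
proof (rule measure_eqI)
  interpret finite_measure "unit_sphere_measure :: (real^'n) measure" by (rule finite_unit_sphere_measure)
  fix A :: "(real^'n) set" assume "A \<in> sets lborel"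
  then have A[measurable]: "A \<in> sets borel" by simp
  have "emeasure lborel A = (\<integral>\<^sup>+x. indicator A x \<partial>lborel)" by simp
  also have "\<dots> = (\<integral>\<^sup>+r. indicator {0<..} r * ennreal (r ^ (CARD('n) - 1)) *
      (\<integral>\<^sup>+\<theta>. indicator A (r *\<^sub>R \<theta>) \<partial>(unit_sphere_measure :: (real^'n) measure)) \<partial>lborel)"
    by (rule nn_integral_polar) simp
  also have "\<dots> = (\<integral>\<^sup>+r. \<integral>\<^sup>+\<theta>. ennreal (indicator {0<..} r * r ^ (CARD('n) - 1)) * indicator A (r *\<^sub>R \<theta>) \<partial>(unit_sphere_measure :: (real^'n) measure) \<partial>lborel)"
  proof (rule nn_integral_cong)
    fix r :: real
    have "indicator {0<..} r * ennreal (r ^ (CARD('n) - 1)) = ennreal (indicator {0<..} r * r ^ (CARD('n) - 1))"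
      by (auto simp: indicator_def)
    then show "indicator {0<..} r * ennreal (r ^ (CARD('n) - 1)) *
      (\<integral>\<^sup>+\<theta>. indicator A (r *\<^sub>R \<theta>) \<partial>(unit_sphere_measure :: (real^'n) measure)) =
      (\<integral>\<^sup>+\<theta>. ennreal (indicator {0<..} r * r ^ (CARD('n) - 1)) * indicator A (r *\<^sub>R \<theta>) \<partial>(unit_sphere_measure :: (real^'n) measure))"
      by (subst nn_integral_cmult) simp_all
  qed
  also have "\<dots> = (\<integral>\<^sup>+p. (case p of (r, \<theta>) \<Rightarrow> ennreal (indicator {0<..} r * r ^ (CARD('n) - 1))) * indicator A (case p of (r, \<theta>) \<Rightarrow> r *\<^sub>R \<theta>)
       \<partial>(lborel \<Otimes>\<^sub>M (unit_sphere_measure :: (real^'n) measure)))"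
    by (subst nn_integral_fst[symmetric]) simp_all
  also have "\<dots> = (\<integral>\<^sup>+x. indicator A x \<partial>distr
     (density (lborel \<Otimes>\<^sub>M (unit_sphere_measure :: (real^'n) measure)) (\<lambda>(r, \<theta>). ennreal (indicator {0<..} r * r ^ (CARD('n) - 1)))) borel (\<lambda>(r, \<theta>). r *\<^sub>R \<theta>))"
    by (subst nn_integral_distr) (simp_all add: nn_integral_density)
  finally show "emeasure lborel A = emeasure (distr
     (density (lborel \<Otimes>\<^sub>M unit_sphere_measure) (\<lambda>(r, \<theta>). ennreal (indicator {0<..} r * r ^ (CARD('n) - 1)))) borel (\<lambda>(r, \<theta>). r *\<^sub>R \<theta>)) A"
    by simp
qed simp

theorem integral_polar:
  fixes F :: "real^'n::finite \<Rightarrow> 'b::{banach, second_countable_topology}"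
  assumes F: "integrable lborel F"
  defines "w \<equiv> \<lambda>r::real. indicator {0<..} r * r ^ (CARD('n) - 1)"
  shows "(LINT x|lborel. F x) = (LINT r|lborel. w r *\<^sub>R (LINT \<theta>|unit_sphere_measure. F (r *\<^sub>R \<theta>)))"
    and "integrable lborel (\<lambda>r. w r *\<^sub>R (LINT \<theta>|unit_sphere_measure. F (r *\<^sub>R \<theta>)))"
    and "AE r in lborel. r > 0 \<longrightarrow> integrable unit_sphere_measure (\<lambda>\<theta>. F (r *\<^sub>R \<theta>))"
proof -
  interpret S: finite_measure "unit_sphere_measure :: (real^'n) measure" by (rule finite_unit_sphere_measure)
  interpret P: pair_sigma_finite "lborel :: real measure" "unit_sphere_measure :: (real^'n) measure" ..
  have Fm[measurable]: "F \<in> borel_measurable borel" using F by simp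
  have wm[measurable]: "w \<in> borel_measurable borel" unfolding w_def by measurable
  have w0: "0 \<le> w r" for r by (simp add: w_def indicator_def)
  let ?P = "lborel \<Otimes>\<^sub>M (unit_sphere_measure :: (real^'n) measure)"
  have dens: "density ?P (\<lambda>(r, \<theta>). ennreal (indicator {0<..} r * r ^ (CARD('n) - 1))) = density ?P (\<lambda>p. ennreal (w (fst p)))"
    unfolding w_def by (intro arg_cong[where f="density ?P"]) auto
  have m1: "(\<lambda>(r, \<theta>). r *\<^sub>R \<theta>) \<in> density ?P (\<lambda>p. ennreal (w (fst p))) \<rightarrow>\<^sub>M (borel :: (real^'n) measure)" by simp
  have m2: "(\<lambda>p. F (fst p *\<^sub>R snd p)) \<in> borel_measurable ?P" by measurable
  have int: "integrable ?P (\<lambda>p. w (fst p) *\<^sub>R F (fst p *\<^sub>R snd p))"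
    using F unfolding lborel_polar dens
    by (subst (asm) integrable_distr_eq[OF m1 Fm]) (simp add: split_beta integrable_density[OF m2] w0)
  have "(LINT x|lborel. F x) = (LINT p|?P. w (fst p) *\<^sub>R F (fst p *\<^sub>R snd p))"
    unfolding lborel_polar[where 'n='n] dens
    by (subst integral_distr[OF m1 Fm]) (simp add: split_beta integral_density[OF m2] w0)
  then show "(LINT x|lborel. F x) = (LINT r|lborel. w r *\<^sub>R (LINT \<theta>|unit_sphere_measure. F (r *\<^sub>R \<theta>)))"
    using P.integral_fst'[OF int] by simp
  show "integrable lborel (\<lambda>r. w r *\<^sub>R (LINT \<theta>|unit_sphere_measure. F (r *\<^sub>R \<theta>)))"
    using P.integrable_fst'[OF int] by simp
  show "AE r in lborel. r > 0 \<longrightarrow> integrable unit_sphere_measure (\<lambda>\<theta>. F (r *\<^sub>R \<theta>))"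
    using P.AE_integrable_fst'[OF int]
  proof eventually_elim
    case (elim r)
    show ?case
    proof
      assume r: "r > 0"
      then have "w r \<noteq> 0" by (simp add: w_def)
      from integrable_scaleR_right[OF elim[unfolded fst_conv snd_conv], of "inverse (w r)"] this
      show "integrable unit_sphere_measure (\<lambda>\<theta>. F (r *\<^sub>R \<theta>))" by simp
    qed
  qed
qed

text \<open>The polar formula for the indicator of a null set; the radial weight is positive for
  \<open>r > 0\<close> and can be divided out.\<close>

lemma AE_polar:
  fixes P :: "real^'n::finite \<Rightarrow> bool"
  assumes "AE x in lborel. P x"
  shows "AE r in lborel. r > 0 \<longrightarrow> (AE \<theta> in unit_sphere_measure. P (r *\<^sub>R \<theta>))"
proof -
  obtain N where N: "{x. \<not> P x} \<subseteq> N" "N \<in> null_sets lborel" using assms by (auto simp: eventually_ae_filter)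
  have Nb[measurable]: "N \<in> sets borel" using N(2) by auto
  interpret S: finite_measure "unit_sphere_measure :: (real^'n) measure" by (rule finite_unit_sphere_measure)
  have "(\<integral>\<^sup>+x. indicator N x \<partial>lborel) = 0" using N(2) by auto
  then have "(\<integral>\<^sup>+r. indicator {0<..} r * ennreal (r ^ (CARD('n) - 1)) *
      (\<integral>\<^sup>+\<theta>. indicator N (r *\<^sub>R \<theta>) \<partial>(unit_sphere_measure :: (real^'n) measure)) \<partial>lborel) = 0"
    by (subst (asm) nn_integral_polar) simp_all
  then have "AE r in lborel. indicator {0<..} r * ennreal (r ^ (CARD('n) - 1)) *
      (\<integral>\<^sup>+\<theta>. indicator N (r *\<^sub>R \<theta>) \<partial>(unit_sphere_measure :: (real^'n) measure)) = 0"
    by (subst (asm) nn_integral_0_iff_AE) measurable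
  then show ?thesis
  proof eventually_elim
    case (elim r)
    show ?case
    proof
      assume r: "r > 0"
      then have "(\<integral>\<^sup>+\<theta>. indicator N (r *\<^sub>R \<theta>) \<partial>(unit_sphere_measure :: (real^'n) measure)) = 0"
        using elim zero_less_power[OF r, of "CARD('n) - 1"] by (auto simp: not_le[symmetric])
      then have "AE \<theta> in unit_sphere_measure. (indicator N (r *\<^sub>R \<theta>) :: ennreal) = 0"
        by (subst (asm) nn_integral_0_iff_AE) simp_all
      then show "AE \<theta> in unit_sphere_measure. P (r *\<^sub>R \<theta>)"
        by eventually_elim (use N(1) in \<open>auto simp: indicator_def split: if_splits\<close>)
    qed
  qed
qed

section \<open>Radial test functions and solid harmonics\<close>

lemma DERIV_zero_off_support:
  assumes "\<forall>x. x < a \<or> b < x \<longrightarrow> F x = (0::real)" "x < a \<or> b < x"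
  shows "(F has_real_derivative 0) (at x)"
  by (rule has_field_derivative_transform_within_open[OF DERIV_const[of 0], of "- {a..b}"])
    (use assms in \<open>auto simp: open_Compl\<close>)

text \<open>The derivative, \<open>F' - F / r\<close> divided by \<open>r\<close>, has the same
  shape and its numerator the same support bounds, which closes the induction. Near the origin there
  is nothing to divide, since \<open>F\<close> vanishes on \<open>{..<a}\<close>.\<close>

lemma Cr_divide:
  assumes a: "0 < a" and supp: "\<forall>x. x < a \<or> b < x \<longrightarrow> F x = 0" and F: "Cr k F"
  shows "Cr k (\<lambda>r. F r / r)"
  using supp F
proof (induction k arbitrary: F)
  case 0
  have "isCont (\<lambda>r. F r / r) x" for x
  proof (cases "x < a")
    case True
    have "((\<lambda>r. F r / r) has_real_derivative 0) (at x)"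
      by (rule DERIV_zero_off_support[of a b]) (use 0 True in auto)
    then show ?thesis by (rule DERIV_isCont)
  next
    case False
    have "isCont F x" using 0 by (simp add: continuous_on_eq_continuous_at)
    then show ?thesis using False a by (intro continuous_intros) auto
  qed
  then show ?case by (simp add: continuous_at_imp_continuous_on)
next
  case (Suc k)
  have dF: "(F has_real_derivative deriv F x) (at x)" for x using Suc.prems(2) by simp
  have d0: "deriv F x = 0" if "x < a \<or> b < x" for x
    by (rule DERIV_imp_deriv[OF DERIV_zero_off_support[OF Suc.prems(1) that]])
  have Fk: "Cr k F" using Suc.prems(2) by (rule Cr_Suc_imp)
  have supp': "\<forall>x. x < a \<or> b < x \<longrightarrow> deriv F x + (-1) * (F x / x) = 0" using Suc.prems(1) d0 by auto
  show ?case
  proof (rule Cr_SucI)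
    show "((\<lambda>r. F r / r) has_real_derivative (deriv F x + (-1) * (F x / x)) / x) (at x)" for x
    proof (cases "x < a")
      case True
      have "((\<lambda>r. F r / r) has_real_derivative 0) (at x)"
        by (rule DERIV_zero_off_support[of a b]) (use Suc.prems(1) True in auto)
      then show ?thesis using supp' True by simp
    next
      case False
      then have x: "x \<noteq> 0" using a by simp
      from DERIV_divide[OF dF[of x] DERIV_ident x] show ?thesis
        using x by (simp add: field_simps)
    qed
    show "Cr k (\<lambda>x. (deriv F x + (-1) * (F x / x)) / x)"
      by (rule Suc.IH[OF supp']) (use Suc.prems Fk in \<open>intro Cr_add Cr_mult Cr_const Suc.IH, simp_all\<close>)
  qed
qed

lemma halfline_test_divide:
  assumes \<rho>: "0 \<le> \<rho>" and F: "halfline_test \<rho> F" shows "halfline_test \<rho> (\<lambda>r. F r / r)"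
proof -
  obtain a b where ab: "\<rho> < a" "a < b" "\<forall>x. x < a \<or> b < x \<longrightarrow> F x = 0"
    using F unfolding halfline_test_def by (elim conjE exE)
  show ?thesis
    by (rule halfline_testI[OF Cr_divide ab(1,2)]) (use \<rho> ab halfline_test_Cr[OF F] in auto)
qed

text \<open>The profile vanishes below some \<open>a > \<rho> \<ge> 0\<close>, so the function is
  zero around the origin and the singularity of the norm is never met.\<close>

lemma radial_has_derivative:
  fixes x :: "real^'n::finite"
  assumes \<rho>: "0 \<le> \<rho>" and F: "halfline_test \<rho> F"
  shows "((\<lambda>x. complex_of_real (F (norm x))) has_derivative (\<lambda>h. of_real (deriv F (norm x) / norm x) * of_real (x \<bullet> h))) (at x)"
proof -
  obtain a b where ab: "\<rho> < a" "a < b" "\<forall>x. x < a \<or> b < x \<longrightarrow> F x = 0"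
    using F unfolding halfline_test_def by (elim conjE exE)
  show ?thesis
  proof (cases "x = 0")
    case True
    have "((\<lambda>x::real^'n. complex_of_real (F (norm x))) has_derivative (\<lambda>h. 0)) (at x)"
      by (rule has_derivative_transform_within_open[OF has_derivative_const[of 0], of "ball 0 a"])
        (use True ab \<rho> in auto)
    then show ?thesis using True by simp
  next
    case False
    have "(F has_derivative (\<lambda>h. h * deriv F (norm x))) (at (norm x))"
      using halfline_test_DERIV[OF F, of "norm x"] by (simp add: has_field_derivative_def mult.commute[of _ "deriv F (norm x)"])
    from has_derivative_compose[OF has_derivative_norm[OF False] this]
    have "((\<lambda>x. F (norm x)) has_derivative (\<lambda>h. (h \<bullet> sgn x) * deriv F (norm x))) (at x)" .
    from has_derivative_of_real[OF this]
    have "((\<lambda>x. complex_of_real (F (norm x))) has_derivative (\<lambda>h. of_real ((h \<bullet> sgn x) * deriv F (norm x)))) (at x)" .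
    moreover have "(h \<bullet> sgn x) * deriv F (norm x) = (deriv F (norm x) / norm x) * (x \<bullet> h)" for h
      by (simp add: sgn_div_norm inner_commute divide_inverse)
    ultimately show ?thesis by (simp only: of_real_mult)
  qed
qed

lemma partial_radial:
  assumes "0 \<le> \<rho>" "halfline_test \<rho> F"
  shows "partial i (\<lambda>x::real^'n::finite. complex_of_real (F (norm x))) = (\<lambda>x. of_real (deriv F (norm x) / norm x) * of_real (x $ i))"
  by (rule ext, subst partial_unique[OF radial_has_derivative[OF assms]]) (simp add: inner_axis)

lemma radial_differentiable:
  assumes "0 \<le> \<rho>" "halfline_test \<rho> F"
  shows "(\<lambda>x::real^'n::finite. complex_of_real (F (norm x))) differentiable_on UNIV"
  using radial_has_derivative[OF assms] by (auto simp: differentiable_on_def differentiable_def)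

lemma bounded_linear_coordinate: "bounded_linear (\<lambda>x::real^'n::finite. complex_of_real (x $ i))"
  by (rule bounded_linear_compose[OF bounded_linear_of_real bounded_linear_vec_nth])

text \<open>A partial derivative is a radial function with the admissible profile
  \<open>deriv F r / r\<close>, times a coordinate, so the induction reproduces its own
  hypothesis.\<close>

lemma Ck_radial:
  assumes "0 \<le> \<rho>" "halfline_test \<rho> F" shows "Ck k (\<lambda>x::real^'n::finite. complex_of_real (F (norm x)))"
  using assms(2)
proof (induction k arbitrary: F)
  case 0
  then show ?case
    using differentiable_imp_continuous_on[OF radial_differentiable[OF assms(1) 0]] by simp
next
  case (Suc k)
  have "Ck k (\<lambda>x::real^'n. complex_of_real (deriv F (norm x) / norm x) * of_real (x $ i))" for i
    by (intro Ck_mult Suc.IH halfline_test_divide[OF assms(1) halfline_test_deriv[OF Suc.prems]]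
        Ck_bounded_linear bounded_linear_coordinate)
  then show ?case
    using radial_differentiable[OF assms(1) Suc.prems] by (simp add: partial_radial[OF assms(1) Suc.prems])
qed

lemma radial_test_fun:
  fixes P :: "real^'n::finite \<Rightarrow> complex"
  assumes \<rho>: "0 \<le> \<rho>" and F: "halfline_test \<rho> F" and P: "\<And>k. Ck k P"
  shows "test_fun {x. norm x > \<rho>} (\<lambda>x. of_real (F (norm x)) * P x)"
proof -
  obtain a b where ab: "\<rho> < a" "a < b" "\<forall>x. x < a \<or> b < x \<longrightarrow> F x = 0"
    using F unfolding halfline_test_def by (elim conjE exE)
  let ?S = "{x. of_real (F (norm x)) * P x \<noteq> 0}"
  have "?S \<subseteq> {x. a \<le> norm x \<and> norm x \<le> b}" using ab(3) by (auto simp: not_less[symmetric])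
  moreover have "closed {x::real^'n. a \<le> norm x \<and> norm x \<le> b}"
    by (intro closed_Collect_conj closed_Collect_le continuous_intros)
  ultimately have cl: "closure ?S \<subseteq> {x. a \<le> norm x \<and> norm x \<le> b}" by (rule closure_minimal)
  then have "closure ?S \<subseteq> cball 0 b" by auto
  then have "bounded (closure ?S)" using bounded_cball bounded_subset by blast
  then have "compact (closure ?S)" by (simp add: compact_eq_bounded_closed)
  moreover have "Ck k (\<lambda>x. of_real (F (norm x)) * P x)" for k by (intro Ck_mult Ck_radial[OF \<rho> F] P)
  ultimately show ?thesis unfolding test_fun_def using cl ab(1) by auto
qed

lemma Ck_real_polynomial: "real_polynomial_function p \<Longrightarrow> Ck k (\<lambda>x::real^'n::finite. complex_of_real (p x))"
proof (induction p rule: real_polynomial_function.induct)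
  case (linear f)
  then show ?case by (intro Ck_bounded_linear bounded_linear_compose[OF bounded_linear_of_real])
qed (auto intro: Ck_const Ck_add Ck_mult)

lemma Ck_polynomial:
  fixes Y :: "real^'n::finite \<Rightarrow> complex"
  assumes "polynomial_function Y" shows "Ck k Y"
proof -
  have "real_polynomial_function (\<lambda>x. Re (Y x))" "real_polynomial_function (\<lambda>x. Im (Y x))"
    using assms bounded_linear_Re bounded_linear_Im unfolding polynomial_function_def o_def by blast+
  then have "Ck k (\<lambda>x. complex_of_real (Re (Y x)) + \<i> * complex_of_real (Im (Y x)))"
    by (intro Ck_add Ck_mult Ck_const Ck_real_polynomial)
  then show ?thesis by (simp add: complex_eq[symmetric])
qed

lemma solid_harmonic_Ck: "solid_harmonic m Y \<Longrightarrow> Ck k Y"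
  by (simp add: solid_harmonic_def Ck_polynomial)

lemma solid_harmonic_differentiable: "solid_harmonic m Y \<Longrightarrow> Y differentiable_on UNIV"
  using solid_harmonic_Ck[of m Y "Suc 0"] by simp

text \<open>Differentiate the homogeneity relation along the ray \<open>t *\<^sub>R x\<close> at
  \<open>t = 1\<close>.\<close>

lemma solid_harmonic_Euler:
  assumes Y: "solid_harmonic m Y"
  shows "(\<Sum>i\<in>UNIV. of_real (x $ i) * partial i Y x) = of_nat m * Y x"
proof -
  have lin: "linear (frechet_derivative Y (at x))"
    using differentiable_on_UNIV_D[OF solid_harmonic_differentiable[OF Y]] has_derivative_linear by blast
  have "(Y has_derivative frechet_derivative Y (at x)) (at (1 *\<^sub>R x))"
    using differentiable_on_UNIV_D[OF solid_harmonic_differentiable[OF Y], of x] by simp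
  moreover have "((\<lambda>t. t *\<^sub>R x) has_derivative (\<lambda>h. h *\<^sub>R x)) (at (1::real))"
    by (rule bounded_linear_imp_has_derivative[OF bounded_linear_scaleR_left])
  ultimately have "((\<lambda>t. Y (t *\<^sub>R x)) has_derivative (\<lambda>h. frechet_derivative Y (at x) (h *\<^sub>R x))) (at 1)"
    by (rule has_derivative_compose[where f="\<lambda>t. t *\<^sub>R x" and g=Y, rotated])
  then have "((\<lambda>t. Y (t *\<^sub>R x)) has_vector_derivative frechet_derivative Y (at x) x) (at 1)"
    by (simp add: has_vector_derivative_def linear_scale[OF lin])
  moreover have "((\<lambda>t. Y (t *\<^sub>R x)) has_vector_derivative of_nat m * Y x) (at 1)"
  proof -
    have "(\<lambda>t. Y (t *\<^sub>R x)) = (\<lambda>t. of_real (t ^ m) * Y x)" using Y by (simp add: solid_harmonic_def)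
    moreover have "((\<lambda>t. complex_of_real (t ^ m)) has_vector_derivative of_real (real m * 1 ^ (m - Suc 0))) (at 1)"
      by (rule bounded_linear.has_vector_derivative[OF bounded_linear_of_real])
        (rule DERIV_pow[unfolded has_real_derivative_iff_has_vector_derivative])
    from has_vector_derivative_mult_left[OF this, of "Y x"]
    have "((\<lambda>t. complex_of_real (t ^ m) * Y x) has_vector_derivative of_nat m * Y x) (at 1)" by simp
    ultimately show ?thesis by simp
  qed
  ultimately have "frechet_derivative Y (at x) x = of_nat m * Y x" by (rule vector_derivative_unique_at)
  then show ?thesis by (simp add: frechet_derivative_partial[OF solid_harmonic_differentiable[OF Y]])
qed

lemma solid_harmonic_cnj:
  assumes Y: "solid_harmonic m Y" shows "solid_harmonic m (\<lambda>x. cnj (Y x))"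
proof -
  have "polynomial_function (\<lambda>x. cnj (Y x))"
    unfolding polynomial_function_def o_def
  proof (intro allI impI)
    fix f :: "complex \<Rightarrow> real" assume "bounded_linear f"
    then have "bounded_linear (\<lambda>z. f (cnj z))" by (rule bounded_linear_compose[OF _ bounded_linear_cnj])
    then show "real_polynomial_function (\<lambda>x. f (cnj (Y x)))"
      using Y unfolding solid_harmonic_def polynomial_function_def o_def by blast
  qed
  moreover have "laplacian (\<lambda>x. cnj (Y x)) x = 0" for x
  proof -
    have "partial i Y differentiable_on UNIV" for i
      using solid_harmonic_Ck[OF Y, of "Suc (Suc 0)"] by simp
    then have "laplacian (\<lambda>x. cnj (Y x)) x = cnj (laplacian Y x)"
      unfolding laplacian_def by (simp add: partial_cnj[OF solid_harmonic_differentiable[OF Y]] partial_cnj)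
    then show ?thesis using Y by (simp add: solid_harmonic_def)
  qed
  ultimately show ?thesis using Y by (simp add: solid_harmonic_def)
qed

text \<open>By the product rule the radial factor contributes \<open>F'' + (d - 1) F' / r\<close>,
  the mixed term is \<open>2 F' / r\<close> times the Euler field applied to \<open>Y\<close>, and
  \<open>Y\<close> is harmonic. Euler's identity turns the mixed term into
  \<open>2 m F' / r\<close>: the factor \<open>Y\<close> acts like raising the dimension by
  \<open>2 m\<close>.\<close>

lemma laplacian_radial_harmonic:
  fixes Y :: "real^'n::finite \<Rightarrow> complex"
  assumes \<rho>: "0 \<le> \<rho>" and F: "halfline_test \<rho> F" and Y: "solid_harmonic m Y" and x: "x \<noteq> 0"
  shows "laplacian (\<lambda>x. of_real (F (norm x)) * Y x) x =
    of_real (deriv (deriv F) (norm x) + real (2 * m + CARD('n) - 1) / norm x * deriv F (norm x)) * Y x"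
proof -
  define A where "A = (\<lambda>x::real^'n. complex_of_real (F (norm x)))"
  define B where "B = (\<lambda>x::real^'n. complex_of_real (deriv F (norm x) / norm x))"
  let ?r = "norm x"
  have r: "?r > 0" using x by simp
  have F': "halfline_test \<rho> (deriv F)" by (rule halfline_test_deriv[OF F])
  have Fr: "halfline_test \<rho> (\<lambda>r. deriv F r / r)" by (rule halfline_test_divide[OF \<rho> F'])
  have dA: "A differentiable_on UNIV" unfolding A_def by (rule radial_differentiable[OF \<rho> F])
  have dB: "B differentiable_on UNIV" unfolding B_def by (rule radial_differentiable[OF \<rho> Fr])
  have dY: "Y differentiable_on UNIV" by (rule solid_harmonic_differentiable[OF Y])
  have dYi: "partial i Y differentiable_on UNIV" for i using solid_harmonic_Ck[OF Y, of "Suc (Suc 0)"] by simp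
  have dxi: "(\<lambda>x::real^'n. complex_of_real (x $ i)) differentiable_on UNIV" for i
    using Ck_bounded_linear[OF bounded_linear_coordinate, of "Suc 0" i] by simp
  have pxi: "partial i (\<lambda>x::real^'n. complex_of_real (x $ i)) = (\<lambda>x. 1)" for i
    by (rule ext, subst partial_unique[OF bounded_linear_imp_has_derivative[OF bounded_linear_coordinate]]) simp
  have pA: "partial i A = (\<lambda>x. B x * of_real (x $ i))" for i
    unfolding A_def B_def by (rule partial_radial[OF \<rho> F])
  have dBx: "(\<lambda>x. B x * of_real (x $ i)) differentiable_on UNIV" for i
    by (intro differentiable_on_mult dB dxi)
  \<comment> \<open>The coefficient of \<open>x $ i\<close> in \<open>partial i B\<close>; summing
    over the squared coordinates it yields \<open>F'' - F' / r\<close>.\<close>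
  define C where "C = deriv (\<lambda>r. deriv F r / r) ?r / ?r"
  have pB: "partial i B x = of_real C * of_real (x $ i)" for i
    unfolding B_def C_def by (simp only: partial_radial[OF \<rho> Fr])
  have ppA: "partial i (\<lambda>x. B x * of_real (x $ i)) x = B x + of_real C * of_real ((x $ i)\<^sup>2)" for i
    by (subst partial_mult[OF dB dxi]) (simp add: pxi pB power2_eq_square)
  have second: "partial i (partial i (\<lambda>x. A x * Y x)) x =
      A x * partial i (partial i Y) x + 2 * B x * (of_real (x $ i) * partial i Y x) + (B x + of_real C * of_real ((x $ i)\<^sup>2)) * Y x" for i
  proof -
    have "partial i (\<lambda>x. A x * Y x) = (\<lambda>x. A x * partial i Y x + (B x * of_real (x $ i)) * Y x)"
      by (subst partial_mult[OF dA dY]) (simp add: pA)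
    then have "partial i (partial i (\<lambda>x. A x * Y x)) = (\<lambda>x. (A x * partial i (partial i Y) x + (B x * of_real (x $ i)) * partial i Y x)
        + ((B x * of_real (x $ i)) * partial i Y x + partial i (\<lambda>x. B x * of_real (x $ i)) x * Y x))"
      by (simp add: partial_add[OF differentiable_on_mult[OF dA dYi] differentiable_on_mult[OF dBx dY]]
          partial_mult[OF dA dYi] partial_mult[OF dBx dY] pA)
    then show ?thesis by (simp add: ppA algebra_simps)
  qed
  have sum_sq: "(\<Sum>i\<in>UNIV. complex_of_real ((x $ i)\<^sup>2)) = of_real (?r\<^sup>2)"
    by (simp add: norm_vec_def L2_set_def sum_nonneg)
  have "laplacian (\<lambda>x. A x * Y x) x = A x * (\<Sum>i\<in>UNIV. partial i (partial i Y) x)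
      + 2 * B x * (\<Sum>i\<in>UNIV. of_real (x $ i) * partial i Y x) + (of_nat CARD('n) * B x + of_real C * (\<Sum>i\<in>UNIV. of_real ((x $ i)\<^sup>2))) * Y x"
    unfolding laplacian_def second by (simp add: sum.distrib sum_distrib_left sum_distrib_right distrib_right)
  also have "(\<Sum>i\<in>UNIV. partial i (partial i Y) x) = 0" using Y by (simp add: solid_harmonic_def laplacian_def)
  also have "(\<Sum>i\<in>UNIV. of_real (x $ i) * partial i Y x) = of_nat m * Y x" by (rule solid_harmonic_Euler[OF Y])
  also have "(\<Sum>i\<in>UNIV. of_real ((x $ i)\<^sup>2)) = complex_of_real (?r\<^sup>2)" by (rule sum_sq)
  also have "A x * 0 + 2 * B x * (of_nat m * Y x) + (of_nat CARD('n) * B x + of_real C * complex_of_real (?r\<^sup>2)) * Y x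
     = of_real ((2 * real m + real CARD('n)) * (deriv F ?r / ?r) + C * ?r\<^sup>2) * Y x"
    by (simp add: B_def algebra_simps)
  also have "(2 * real m + real CARD('n)) * (deriv F ?r / ?r) + C * ?r\<^sup>2
     = deriv (deriv F) ?r + real (2 * m + CARD('n) - 1) / ?r * deriv F ?r"
  proof -
    have "deriv (\<lambda>r. deriv F r / r) ?r = (deriv (deriv F) ?r * ?r - deriv F ?r * 1) / (?r * ?r)"
      by (rule DERIV_imp_deriv, rule DERIV_divide[OF halfline_test_DERIV[OF F'] DERIV_ident]) (use r in simp)
    then have "C * ?r\<^sup>2 = deriv (deriv F) ?r - deriv F ?r / ?r"
      using r by (simp add: C_def field_simps power2_eq_square)
    moreover have "real (2 * m + CARD('n) - 1) = 2 * real m + real CARD('n) - 1"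
    proof -
      have "1 \<le> 2 * m + CARD('n)" by (simp add: Suc_leI)
      then show ?thesis by (simp add: of_nat_diff)
    qed
    ultimately show ?thesis using r by (simp add: field_simps)
  qed
  finally show ?thesis unfolding A_def .
qed

section \<open>Modes of square integrable solutions and the outgoing condition\<close>

section \<open>Hankel functions as decaying radial solutions\<close>

lemma ms_integral_ray_derivative:
  fixes a :: real
  assumes \<kappa>: "Im \<kappa> > 0" and r: "r > 0"
    and D: "(ms_integral \<nu> has_field_derivative D) (at (\<kappa> * of_real r))"
  shows "((\<lambda>r. of_real (r powr a) * ms_integral \<nu> (\<kappa> * of_real r)) has_vector_derivative
    of_real (r powr a) * (\<kappa> * D + of_real (a / r) * ms_integral \<nu> (\<kappa> * of_real r))) (at r)"
proof -
  have "((\<lambda>r. \<kappa> * of_real r) has_vector_derivative \<kappa>) (at r)"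
    using has_vector_derivative_mult_right[OF has_vector_derivative_of_real[OF DERIV_ident], where a=\<kappa>] by simp
  from field_vector_diff_chain_at[OF this D]
  have 1: "((\<lambda>r. ms_integral \<nu> (\<kappa> * of_real r)) has_vector_derivative \<kappa> * D) (at r)" by (simp add: o_def)
  have 2: "((\<lambda>r. complex_of_real (r powr a)) has_vector_derivative of_real (a * r powr (a - 1))) (at r)"
    by (rule has_vector_derivative_of_real[OF has_real_derivative_powr[OF r]])
  have "r powr (a - 1) = r powr a / r" using r by (simp add: powr_diff)
  then show ?thesis
    using has_vector_derivative_mult[OF 2 1] by (simp add: algebra_simps)
qed

text \<open>The raising relation makes \<open>zh\<close> the flux of \<open>h\<close>, the lowering
  relation brings its derivative back to \<open>h\<close>, and \<open>M = 2 * \<nu> + 1\<close>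
  makes the powers of \<open>r\<close> match. For integrability,
  \<open>r ^ M * (norm (h r))\<^sup>2\<close> reduces to \<open>r\<close> times the squared modulus
  of the integral, and one of the two exponential factors absorbs \<open>r\<close>.\<close>

lemma hankel_radial_solution:
  assumes \<kappa>: "Im \<kappa> > 0" and M: "real M = 2 * \<nu> + 1"
  defines "h \<equiv> \<lambda>r. complex_of_real (r powr - \<nu>) * ms_integral \<nu> (\<kappa> * of_real r)"
    and "zh \<equiv> \<lambda>r. \<i> * \<kappa> * (of_real (r powr (\<nu> + 1)) * ms_integral (\<nu> + 1) (\<kappa> * of_real r))"
  shows "r > 0 \<Longrightarrow> (h has_vector_derivative zh r / of_real (r ^ M)) (at r)"
    and "r > 0 \<Longrightarrow> (zh has_vector_derivative - (\<kappa>\<^sup>2) * of_real (r ^ M) * h r) (at r)"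
    and "\<rho> > 0 \<Longrightarrow> set_integrable lborel {\<rho><..} (\<lambda>r. r ^ M * (norm (h r))\<^sup>2)"
proof -
  have pM: "r ^ M = r powr (\<nu> + 1) * r powr \<nu>" "r ^ M = r * (r powr \<nu>)\<^sup>2" if "r > 0" for r
  proof -
    have "r ^ M = r powr (\<nu> + 1 + \<nu>)" using that by (simp add: powr_realpow[symmetric] M)
    then show "r ^ M = r powr (\<nu> + 1) * r powr \<nu>" by (simp only: powr_add)
    then show "r ^ M = r * (r powr \<nu>)\<^sup>2" using that by (simp add: powr_add power2_eq_square)
  qed
  have dh: "(h has_vector_derivative zh r / of_real (r ^ M)) (at r)" if r: "r > 0" for r
  proof -
    have z: "Im (\<kappa> * of_real r) > 0" "\<kappa> \<noteq> 0" using \<kappa> r by auto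
    have eq: "of_real (r powr - \<nu>) * (\<kappa> * (\<i> * ms_integral (\<nu> + 1) (\<kappa> * of_real r)
        + of_real \<nu> / (\<kappa> * of_real r) * ms_integral \<nu> (\<kappa> * of_real r))
        + of_real (- \<nu> / r) * ms_integral \<nu> (\<kappa> * of_real r)) = zh r / of_real (r ^ M)"
    proof -
      have "r powr (\<nu> + 1) / r ^ M = r powr - \<nu>" using r unfolding pM(1)[OF r] by (simp add: powr_minus field_simps)
      then have 1: "zh r / of_real (r ^ M) = \<i> * \<kappa> * ms_integral (\<nu> + 1) (\<kappa> * of_real r) * of_real (r powr - \<nu>)"
        unfolding zh_def by (metis (no_types, lifting) mult.assoc mult.commute of_real_divide times_divide_eq_right)
      show ?thesis unfolding 1 using r z(2) by (simp add: field_simps)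
    qed
    show ?thesis
      using ms_integral_ray_derivative[OF \<kappa> r ms_integral_recurrence(1)[OF z(1), of \<nu>], of "- \<nu>"]
      unfolding eq h_def .
  qed
  then show "r > 0 \<Longrightarrow> (h has_vector_derivative zh r / of_real (r ^ M)) (at r)" .
  show "(zh has_vector_derivative - (\<kappa>\<^sup>2) * of_real (r ^ M) * h r) (at r)" if r: "r > 0"
  proof -
    have z: "Im (\<kappa> * of_real r) > 0" "\<kappa> \<noteq> 0" using \<kappa> r by auto
    have eq: "\<i> * \<kappa> * (of_real (r powr (\<nu> + 1)) * (\<kappa> * (\<i> * ms_integral (\<nu> + 1 - 1) (\<kappa> * of_real r)
        - of_real (\<nu> + 1) / (\<kappa> * of_real r) * ms_integral (\<nu> + 1) (\<kappa> * of_real r))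
        + of_real ((\<nu> + 1) / r) * ms_integral (\<nu> + 1) (\<kappa> * of_real r)))
        = - (\<kappa>\<^sup>2) * of_real (r ^ M) * h r"
    proof -
      have "r ^ M * r powr - \<nu> = r powr (\<nu> + 1)" using r unfolding pM(1)[OF r] by (simp add: powr_minus field_simps)
      then have 1: "- (\<kappa>\<^sup>2) * of_real (r ^ M) * h r = - (\<kappa>\<^sup>2) * of_real (r powr (\<nu> + 1)) * ms_integral \<nu> (\<kappa> * of_real r)"
        unfolding h_def by (metis (no_types, lifting) mult.assoc of_real_mult)
      have "(\<kappa> * (\<i> * ms_integral (\<nu> + 1 - 1) (\<kappa> * of_real r)
        - of_real (\<nu> + 1) / (\<kappa> * of_real r) * ms_integral (\<nu> + 1) (\<kappa> * of_real r))
        + of_real ((\<nu> + 1) / r) * ms_integral (\<nu> + 1) (\<kappa> * of_real r)) = \<i> * \<kappa> * ms_integral \<nu> (\<kappa> * of_real r)"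
        using r z(2) by (simp add: divide_simps)
      then have "\<i> * \<kappa> * (of_real (r powr (\<nu> + 1)) * (\<kappa> * (\<i> * ms_integral (\<nu> + 1 - 1) (\<kappa> * of_real r)
        - of_real (\<nu> + 1) / (\<kappa> * of_real r) * ms_integral (\<nu> + 1) (\<kappa> * of_real r))
        + of_real ((\<nu> + 1) / r) * ms_integral (\<nu> + 1) (\<kappa> * of_real r)))
        = \<i> * \<kappa> * (of_real (r powr (\<nu> + 1)) * (\<i> * \<kappa> * ms_integral \<nu> (\<kappa> * of_real r)))"
        by (simp only:)
      also have "\<dots> = - (\<kappa>\<^sup>2) * of_real (r powr (\<nu> + 1)) * ms_integral \<nu> (\<kappa> * of_real r)"
        using i_squared by (simp add: power2_eq_square algebra_simps)
      finally show ?thesis unfolding 1 .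
    qed
    show ?thesis
      using has_vector_derivative_mult_right[OF
        ms_integral_ray_derivative[OF \<kappa> r ms_integral_recurrence(2)[OF z(1), of "\<nu> + 1"], of "\<nu> + 1"], of "\<i> * \<kappa>"]
      unfolding eq unfolding zh_def .
  qed
  show "set_integrable lborel {\<rho><..} (\<lambda>r. r ^ M * (norm (h r))\<^sup>2)" if \<rho>: "\<rho> > 0"
  proof -
    obtain K where K: "\<forall>r\<ge>\<rho>. norm (ms_integral \<nu> (\<kappa> * of_real r)) \<le> K * exp (- Im \<kappa> * r)"
      using norm_ms_integral_le[OF \<kappa> \<rho>, of \<nu>] by blast
    have "set_integrable lborel {\<rho>..} (\<lambda>r. exp (- Im \<kappa> * r))" by (rule set_integrable_exp_atLeast[OF \<kappa>])
    then have "set_integrable lborel {\<rho><..} (\<lambda>r. exp (- Im \<kappa> * r))" by (rule set_integrable_subset) auto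
    then have int: "integrable lborel (\<lambda>r. K\<^sup>2 / Im \<kappa> * (indicator {\<rho><..} r * exp (- Im \<kappa> * r)))"
      unfolding set_integrable_def by (simp only: real_scaleR_def) (rule integrable_mult_right)
    have "continuous_on {\<rho><..} h"
    proof (rule continuous_at_imp_continuous_on, rule ballI)
      fix r assume "r \<in> {\<rho><..}"
      then have "r > 0" using \<rho> by simp
      from has_vector_derivative_continuous[OF dh[OF this]] show "isCont h r" .
    qed
    then have m: "(\<lambda>r. indicator {\<rho><..} r *\<^sub>R (r ^ M * (norm (h r))\<^sup>2)) \<in> borel_measurable borel"
      by (intro borel_measurable_continuous_on_indicator continuous_intros) auto
    have le: "r ^ M * (norm (h r))\<^sup>2 \<le> K\<^sup>2 / Im \<kappa> * exp (- Im \<kappa> * r)" if "r > \<rho>" for r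
    proof -
      have r: "r > 0" using that \<rho> by simp
      have "r ^ M * (norm (h r))\<^sup>2 = r * ((r powr \<nu>)\<^sup>2 * (r powr - \<nu>)\<^sup>2) * (norm (ms_integral \<nu> (\<kappa> * of_real r)))\<^sup>2"
        unfolding pM(2)[OF r] h_def by (simp add: norm_mult power_mult_distrib)
      also have "(r powr \<nu>)\<^sup>2 * (r powr - \<nu>)\<^sup>2 = 1" using r by (simp add: powr_minus power_mult_distrib[symmetric])
      also have "r * 1 * (norm (ms_integral \<nu> (\<kappa> * of_real r)))\<^sup>2 \<le> r * 1 * (K * exp (- Im \<kappa> * r))\<^sup>2"
        using K that r by (intro mult_left_mono power_mono) auto
      also have "\<dots> = K\<^sup>2 / Im \<kappa> * exp (- Im \<kappa> * r) * ((Im \<kappa> * r) * exp (- Im \<kappa> * r))"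
        using \<kappa> by (simp add: power_mult_distrib power2_eq_square)
      also have "\<dots> \<le> K\<^sup>2 / Im \<kappa> * exp (- Im \<kappa> * r) * 1"
      proof (rule mult_left_mono)
        have "Im \<kappa> * r \<le> exp (Im \<kappa> * r)" by (rule order_trans[OF _ exp_ge_add_one_self]) simp
        from mult_right_mono[OF this, of "exp (- Im \<kappa> * r)"]
        show "Im \<kappa> * r * exp (- Im \<kappa> * r) \<le> 1" by (simp add: exp_minus)
        show "0 \<le> K\<^sup>2 / Im \<kappa> * exp (- Im \<kappa> * r)" using \<kappa> by simp
      qed
      finally show ?thesis by simp
    qed
    show ?thesis
      unfolding set_integrable_def
    proof (rule Bochner_Integration.integrable_bound[OF int])
      show "(\<lambda>r. indicator {\<rho><..} r *\<^sub>R (r ^ M * (norm (h r))\<^sup>2)) \<in> borel_measurable lborel" using m by simp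
      show "AE r in lborel. norm (indicator {\<rho><..} r *\<^sub>R (r ^ M * (norm (h r))\<^sup>2))
          \<le> norm (K\<^sup>2 / Im \<kappa> * (indicator {\<rho><..} r * exp (- Im \<kappa> * r)))"
      proof (rule AE_I2)
        fix r :: real
        show "norm (indicator {\<rho><..} r *\<^sub>R (r ^ M * (norm (h r))\<^sup>2))
          \<le> norm (K\<^sup>2 / Im \<kappa> * (indicator {\<rho><..} r * exp (- Im \<kappa> * r)))"
        proof (cases "r > \<rho>")
          case True
          then show ?thesis using le[OF True] \<rho> \<kappa> by (simp add: abs_mult)
        qed simp
      qed
    qed
  qed
qed

section \<open>Modes of square integrable solutions of the Helmholtz equation\<close>

lemma measurable_completion_AE_eq:
  assumes g: "g \<in> borel_measurable M" and ae: "AE x in M. f x = g x"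
  shows "f \<in> borel_measurable (completion M)"
proof (rule measurableI)
  fix A :: "'b set" assume A: "A \<in> sets borel"
  have "g -` A \<inter> space M \<in> sets (completion M)" using measurable_sets[OF g A] by simp
  moreover have "AE x in completion M. x \<in> g -` A \<inter> space M \<longleftrightarrow> x \<in> f -` A \<inter> space M"
    by (rule AE_completion) (use ae in eventually_elim, simp)
  ultimately have "f -` A \<inter> space M \<in> sets (completion M)"
    using completion.in_sets_AE[of "g -` A \<inter> space M" "f -` A \<inter> space M" M] by simp
  then show "f -` A \<inter> space (completion M) \<in> sets (completion M)" by simp
qed simp

lemma integral_completion_AE_eq:
  fixes f g :: "'a \<Rightarrow> 'b::{banach, second_countable_topology}"
  assumes g: "g \<in> borel_measurable M" and ae: "AE x in M. f x = g x"
  shows "(LINT x|completion M. f x) = (LINT x|M. g x)"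
  unfolding integral_completion[OF g, symmetric]
  by (rule integral_cong_AE[OF measurable_completion_AE_eq[OF assms] measurable_completion[OF g] AE_completion[OF ae]])

text \<open>\<open>mode\<close> uses the completed sphere measure, whereas Fubini needs the Borel
  one. For almost every radius \<open>u\<close> agrees almost everywhere on the sphere with its
  Borel representative, so the two integrals coincide.\<close>

lemma mode_AE_eq:
  fixes u v Y :: "real^'n::finite \<Rightarrow> complex"
  assumes v[measurable]: "v \<in> borel_measurable borel" and Y[measurable]: "Y \<in> borel_measurable borel"
    and ae: "AE x in lborel. u x = v x"
  shows "AE r in lborel. r > 0 \<longrightarrow> mode u Y r = (LINT \<theta>|unit_sphere_measure. v (r *\<^sub>R \<theta>) * cnj (Y \<theta>))"
  using AE_polar[OF ae]
proof eventually_elim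
  case (elim r)
  show ?case
  proof
    assume "r > 0"
    with elim have "AE \<theta> in unit_sphere_measure. u (r *\<^sub>R \<theta>) = v (r *\<^sub>R \<theta>)" by simp
    then have "AE \<theta> in unit_sphere_measure. u (r *\<^sub>R \<theta>) * cnj (Y \<theta>) = v (r *\<^sub>R \<theta>) * cnj (Y \<theta>)" by eventually_elim simp
    then show "mode u Y r = (LINT \<theta>|unit_sphere_measure. v (r *\<^sub>R \<theta>) * cnj (Y \<theta>))"
      unfolding mode_def sphere_measure_1
    proof (intro integral_completion_AE_eq)
      have [measurable]: "cnj \<in> borel_measurable borel" by (intro borel_measurable_continuous_onI continuous_intros)
      show "(\<lambda>\<theta>. v (r *\<^sub>R \<theta>) * cnj (Y \<theta>)) \<in> borel_measurable unit_sphere_measure" by measurable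
    qed
  qed
qed

lemma continuous_laplacian: "test_fun \<Omega> \<phi> \<Longrightarrow> continuous_on UNIV (\<lambda>x. laplacian \<phi> x + q * \<phi> x)"
  unfolding laplacian_def
  using test_fun_Ck[OF test_fun_partial[OF test_fun_partial], of \<Omega> \<phi> 0] test_fun_Ck[of \<Omega> \<phi> 0]
  by (intro continuous_intros) simp_all

lemma helmholtz_integrals:
  fixes u :: "real^'n::finite \<Rightarrow> complex"
  assumes u: "L2 lebesgue u" and \<phi>: "test_fun \<Omega> \<phi>"
  shows "integrable lebesgue (\<lambda>x. u x * (laplacian \<phi> x + q * \<phi> x))"
    and "(LINT x|lebesgue. u x * (laplacian \<phi> x + q * \<phi> x))
      = (\<Sum>i\<in>UNIV. LINT x|lebesgue. u x * partial i (partial i \<phi>) x) + q * (LINT x|lebesgue. u x * \<phi> x)"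
proof -
  have loc: "\<And>r. set_integrable lebesgue (cball 0 r) u" by (rule L2_locally_integrable[OF u])
  have 1: "integrable lebesgue (\<lambda>x. u x * partial i (partial i \<phi>) x)" for i
    by (rule test_fun_product_integrable[OF test_fun_partial[OF test_fun_partial[OF \<phi>]] loc])
  have 2: "integrable lebesgue (\<lambda>x. u x * \<phi> x)" by (rule test_fun_product_integrable[OF \<phi> loc])
  have eq: "(\<lambda>x. u x * (laplacian \<phi> x + q * \<phi> x)) = (\<lambda>x. (\<Sum>i\<in>UNIV. u x * partial i (partial i \<phi>) x) + q * (u x * \<phi> x))"
    unfolding laplacian_def by (simp add: sum_distrib_left algebra_simps)
  show "integrable lebesgue (\<lambda>x. u x * (laplacian \<phi> x + q * \<phi> x))"
    unfolding eq using 1 2 by (intro Bochner_Integration.integrable_add Bochner_Integration.integrable_sum integrable_mult_right)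
  show "(LINT x|lebesgue. u x * (laplacian \<phi> x + q * \<phi> x))
      = (\<Sum>i\<in>UNIV. LINT x|lebesgue. u x * partial i (partial i \<phi>) x) + q * (LINT x|lebesgue. u x * \<phi> x)"
    unfolding eq using 1 2
    by (simp add: Bochner_Integration.integral_add Bochner_Integration.integral_sum Bochner_Integration.integrable_sum)
qed

lemma helmholtz_on_iff:
  fixes u :: "real^'n::finite \<Rightarrow> complex"
  assumes \<Omega>: "open \<Omega>"
  shows "helmholtz_on \<Omega> q u \<longleftrightarrow>
    (\<forall>\<phi>. test_fun \<Omega> \<phi> \<longrightarrow> (LINT x|lebesgue. u x * (laplacian \<phi> x + q * \<phi> x)) = 0)"
proof -
  have "(LINT x|lebesgue_on \<Omega>. u x * (laplacian \<phi> x + q * \<phi> x)) = (LINT x|lebesgue. u x * (laplacian \<phi> x + q * \<phi> x))"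
    if \<phi>: "test_fun \<Omega> \<phi>" for \<phi>
  proof -
    have lap0: "laplacian \<phi> x + q * \<phi> x = 0" if "x \<notin> \<Omega>" for x
    proof -
      have "partial i (partial i \<phi>) x = 0" for i
        by (rule test_fun_zero_outside[OF test_fun_partial[OF test_fun_partial[OF \<phi>]] that])
      then show ?thesis unfolding laplacian_def using test_fun_zero_outside[OF \<phi> that] by simp
    qed
    have "(LINT x|lebesgue_on \<Omega>. u x * (laplacian \<phi> x + q * \<phi> x))
      = (LINT x|lebesgue. indicator \<Omega> x *\<^sub>R (u x * (laplacian \<phi> x + q * \<phi> x)))"
      by (rule integral_restrict_space) (use \<Omega> in \<open>simp add: borel_open\<close>)
    also have "\<dots> = (LINT x|lebesgue. u x * (laplacian \<phi> x + q * \<phi> x))"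
      using lap0 by (intro Bochner_Integration.integral_cong) (auto simp: indicator_def)
    finally show ?thesis .
  qed
  then show ?thesis unfolding helmholtz_on_def by auto
qed

lemma open_norm_greater: "open {x::'a::real_normed_vector. norm x > \<rho>}"
  by (intro open_Collect_less continuous_intros)

text \<open>Testing with \<open>F (norm x) * cnj (Y x)\<close> and passing to polar coordinates. In
  \<open>\<gamma>\<close> the power \<open>r ^ (d - 1)\<close> is the surface element and
  \<open>r ^ m\<close> the homogeneity of \<open>Y\<close>; what remains of the test function is the
  radial operator of \<open>laplacian_radial_harmonic\<close>.\<close>

lemma weak_radial_equation:
  fixes u Y :: "real^'n::finite \<Rightarrow> complex"
  assumes u[measurable]: "u \<in> borel_measurable borel" and u2: "L2 lebesgue u" and \<rho>: "\<rho> > 0"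
    and helm: "helmholtz_on {x. norm x > \<rho>} q u" and Y: "solid_harmonic m Y" and F: "halfline_test \<rho> F"
  defines "\<gamma> \<equiv> \<lambda>r. (indicator {0<..} r * r ^ (CARD('n) - 1) * r ^ m) *\<^sub>R
    (LINT \<theta>|unit_sphere_measure. u (r *\<^sub>R \<theta>) * cnj (Y \<theta>))"
  shows "(LINT r|lborel. of_real (deriv (deriv F) r + real (2 * m + CARD('n) - 1) / r * deriv F r) * \<gamma> r
    + q * (of_real (F r) * \<gamma> r)) = 0"
proof -
  define \<phi> where "\<phi> x = of_real (F (norm x)) * cnj (Y x)" for x :: "real^'n"
  let ?S = "{x::real^'n. norm x > \<rho>}"
  have cY: "solid_harmonic m (\<lambda>x. cnj (Y x))" by (rule solid_harmonic_cnj[OF Y])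
  have \<phi>: "test_fun ?S \<phi>"
    unfolding \<phi>_def by (rule radial_test_fun[OF less_imp_le[OF \<rho>] F solid_harmonic_Ck[OF cY]])
  define \<psi> where "\<psi> x = laplacian \<phi> x + q * \<phi> x" for x
  have [measurable]: "\<psi> \<in> borel_measurable borel"
    using continuous_laplacian[OF \<phi>] unfolding \<psi>_def[abs_def] by (rule borel_measurable_continuous_onI)
  have um: "(\<lambda>x. u x * \<psi> x) \<in> borel_measurable lborel" by measurable
  have int: "integrable lborel (\<lambda>x. u x * \<psi> x)"
    using helmholtz_integrals(1)[OF u2 \<phi>] integrable_completion[OF um] unfolding \<psi>_def by simp
  have "0 = (LINT x|lebesgue. u x * \<psi> x)"
    using helm \<phi> unfolding helmholtz_on_iff[OF open_norm_greater] \<psi>_def by simp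
  also have "\<dots> = (LINT x|lborel. u x * \<psi> x)" by (rule integral_completion[OF um])
  also have "\<dots> = (LINT r|lborel. (indicator {0<..} r * r ^ (CARD('n) - 1)) *\<^sub>R
      (LINT \<theta>|unit_sphere_measure. u (r *\<^sub>R \<theta>) * \<psi> (r *\<^sub>R \<theta>)))"
    by (rule integral_polar(1)[OF int])
  also have "\<dots> = (LINT r|lborel. of_real (deriv (deriv F) r + real (2 * m + CARD('n) - 1) / r * deriv F r) * \<gamma> r
    + q * (of_real (F r) * \<gamma> r))"
  proof (rule Bochner_Integration.integral_cong[OF refl])
    fix r :: real
    show "(indicator {0<..} r * r ^ (CARD('n) - 1)) *\<^sub>R (LINT \<theta>|unit_sphere_measure. u (r *\<^sub>R \<theta>) * \<psi> (r *\<^sub>R \<theta>))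
      = of_real (deriv (deriv F) r + real (2 * m + CARD('n) - 1) / r * deriv F r) * \<gamma> r + q * (of_real (F r) * \<gamma> r)"
    proof (cases "r > 0")
      case r: True
      define c where "c = complex_of_real (deriv (deriv F) r + real (2 * m + CARD('n) - 1) / r * deriv F r) + q * of_real (F r)"
      have [measurable]: "cnj \<in> borel_measurable borel" by (intro borel_measurable_continuous_onI continuous_intros)
      have [measurable]: "Y \<in> borel_measurable borel"
        using solid_harmonic_Ck[OF Y, of 0] by (auto intro!: borel_measurable_continuous_onI)
      have "(LINT \<theta>|unit_sphere_measure. u (r *\<^sub>R \<theta>) * \<psi> (r *\<^sub>R \<theta>))
        = (LINT \<theta>|unit_sphere_measure. (c * of_real (r ^ m)) * (u (r *\<^sub>R \<theta>) * cnj (Y \<theta>)))"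
      proof (rule integral_cong_AE)
        show "AE \<theta> in unit_sphere_measure. u (r *\<^sub>R \<theta>) * \<psi> (r *\<^sub>R \<theta>) = c * of_real (r ^ m) * (u (r *\<^sub>R \<theta>) * cnj (Y \<theta>))"
          using AE_unit_sphere_norm
        proof eventually_elim
          case (elim \<theta>)
          have n: "norm (r *\<^sub>R \<theta>) = r" using elim r by simp
          then have "r *\<^sub>R \<theta> \<noteq> 0" using r by auto
          from laplacian_radial_harmonic[OF less_imp_le[OF \<rho>] F cY this]
          have "\<psi> (r *\<^sub>R \<theta>) = c * cnj (Y (r *\<^sub>R \<theta>))"
            unfolding \<psi>_def \<phi>_def[abs_def] n c_def by (simp add: algebra_simps)
          also have "Y (r *\<^sub>R \<theta>) = of_real (r ^ m) * Y \<theta>" using Y by (simp add: solid_harmonic_def)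
          finally show ?case by simp
        qed
      qed measurable
      also have "\<dots> = (c * of_real (r ^ m)) * (LINT \<theta>|unit_sphere_measure. u (r *\<^sub>R \<theta>) * cnj (Y \<theta>))"
        by (rule integral_mult_right_zero)
      finally show ?thesis using r unfolding \<gamma>_def c_def by (simp add: scaleR_conv_of_real algebra_simps)
    qed (simp add: \<gamma>_def)
  qed
  finally show ?thesis by simp
qed

text \<open>Cauchy-Schwarz on the sphere, with \<open>B\<close> the integral of
  \<open>(norm (Y \<theta>))\<^sup>2\<close>. It converts square integrability of \<open>u\<close>
  into weighted square integrability of its modes.\<close>

lemma norm_mode_sq_le:
  fixes u Y :: "real^'n::finite \<Rightarrow> complex"
  assumes u2: "L2 lebesgue u" and u[measurable]: "u \<in> borel_measurable borel" and Y: "continuous_on UNIV Y"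
  shows "\<exists>B\<ge>0. AE r in lborel. r > 0 \<longrightarrow>
    (norm (LINT \<theta>|unit_sphere_measure. u (r *\<^sub>R \<theta>) * cnj (Y \<theta>)))\<^sup>2
      \<le> B * (LINT \<theta>|unit_sphere_measure. (norm (u (r *\<^sub>R \<theta>)))\<^sup>2)"
proof (intro exI conjI)
  let ?S = "unit_sphere_measure :: (real^'n) measure"
  interpret S: finite_measure ?S by (rule finite_unit_sphere_measure)
  have Ym[measurable]: "Y \<in> borel_measurable borel" using Y by (rule borel_measurable_continuous_onI)
  have "compact (Y ` sphere 0 1)" by (intro compact_continuous_image continuous_on_subset[OF Y]) auto
  then obtain K where K: "\<And>\<theta>. norm \<theta> = 1 \<Longrightarrow> norm (Y \<theta>) \<le> K" 
    by (metis bounded_iff compact_imp_bounded imageI mem_sphere_0)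
  have "integrable ?S (\<lambda>\<theta>. (norm (Y \<theta>))\<^sup>2)"
  proof (rule S.integrable_const_bound[where B="K\<^sup>2"])
    show "AE \<theta> in ?S. norm ((norm (Y \<theta>))\<^sup>2) \<le> K\<^sup>2"
      using AE_unit_sphere_norm by eventually_elim (simp add: K power_mono)
  qed measurable
  then have L2Y: "L2 ?S (\<lambda>\<theta>. norm (Y \<theta>))" unfolding L2_def by simp
  show "0 \<le> (LINT \<theta>|?S. (norm (Y \<theta>))\<^sup>2)" by simp
  have "integrable lebesgue (\<lambda>x. (norm (u x))\<^sup>2)" using u2 by (simp add: L2_def)
  then have "integrable lborel (\<lambda>x. (norm (u x))\<^sup>2)"
    by (subst (asm) integrable_completion) measurable
  from integral_polar(3)[OF this]
  show "AE r in lborel. r > 0 \<longrightarrow> (norm (LINT \<theta>|?S. u (r *\<^sub>R \<theta>) * cnj (Y \<theta>)))\<^sup>2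
      \<le> (LINT \<theta>|?S. (norm (Y \<theta>))\<^sup>2) * (LINT \<theta>|?S. (norm (u (r *\<^sub>R \<theta>)))\<^sup>2)"
  proof eventually_elim
    case (elim r)
    show ?case
    proof
      assume "r > 0"
      with elim have "L2 ?S (\<lambda>\<theta>. norm (u (r *\<^sub>R \<theta>)))" unfolding L2_def by simp
      from L2_Cauchy_Schwarz[OF this L2Y]
      have "(LINT \<theta>|?S. norm (u (r *\<^sub>R \<theta>)) * norm (Y \<theta>))\<^sup>2 \<le> (LINT \<theta>|?S. (norm (u (r *\<^sub>R \<theta>)))\<^sup>2) * (LINT \<theta>|?S. (norm (Y \<theta>))\<^sup>2)"
        by simp
      moreover have "norm (LINT \<theta>|?S. u (r *\<^sub>R \<theta>) * cnj (Y \<theta>)) \<le> (LINT \<theta>|?S. norm (u (r *\<^sub>R \<theta>)) * norm (Y \<theta>))"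
        using integral_norm_bound[of ?S "\<lambda>\<theta>. u (r *\<^sub>R \<theta>) * cnj (Y \<theta>)"] by (simp add: norm_mult)
      ultimately show "(norm (LINT \<theta>|?S. u (r *\<^sub>R \<theta>) * cnj (Y \<theta>)))\<^sup>2
          \<le> (LINT \<theta>|?S. (norm (Y \<theta>))\<^sup>2) * (LINT \<theta>|?S. (norm (u (r *\<^sub>R \<theta>)))\<^sup>2)"
        by (smt (verit) mult.commute norm_ge_zero power_mono)
    qed
  qed
qed

lemma helmholtz_mode:
  fixes u Y :: "real^'n::finite \<Rightarrow> complex"
  assumes u2: "L2 lebesgue u" and \<rho>: "\<rho> > 0" and \<kappa>: "Im \<kappa> > 0" "Im (\<kappa>\<^sup>2) > 0"
    and helm: "helmholtz_on {x. norm x > \<rho>} (\<kappa>\<^sup>2) u" and Y: "solid_harmonic m Y"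
  shows "\<exists>c. AE r in lborel. r > \<rho> \<longrightarrow> mode u Y r = c * of_real (r powr (- (real CARD('n) - 2) / 2)) *
    hankel1 (real m + (real CARD('n) - 2) / 2) (\<kappa> * of_real r)"
proof -
  let ?S = "unit_sphere_measure :: (real^'n) measure"
  interpret S: finite_measure ?S by (rule finite_unit_sphere_measure)
  \<comment> \<open>\<open>u\<close> is only Lebesgue measurable, and polar coordinates need a Borel
    function; it is assembled from real and imaginary part.\<close>
  obtain v where v[measurable]: "v \<in> borel_measurable borel" and uv: "AE x in lborel. u x = v x"
  proof -
    have m: "u \<in> borel_measurable lebesgue" using u2 by (simp add: L2_def)
    have "(\<lambda>x. Re (u x)) \<in> borel_measurable (completion lborel)" "(\<lambda>x. Im (u x)) \<in> borel_measurable (completion lborel)"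
      using m by measurable
    then obtain a b where ab: "a \<in> borel_measurable lborel" "AE x in lborel. Re (u x) = a x"
      "b \<in> borel_measurable lborel" "AE x in lborel. Im (u x) = b x"
      using completion_ex_borel_measurable_real[of "\<lambda>x. Re (u x)" lborel]
        completion_ex_borel_measurable_real[of "\<lambda>x. Im (u x)" lborel] by blast
    note ab(1,3)[measurable]
    show thesis
    proof (rule that[of "\<lambda>x. of_real (a x) + \<i> * of_real (b x)"])
      show "AE x in lborel. u x = of_real (a x) + \<i> * of_real (b x)"
        using ab(2,4) by eventually_elim (simp add: complex_eq_iff)
    qed measurable
  qed
  have vm: "v \<in> borel_measurable lebesgue" using v by (simp add: measurable_completion)
  have um: "u \<in> borel_measurable lebesgue" using u2 by (simp add: L2_def)
  have uv': "AE x in lebesgue. v x = u x" using AE_completion[OF uv] by eventually_elim simp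
  have v2: "L2 lebesgue v" by (rule L2_cong_AE[OF u2 vm uv'])
  have helmv: "helmholtz_on {x. norm x > \<rho>} (\<kappa>\<^sup>2) v"
    unfolding helmholtz_on_iff[OF open_norm_greater]
  proof (intro allI impI)
    fix \<phi> :: "real^'n \<Rightarrow> complex" assume \<phi>: "test_fun {x. norm x > \<rho>} \<phi>"
    have pm: "(\<lambda>x. laplacian \<phi> x + \<kappa>\<^sup>2 * \<phi> x) \<in> borel_measurable lebesgue"
      by (rule borel_measurable_lebesgue_continuous[OF continuous_laplacian[OF \<phi>]])
    have "(LINT x|lebesgue. v x * (laplacian \<phi> x + \<kappa>\<^sup>2 * \<phi> x)) = (LINT x|lebesgue. u x * (laplacian \<phi> x + \<kappa>\<^sup>2 * \<phi> x))"
      by (rule integral_cong_AE[OF borel_measurable_times[OF vm pm] borel_measurable_times[OF um pm]])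
        (use uv' in eventually_elim, simp)
    then show "(LINT x|lebesgue. v x * (laplacian \<phi> x + \<kappa>\<^sup>2 * \<phi> x)) = 0"
      using helm \<phi> unfolding helmholtz_on_iff[OF open_norm_greater] by simp
  qed
  have Yc: "continuous_on UNIV Y" using solid_harmonic_Ck[OF Y, of 0] by simp
  have Ym[measurable]: "Y \<in> borel_measurable borel" by (rule borel_measurable_continuous_onI[OF Yc])
  have [measurable]: "cnj \<in> borel_measurable borel" by (intro borel_measurable_continuous_onI continuous_intros)
  define w where "w r = indicator {0<..} r * r ^ (CARD('n) - 1)" for r :: real
  define g where "g r = (LINT \<theta>|?S. v (r *\<^sub>R \<theta>) * cnj (Y \<theta>))" for r
  define s where "s r = (LINT \<theta>|?S. (norm (v (r *\<^sub>R \<theta>)))\<^sup>2)" for r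
  define \<gamma> where "\<gamma> r = (w r * r ^ m) *\<^sub>R g r" for r
  have [measurable]: "g \<in> borel_measurable borel" unfolding g_def[abs_def] by measurable
  have [measurable]: "w \<in> borel_measurable borel" unfolding w_def[abs_def] by measurable
  have \<gamma>m: "\<gamma> \<in> borel_measurable borel" unfolding \<gamma>_def[abs_def] by measurable
  have w0: "0 \<le> w r" for r by (simp add: w_def indicator_def)
  have s0: "0 \<le> s r" for r by (simp add: s_def)
  have "integrable lborel (\<lambda>x. (norm (v x))\<^sup>2)"
    using v2 by (subst integrable_completion[symmetric]) (auto simp: L2_def)
  from integral_polar(2)[OF this] have ws: "integrable lborel (\<lambda>r. w r * s r)" by (simp add: w_def s_def)
  obtain B where B: "B \<ge> 0" "AE r in lborel. r > 0 \<longrightarrow> (norm (g r))\<^sup>2 \<le> B * s r"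
    using norm_mode_sq_le[OF v2 v Yc] unfolding g_def s_def by blast
  define M where "M = 2 * m + CARD('n) - 1"
  define \<nu> where "\<nu> = real m + (real CARD('n) - 2) / 2"
  have d1: "1 \<le> CARD('n)" by (simp add: Suc_leI)
  have "real M = 2 * real m + real CARD('n) - 1" using d1 trans_le_add2[OF d1, of "2 * m"] unfolding M_def by (subst of_nat_diff) simp_all
  then have M: "real M = 2 * \<nu> + 1" by (simp add: \<nu>_def field_simps)
  \<comment> \<open>The power \<open>r ^ (d - 1)\<close> is the surface element, one
    \<open>r ^ m\<close> sits in \<open>\<gamma>\<close>, and the other one converts
    \<open>G\<close> into the mode \<open>g\<close>.\<close>
  have pw: "r ^ M = r ^ (CARD('n) - 1) * r ^ m * r ^ m" for r :: real
  proof -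
    have "M = CARD('n) - 1 + m + m" using d1 unfolding M_def by arith
    then show ?thesis by (simp only: power_add)
  qed
  have \<gamma>i: "set_integrable lborel {\<rho>..b} \<gamma>" for b
    unfolding set_integrable_def
  proof (rule Bochner_Integration.integrable_bound)
    show "integrable lborel (\<lambda>r. (b ^ (CARD('n) - 1) * b ^ m) * indicator {\<rho>..b} r + (b ^ m * B) * (w r * s r))"
      by (intro Bochner_Integration.integrable_add integrable_mult_right ws integrable_real_indicator)
        (simp_all add: emeasure_lborel_Icc_eq)
    show "(\<lambda>r. indicator {\<rho>..b} r *\<^sub>R \<gamma> r) \<in> borel_measurable lborel" using \<gamma>m by measurable
    show "AE r in lborel. norm (indicator {\<rho>..b} r *\<^sub>R \<gamma> r)
        \<le> norm ((b ^ (CARD('n) - 1) * b ^ m) * indicator {\<rho>..b} r + (b ^ m * B) * (w r * s r))"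
      using B(2)
    proof eventually_elim
      case (elim r)
      show ?case
      proof (cases "r \<in> {\<rho>..b}")
        case True
        then have r: "0 < r" "r \<le> b" using \<rho> by auto
        \<comment> \<open>The mode is controlled only in square mean; on a bounded interval this
          inequality gives integrability of the first power.\<close>
        have "norm (g r) \<le> 1 + (norm (g r))\<^sup>2"
        proof -
          have "0 \<le> (norm (g r) - 1)\<^sup>2" by simp
          then have "2 * norm (g r) \<le> (norm (g r))\<^sup>2 + 1" by (simp add: power2_diff)
          then show ?thesis using norm_ge_zero[of "g r"] by linarith
        qed
        also have "\<dots> \<le> 1 + B * s r" using elim r by simp
        finally have "w r * r ^ m * norm (g r) \<le> w r * r ^ m * (1 + B * s r)"
          using w0[of r] r by (intro mult_left_mono) auto
        also have "\<dots> \<le> w r * b ^ m * (1 + B * s r)"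
          using w0[of r] r s0[of r] B(1) by (intro mult_right_mono mult_left_mono power_mono) auto
        also have "\<dots> = w r * b ^ m + b ^ m * B * (w r * s r)" by (simp add: algebra_simps)
        also have "w r * b ^ m \<le> b ^ (CARD('n) - 1) * b ^ m"
          using r by (intro mult_right_mono) (auto simp: w_def intro: power_mono)
        finally show ?thesis using True r w0[of r] by (simp add: \<gamma>_def abs_mult)
      next
        case False
        then show ?thesis by simp
      qed
    qed
  qed
  have eq: "(LINT r|lborel. of_real (deriv (deriv F) r + real M / r * deriv F r) * \<gamma> r + \<kappa>\<^sup>2 * (of_real (F r) * \<gamma> r)) = 0"
    if "halfline_test \<rho> F" for F
    using weak_radial_equation[OF v v2 \<rho> helmv Y that] unfolding \<gamma>_def w_def g_def M_def .
  obtain G Z where G: "\<forall>r>\<rho>. (G has_vector_derivative Z r / of_real (r ^ M)) (at r)"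
    and Z: "\<forall>r>\<rho>. (Z has_vector_derivative - (\<kappa>\<^sup>2) * of_real (r ^ M) * G r) (at r)"
    and \<gamma>G: "AE r in lborel. r > \<rho> \<longrightarrow> \<gamma> r = of_real (r ^ M) * G r"
  proof -
    have "\<exists>G Z. (\<forall>r>\<rho>. (G has_vector_derivative Z r / of_real (r ^ M)) (at r)) \<and>
        (\<forall>r>\<rho>. (Z has_vector_derivative - (\<kappa>\<^sup>2) * of_real (r ^ M) * G r) (at r)) \<and>
        (AE r in lborel. r > \<rho> \<longrightarrow> \<gamma> r = of_real (r ^ M) * G r)"
      by (rule weak_radial_solution_regular[OF \<rho> \<gamma>m \<gamma>i]) (rule eq)
    then show thesis using that by (elim exE conjE)
  qed
  have gG: "AE r in lborel. r > \<rho> \<longrightarrow> g r = of_real (r ^ m) * G r"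
    using \<gamma>G
  proof eventually_elim
    case (elim r)
    show ?case
    proof
      assume r: "r > \<rho>"
      then have "of_real (r ^ (CARD('n) - 1) * r ^ m) * g r = of_real (r ^ (CARD('n) - 1) * r ^ m) * (of_real (r ^ m) * G r)"
        using elim \<rho> by (simp add: \<gamma>_def w_def pw scaleR_conv_of_real)
      moreover have "complex_of_real (r ^ (CARD('n) - 1) * r ^ m) \<noteq> 0" using r \<rho> by simp
      ultimately show "g r = of_real (r ^ m) * G r" by (simp only: mult_cancel_left) simp
    qed
  qed
  \<comment> \<open>Since \<open>g r = r ^ m * G r\<close>, the weight \<open>r ^ M\<close> makes
    this the integral of \<open>(norm (g r))\<^sup>2\<close> against
    \<open>r ^ (d - 1)\<close>.\<close>
  have G2: "set_integrable lborel {\<rho><..} (\<lambda>r. r ^ M * (norm (G r))\<^sup>2)"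
    unfolding set_integrable_def
  proof (rule Bochner_Integration.integrable_bound[OF integrable_mult_right[OF ws, of B]])
    have "continuous_on {\<rho><..} G"
      using G has_vector_derivative_continuous[of G _ _ UNIV] by (intro continuous_at_imp_continuous_on) blast
    then have "(\<lambda>r. indicator {\<rho><..} r *\<^sub>R (r ^ M * (norm (G r))\<^sup>2)) \<in> borel_measurable borel"
      by (intro borel_measurable_continuous_on_indicator continuous_intros) auto
    then show "(\<lambda>r. indicator {\<rho><..} r *\<^sub>R (r ^ M * (norm (G r))\<^sup>2)) \<in> borel_measurable lborel" by simp
    show "AE r in lborel. norm (indicator {\<rho><..} r *\<^sub>R (r ^ M * (norm (G r))\<^sup>2)) \<le> norm (B * (w r * s r))"
      using gG B(2)
    proof eventually_elim
      case (elim r)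
      show ?case
      proof (cases "r > \<rho>")
        case True
        then have r: "r > 0" using \<rho> by simp
        have "r ^ M * (norm (G r))\<^sup>2 = w r * (norm (g r))\<^sup>2"
          using elim(1) True r by (simp add: pw w_def norm_mult norm_power power_mult_distrib power2_eq_square)
        also have "\<dots> \<le> w r * (B * s r)" using elim(2) r w0 by (intro mult_left_mono) auto
        finally show ?thesis using True r w0[of r] s0[of r] B(1) by (simp add: abs_mult algebra_simps)
      qed (use w0[of r] s0[of r] B(1) in simp)
    qed
  qed
  obtain r1 where r1: "r1 > \<rho>" "ms_integral \<nu> (\<kappa> * of_real r1) \<noteq> 0" using ms_integral_ray_nonzero[OF \<kappa>(1) \<rho>] by blast
  have "\<exists>c. \<forall>r>\<rho>. G r = c * (complex_of_real (r powr - \<nu>) * ms_integral \<nu> (\<kappa> * of_real r))"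
  proof (rule radial_solutions_proportional[where M=M and q="\<kappa>\<^sup>2" and zg=Z and ?r1.0=r1 and
        zh="\<lambda>r. \<i> * \<kappa> * (of_real (r powr (\<nu> + 1)) * ms_integral (\<nu> + 1) (\<kappa> * of_real r))"])
    show "set_integrable lborel {\<rho><..} (\<lambda>r. r ^ M * (norm (complex_of_real (r powr - \<nu>) * ms_integral \<nu> (\<kappa> * of_real r)))\<^sup>2)"
      by (rule hankel_radial_solution(3)[OF \<kappa>(1) M \<rho>])
    show "complex_of_real (r1 powr - \<nu>) * ms_integral \<nu> (\<kappa> * of_real r1) \<noteq> 0" using r1 \<rho> by simp
    show "0 \<le> \<rho>" "Im (\<kappa>\<^sup>2) > 0" "r1 > \<rho>" using \<rho> \<kappa>(2) r1(1) by simp_all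
    show "set_integrable lborel {\<rho><..} (\<lambda>r. r ^ M * (norm (G r))\<^sup>2)" by (rule G2)
  next
    fix r assume r: "\<rho> < r"
    show "(G has_vector_derivative Z r / of_real (r ^ M)) (at r)" using G r by blast
    show "(Z has_vector_derivative - (\<kappa>\<^sup>2) * of_real (r ^ M) * G r) (at r)" using Z r by blast
    from r have "r > 0" using \<rho> by simp
    note H = hankel_radial_solution(1,2)[OF \<kappa>(1) M this]
    show "((\<lambda>r. complex_of_real (r powr - \<nu>) * ms_integral \<nu> (\<kappa> * of_real r)) has_vector_derivative
        \<i> * \<kappa> * (of_real (r powr (\<nu> + 1)) * ms_integral (\<nu> + 1) (\<kappa> * of_real r)) / of_real (r ^ M)) (at r)"
      by (rule H(1))
    show "((\<lambda>r. \<i> * \<kappa> * (of_real (r powr (\<nu> + 1)) * ms_integral (\<nu> + 1) (\<kappa> * of_real r))) has_vector_derivative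
        - (\<kappa>\<^sup>2) * of_real (r ^ M) * (of_real (r powr - \<nu>) * ms_integral \<nu> (\<kappa> * of_real r))) (at r)"
      by (rule H(2))
  qed
  then obtain c where c: "\<forall>r>\<rho>. G r = c * (complex_of_real (r powr - \<nu>) * ms_integral \<nu> (\<kappa> * of_real r))" by blast
  \<comment> \<open>The prefactor of \<open>hankel1\<close>; being nonzero and independent of
    \<open>r\<close>, it is absorbed in the constant.\<close>
  define C where "C = exp (- \<i> * of_real (pi * \<nu> / 2)) / (\<i> * of_real pi)"
  have C: "C \<noteq> 0" unfolding C_def by simp
  have hankel: "hankel1 \<nu> z = C * ms_integral \<nu> z" for z
    unfolding hankel1_def C_def ms_integral_def ms_kernel_def ..
  show ?thesis
  proof (rule exI[of _ "c / C"])
    show "AE r in lborel. r > \<rho> \<longrightarrow> mode u Y r = c / C * of_real (r powr (- (real CARD('n) - 2) / 2)) *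
        hankel1 (real m + (real CARD('n) - 2) / 2) (\<kappa> * of_real r)"
      using mode_AE_eq[OF v Ym uv] gG
    proof eventually_elim
      case (elim r)
      show ?case
      proof
        assume r: "r > \<rho>"
        then have r0: "r > 0" using \<rho> by simp
        have "r powr (- (real CARD('n) - 2) / 2) = r powr (real m + - \<nu>)" by (simp add: \<nu>_def field_simps)
        also have "\<dots> = r ^ m * r powr - \<nu>" using r0 by (simp only: powr_add powr_realpow)
        finally have p: "r powr (- (real CARD('n) - 2) / 2) = r ^ m * r powr - \<nu>" .
        have "mode u Y r = of_real (r ^ m) * (c * (complex_of_real (r powr - \<nu>) * ms_integral \<nu> (\<kappa> * of_real r)))"
          using elim r r0 c by (simp add: g_def)
        then show "mode u Y r = c / C * of_real (r powr (- (real CARD('n) - 2) / 2)) *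
            hankel1 (real m + (real CARD('n) - 2) / 2) (\<kappa> * of_real r)"
          unfolding p \<nu>_def[symmetric] hankel using C by simp
      qed
    qed
  qed
qed

section \<open>The outgoing condition\<close>

text \<open>The complement of the support is a union of possibly uncountably many open sets;
  Lindelof's theorem leaves countably many, whose exceptional null sets can be united.\<close>

lemma AE_ess_support: "AE x in lebesgue. x \<notin> ess_support f \<longrightarrow> f x = 0"
proof -
  define \<U> where "\<U> = {U. open U \<and> (AE x in lebesgue. x \<in> U \<longrightarrow> f x = 0)}"
  obtain \<V> where \<V>: "\<V> \<subseteq> \<U>" "countable \<V>" "\<Union>\<V> = \<Union>\<U>"
    by (rule Lindelof[of \<U>]) (auto simp: \<U>_def)
  have "AE x in lebesgue. \<forall>U\<in>\<V>. x \<in> U \<longrightarrow> f x = 0"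
    unfolding AE_ball_countable[OF \<V>(2)] using \<V>(1) by (auto simp: \<U>_def)
  then show ?thesis
    by eventually_elim (use \<V>(3) in \<open>auto simp: ess_support_def \<U>_def\<close>)
qed

text \<open>Beyond the last interface and the support of \<open>f\<close> the coefficients are those
  of the outer layer. Moving the remaining derivative onto the test function and multiplying by
  \<open>\<epsilon> n\<close> leaves the Laplacian and the factor \<open>\<epsilon> n *
  (\<omega>\<^sup>2 * \<mu> n + \<i> * \<sigma>)\<close>, which is the square of
  \<open>kappa\<close>.\<close>

lemma weak_solution_helmholtz:
  fixes u f :: "real^'n::finite \<Rightarrow> complex"
  assumes R: "n \<ge> 3" "0 < R 1" "\<forall>i\<in>{1..<n - 1}. R i < R (i + 1)"
    and n: "odd n" "\<epsilon> n > 0" and \<omega>: "\<omega> > 0"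
    and f: "ess_support f \<subseteq> ball 0 R0"
    and u: "u \<in> H1 UNIV" "weak_solution n R \<epsilon> \<mu> \<sigma> \<omega> f u"
    and \<rho>: "\<rho> \<ge> R (n - 1)" "\<rho> \<ge> R0"
  shows "helmholtz_on {x. norm x > \<rho>} ((kappa n \<epsilon> \<mu> \<sigma> \<omega>)\<^sup>2) u"
  unfolding helmholtz_on_iff[OF open_norm_greater]
proof (intro allI impI)
  fix \<phi> :: "real^'n \<Rightarrow> complex" assume \<phi>: "test_fun {x. norm x > \<rho>} \<phi>"
  note \<phi>U = test_fun_mono[OF \<phi> subset_UNIV]
  have u2: "L2 lebesgue u" and "\<exists>g. weak_gradient UNIV u g" using u(1) by (simp_all add: H1_def lebesgue_on_UNIV_eq)
  from someI_ex[OF this(2)] have wg: "weak_gradient UNIV u (wgrad UNIV u)" by (simp add: wgrad_def)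
  then have g2: "L2 lebesgue (wgrad UNIV u)" by (simp add: weak_gradient_def lebesgue_on_UNIV_eq)
  define S where "S = (\<Sum>i\<in>UNIV. LINT x|lebesgue. u x * partial i (partial i \<phi>) x)"
  define J where "J = (LINT x|lebesgue. u x * \<phi> x)"
  define e where "e = complex_of_real (\<epsilon> n)"
  define k where "k = complex_of_real (\<omega>\<^sup>2) * of_real (\<mu> n) + \<i> * of_real \<sigma>"
  have int1: "integrable lebesgue (\<lambda>x. wgrad UNIV u x $ i * partial i \<phi> x)" for i
    by (rule weak_gradient_UNIV_integrable(2)[OF u2 g2 test_fun_partial[OF \<phi>U]])
  have int2: "integrable lebesgue (\<lambda>x. u x * \<phi> x)"
    by (rule L2_mult_integrable[OF u2 test_fun_L2[OF \<phi>]])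
  have by_parts: "(LINT x|lebesgue. wgrad UNIV u x $ i * partial i \<phi> x) = - (LINT x|lebesgue. u x * partial i (partial i \<phi>) x)" for i
    using wg test_fun_partial[OF \<phi>U, of i] unfolding weak_gradient_def lebesgue_on_UNIV_eq by auto
  have f0: "(LINT x|lebesgue. f x * \<phi> x) = 0"
  proof (rule integral_eq_zero_AE)
    show "AE x in lebesgue. f x * \<phi> x = 0"
      using AE_ess_support[of f]
    proof eventually_elim
      case (elim x)
      show ?case
      proof (cases "norm x > \<rho>")
        case True
        then have "x \<notin> ess_support f" using f \<rho>(2) by (auto simp: subset_iff)
        then show ?thesis using elim by simp
      next
        case False
        then show ?thesis using test_fun_zero_outside[OF \<phi>, of x] by simp
      qed
    qed
  qed
  \<comment> \<open>Where the coefficients differ from the outer constants, \<open>\<phi>\<close>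
    and its derivatives vanish, so the constants may be used everywhere.\<close>
  have eq: "- inverse (piecewise n R (eps_sigma \<epsilon> \<sigma> \<omega>) x) * (\<Sum>i\<in>UNIV. wgrad UNIV u x $ i * partial i \<phi> x)
      + (of_real (\<omega>\<^sup>2) * piecewise n R (\<lambda>i. of_real (\<mu> i)) x + \<i> * of_real \<sigma>) * u x * \<phi> x
    = - inverse e * (\<Sum>i\<in>UNIV. wgrad UNIV u x $ i * partial i \<phi> x) + k * (u x * \<phi> x)" for x
  proof (cases "norm x > \<rho>")
    case True
    then have "R (n - 1) < norm x" using \<rho>(1) by simp
    from piecewise_outer[OF R this]
    show ?thesis using n(1) by (simp add: eps_sigma_def e_def k_def mult.assoc)
  next
    case False
    then have "\<phi> x = 0" "partial i \<phi> x = 0" for i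
      using test_fun_zero_outside[OF \<phi>, of x] test_fun_zero_outside[OF test_fun_partial[OF \<phi>], of x] by auto
    then show ?thesis by simp
  qed
  have "0 = (LINT x|lebesgue. - inverse e * (\<Sum>i\<in>UNIV. wgrad UNIV u x $ i * partial i \<phi> x) + k * (u x * \<phi> x))"
    using u(2)[unfolded weak_solution_def, rule_format, OF \<phi>U] unfolding eq f0 by (rule sym)
  also have "\<dots> = (LINT x|lebesgue. - inverse e * (\<Sum>i\<in>UNIV. wgrad UNIV u x $ i * partial i \<phi> x)) + (LINT x|lebesgue. k * (u x * \<phi> x))"
    by (intro Bochner_Integration.integral_add integrable_mult_right Bochner_Integration.integrable_sum int1 int2)
  also have "\<dots> = - inverse e * (\<Sum>i\<in>UNIV. LINT x|lebesgue. wgrad UNIV u x $ i * partial i \<phi> x) + k * J"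
    unfolding J_def integral_mult_right_zero Bochner_Integration.integral_sum[OF int1] ..
  also have "\<dots> = inverse e * S + k * J" unfolding by_parts S_def by (simp add: sum_negf)
  finally have "0 = e * (inverse e * S + k * J)" by simp
  also have "\<dots> = S + e * k * J" using n(2) by (simp add: e_def field_simps)
  also have "e * k = (kappa n \<epsilon> \<mu> \<sigma> \<omega>)\<^sup>2"
    unfolding kappa_square by (simp add: e_def k_def complex_eq_iff)
  finally show "(LINT x|lebesgue. u x * (laplacian \<phi> x + (kappa n \<epsilon> \<mu> \<sigma> \<omega>)\<^sup>2 * \<phi> x)) = 0"
    unfolding helmholtz_integrals(2)[OF u2 \<phi>] S_def J_def by simp
qed

lemma weak_solution_outgoing:
  fixes u f :: "real^'n::finite \<Rightarrow> complex"
  assumes R: "n \<ge> 3" "0 < R 1" "\<forall>i\<in>{1..<n - 1}. R i < R (i + 1)" "R0 > 0"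
    and n: "odd n" "\<epsilon> n > 0" and \<sigma>: "\<sigma> > 0" and \<omega>: "\<omega> > 0"
    and f: "ess_support f \<subseteq> ball 0 R0"
    and u: "u \<in> H1 UNIV" "weak_solution n R \<epsilon> \<mu> \<sigma> \<omega> f u"
  shows "outgoing (kappa n \<epsilon> \<mu> \<sigma> \<omega>) u"
  unfolding outgoing_def
proof (rule exI[of _ "max (R (n - 1)) R0"], intro conjI allI impI)
  let ?\<rho> = "max (R (n - 1)) R0"
  show \<rho>: "?\<rho> > 0" using R(4) by simp
  show helm: "helmholtz_on {x. norm x > ?\<rho>} ((kappa n \<epsilon> \<mu> \<sigma> \<omega>)\<^sup>2) u"
    by (rule weak_solution_helmholtz[OF R(1-3) n \<omega> f u]) auto
  fix m and Y :: "real^'n \<Rightarrow> complex" assume Y: "solid_harmonic m Y"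
  have "L2 lebesgue u" using u(1) by (simp add: H1_def lebesgue_on_UNIV_eq)
  moreover have "Im ((kappa n \<epsilon> \<mu> \<sigma> \<omega>)\<^sup>2) > 0" using n(2) \<sigma> by (simp add: kappa_square)
  moreover have "Im (kappa n \<epsilon> \<mu> \<sigma> \<omega>) > 0" by (rule Im_kappa_pos) (rule n(2) \<sigma>)+
  ultimately show "\<exists>c. AE r in lborel. r > ?\<rho> \<longrightarrow>
      mode u Y r = c * of_real (r powr (- (real CARD('n) - 2) / 2)) *
        hankel1 (real m + (real CARD('n) - 2) / 2) (kappa n \<epsilon> \<mu> \<sigma> \<omega> * of_real r)"
    using helmholtz_mode[OF _ \<rho> _ _ helm Y] by blast
qed

theorem theorem3p7:
  fixes n :: nat and R \<epsilon> \<mu> C :: "nat \<Rightarrow> real" and R0 \<sigma> :: real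
    and N NB :: "nat \<Rightarrow> (real^'n::finite \<Rightarrow> complex) \<Rightarrow> real"
  assumes "CARD('n) \<ge> 2" and "n \<ge> 3" and "odd n"
    and "0 < R 1" and "\<forall>i\<in>{1..<n - 1}. R i < R (i + 1)" and "R0 > 0"
    and "\<forall>i\<in>{1..n}. odd i \<longrightarrow> \<epsilon> i > 0 \<and> \<mu> i > 0"
    and "\<forall>i\<in>{1..n}. even i \<longrightarrow> \<epsilon> i < 0 \<and> \<mu> i < 0"
    and "\<forall>i\<in>{1..n - 1}. \<epsilon> i / \<epsilon> (i + 1) \<noteq> -1"
    and "\<sigma> > 0"
    and "\<forall>i\<in>{1..n - 1}. Hhalf_norm (R i) (N i)"
    and "\<forall>k\<in>{1..n - 2}. odd k \<longrightarrow> Hhalf2_norm (R k) (R (k + 1)) (NB k) \<and>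
           (\<forall>\<psi>\<in>Hhalf2 (R k) (R (k + 1)). (NB k \<psi>)\<^sup>2 \<le> (N k \<psi>)\<^sup>2 + (N (k + 1) \<psi>)\<^sup>2)"
    and "\<forall>j\<in>{1..n}. odd j \<longrightarrow> trace_constant n R N j (C j)"
  shows "\<exists>I. I \<subseteq> {0<..} \<and> I sparse_in {0<..} \<and>
    (\<forall>\<omega>\<in>{0<..} - I.
       (\<forall>k\<in>{1..n - 2}. odd k \<longrightarrow>
          ((\<epsilon> (k + 1))\<^sup>2 + (\<sigma> / \<omega>)\<^sup>2) / (\<epsilon> k * \<bar>\<epsilon> (k + 1)\<bar>)
            > (lift_norm (R k) (R (k + 1)) (NB k) * C k)\<^sup>2 \<and>
          ((\<epsilon> (k + 1))\<^sup>2 + (\<sigma> / \<omega>)\<^sup>2) / (\<epsilon> (k + 2) * \<bar>\<epsilon> (k + 1)\<bar>)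
            > (lift_norm (R k) (R (k + 1)) (NB k) * C (k + 2))\<^sup>2) \<longrightarrow>
       (\<forall>f :: real^'n \<Rightarrow> complex. L2 lebesgue f \<and> compact (ess_support f) \<and> ess_support f \<subseteq> ball 0 R0 \<longrightarrow>
          (\<exists>u. solves n R \<epsilon> \<mu> \<sigma> \<omega> f u \<and>
             (\<forall>v. solves n R \<epsilon> \<mu> \<sigma> \<omega> f v \<longrightarrow> (AE x in lebesgue. v x = u x)))))"

\<comment> \<open>The exceptional set is empty: coercivity is available at each
  \<open>\<omega> > 0\<close>, with a rotation that may depend on \<open>\<omega>\<close>.\<close>
proof (rule exI[of _ "{}"], intro conjI ballI impI allI)
  fix \<omega> :: real and f :: "real^'n \<Rightarrow> complex"
  assume "\<omega> \<in> {0<..} - {}" and f: "L2 lebesgue f \<and> compact (ess_support f) \<and> ess_support f \<subseteq> ball 0 R0"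
  then have \<omega>: "\<omega> > 0" and f2: "L2 lebesgue f" and fs: "ess_support f \<subseteq> ball 0 R0" by auto

  have odd: "\<forall>i\<in>{1..n}. odd i \<longrightarrow> \<epsilon> i > 0" and even: "\<forall>i\<in>{1..n}. even i \<longrightarrow> \<epsilon> i < 0"
    using assms(7,8) by auto
  have \<epsilon>n: "\<epsilon> n > 0" using odd assms(2,3) by simp
  note well_posed = transmission_problem_well_posed[OF assms(2,4,5) odd even assms(10) \<omega> f2, where \<mu>=\<mu>]
  obtain u where u: "u \<in> H1 UNIV" "weak_solution n R \<epsilon> \<mu> \<sigma> \<omega> f u" using well_posed(1) by blast
  show "\<exists>u. solves n R \<epsilon> \<mu> \<sigma> \<omega> f u \<and> (\<forall>v. solves n R \<epsilon> \<mu> \<sigma> \<omega> f v \<longrightarrow> (AE x in lebesgue. v x = u x))"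
  proof (intro exI conjI allI impI)
    show "solves n R \<epsilon> \<mu> \<sigma> \<omega> f u"
      unfolding solves_def
      using u weak_solution_outgoing[OF assms(2,4,5,6,3) \<epsilon>n assms(10) \<omega> fs u] by blast
    show "AE x in lebesgue. v x = u x" if "solves n R \<epsilon> \<mu> \<sigma> \<omega> f v" for v
      using that well_posed(2)[OF u] unfolding solves_def by blast
  qed
qed (auto simp: sparse_in_empty)

end
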